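(* Group isomorphism is $n^{(1/6)\log_p n + O(1)}$ time quantum Turing reducible to composition-series canonization, where $p$ is the smallest prime dividing the order $n$ of the groups. That is, there is a quantum algorithm with access to an oracle computing canonical forms of composition series which, given finite groups $G$ and $H$ of order $n$ by multiplication tables, decides (with high probability) whether $G\cong H$ in time $n^{(1/6)\log_p n+O(1)}$.
   Context: A composition series of $G$ is a maximal subnormal series $G_0 = 1 \triangleleft \cdots \triangleleft G_m = G$; composition series of $G$ and of $H$ (given by $H_0=1\triangleleft\cdots\triangleleft H_m=H$) are isomorphic if some isomorphism $\phi:G\to H$ has $\phi(G_i)=H_i$ for all $i$. In the composition-series canonization problem one is given a composition series $S$ of a group $G$ of order $n$ and must output $\mathrm{Can}(S) = (M, \psi(G_0),\dots,\psi(G_m))$, where $M$ is an $n\times n$ multiplication table on $[n]$ of a group isomorphic to $G$ via $\psi:G\to[n]$, such that $\mathrm{Can}(S)$ has size polynomial in $n$ and, for composition series $S$, $S'$ of groups $G$, $H$, $S\cong S'$ if and only if $\mathrm{Can}(S)=\mathrm{Can}(S')$. *)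

theory Defs
  imports
    "HOL-Algebra.Coset"
    "HOL-Computational_Algebra.Primes"
    "HOL-Library.Log_Nat"
    "HOL-Probability.Probability_Mass_Function"
begin

section \<open>Multiplication tables and composition series\<close>

text \<open>The paper's \<open>[n]\<close> is \<open>{0..<n}\<close>. A table is a list of rows, so that equality of tables is
  literal equality of data.\<close>

type_synonym table = "nat list list"

definition table_group :: "table \<Rightarrow> nat monoid" where
  "table_group M =
     \<lparr>carrier = {0..<length M},
      monoid.mult = (\<lambda>i j. M ! i ! j),
      one = (THE e. e < length M \<and> (\<forall>x<length M. M ! e ! x = x \<and> M ! x ! e = x))\<rparr>"

definition group_table :: "nat \<Rightarrow> table \<Rightarrow> bool" where
  "group_table n M \<longleftrightarrow>
     length M = n \<and> (\<forall>r\<in>set M. length r = n) \<and> group (table_group M)"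

text \<open>Inclusions in a series are strict: with repetitions allowed, every series could be lengthened.\<close>

definition subnormal_series :: "('a, 'b) monoid_scheme \<Rightarrow> 'a set list \<Rightarrow> bool" where
  "subnormal_series G Gs \<longleftrightarrow>
     Gs \<noteq> [] \<and> hd Gs = {\<one>\<^bsub>G\<^esub>} \<and> last Gs = carrier G \<and>
     (\<forall>N\<in>set Gs. subgroup N G) \<and>
     (\<forall>i. Suc i < length Gs \<longrightarrow>
        Gs ! i \<subset> Gs ! Suc i \<and> Gs ! i \<lhd> (G\<lparr>carrier := Gs ! Suc i\<rparr>))"

definition composition_series :: "('a, 'b) monoid_scheme \<Rightarrow> 'a set list \<Rightarrow> bool" where
  "composition_series G Gs \<longleftrightarrow>
     subnormal_series G Gs \<and> \<not> (\<exists>Hs. subnormal_series G Hs \<and> set Gs \<subset> set Hs)"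

type_synonym series = "table \<times> nat set list"

definition comp_series :: "nat \<Rightarrow> series \<Rightarrow> bool" where
  "comp_series n S \<longleftrightarrow>
     group_table n (fst S) \<and> composition_series (table_group (fst S)) (snd S)"

definition series_iso :: "series \<Rightarrow> series \<Rightarrow> bool" where
  "series_iso S S' \<longleftrightarrow>
     (\<exists>\<phi>\<in>iso (table_group (fst S)) (table_group (fst S')). map (image \<phi>) (snd S) = snd S')"

text \<open>The polynomial size of \<open>Can S\<close> is automatic: it consists of an \<open>n\<close> by \<open>n\<close> table over \<open>[n]\<close>
  and of as many subsets of \<open>[n]\<close> as \<open>S\<close> has terms, and the terms of a series are strictly
  increasing.\<close>

definition canonization :: "(series \<Rightarrow> series) \<Rightarrow> bool" where
  "canonization Can \<longleftrightarrow>
     (\<forall>n S. comp_series n S \<longrightarrow>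
        (\<exists>M. group_table n M \<and>
          (\<exists>\<psi>\<in>iso (table_group (fst S)) (table_group M).
             Can S = (M, map (image \<psi>) (snd S))))) \<and>
     (\<forall>n n' S S'. comp_series n S \<longrightarrow> comp_series n' S' \<longrightarrow>
        (series_iso S S' \<longleftrightarrow> Can S = Can S'))"


section \<open>Quantum random access machines with an oracle\<close>

text \<open>A classical random access machine with logarithmic cost drives an unbounded array of qubits,
  to which it applies gates from a universal set and which it measures. Programs are finite and
  independent of the input, so that the model is uniform. The classical memory can be read at an
  address held in superposition. A computational basis state is the set of the
  indices of the qubits that are 1; the state vectors that occur have finite support.\<close>

type_synonym qstate = "nat set \<Rightarrow> complex"

definition hadamard :: "nat \<Rightarrow> qstate \<Rightarrow> qstate" where
  "hadamard q \<psi> = (\<lambda>B. (if q \<in> B then \<psi> (B - {q}) - \<psi> B else \<psi> B + \<psi> (insert q B))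
                          / complex_of_real (sqrt 2))"

definition t_gate :: "nat \<Rightarrow> qstate \<Rightarrow> qstate" where
  "t_gate q \<psi> = (\<lambda>B. if q \<in> B then cis (pi / 4) * \<psi> B else \<psi> B)"

text \<open>XOR of the bits \<open>F B\<close>, where \<open>F B\<close> depends only on qubits of \<open>B\<close> that the operation does not
  change. The map \<open>B \<mapsto> sym_diff B (F B)\<close> is then its own inverse.\<close>

definition xor_gate :: "(nat set \<Rightarrow> nat set) \<Rightarrow> qstate \<Rightarrow> qstate" where
  "xor_gate F \<psi> = (\<lambda>B. \<psi> (sym_diff B (F B)))"

definition controlled_not :: "nat set \<Rightarrow> nat \<Rightarrow> qstate \<Rightarrow> qstate" where
  "controlled_not Q t \<psi> =
     (if t \<in> Q then \<psi> else xor_gate (\<lambda>B. if Q \<subseteq> B then {t} else {}) \<psi>)"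

text \<open>The \<open>k\<close> qubits from \<open>a\<close> on hold an address in binary, least significant bit first.\<close>

definition quantum_read :: "(nat \<Rightarrow> nat) \<Rightarrow> nat \<Rightarrow> nat \<Rightarrow> nat \<Rightarrow> nat \<Rightarrow> qstate \<Rightarrow> qstate" where
  "quantum_read h b a k t \<psi> =
     (if t \<in> {a..<a + k} then \<psi>
      else xor_gate (\<lambda>B. if h (b + (\<Sum>i | i < k \<and> a + i \<in> B. 2 ^ i)) \<noteq> 0 then {t} else {}) \<psi>)"

text \<open>An oracle maps a bit string, given by its length and the set of positions of its ones, to a
  bit string of the same length.\<close>

type_synonym oracle_fun = "nat \<Rightarrow> nat set \<Rightarrow> nat set"

definition oracle_gate :: "oracle_fun \<Rightarrow> nat \<Rightarrow> nat \<Rightarrow> nat \<Rightarrow> qstate \<Rightarrow> qstate" where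
  "oracle_gate f l x y \<psi> =
     (if {x..<x + l} \<inter> {y..<y + l} \<noteq> {} then \<psi>
      else xor_gate (\<lambda>B. (+) y ` (f l {k. k < l \<and> x + k \<in> B} \<inter> {..<l})) \<psi>)"

definition outcome_prob :: "nat \<Rightarrow> bool \<Rightarrow> qstate \<Rightarrow> real" where
  "outcome_prob q b \<psi> = (\<Sum>B | \<psi> B \<noteq> 0 \<and> (q \<in> B) = b. (cmod (\<psi> B))\<^sup>2)"

definition collapse :: "nat \<Rightarrow> bool \<Rightarrow> qstate \<Rightarrow> qstate" where
  "collapse q b \<psi> =
     (\<lambda>B. if (q \<in> B) = b then \<psi> B / complex_of_real (sqrt (outcome_prob q b \<psi>)) else 0)"

datatype arith = Plus | Minus | Times | Divide

primrec eval_arith :: "arith \<Rightarrow> nat \<Rightarrow> nat \<Rightarrow> nat" where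
  "eval_arith Plus a b = a + b"
| "eval_arith Minus a b = a - b"
| "eval_arith Times a b = a * b"
| "eval_arith Divide a b = a div b"

text \<open>The arguments of type nat of an instruction are names of registers, except for the
  second argument of \<open>Literal\<close>, which is a constant. Qubits and memory cells are addressed through the
  contents of registers.\<close>

datatype instr =
    Literal nat nat
  | Arith arith nat nat nat
  | Load nat nat
  | Store nat nat
  | Had nat
  | TGate nat
  | CNot nat nat
  | Toffoli nat nat nat
  | QLoad nat nat nat nat
  | Measure nat nat
  | Query nat nat nat

datatype prog =
    Done
  | Instr instr
  | Seq prog prog
  | Cond nat prog prog
  | While nat prog

record config =
  reg :: "nat \<Rightarrow> nat"
  heap :: "nat \<Rightarrow> nat"
  qst :: qstate
  clock :: nat

text \<open>Logarithmic cost: \<open>floorlog 2 v\<close> is the number of binary digits of \<open>v\<close>.\<close>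

definition tick :: "nat list \<Rightarrow> config \<Rightarrow> config" where
  "tick vs s = s\<lparr>clock := clock s + 1 + (\<Sum>v\<leftarrow>vs. floorlog 2 v)\<rparr>"

definition set_reg :: "nat \<Rightarrow> nat \<Rightarrow> config \<Rightarrow> config" where
  "set_reg x v s = s\<lparr>reg := (reg s)(x := v)\<rparr>"

definition apply_gate :: "(qstate \<Rightarrow> qstate) \<Rightarrow> config \<Rightarrow> config" where
  "apply_gate U s = s\<lparr>qst := U (qst s)\<rparr>"

text \<open>Besides the logarithmic cost, reading the memory in superposition costs the number of
  address qubits, and a query costs its length.\<close>

primrec exec :: "oracle_fun \<Rightarrow> instr \<Rightarrow> config \<Rightarrow> config pmf" where
  "exec f (Literal x v) s = return_pmf (tick [v] (set_reg x v s))"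
| "exec f (Arith p x y z) s = return_pmf
     (tick [reg s y, reg s z] (set_reg x (eval_arith p (reg s y) (reg s z)) s))"
| "exec f (Load x y) s = return_pmf
     (tick [reg s y, heap s (reg s y)] (set_reg x (heap s (reg s y)) s))"
| "exec f (Store x y) s = return_pmf
     (tick [reg s x, reg s y] (s\<lparr>heap := (heap s)(reg s x := reg s y)\<rparr>))"
| "exec f (Had x) s = return_pmf
     (tick [reg s x] (apply_gate (hadamard (reg s x)) s))"
| "exec f (TGate x) s = return_pmf
     (tick [reg s x] (apply_gate (t_gate (reg s x)) s))"
| "exec f (CNot x z) s = return_pmf
     (tick [reg s x, reg s z] (apply_gate (controlled_not {reg s x} (reg s z)) s))"
| "exec f (Toffoli x y z) s = return_pmf
     (tick [reg s x, reg s y, reg s z]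
        (apply_gate (controlled_not {reg s x, reg s y} (reg s z)) s))"
| "exec f (QLoad b a k t) s = return_pmf
     (tick ([reg s b, reg s a, reg s k, reg s t] @ replicate (reg s k) 1)
        (apply_gate (quantum_read (heap s) (reg s b) (reg s a) (reg s k) (reg s t)) s))"
| "exec f (Measure x y) s = map_pmf
     (\<lambda>b. tick [reg s y]
            (set_reg x (of_bool b) (apply_gate (collapse (reg s y) b) s)))
     (bernoulli_pmf (outcome_prob (reg s y) True (qst s)))"
| "exec f (Query l x y) s = return_pmf
     (tick ([reg s l, reg s x, reg s y] @ replicate (reg s l) 1)
        (apply_gate (oracle_gate f (reg s l) (reg s x) (reg s y)) s))"

primrec step :: "oracle_fun \<Rightarrow> prog \<Rightarrow> config \<Rightarrow> (prog \<times> config) pmf" where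
  "step f Done s = return_pmf (Done, s)"
| "step f (Instr i) s = map_pmf (Pair Done) (exec f i s)"
| "step f (Seq P Q) s =
     (if P = Done then return_pmf (Q, s)
      else map_pmf (\<lambda>(P', s'). (Seq P' Q, s')) (step f P s))"
| "step f (Cond x P Q) s =
     return_pmf (if reg s x \<noteq> 0 then P else Q, tick [reg s x] s)"
| "step f (While x P) s =
     return_pmf (if reg s x \<noteq> 0 then Seq P (While x P) else Done, tick [reg s x] s)"

definition run :: "oracle_fun \<Rightarrow> prog \<Rightarrow> nat \<Rightarrow> config \<Rightarrow> (prog \<times> config) pmf" where
  "run f P k s = ((\<lambda>D. bind_pmf D (\<lambda>(P', s'). step f P' s')) ^^ k) (return_pmf (P, s))"

text \<open>Every computation halts within time \<open>T\<close>, and register 0 holds the answer (nonzero for yes)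
  with probability at least \<open>1 - \<epsilon>\<close>. The number \<open>k\<close> of steps is only a bound by
  which the program has terminated (the program \<open>Done\<close> stays put); time is measured by the clock.\<close>

definition decides_within ::
    "oracle_fun \<Rightarrow> prog \<Rightarrow> config \<Rightarrow> real \<Rightarrow> real \<Rightarrow> bool \<Rightarrow> bool" where
  "decides_within f P s T \<epsilon> answer \<longleftrightarrow>
     (\<exists>k. (\<forall>(P', s')\<in>set_pmf (run f P k s). P' = Done \<and> real (clock s') \<le> T) \<and>
          measure_pmf.prob (run f P k s) {(P', s'). (reg s' 0 \<noteq> 0) = answer} \<ge> 1 - \<epsilon>)"


section \<open>Inputs and the canonization oracle\<close>

definition initial_config :: "nat \<Rightarrow> nat list \<Rightarrow> config" where
  "initial_config n xs =
     \<lparr>reg = (\<lambda>_. 0)(0 := n),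
      heap = (\<lambda>i. if i < length xs then xs ! i else 0),
      qst = (\<lambda>B. if B = {} then 1 else 0),
      clock = 0\<rparr>"

text \<open>A pair of groups of order \<open>n\<close>: register 0 contains \<open>n\<close>, the memory the two tables row by row.\<close>

definition group_pair_input :: "nat \<Rightarrow> table \<Rightarrow> table \<Rightarrow> config" where
  "group_pair_input n G H = initial_config n (concat G @ concat H)"

text \<open>A series of a group of order \<open>n\<close> is a bit string of length \<open>n\<^sup>3 + n\<^sup>2\<close>: the entries of the
  table are one-hot encoded, followed by the characteristic vectors of the terms of the series, padded
  by empty sets to \<open>n\<close> sets (a composition series has at most \<open>n\<close> terms, all nonempty).\<close>

definition code_length :: "nat \<Rightarrow> nat" where
  "code_length n = n ^ 3 + n ^ 2"

definition encode_series :: "nat \<Rightarrow> series \<Rightarrow> nat set" where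
  "encode_series n S =
     {(i * n + j) * n + fst S ! i ! j | i j. i < n \<and> j < n} \<union>
     {n ^ 3 + i * n + x | i x. i < length (snd S) \<and> x \<in> snd S ! i}"

text \<open>At most one series contributes to the union, as the encoding is injective and \<open>code_length\<close>
  determines \<open>n\<close>. Strings that encode no composition series are answered by zeros.\<close>

definition canonization_oracle :: "(series \<Rightarrow> series) \<Rightarrow> oracle_fun" where
  "canonization_oracle Can l X =
     \<Union> {encode_series n (Can S) | n S.
          comp_series n S \<and> code_length n = l \<and> encode_series n S = X}"

definition smallest_prime_divisor :: "nat \<Rightarrow> nat" where
  "smallest_prime_divisor n = (LEAST p. prime p \<and> p dvd n)"

end

theory Submission
  imports Defs
begin

text \<open>A composition series of a group of order \<open>n\<close> is grown from the bottom. A term \<open>K\<close> is followed by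
  the subnormal closure of \<open>K\<close> and an element \<open>x\<close> for which this closure is minimal, and \<open>x\<close> is chosen by
  its number among representatives of the cosets of \<open>K\<close>. Since term \<open>i\<close> has at least \<open>p ^ i\<close> elements,
  there are at most \<open>n / p ^ i\<close> choices, and \<open>b\<close> bits with \<open>2 ^ b = n powr ((1 / 2) log p n + O(1))\<close>
  determine the series. An isomorphism from \<open>G\<close> to \<open>H\<close> preserves the distribution of the series of a
  random index up to a factor \<open>n\<close>. The two groups are compared by quantum collision finding
  (Brassard, Hoyer and Tapp): the canonical forms for \<open>2 ^ (b / 3)\<close> indices of \<open>G\<close> are stored, and
  amplitude amplification, with numbers of iterations that are doubled up to \<open>n * 2 ^ (b / 3)\<close>,
  searches for an index of \<open>H\<close> whose canonical form is stored. No such index exists if the groups are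
  not isomorphic; otherwise a fraction of at least \<open>2 ^ (b / 3 - b - 1) / n\<close> of the indices is good.
  The superposition over the indices requires the series to be computed reversibly. This is done by
  a circuit whose nodes are disjunctions of conjunctions of two wires.\<close>

section \<open>Growing composition series\<close>

text \<open>Closures and the number of choices are preserved by isomorphisms, the numbering of the
  choices is not, so only the distributions of the series of \<open>G\<close> and \<open>H\<close>
  can be compared. The number of choices need not divide a power of two; reducing an index modulo it
  distorts the probability of a step by a factor of at most 2, and at most \<open>log 2 n\<close>
  steps are proper: this is the origin of the factor \<open>n\<close>. Storing \<open>2 ^ s\<close>
  forms costs about \<open>2 ^ s\<close> and the search about the square root of
  \<open>2 ^ b / 2 ^ s\<close>; the two balance at \<open>s = b / 3\<close>. Canonical forms serve
  directly as memory addresses: they have polynomially many bits, so an access costs polynomial time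
  although the table is sparse and its address range exponential. In superposition there is neither
  branching nor early exit. Hence every iteration has a fixed number of rounds, a chain that has
  reached the whole group continues with empty sets, and garbage is removed by running the circuit
  backwards.\<close>

lemma iterate_increasing_fixed:
 fixes h :: "'a set => 'a set"
 assumes "!!t. (h ^^ t) A \<subseteq> (h ^^ Suc t) A" "!!t. (h ^^ t) A \<subseteq> U" "finite U"
 shows "h ((h ^^ card U) A) = (h ^^ card U) A"
proof -
 \<comment> \<open>Every round before the fixed point adds an element, so the number of rounds is a
   lower bound of the cardinality.\<close>
 have "h ((h ^^ t) A) = (h ^^ t) A \<or> t <= card ((h ^^ t) A)" for t
 proof (induction t)
  case (Suc t)
  show ?case
  proof (cases "h ((h ^^ t) A) = (h ^^ t) A")
   case False
   hence "(h ^^ t) A \<subset> (h ^^ Suc t) A" using assms(1)[of t] by auto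
   hence "card ((h ^^ t) A) < card ((h ^^ Suc t) A)"
    by (intro psubset_card_mono finite_subset[OF assms(2) assms(3)])
   thus ?thesis using Suc False by auto
  qed auto
 qed auto
 then consider "h ((h ^^ card U) A) = (h ^^ card U) A" | "card U <= card ((h ^^ card U) A)" by blast
 thus ?thesis
 proof cases
  case 2
  hence "(h ^^ card U) A = U" using assms(2,3) by (simp add: card_seteq)
  thus ?thesis using assms(1)[of "card U"] assms(2)[of "Suc (card U)"] by auto
 qed
qed

text \<open>The decreasing counterpart, for a sequence that starts with the whole set
  \<open>U\<close>: a round that changes the set removes an element, and the empty set is fixed
  because the next set lies inside it.\<close>

lemma iterate_decreasing_fixed:
 fixes F :: "nat => 'a set"
 assumes "!!t. F (Suc t) = h (F t)" "!!t. F (Suc t) \<subseteq> F t" "F 0 = U" "finite U"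
 shows "h (F (card U)) = F (card U)"
proof -
 have fin: "finite (F t)" for t
  by (induction t) (use assms(3,4) finite_subset[OF assms(2)] in auto)
 have "h (F t) = F t \<or> card (F t) + t <= card U" for t
 proof (induction t)
  case (Suc t)
  show ?case
  proof (cases "h (F t) = F t")
   case False
   hence "F (Suc t) \<subset> F t" using assms(1,2)[of t] by auto
   hence "card (F (Suc t)) < card (F t)" using fin by (intro psubset_card_mono)
   thus ?thesis using Suc False by auto
  qed (use assms(1) in auto)
 qed (use assms in auto)
 then consider "h (F (card U)) = F (card U)" | "card (F (card U)) = 0" by fastforce
 thus ?thesis
 proof cases
  case 2
  hence "F (card U) = {}" using fin by simp
  thus ?thesis using assms(1,2)[of "card U"] by auto
 qed
qed

text \<open>One round of closing \<open>N\<close> under products and under conjugation by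
  \<open>S\<close>. That \<open>y\<close> is the conjugate of \<open>u\<close> by \<open>s\<close>
  is written without an inverse, so that two lookups in the multiplication table test it.\<close>

definition cstep :: "('a, 'b) monoid_scheme => 'a set => 'a set => 'a set" where
 "cstep G S N = {y : carrier G. (EX u:N. EX v:N. u \<otimes>\<^bsub>G\<^esub> v = y) \<or> (EX s:S. EX u:N. y \<otimes>\<^bsub>G\<^esub> s = s \<otimes>\<^bsub>G\<^esub> u)}"

text \<open>The number of rounds is fixed in advance because a circuit cannot stop early;
  \<open>card (carrier G)\<close> rounds always reach the fixed point.\<close>

definition normal_closure :: "('a, 'b) monoid_scheme => 'a set => 'a set => 'a set" where
 "normal_closure G S A = (cstep G S ^^ card (carrier G)) A"

text \<open>The series of successive normal closures: each term is the normal closure of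
  \<open>A\<close> in its predecessor. Its limit is the smallest subnormal subgroup that contains
  \<open>A\<close>.\<close>

primrec descent :: "('a, 'b) monoid_scheme => 'a set => nat => 'a set" where
 "descent G A 0 = carrier G"
| "descent G A (Suc j) = normal_closure G (descent G A j) A"

definition sn_closure :: "('a, 'b) monoid_scheme => 'a set => 'a => 'a set" where
 "sn_closure G K x = descent G (insert x K) (card (carrier G))"

definition normal_in :: "('a, 'b) monoid_scheme => 'a set => 'a set => bool" where
 "normal_in G H S \<longleftrightarrow> subgroup H G & subgroup S G & H \<subseteq> S
   & (ALL s:S. ALL h:H. s \<otimes>\<^bsub>G\<^esub> h \<otimes>\<^bsub>G\<^esub> inv\<^bsub>G\<^esub> s : H)"

inductive subnormal :: "('a, 'b) monoid_scheme => 'a set => bool" for G where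
 top: "subnormal G (carrier G)"
| below: "normal_in G H S ==> subnormal G S ==> subnormal G H"

text \<open>The elements whose closure with \<open>K\<close> is minimal, expressed by membership
  alone: every element of that closure outside \<open>K\<close> must regenerate \<open>x\<close>. In
  this form the condition is a disjunction over wires.\<close>

definition min_above :: "('a, 'b) monoid_scheme => 'a set => 'a set" where
 "min_above G K = {x : carrier G - K.
   ALL y:sn_closure G K x. y : K \<or> x : sn_closure G K y}"

lemma (in group) normal_in_iff:
 assumes "subgroup H G" "subgroup S G"
 shows "normal_in G H S \<longleftrightarrow> H \<lhd> (G\<lparr>carrier := S\<rparr>)"
proof -
 interpret S: group "G\<lparr>carrier := S\<rparr>" by (rule subgroup.subgroup_is_group[OF assms(2) group_axioms])
 have "subgroup H (G\<lparr>carrier := S\<rparr>) \<longleftrightarrow> H \<subseteq> S"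
  using assms subgroup_incl subgroup.subset[of H "G\<lparr>carrier := S\<rparr>"] by auto
 thus ?thesis
  unfolding S.normal_inv_iff normal_in_def using assms by (auto simp: m_inv_consistent[OF assms(2)])
qed

context group begin

context
 assumes fin: "finite (carrier G)"
begin

lemma subgroup_finite_closed:
 assumes "H <= carrier G" "\<one> : H" "!!x y. x : H ==> y : H ==> x \<otimes> y : H"
 shows "subgroup H G"
proof (rule subgroupI)
 show "inv a : H" if a: "a : H" for a
 proof -
  have "(%x. a \<otimes> x) ` H \<subseteq> H" using assms a by auto
  moreover have "inj_on (%x. a \<otimes> x) H"
   using assms(1) a by (auto simp: inj_on_def subset_iff)
  moreover have "finite H" using assms(1) fin finite_subset by auto
  ultimately have "(%x. a \<otimes> x) ` H = H" by (simp add: endo_inj_surj)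
  then obtain b where "b : H" "a \<otimes> b = \<one>" using assms(2) by (metis imageE)
  moreover have "inv a = b" using calculation assms(1) a by (metis inv_equality inv_inv inv_comm subsetD)
  ultimately show ?thesis by simp
 qed
qed (use assms in auto)

lemma cstep_mono: "N \<subseteq> N' ==> cstep G S N \<subseteq> cstep G S N'"
 unfolding cstep_def by blast

lemma cstep_iterates:
 assumes "A <= carrier G" "\<one> : A"
 shows "(cstep G S ^^ t) A <= carrier G & \<one> : (cstep G S ^^ t) A
  & (cstep G S ^^ t) A \<subseteq> (cstep G S ^^ Suc t) A"
proof (induction t)
 case 0
 have "x : cstep G S A" if "x : A" for x
 proof -
  have "x : carrier G" "x \<otimes> \<one> = x" using that assms by auto
  thus ?thesis using that assms(2) unfolding cstep_def by blast
 qed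
 thus ?case using assms by auto
next
 case (Suc t)
 let ?B = "(cstep G S ^^ Suc t) A"
 have "?B <= carrier G" by (auto simp: cstep_def)
 moreover have "\<one> : ?B" using Suc by auto
 moreover have "?B \<subseteq> (cstep G S ^^ Suc (Suc t)) A"
  using cstep_mono[of "(cstep G S ^^ t) A" ?B] Suc by simp
 ultimately show ?case by blast
qed

lemma normal_closure_fixed:
 assumes "A <= carrier G" "\<one> : A"
 shows "cstep G S (normal_closure G S A) = normal_closure G S A"
 unfolding normal_closure_def
proof (rule iterate_increasing_fixed)
 show "(cstep G S ^^ t) A \<subseteq> (cstep G S ^^ Suc t) A" for t
  using cstep_iterates[OF assms, where t = t] by blast
 show "(cstep G S ^^ t) A <= carrier G" for t
  using cstep_iterates[OF assms, where t = t] by blast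
qed (rule fin)

lemma normal_closure_contains:
 assumes "A <= carrier G" "\<one> : A"
 shows "A \<subseteq> normal_closure G S A"
proof -
 have "A \<subseteq> (cstep G S ^^ t) A" for t
 proof (induction t)
  case (Suc t)
  thus ?case using cstep_iterates[OF assms, where t = t] by blast
 qed simp
 thus ?thesis by (simp add: normal_closure_def)
qed

lemma conj_eq: "y : carrier G ==> s : carrier G ==> u : carrier G ==> y \<otimes> s = s \<otimes> u \<longleftrightarrow> y = s \<otimes> u \<otimes> inv s"
 by (metis inv_solve_right m_closed)

lemma normal_closure_least:
 assumes "normal_in G M S" "A \<subseteq> M"
 shows "normal_closure G S A \<subseteq> M"
proof -
 have M: "subgroup M G" "subgroup S G" "M <= carrier G" "S <= carrier G"
  using assms by (auto simp: normal_in_def subgroup.subset)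
 have step: "cstep G S N \<subseteq> M" if "N \<subseteq> M" for N
 proof
  fix y assume "y : cstep G S N"
  then consider u v where "u : N" "v : N" "u \<otimes> v = y"
   | s u where "s : S" "u : N" "y \<otimes> s = s \<otimes> u" "y : carrier G"
   unfolding cstep_def by blast
  thus "y : M"
  proof cases
   case 1
   thus ?thesis using that M subgroup.m_closed by (metis subsetD)
  next
   case 2
   hence "y = s \<otimes> u \<otimes> inv s" using conj_eq M that by (metis subsetD)
   thus ?thesis using 2 assms that by (auto simp: normal_in_def)
  qed
 qed
 have "(cstep G S ^^ t) A \<subseteq> M" for t
  by (induction t) (use assms step in auto)
 thus ?thesis by (simp add: normal_closure_def)
qed

lemma normal_closure_normal:
 assumes "subgroup S G" "A \<subseteq> S" "\<one> : A"
 shows "normal_in G (normal_closure G S A) S"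
proof -
 let ?N = "normal_closure G S A"
 have S: "S <= carrier G" using assms subgroup.subset by auto
 have A: "A <= carrier G" using S assms by auto
 note fx = normal_closure_fixed[OF A assms(3), of S]
 have sub: "?N <= carrier G" using fx unfolding cstep_def by blast
 have "normal_in G S S" using assms S by (auto simp: normal_in_def subgroup.m_closed subgroup.m_inv_closed)
 hence NS: "?N \<subseteq> S" using normal_closure_least assms by blast
 have one: "\<one> : ?N" using normal_closure_contains[OF A assms(3)] assms by auto
 have mult: "x \<otimes> y : ?N" if "x : ?N" "y : ?N" for x y
 proof -
  have "x \<otimes> y : cstep G S ?N" using that sub unfolding cstep_def by auto
  thus ?thesis using fx by simp
 qed
 have sg: "subgroup ?N G" by (rule subgroup_finite_closed[OF sub one mult])
 have "s \<otimes> h \<otimes> inv s : ?N" if "s : S" "h : ?N" for s h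
 proof -
  have c: "s : carrier G" "h : carrier G" using that S sub by auto
  have "(s \<otimes> h \<otimes> inv s) \<otimes> s = s \<otimes> h" using c by (simp add: m_assoc)
  hence "s \<otimes> h \<otimes> inv s : cstep G S ?N"
   using that c m_closed inv_closed unfolding cstep_def by blast
  thus ?thesis using fx by simp
 qed
 thus ?thesis using sg assms NS by (auto simp: normal_in_def)
qed

lemma subnormal_subgroup: "subnormal G H ==> subgroup H G"
 by (induction rule: subnormal.induct) (auto simp: subgroup_self normal_in_def)

lemma normal_in_Int:
 assumes "normal_in G H S" "subgroup L G" "L \<subseteq> S"
 shows "normal_in G (L Int H) L"
 using assms subgroups_Inter_pair[of L H]
 by (auto simp: normal_in_def subgroup.m_closed subgroup.m_inv_closed)

lemma descent_props:
 assumes "A <= carrier G" "\<one> : A"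
 shows "subnormal G (descent G A j) & A \<subseteq> descent G A j & descent G A (Suc j) \<subseteq> descent G A j"
proof (induction j)
 case 0
 have "normal_in G (normal_closure G (carrier G) A) (carrier G)"
  using normal_closure_normal[OF subgroup_self] assms by auto
 thus ?case using assms by (auto intro: subnormal.top simp: normal_in_def)
next
 case (Suc j)
 let ?S = "descent G A j"
 let ?T = "descent G A (Suc j)"
 have n: "normal_in G ?T ?S" using normal_closure_normal[of ?S A] Suc assms subnormal_subgroup by auto
 hence sT: "subnormal G ?T" using Suc subnormal.below by blast
 moreover have AT: "A \<subseteq> ?T" using normal_closure_contains[OF assms] by auto
 moreover have "normal_in G (normal_closure G ?T A) ?T"
  using normal_closure_normal[OF subnormal_subgroup[OF sT] AT assms(2)] .
 ultimately show ?case by (auto simp: normal_in_def)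
qed

context
 fixes K assumes K: "subgroup K G"
begin

lemma insert_ok: "x : carrier G ==> insert x K <= carrier G" "\<one> : insert x K"
 using subgroup.subset[OF K] subgroup.one_closed[OF K] by auto

lemma sn_closure_props:
 assumes "x : carrier G"
 shows "subnormal G (sn_closure G K x)" "K \<subseteq> sn_closure G K x" "x : sn_closure G K x"
  "subgroup (sn_closure G K x) G"
 using descent_props[OF insert_ok(1)[OF assms] insert_ok(2), of "card (carrier G)"] subnormal_subgroup
 unfolding sn_closure_def by auto

lemma sn_closure_fixed:
 assumes "x : carrier G"
 shows "normal_closure G (sn_closure G K x) (insert x K) = sn_closure G K x"
 unfolding sn_closure_def
 by (rule iterate_decreasing_fixed[of "descent G (insert x K)" "%S. normal_closure G S (insert x K)"])
   (use descent_props[OF insert_ok(1)[OF assms] insert_ok(2)] fin in auto)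

text \<open>Induction along the normal chain from the whole group down to \<open>W\<close>. If
  \<open>L\<close> lies in the term \<open>S\<close>, then \<open>L Int H\<close> is normal in
  \<open>L\<close> and contains \<open>A\<close>; as \<open>L\<close> is its own normal closure of
  \<open>A\<close>, it lies in the next term \<open>H\<close>.\<close>

lemma below_subnormal:
 assumes "subnormal G W" "subgroup L G" "A \<subseteq> W" "A \<subseteq> L" "L \<subseteq> normal_closure G L A"
 shows "L \<subseteq> W"
 using assms
proof (induction rule: subnormal.induct)
 case top
 thus ?case by (simp add: subgroup.subset)
next
 case (below H S)
 hence "L \<subseteq> S" by (auto simp: normal_in_def)
 hence "normal_in G (L Int H) L" using below normal_in_Int by blast
 hence "normal_closure G L A \<subseteq> L Int H" by (rule normal_closure_least) (use below in auto)
 thus ?case using below by auto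
qed

lemma sn_closure_least:
 assumes "subnormal G W" "K \<subseteq> W" "x : W"
 shows "sn_closure G K x \<subseteq> W"
proof -
 have x: "x : carrier G" using assms subnormal_subgroup subgroup.subset by blast
 show ?thesis
  by (rule below_subnormal[OF assms(1), of _ "insert x K"])
    (use sn_closure_props[OF x] sn_closure_fixed[OF x] assms in auto)
qed

text \<open>An element of \<open>W\<close> outside \<open>K\<close> regenerates \<open>x\<close>
  inside \<open>W\<close>. Hence no subnormal subgroup fits strictly between \<open>K\<close> and
  the closure, which is what makes the grown series maximal.\<close>

lemma min_aboveD:
 assumes "x : min_above G K" "subnormal G W" "K \<subseteq> W" "W \<subseteq> sn_closure G K x" "W ~= K"
 shows "W = sn_closure G K x"
proof -
 obtain y where y: "y : W" "y ~: K" using assms by auto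
 hence "x : sn_closure G K y" using assms unfolding min_above_def by auto
 hence "x : W" using sn_closure_least[OF assms(2,3) y(1)] by auto
 thus ?thesis using sn_closure_least[OF assms(2,3)] assms(4) by auto
qed

text \<open>By minimality the normal closure of \<open>K\<close> in \<open>?L\<close> is
  \<open>K\<close> or \<open>?L\<close>. In the second case \<open>below_subnormal\<close>, applied
  to the subnormal subgroup \<open>K\<close> itself, puts \<open>?L\<close> inside \<open>K\<close>,
  although \<open>x\<close> lies outside.\<close>

lemma min_above_normal:
 assumes "subnormal G K" "x : min_above G K"
 shows "normal_in G K (sn_closure G K x)"
proof -
 let ?L = "sn_closure G K x"
 let ?P = "normal_closure G ?L K"
 have x: "x : carrier G" "x ~: K" using assms by (auto simp: min_above_def)
 note L = sn_closure_props[OF x(1)]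
 have one: "\<one> : K" using K subgroup.one_closed by auto
 have P: "normal_in G ?P ?L" using normal_closure_normal[OF L(4) L(2) one] .
 have KP: "K \<subseteq> ?P" using normal_closure_contains[OF _ one] K subgroup.subset by blast
 have "?P = K"
 proof (rule ccontr)
  assume ne: "?P ~= K"
  have "?P = ?L" by (rule min_aboveD[OF assms(2) subnormal.below[OF P L(1)] KP _ ne])
   (use P in "auto simp: normal_in_def")
  hence "?L \<subseteq> K" using below_subnormal[OF assms(1) L(4), of K] L(2) by auto
  thus False using x L by auto
 qed
 thus ?thesis using P by simp
qed

text \<open>An element outside \<open>K\<close> whose closure has the fewest elements
  qualifies.\<close>

lemma min_above_nonempty:
 assumes "K ~= carrier G"
 shows "min_above G K ~= {}"
proof -
 have "K \<subset> carrier G" using assms K subgroup.subset by auto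
 hence "EX x. x : carrier G - K" by auto
 define x where "x = (ARG_MIN (%x. card (sn_closure G K x)) x. x : carrier G - K)"
 obtain z where z: "z : carrier G - K" using \<open>EX x. x : carrier G - K\<close> by blast
 have x: "x : carrier G - K"
  unfolding x_def by (rule arg_min_natI[where P = "%x. x : carrier G - K", OF z])
 have min: "card (sn_closure G K x) <= card (sn_closure G K y)" if "y : carrier G - K" for y
  unfolding x_def by (rule arg_min_nat_le[where P = "%x. x : carrier G - K", OF that])
 have xc: "x : carrier G" using x by simp
 note L = sn_closure_props[OF xc]
 have "x : sn_closure G K y" if y: "y : sn_closure G K x" "y ~: K" for y
 proof -
  have yc: "y : carrier G" using y subgroup.subset[OF L(4)] by auto
  have "sn_closure G K y \<subseteq> sn_closure G K x"
   using sn_closure_least[OF L(1,2) y(1)] .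
  moreover have "finite (sn_closure G K x)" using L(4) subgroup.subset fin finite_subset by metis
  ultimately have "sn_closure G K y = sn_closure G K x"
   using min[of y] y yc by (intro card_seteq) auto
  thus ?thesis using L(3) by simp
 qed
 hence "x : min_above G K" using x by (auto simp: min_above_def)
 thus ?thesis by auto
qed

text \<open>Only the coset of \<open>x\<close> by \<open>K\<close> matters, so one representative
  per coset suffices. This divides the number of choices by \<open>card K\<close>.\<close>

lemma min_above_coset:
 assumes "x : min_above G K" "k : K"
 shows "x \<otimes> k : min_above G K" "sn_closure G K (x \<otimes> k) = sn_closure G K x"
proof -
 have x: "x : carrier G" "x ~: K" and k: "k : carrier G"
  using assms K subgroup.subset by (auto simp: min_above_def)
 note L = sn_closure_props[OF x(1)]
 have xk: "x \<otimes> k : carrier G" using x k by simp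
 note L' = sn_closure_props[OF xk]
 have "x \<otimes> k : sn_closure G K x" using L assms subgroup.m_closed[OF L(4)] by auto
 hence 1: "sn_closure G K (x \<otimes> k) \<subseteq> sn_closure G K x"
  using sn_closure_least[OF L(1,2)] by auto
 have xx: "x = (x \<otimes> k) \<otimes> inv k" using x k by (simp add: m_assoc)
 have ik: "inv k : K" using subgroup.m_inv_closed[OF K assms(2)] .
 have "x : sn_closure G K (x \<otimes> k)"
  using L' ik subgroup.m_closed[OF L'(4) L'(3), of "inv k"] xx by auto
 hence 2: "sn_closure G K x \<subseteq> sn_closure G K (x \<otimes> k)"
  using sn_closure_least[OF L'(1,2)] by auto
 show eq: "sn_closure G K (x \<otimes> k) = sn_closure G K x" using 1 2 by auto
 have nk: "x \<otimes> k ~: K" using xx x ik subgroup.m_closed[OF K] by metis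
 have "x \<otimes> k : sn_closure G K y" if "y : sn_closure G K x" "y ~: K" for y
 proof -
  have y: "y : carrier G" using that subgroup.subset[OF L(4)] by auto
  have "x : sn_closure G K y" using assms that by (auto simp: min_above_def)
  thus ?thesis using sn_closure_props[OF y] assms(2)
   by (auto intro: subgroup.m_closed[OF sn_closure_props(4)[OF y]])
 qed
 thus "x \<otimes> k : min_above G K" using eq xk nk by (auto simp: min_above_def)
qed

end

section \<open>Maximality of the grown series\<close>

lemma subnormal_series_subnormal:
 assumes "subnormal_series G Hs" "i < length Hs"
 shows "subnormal G (Hs ! i)"
 using assms(2)
proof (induction "length Hs - 1 - i" arbitrary: i)
 case 0
 hence "i = length Hs - 1" by simp
 hence "Hs ! i = carrier G" using assms(1) by (auto simp: subnormal_series_def last_conv_nth)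
 thus ?case by (simp add: subnormal.top)
next
 case (Suc d)
 hence i: "Suc i < length Hs" "d = length Hs - 1 - Suc i" by auto
 hence "subnormal G (Hs ! Suc i)" using Suc by auto
 moreover have "normal_in G (Hs ! i) (Hs ! Suc i)"
  using assms(1) i Suc.prems unfolding subnormal_series_def
  by (subst normal_in_iff) auto
 ultimately show ?case by (rule subnormal.below[rotated])
qed

lemma subnormal_series_mono:
 assumes "subnormal_series G Hs" "i < j" "j < length Hs"
 shows "Hs ! i \<subset> Hs ! j"
 using assms(2,3)
proof (induction j)
 case (Suc j)
 have "Hs ! j \<subset> Hs ! Suc j" using assms(1) Suc by (auto simp: subnormal_series_def)
 thus ?case using Suc by (cases "i = j") auto
qed simp

lemma subnormal_series_comparable:
 assumes "subnormal_series G Hs" "A : set Hs" "B : set Hs"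
 shows "A \<subseteq> B \<or> B \<subset> A"
proof -
 obtain i j where "A = Hs ! i" "B = Hs ! j" "i < length Hs" "j < length Hs"
  using assms by (metis in_set_conv_nth)
 thus ?thesis using subnormal_series_mono[OF assms(1), of i j] subnormal_series_mono[OF assms(1), of j i]
  by (cases i j rule: linorder_cases) auto
qed

lemma composition_seriesI:
 assumes ne: "Ks ~= []" "hd Ks = {\<one>}" "last Ks = carrier G"
  and sub: "!!i. i < length Ks ==> subnormal G (Ks ! i)"
  and step: "!!i. Suc i < length Ks ==> EX x:min_above G (Ks ! i). Ks ! Suc i = sn_closure G (Ks ! i) x"
 shows "composition_series G Ks"
proof -
 have sg: "subgroup (Ks ! i) G" if "i < length Ks" for i using sub[OF that] subnormal_subgroup by blast
 have st: "Ks ! i \<subset> Ks ! Suc i & Ks ! i \<lhd> (G\<lparr>carrier := Ks ! Suc i\<rparr>)" if i: "Suc i < length Ks" for i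
 proof -
  obtain x where x: "x : min_above G (Ks ! i)" "Ks ! Suc i = sn_closure G (Ks ! i) x"
   using step[OF i] by auto
  have xc: "x : carrier G" "x ~: Ks ! i" using x by (auto simp: min_above_def)
  have s: "subgroup (Ks ! i) G" "subgroup (Ks ! Suc i) G" using sg i by auto
  have "Ks ! i \<subset> Ks ! Suc i" using sn_closure_props[OF s(1) xc(1)] xc x by auto
  moreover have "normal_in G (Ks ! i) (Ks ! Suc i)"
   using min_above_normal[OF s(1) sub x(1)] x i by auto
  ultimately show ?thesis using normal_in_iff[OF s] by auto
 qed
 have ss: "subnormal_series G Ks"
  unfolding subnormal_series_def using ne sg st by (auto simp: in_set_conv_nth)
 have "\<not> (EX Hs. subnormal_series G Hs & set Ks \<subset> set Hs)"
 proof
  assume "EX Hs. subnormal_series G Hs & set Ks \<subset> set Hs"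
  then obtain Hs where Hs: "subnormal_series G Hs" "set Ks \<subset> set Hs" by auto
  then obtain W where W: "W : set Hs" "W ~: set Ks" by auto
  have Wsub: "subnormal G W" using W Hs subnormal_series_subnormal by (metis in_set_conv_nth)
  have "W \<subset> carrier G"
  proof -
   have "W <= carrier G" using Wsub subnormal_subgroup subgroup.subset by blast
   moreover have "carrier G : set Ks" using ne by (metis last_in_set)
   ultimately show ?thesis using W by auto
  qed
  \<comment> \<open>The first term that properly contains the additional subgroup \<open>W\<close>.
    Terms of \<open>Hs\<close> are comparable, so its predecessor lies below \<open>W\<close>, and
    \<open>min_aboveD\<close> leaves no room between the two.\<close>
  define i where "i = (LEAST i. i < length Ks & W \<subset> Ks ! i)"
  have "EX i. i < length Ks & W \<subset> Ks ! i"
   using \<open>W \<subset> carrier G\<close> ne by (intro exI[of _ "length Ks - 1"]) (auto simp: last_conv_nth)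
  hence i: "i < length Ks" "W \<subset> Ks ! i" unfolding i_def using LeastI_ex by (metis (mono_tags, lifting))+
  have "i ~= 0"
  proof
   assume "i = 0"
   hence "W \<subset> {\<one>}" using i ne by (simp add: hd_conv_nth)
   moreover have "\<one> : W" using Wsub subnormal_subgroup subgroup.one_closed by blast
   ultimately show False by auto
  qed
  then obtain j where j: "i = Suc j" by (cases i) auto
  hence jl: "j < length Ks" "Ks ! j : set Ks" using i by auto
  hence jH: "Ks ! j : set Hs" using Hs by blast
  have "\<not> W \<subset> Ks ! j" using j jl not_less_Least[of j "%i. i < length Ks & W \<subset> Ks ! i"] by (auto simp: i_def)
  hence KW: "Ks ! j \<subseteq> W" using subnormal_series_comparable[OF Hs(1) jH W(1)] by auto
  obtain x where x: "x : min_above G (Ks ! j)" "Ks ! i = sn_closure G (Ks ! j) x"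
   using step[of j] i j by auto
  have "W = Ks ! i"
   unfolding x(2) by (rule min_aboveD[OF sg[OF jl(1)] x(1) Wsub KW]) (use i x W jl in auto)
  thus False using i by auto
 qed
 thus ?thesis using ss by (simp add: composition_series_def)
qed

end
end

section \<open>Coset representatives and the chain of an index\<close>

definition reps :: "(nat, 'b) monoid_scheme => nat set => nat set => nat set" where
 "reps G X K = {x : X. ALL z:K. x <= x \<otimes>\<^bsub>G\<^esub> z}"

text \<open>\<open>reps\<close> keeps the numerically smallest element of each left coset, and
  multiplication is a bijection from pairs of a representative and an element of \<open>K\<close> to
  \<open>X\<close>. The representatives depend on the numbering of the group, their number does
  not.\<close>

lemma card_reps:
 fixes G :: "(nat, 'b) monoid_scheme" (structure)
 assumes "group G" "finite (carrier G)" "subgroup K G" "X <= carrier G"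
  and closed: "!!x k. x : X ==> k : K ==> x \<otimes> k : X"
 shows "card (reps G X K) * card K = card X"
proof -
 interpret group G by fact
 have Kc: "K <= carrier G" using subgroup.subset[OF assms(3)] .
 have K1: "\<one> : K" and Kinv: "!!k. k : K ==> inv k : K" and Km: "!!k l. k : K ==> l : K ==> k \<otimes> l : K"
  using subgroup.one_closed[OF assms(3)] subgroup.m_inv_closed[OF assms(3)] subgroup.m_closed[OF assms(3)] by auto
 have finK: "finite K" using Kc assms(2) finite_subset by auto
 let ?f = "%(x, k). x \<otimes> k"
 have le: "x <= x'" if "x : reps G X K" "x' : X" "k : K" "k' : K" "x \<otimes> k = x' \<otimes> k'" for x x' k k'
 proof -
  have c: "x : carrier G" "x' : carrier G" "k : carrier G" "k' : carrier G"
   using that assms(4) Kc by (auto simp: reps_def)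
  have "x' = x' \<otimes> k' \<otimes> inv k'" using c by (simp add: m_assoc)
  also have "... = x \<otimes> (k \<otimes> inv k')" using c that(5)[symmetric] by (simp add: m_assoc)
  finally have "x' = x \<otimes> (k \<otimes> inv k')" .
  moreover have "k \<otimes> inv k' : K" using Km Kinv that by auto
  ultimately show ?thesis using that(1) by (auto simp: reps_def)
 qed
 have "bij_betw ?f (reps G X K \<times> K) X"
 proof (rule bij_betw_imageI)
  show "inj_on ?f (reps G X K \<times> K)"
  proof (rule inj_onI, clarify)
   fix x k x' k'
   assume a: "x : reps G X K" "k : K" "x' : reps G X K" "k' : K" "x \<otimes> k = x' \<otimes> k'"
   have X: "x : X" "x' : X" using a by (auto simp: reps_def)
   have "x = x'" using le[OF a(1) X(2) a(2,4,5)] le[OF a(3) X(1) a(4,2) a(5)[symmetric]] by simp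
   moreover have "x : carrier G" "k : carrier G" "k' : carrier G" using a X assms(4) Kc by auto
   ultimately show "x = x' & k = k'" using a(5) by auto
  qed
  show "?f ` (reps G X K \<times> K) = X"
  proof
   show "?f ` (reps G X K \<times> K) \<subseteq> X" using closed by (auto simp: reps_def)
   show "X \<subseteq> ?f ` (reps G X K \<times> K)"
   proof
    fix y assume y: "y : X"
    define S where "S = (%k. y \<otimes> k) ` K"
    have S: "finite S" "S ~= {}" using finK K1 by (auto simp: S_def)
    hence "Min S : S" by (rule Min_in)
    then obtain k where k: "k : K" "Min S = y \<otimes> k" by (auto simp: S_def)
    have c: "y : carrier G" "k : carrier G" using y k assms(4) Kc by auto
    have "y \<otimes> k <= (y \<otimes> k) \<otimes> z" if z: "z : K" for z
    proof -
     have "(y \<otimes> k) \<otimes> z = y \<otimes> (k \<otimes> z)" using c z Kc by (auto simp: m_assoc)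
     hence "(y \<otimes> k) \<otimes> z : S" using Km k z by (auto simp: S_def)
     thus ?thesis using Min_le[OF S(1)] k(2) by simp
    qed
    hence r: "y \<otimes> k : reps G X K" using closed y k by (auto simp: reps_def)
    have "y = (y \<otimes> k) \<otimes> inv k" using c by (simp add: m_assoc)
    thus "y : ?f ` (reps G X K \<times> K)" using r Kinv[OF k(1)]
     by (intro image_eqI[of _ _ "(y \<otimes> k, inv k)"]) auto
   qed
  qed
 qed
 hence "card (reps G X K \<times> K) = card X" by (rule bij_betw_same_card)
 thus ?thesis by (simp add: card_cartesian_product)
qed

definition rank :: "nat set => nat => nat" where "rank T x = card {y : T. y < x}"

lemma rank_bij:
 assumes "finite T"
 shows "bij_betw (rank T) T {..<card T}"
proof -
 have lt: "rank T x < rank T y" if "x : T" "x < y" for x y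
  unfolding rank_def using assms that by (intro psubset_card_mono) auto
 have inj: "inj_on (rank T) T"
  by (rule inj_onI) (metis lt less_irrefl linorder_neqE_nat)
 have "rank T x < card T" if "x : T" for x
  unfolding rank_def using assms that by (intro psubset_card_mono) auto
 hence "rank T ` T <= {..<card T}" by auto
 moreover have "card (rank T ` T) = card {..<card T}" using inj by (simp add: card_image)
 ultimately have "rank T ` T = {..<card T}" by (intro card_subset_eq) auto
 thus ?thesis using inj by (simp add: bij_betw_def)
qed

text \<open>The test for the identity separates subgroups from the empty set, which marks the end of
  a chain and must have no successor.\<close>

definition choices :: "(nat, 'b) monoid_scheme => nat set => nat set" where
 "choices G K = (if \<one>\<^bsub>G\<^esub> : K then reps G (min_above G K) K else {})"

text \<open>The union has at most one member and becomes empty when there is no choice. Reduction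
  modulo the number of choices makes every number \<open>r\<close> usable, at the price of a
  slightly uneven distribution.\<close>

definition next_term :: "(nat, 'b) monoid_scheme => nat set => nat => nat set" where
 "next_term G K r = \<Union> {sn_closure G K x | x.
   x : choices G K & rank (choices G K) x = r mod card (choices G K)}"

primrec chain :: "(nat, 'b) monoid_scheme => (nat => nat) => nat => nat set" where
 "chain G r 0 = {\<one>\<^bsub>G\<^esub>}"
| "chain G r (Suc i) = next_term G (chain G r i) (r i)"

definition chain_series :: "(nat, 'b) monoid_scheme => (nat => nat) => nat set list" where
 "chain_series G r = filter (%A. A ~= {}) (map (chain G r) [0..<card (carrier G)])"

lemma chain_cong: "(!!j. j < i ==> r j = r' j) ==> chain G r i = chain G r' i"
 by (induction i) auto

context
 fixes G :: "(nat, 'b) monoid_scheme" (structure)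
 assumes G: "group G" and fin: "finite (carrier G)"
begin

interpretation group G by (rule G)

lemma choices_subset: "choices G K \<subseteq> min_above G K" "choices G K <= carrier G"
 by (auto simp: choices_def reps_def min_above_def)

lemma finite_choices: "finite (choices G K)"
 using choices_subset(2) fin finite_subset by blast

lemma next_term_empty: "choices G K = {} ==> next_term G K r = {}"
 by (simp add: next_term_def)

lemma next_term_eq:
 assumes "x : choices G K" "rank (choices G K) x = r mod card (choices G K)"
 shows "next_term G K r = sn_closure G K x"
proof -
 have "{sn_closure G K x' | x'. x' : choices G K & rank (choices G K) x' = r mod card (choices G K)}
   = {sn_closure G K x}"
  using assms rank_bij[OF finite_choices, of K] by (auto simp: bij_betw_def inj_on_def)
 thus ?thesis by (simp add: next_term_def)
qed

lemma next_termE: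
 assumes "choices G K ~= {}"
 obtains x where "x : choices G K" "rank (choices G K) x = r mod card (choices G K)"
  "next_term G K r = sn_closure G K x"
proof -
 have "r mod card (choices G K) < card (choices G K)"
  using assms finite_choices by (simp add: card_gt_0_iff)
 hence "r mod card (choices G K) : rank (choices G K) ` choices G K"
  using rank_bij[OF finite_choices, of K] by (auto simp: bij_betw_def)
 then obtain x where "x : choices G K" "rank (choices G K) x = r mod card (choices G K)" by auto
 thus ?thesis using next_term_eq that by blast
qed

lemma card_choices:
 assumes "subgroup K G"
 shows "card (choices G K) * card K = card (min_above G K)"
proof -
 have "\<one> : K" using assms subgroup.one_closed by auto
 thus ?thesis unfolding choices_def
  using card_reps[OF G fin assms, of "min_above G K"] min_above_coset[OF fin assms]
  by (auto simp: min_above_def)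
qed

lemma choices_nonempty_iff:
 assumes "subgroup K G"
 shows "choices G K = {} \<longleftrightarrow> K = carrier G"
proof
 assume "choices G K = {}"
 hence "card (min_above G K) = 0" using card_choices[OF assms] by simp
 moreover have "finite (min_above G K)" using fin finite_subset[of _ "carrier G"] by (auto simp: min_above_def)
 ultimately show "K = carrier G" using min_above_nonempty[OF fin assms] by auto
qed (auto simp: choices_def reps_def min_above_def)

lemma card_choices_le: "subgroup K G ==> card (choices G K) * card K <= card (carrier G)"
 unfolding card_choices using fin by (intro card_mono) (auto simp: min_above_def)

lemma chain_step:
 assumes "subnormal G (chain G r i)" "chain G r i ~= carrier G"
 obtains x where "x : min_above G (chain G r i)" "chain G r (Suc i) = sn_closure G (chain G r i) x"
  "subnormal G (chain G r (Suc i))" "chain G r i \<subset> chain G r (Suc i)"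
proof -
 have sg: "subgroup (chain G r i) G" using subnormal_subgroup[OF fin assms(1)] .
 hence "choices G (chain G r i) ~= {}" using choices_nonempty_iff assms by auto
 then obtain x where x: "x : choices G (chain G r i)"
  "next_term G (chain G r i) (r i) = sn_closure G (chain G r i) x"
  by (rule next_termE)
 have xm: "x : min_above G (chain G r i)" using x choices_subset by auto
 hence "x : carrier G" "x ~: chain G r i" by (auto simp: min_above_def)
 thus ?thesis using that[OF xm] x sn_closure_props[OF fin sg, of x] by auto
qed

lemma chain_cases: "chain G r i = {} \<or> subnormal G (chain G r i)"
proof (induction i)
 case 0
 have "normal_in G {\<one>} (carrier G)" by (auto simp: normal_in_def triv_subgroup subgroup_self)
 thus ?case using subnormal.top subnormal.below by fastforce
next
 case (Suc i)
 then consider "chain G r i = {}" | "chain G r i = carrier G" "subnormal G (chain G r i)"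
  | "subnormal G (chain G r i)" "chain G r i ~= carrier G" by blast
 thus ?case
 proof cases
  case 1
  thus ?thesis by (simp add: next_term_empty choices_def)
 next
  case 2
  hence "choices G (chain G r i) = {}" using choices_nonempty_iff subnormal_subgroup[OF fin] by blast
  thus ?thesis by (simp add: next_term_empty)
 next
  case 3
  then obtain x where "subnormal G (chain G r (Suc i))" by (rule chain_step)
  thus ?thesis by simp
 qed
qed

lemma chain_subgroup: "chain G r i ~= {} ==> subgroup (chain G r i) G"
 using chain_cases subnormal_subgroup[OF fin] by blast

lemma chain_subset: "chain G r i <= carrier G"
 using subgroup.subset[OF chain_subgroup] by (cases "chain G r i = {}") (simp, blast)

lemma chain_stops: "chain G r i = {} \<or> chain G r i = carrier G ==> chain G r (Suc i) = {}"
 using choices_nonempty_iff[OF subgroup_self] by (auto simp: next_term_empty choices_def)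

lemma chain_empty_mono: "chain G r i = {} ==> i <= j ==> chain G r j = {}"
proof (induction j)
 case (Suc j)
 thus ?case using chain_stops[of r j] by (cases "i = Suc j") auto
qed simp

text \<open>The index \<open>q\<close> exceeds 1 and divides the group order, so its prime factors
  are at least \<open>p\<close>.\<close>

lemma card_strict_subgroup:
 assumes "subgroup A G" "subgroup B G" "A \<subset> B"
  and p: "!!q. prime q ==> q dvd card (carrier G) ==> p <= q"
 shows "p * card A <= card B"
proof -
 interpret B: group "G\<lparr>carrier := B\<rparr>" by (rule subgroup.subgroup_is_group[OF assms(2) G])
 have finB: "finite B" using assms(2) fin subgroup.subset finite_subset by blast
 have "subgroup A (G\<lparr>carrier := B\<rparr>)" using subgroup_incl assms by auto
 from B.lagrange[OF this] obtain q where q: "q * card A = card B" unfolding Coset.order_def by auto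
 have cA: "card A < card B" using assms(3) finB by (intro psubset_card_mono)
 hence "q ~= 1" using q by auto
 then obtain l where l: "prime l" "l dvd q" using prime_factor_nat by blast
 have "card B dvd card (carrier G)" using lagrange[OF assms(2)] by (metis dvd_triv_right Coset.order_def)
 hence "l dvd card (carrier G)" using l q by (metis dvd_trans dvd_mult2)
 hence "p <= l" using p l by auto
 moreover have "q ~= 0" using q cA by (metis mult_0 not_less_zero)
 hence "l <= q" using l by (intro dvd_imp_le) auto
 ultimately show ?thesis using q by (metis le_trans mult_le_mono1)
qed

lemma chain_card:
 assumes p: "!!q. prime q ==> q dvd card (carrier G) ==> p <= q" and "chain G r i ~= {}"
 shows "p ^ i <= card (chain G r i)"
 using assms(2)
proof (induction i)
 case (Suc i)
 have ne: "chain G r i ~= {}" "chain G r i ~= carrier G" using Suc.prems chain_stops by blast+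
 hence sub: "subnormal G (chain G r i)" using chain_cases by blast
 obtain x where "subnormal G (chain G r (Suc i))" "chain G r i \<subset> chain G r (Suc i)"
  by (rule chain_step[OF sub ne(2)])
 hence "p * card (chain G r i) <= card (chain G r (Suc i))"
  using card_strict_subgroup[OF _ _ _ p] sub subnormal_subgroup[OF fin] by blast
 moreover have "p * p ^ i <= p * card (chain G r i)" using Suc.IH[OF ne(1)] by (rule mult_le_mono2)
 ultimately show ?case unfolding power_Suc by (rule order_trans[rotated])
qed simp

lemma chain_card2: "chain G r i ~= {} ==> 2 ^ i <= card (chain G r i)"
 using chain_card[of 2] prime_ge_2_nat by blast

text \<open>Every proper step at least doubles the term, so the whole group is reached within
  \<open>log 2\<close> of its order steps; the following term is empty. The bound on
  \<open>2 ^ m\<close> is what limits the loss in \<open>matching_indices\<close> to the group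
  order.\<close>

lemma chain_length:
 obtains m where "m < card (carrier G)" "2 ^ m <= card (carrier G)" "chain G r m = carrier G"
  "!!i. i <= m ==> chain G r i ~= {}" "!!i. i < m ==> chain G r i ~= carrier G" "!!i. m < i ==> chain G r i = {}"
proof -
 have bound: "2 ^ i <= card (carrier G)" if "chain G r i ~= {}" for i
  using chain_card2[OF that] card_mono[OF fin chain_subset, of r i] by linarith
 have "chain G r (card (carrier G)) = {}"
  using bound[of "card (carrier G)"] less_exp[of "card (carrier G)"] by (meson linorder_not_less)
 hence ex: "EX i. chain G r (Suc i) = {}" using chain_stops[of r "card (carrier G)"] by blast
 define m where "m = (LEAST i. chain G r (Suc i) = {})"
 have m: "chain G r (Suc m) = {}" unfolding m_def by (rule LeastI_ex[OF ex])
 have ne: "chain G r i ~= {}" if "i <= m" for i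
 proof (cases i)
  case (Suc j)
  thus ?thesis using not_less_Least[of j "%i. chain G r (Suc i) = {}"] that by (auto simp: m_def)
 qed simp
 have carr: "chain G r m = carrier G"
 proof (rule ccontr)
  assume "chain G r m ~= carrier G"
  moreover have "subnormal G (chain G r m)" using chain_cases ne[of m] by blast
  ultimately obtain x where "chain G r m \<subset> chain G r (Suc m)" by (elim chain_step[rotated]) simp
  thus False using m by simp
 qed
 have 2: "2 ^ m <= card (carrier G)" using bound ne by blast
 moreover have "m < card (carrier G)" using 2 less_exp[of m] by (meson le_less_trans less_le_trans)
 moreover have "chain G r i ~= carrier G" if "i < m" for i
  using chain_stops[of r i] ne[of "Suc i"] that by auto
 moreover have "chain G r i = {}" if "m < i" for i using chain_empty_mono[OF m] that by auto
 ultimately show thesis using that carr ne by blast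
qed

lemma chain_series_eq:
 assumes "m < card (carrier G)" "!!i. i <= m ==> chain G r i ~= {}" "!!i. m < i ==> chain G r i = {}"
 shows "chain_series G r = map (chain G r) [0..<Suc m]"
proof -
 have "[0..<card (carrier G)] = [0..<Suc m] @ [Suc m..<card (carrier G)]"
  using assms(1) upt_add_eq_append[of 0 "Suc m" "card (carrier G) - Suc m"] by simp
 moreover have "filter (%A. A ~= {}) (map (chain G r) [0..<Suc m]) = map (chain G r) [0..<Suc m]"
  using assms(2) by (intro filter_True) auto
 moreover have "filter (%A. A ~= {}) (map (chain G r) [Suc m..<card (carrier G)]) = []"
  using assms(3) by (intro filter_False) auto
 ultimately show ?thesis unfolding chain_series_def by (simp only: map_append filter_append append_Nil2)
qed

theorem chain_series_composition: "composition_series G (chain_series G r)"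
proof -
 obtain m where m: "m < card (carrier G)" "chain G r m = carrier G" 
  "!!i. i <= m ==> chain G r i ~= {}" "!!i. i < m ==> chain G r i ~= carrier G" "!!i. m < i ==> chain G r i = {}"
  by (rule chain_length[of r]) blast
 have eq: "chain_series G r = map (chain G r) [0..<Suc m]" using chain_series_eq m by blast
 show ?thesis
 proof (rule composition_seriesI[OF fin])
  show "chain_series G r ~= []" by (simp add: eq)
  show "hd (chain_series G r) = {\<one>}" unfolding eq by (simp add: upt_rec del: upt_Suc)
  show "last (chain_series G r) = carrier G" using m by (simp add: eq)
  fix i
  show "subnormal G (chain_series G r ! i)" if "i < length (chain_series G r)"
   using that chain_cases[of r i] m(3)[of i] by (simp add: eq del: upt_Suc)
  show "EX x:min_above G (chain_series G r ! i). chain_series G r ! Suc i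
    = sn_closure G (chain_series G r ! i) x" if "Suc i < length (chain_series G r)"
  proof -
   have i: "i < m" using that by (simp add: eq)
   hence "subnormal G (chain G r i)" using chain_cases m(3)[of i] by auto
   then obtain x where "x : min_above G (chain G r i)" "chain G r (Suc i) = sn_closure G (chain G r i) x"
    using m(4)[OF i] by (rule chain_step)
   moreover have "chain_series G r ! i = chain G r i" "chain_series G r ! Suc i = chain G r (Suc i)"
    using i by (simp_all add: eq del: upt_Suc chain.simps)
   ultimately show ?thesis by auto
  qed
 qed
qed

text \<open>Term \<open>i\<close> has at least \<open>p ^ i\<close> elements, and its cosets by
  choices are disjoint. The bound fixes the number of index bits spent on step
  \<open>i\<close>.\<close>

lemma card_choices_chain:
 assumes p: "!!q. prime q ==> q dvd card (carrier G) ==> p <= q"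
 shows "card (choices G (chain G r i)) * p ^ i <= card (carrier G)"
proof (cases "chain G r i = {}")
 case False
 have "card (choices G (chain G r i)) * p ^ i <= card (choices G (chain G r i)) * card (chain G r i)"
  using chain_card[OF p False] by simp
 also have "... <= card (carrier G)" using card_choices_le chain_subgroup[OF False] by blast
 finally show ?thesis .
qed (simp add: choices_def)

end

section \<open>Invariance of the construction under isomorphisms\<close>

locale group_pair =
 fixes G :: "('a, 'm) monoid_scheme" and H :: "('b, 'k) monoid_scheme" and ph :: "'a => 'b"
 assumes GG: "group G" and GH: "group H" and finG: "finite (carrier G)" and finH: "finite (carrier H)"
  and iso: "ph : iso G H"
begin

lemma hom: "x : carrier G ==> y : carrier G ==> ph (x \<otimes>\<^bsub>G\<^esub> y) = ph x \<otimes>\<^bsub>H\<^esub> ph y"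
 using iso by (auto simp: iso_def hom_def)

lemma bij: "bij_betw ph (carrier G) (carrier H)"
 using iso by (auto simp: iso_def)

lemma inj: "inj_on ph (carrier G)" and surj: "ph ` carrier G = carrier H"
 using bij by (auto simp: bij_betw_def)

lemma closed: "x : carrier G ==> ph x : carrier H"
 using surj by auto

lemma card_eq: "card (carrier H) = card (carrier G)"
 using bij by (simp add: bij_betw_same_card)

lemma eq_iff: "x : carrier G ==> y : carrier G ==> ph x = ph y \<longleftrightarrow> x = y"
 using inj by (auto simp: inj_on_def)

lemma mem_image: "x : carrier G ==> A <= carrier G ==> ph x : ph ` A \<longleftrightarrow> x : A"
 using inj by (auto simp: inj_on_def)

lemma one_eq: "ph \<one>\<^bsub>G\<^esub> = \<one>\<^bsub>H\<^esub>"
 using iso GG GH by (auto simp: iso_def intro: hom_one)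

lemma mult_closed: "x : carrier G ==> y : carrier G ==> x \<otimes>\<^bsub>G\<^esub> y : carrier G"
 by (rule monoid.m_closed[OF group.is_monoid[OF GG]])

lemma cstep_image:
 assumes "S <= carrier G" "A <= carrier G"
 shows "cstep H (ph ` S) (ph ` A) = ph ` cstep G S A"
proof (intro equalityI subsetI)
 fix y assume y: "y : cstep H (ph ` S) (ph ` A)"
 hence "y : carrier H" by (simp add: cstep_def)
 then obtain x where x: "x : carrier G" "y = ph x" using surj by auto
 have "x : cstep G S A"
  using y x assms mult_closed unfolding cstep_def
  by (auto simp: hom[symmetric] eq_iff subset_iff)
 thus "y : ph ` cstep G S A" using x by auto
next
 fix y assume "y : ph ` cstep G S A"
 then obtain x where x: "y = ph x" "x : cstep G S A" by auto
 hence xc: "x : carrier G" by (simp add: cstep_def)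
 hence yc: "y : carrier H" using closed x(1) by simp
 from x consider u v where "u : A" "v : A" "u \<otimes>\<^bsub>G\<^esub> v = x" | s u where "s : S" "u : A" "x \<otimes>\<^bsub>G\<^esub> s = s \<otimes>\<^bsub>G\<^esub> u"
  unfolding cstep_def by blast
 thus "y : cstep H (ph ` S) (ph ` A)"
 proof cases
  case 1
  hence "ph u \<otimes>\<^bsub>H\<^esub> ph v = y" using hom[of u v] assms x by (auto simp: subset_iff)
  thus ?thesis using 1 yc unfolding cstep_def by blast
 next
  case 2
  hence c: "s : carrier G" "u : carrier G" using assms by auto
  have "y \<otimes>\<^bsub>H\<^esub> ph s = ph s \<otimes>\<^bsub>H\<^esub> ph u" using hom[of x s] hom[of s u] c xc x 2 by simp
  thus ?thesis using 2 yc unfolding cstep_def by blast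
 qed
qed

lemma funpow_carrier: "A <= carrier G ==> (cstep G S ^^ t) A <= carrier G"
 by (cases t) (auto simp: cstep_def)

lemma funpow_image:
 assumes "S <= carrier G" "A <= carrier G"
 shows "(cstep H (ph ` S) ^^ t) (ph ` A) = ph ` ((cstep G S ^^ t) A)"
 by (induction t) (simp_all add: cstep_image[OF assms(1) funpow_carrier[OF assms(2)]])

lemma normal_closure_image:
 assumes "S <= carrier G" "A <= carrier G"
 shows "normal_closure H (ph ` S) (ph ` A) = ph ` normal_closure G S A"
 unfolding normal_closure_def card_eq by (rule funpow_image[OF assms])

lemma descent_carrier: "A <= carrier G ==> descent G A j <= carrier G"
 by (cases j) (auto simp: normal_closure_def dest: funpow_carrier[THEN subsetD])

lemma descent_image:
 assumes "A <= carrier G"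
 shows "descent H (ph ` A) j = ph ` descent G A j"
 by (induction j) (simp_all add: surj normal_closure_image[OF descent_carrier[OF assms] assms])

lemma sn_closure_image:
 assumes "K <= carrier G" "x : carrier G"
 shows "sn_closure H (ph ` K) (ph x) = ph ` sn_closure G K x"
proof -
 have "insert x K <= carrier G" using assms by auto
 from descent_image[OF this] show ?thesis unfolding sn_closure_def card_eq by simp
qed

lemma sn_closure_carrier:
 "K <= carrier G ==> x : carrier G ==> sn_closure G K x <= carrier G"
 unfolding sn_closure_def by (rule descent_carrier) auto

lemma min_above_image:
 assumes K: "K <= carrier G"
 shows "min_above H (ph ` K) = ph ` min_above G K"
proof -
 have "ph x : min_above H (ph ` K) \<longleftrightarrow> x : min_above G K" if x: "x : carrier G" for x
 proof -
  have "(ALL y:sn_closure H (ph ` K) (ph x). y : ph ` K \<or> ph x : sn_closure H (ph ` K) y)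
   \<longleftrightarrow> (ALL y:sn_closure G K x. ph y : ph ` K \<or> ph x : sn_closure H (ph ` K) (ph y))"
   unfolding sn_closure_image[OF K x] by simp
  also have "... \<longleftrightarrow> (ALL y:sn_closure G K x. y : K \<or> x : sn_closure G K y)"
  proof (rule ball_cong[OF refl])
   fix y assume "y : sn_closure G K x"
   hence y: "y : carrier G" using sn_closure_carrier[OF K x] by auto
   show "(ph y : ph ` K \<or> ph x : sn_closure H (ph ` K) (ph y)) = (y : K \<or> x : sn_closure G K y)"
    unfolding sn_closure_image[OF K y] using mem_image[OF y K]
     mem_image[OF x sn_closure_carrier[OF K y]] by simp
  qed
  finally show ?thesis using x closed[OF x] mem_image[OF x K] by (simp add: min_above_def)
 qed
 note mem = this
 show ?thesis
 proof (intro equalityI subsetI)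
  fix y assume y: "y : min_above H (ph ` K)"
  hence "y : ph ` carrier G" unfolding surj by (simp add: min_above_def)
  then obtain x where "x : carrier G" "y = ph x" by blast
  thus "y : ph ` min_above G K" using mem[of x] y by simp
 next
  fix y assume "y : ph ` min_above G K"
  then obtain x where x: "x : min_above G K" "y = ph x" by blast
  hence "x : carrier G" by (simp add: min_above_def)
  thus "y : min_above H (ph ` K)" using mem[of x] x by simp
 qed
qed

lemma subgroup_image: "subgroup K G ==> subgroup (ph ` K) H"
 using group_hom.subgroup_img_is_subgroup[of G H ph K] iso GG GH
 by (auto simp: group_hom_def group_hom_axioms_def iso_def)

end

section \<open>Counting the indices that lead to a given chain\<close>

lemma card_mod_class:
 fixes W c j :: nat
 assumes "j < c"
 shows "W div c <= card {r. r < W & r mod c = j}" "card {r. r < W & r mod c = j} <= W div c + 1"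
proof -
 have c: "c > 0" using assms by simp
 have fin: "finite {r. r < W & r mod c = j}" by simp
 have "t * c + j < W" if "t < W div c" for t
 proof -
  have "t * c + j < Suc t * c" using assms by simp
  also have "... <= W div c * c" using that by (intro mult_le_mono1) simp
  also have "... <= W" by simp
  finally show ?thesis .
 qed
 hence "(%t. t * c + j) ` {..<W div c} <= {r. r < W & r mod c = j}" using assms by auto
 hence "card ((%t. t * c + j) ` {..<W div c}) <= card {r. r < W & r mod c = j}"
  using fin by (rule card_mono[rotated])
 moreover have "inj_on (%t. t * c + j) {..<W div c}" using c by (auto simp: inj_on_def)
 ultimately show "W div c <= card {r. r < W & r mod c = j}" by (simp add: card_image)
 have "(%r. r div c) ` {r. r < W & r mod c = j} <= {..W div c}" by (auto intro: div_le_mono)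
 hence "card ((%r. r div c) ` {r. r < W & r mod c = j}) <= card {..W div c}"
  by (rule card_mono[rotated]) simp
 moreover have "inj_on (%r. r div c) {r. r < W & r mod c = j}"
  by (rule inj_onI) (metis (mono_tags, lifting) div_mult_mod_eq mem_Collect_eq)
 ultimately show "card {r. r < W & r mod c = j} <= W div c + 1" by (simp add: card_image)
qed

lemma card_mod_set:
 fixes W c :: nat
 assumes "J <= {..<c}"
 shows "card J * (W div c) <= card {r. r < W & r mod c : J}"
  "card {r. r < W & r mod c : J} <= card J * (W div c + 1)"
proof -
 have fin: "finite J" using assms finite_subset by blast
 have "{r. r < W & r mod c : J} = (\<Union>j\<in>J. {r. r < W & r mod c = j})" by auto
 hence eq: "card {r. r < W & r mod c : J} = (\<Sum>j\<in>J. card {r. r < W & r mod c = j})"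
  using fin by (simp only:, subst card_UN_disjoint) auto
 have "(\<Sum>j\<in>J. W div c) <= (\<Sum>j\<in>J. card {r. r < W & r mod c = j})"
  by (rule sum_mono) (use assms card_mod_class(1) in auto)
 thus "card J * (W div c) <= card {r. r < W & r mod c : J}" unfolding eq by simp
 have "(\<Sum>j\<in>J. card {r. r < W & r mod c = j}) <= (\<Sum>j\<in>J. W div c + 1)"
  by (rule sum_mono) (use assms card_mod_class(2) in auto)
 thus "card {r. r < W & r mod c : J} <= card J * (W div c + 1)" unfolding eq by simp
qed

definition closure_choices :: "(nat, 'c) monoid_scheme => nat set => nat set => nat set" where
 "closure_choices G K K' = {x : choices G K. sn_closure G K x = K'}"

definition hits :: "(nat, 'c) monoid_scheme => nat => nat set => nat set => nat set" where
 "hits G W K K' = {r. r < W & next_term G K r = K'}"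

text \<open>As \<open>rank\<close> is a bijection onto an initial segment, the numbers that lead to
  \<open>K'\<close> are those in as many residue classes as there are choices with closure
  \<open>K'\<close>.\<close>

lemma hits_eq:
 fixes G :: "(nat, 'c) monoid_scheme"
 assumes "group G" "finite (carrier G)" "choices G K ~= {}"
 shows "hits G W K K' = {r. r < W & r mod card (choices G K) : rank (choices G K) ` closure_choices G K K'}"
  and "card (rank (choices G K) ` closure_choices G K K') = card (closure_choices G K K')"
  and "rank (choices G K) ` closure_choices G K K' <= {..<card (choices G K)}"
proof -
 let ?T = "choices G K"
 have b: "bij_betw (rank ?T) ?T {..<card ?T}" using rank_bij finite_choices[OF assms(1,2)] by blast
 have sub: "closure_choices G K K' \<subseteq> ?T" by (auto simp: closure_choices_def)
 show "card (rank ?T ` closure_choices G K K') = card (closure_choices G K K')"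
  using b sub by (intro card_image) (auto simp: bij_betw_def inj_on_subset)
 show "rank ?T ` closure_choices G K K' <= {..<card ?T}"
  using b sub by (auto simp: bij_betw_def)
 have "next_term G K r = K' \<longleftrightarrow> r mod card ?T : rank ?T ` closure_choices G K K'" for r
 proof -
  obtain x where x: "x : ?T" "rank ?T x = r mod card ?T" "next_term G K r = sn_closure G K x"
   by (rule next_termE[OF assms])
  have "rank ?T x : rank ?T ` closure_choices G K K' \<longleftrightarrow> x : closure_choices G K K'"
   using b by (intro inj_on_image_mem_iff[OF _ x(1) sub]) (simp add: bij_betw_def)
  thus ?thesis using x by (auto simp: closure_choices_def)
 qed
 thus "hits G W K K' = {r. r < W & r mod card ?T : rank ?T ` closure_choices G K K'}"
  by (simp add: hits_def)
qed

definition index_space :: "(nat => nat) => nat => (nat => nat) set" where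
 "index_space W m = (\<Pi>\<^sub>E i\<in>{..<m}. {..<W i})"

locale nat_group_pair = group_pair G H ph
 for G :: "(nat, 'm) monoid_scheme" and H :: "(nat, 'k) monoid_scheme" and ph :: "nat => nat"
begin

text \<open>The isomorphism need not map the smallest element of a coset to the smallest one, so the
  sets of choices do not correspond. Their cardinalities do: by \<open>card_reps\<close> they are
  the numbers of suitable elements divided by \<open>card K\<close>.\<close>

lemma card_choices_image:
 assumes K: "subgroup K G"
 shows "card (choices H (ph ` K)) = card (choices G K)"
  and "K' <= carrier G ==> card (closure_choices H (ph ` K) (ph ` K')) = card (closure_choices G K K')"
proof -
 have Kc: "K <= carrier G" using subgroup.subset[OF K] .
 have finK: "finite K" "K ~= {}" using Kc finG finite_subset subgroup.one_closed[OF K] by auto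
 hence cK: "card K > 0" by (simp add: card_gt_0_iff)
 have cKH: "card (ph ` K) = card K" using inj_on_subset[OF inj Kc] by (simp add: card_image)
 note KH = subgroup_image[OF K]
 have mc: "min_above G K <= carrier G" by (auto simp: min_above_def)
 have "card (min_above H (ph ` K)) = card (min_above G K)"
  unfolding min_above_image[OF Kc] using inj_on_subset[OF inj mc] by (simp add: card_image)
 hence "card (choices H (ph ` K)) * card K = card (choices G K) * card K"
  using card_choices[OF GG finG K] card_choices[OF GH finH KH] cKH by simp
 thus "card (choices H (ph ` K)) = card (choices G K)" using cK by simp
 assume K': "K' <= carrier G"
 define X where "X = {x : min_above G K. sn_closure G K x = K'}"
 define Y where "Y = {x : min_above H (ph ` K). sn_closure H (ph ` K) x = ph ` K'}"
 have cc: "closure_choices G K K' = reps G X K" "closure_choices H (ph ` K) (ph ` K') = reps H Y (ph ` K)"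
  using subgroup.one_closed[OF K] subgroup.one_closed[OF KH]
  by (auto simp: closure_choices_def choices_def reps_def X_def Y_def)
 have "Y = ph ` X"
 proof -
  have "sn_closure H (ph ` K) (ph x) = ph ` K' \<longleftrightarrow> sn_closure G K x = K'" if "x : carrier G" for x
   unfolding sn_closure_image[OF Kc that]
   using inj_on_image_eq_iff[OF inj sn_closure_carrier[OF Kc that] K'] .
  thus ?thesis using mc unfolding X_def Y_def min_above_image[OF Kc] by auto
 qed
 moreover have Xc: "X <= carrier G" using mc by (auto simp: X_def)
 ultimately have cXY: "card Y = card X" using inj_on_subset[OF inj Xc] by (simp add: card_image)
 have Yc: "Y <= carrier H" by (auto simp: Y_def min_above_def)
 have "card (reps G X K) * card K = card X"
  by (rule card_reps[OF GG finG K Xc])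
    (use group.min_above_coset[OF GG finG K] in "auto simp: X_def")
 moreover have "card (reps H Y (ph ` K)) * card K = card Y"
  unfolding cKH[symmetric] by (rule card_reps[OF GH finH KH Yc])
    (use group.min_above_coset[OF GH finH KH] in "auto simp: Y_def")
 ultimately have "card (reps H Y (ph ` K)) * card K = card (reps G X K) * card K" using cXY by simp
 thus "card (closure_choices H (ph ` K) (ph ` K')) = card (closure_choices G K K')"
  unfolding cc using cK by simp
qed

text \<open>With \<open>q\<close> suitable choices among \<open>c\<close>, both counts lie between
  \<open>q * (W div c)\<close> and \<open>q * (W div c + 1)\<close>. Since \<open>c <= W\<close>
  gives \<open>W div c >= 1\<close>, they differ by a factor of at most 2. Without any choice the
  next term is empty on both sides and nothing is lost.\<close>

lemma hits_bound:
 assumes "K = {} \<or> subgroup K G" "K' <= carrier G" "card (choices G K) <= W"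
 shows "card (hits G W K K') <= (if choices G K = {} then 1 else 2) * card (hits H W (ph ` K) (ph ` K'))"
proof (cases "choices G K = {}")
 case True
 have "choices H (ph ` K) = {}"
 proof (cases "K = {}")
  case False
  hence "card (choices H (ph ` K)) = 0" using card_choices_image(1) assms(1) True by fastforce
  thus ?thesis using finite_choices[OF GH finH] by simp
 qed (simp add: choices_def)
 hence "hits G W K K' = hits H W (ph ` K) (ph ` K')"
  using True by (auto simp: hits_def next_term_def)
 thus ?thesis using True by simp
next
 case False
 hence K: "subgroup K G" using assms(1) by (auto simp: choices_def)
 let ?c = "card (choices G K)"
 have fin: "finite (choices G K)" using finite_choices[OF GG finG] .
 hence c0: "?c > 0" using False by (simp add: card_gt_0_iff)
 have ce: "card (choices H (ph ` K)) = ?c" using card_choices_image(1)[OF K] .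
 hence neH: "choices H (ph ` K) ~= {}" using c0 by auto
 let ?q = "card (closure_choices G K K')"
 note h1 = hits_eq[OF GG finG False, where K' = K'] and h2 = hits_eq[OF GH finH neH, where K' = "ph ` K'"]
 have "card (hits G W K K') <= ?q * (W div ?c + 1)"
  using card_mod_set(2)[OF h1(3), of W] h1(2) unfolding h1(1) by simp
 also have "W div ?c >= 1" using assms(3) c0 by (simp add: Suc_le_eq div_greater_zero_iff)
 hence "?q * (W div ?c + 1) <= ?q * (2 * (W div ?c))" by (intro mult_le_mono2) simp
 also have "... = 2 * (card (closure_choices H (ph ` K) (ph ` K')) * (W div card (choices H (ph ` K))))"
  using card_choices_image(2)[OF K assms(2)] ce by simp
 also have "card (closure_choices H (ph ` K) (ph ` K')) * (W div card (choices H (ph ` K)))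
   <= card (hits H W (ph ` K) (ph ` K'))"
  using card_mod_set(1)[OF h2(3), of W] h2(2) unfolding h2(1) by simp
 finally show ?thesis using False by simp
qed

text \<open>The value at position \<open>m\<close> affects only the terms after \<open>m\<close>, so
  a longer index is an arbitrary pair of a shorter index and a hit.\<close>

lemma (in -) card_prefix_Suc:
 fixes G :: "(nat, 'c) monoid_scheme"
 shows "card {r : (\<Pi>\<^sub>E i\<in>{..<Suc m}. {..<W i}). ALL i<=Suc m. chain G r i = ka i}
  = card {r : (\<Pi>\<^sub>E i\<in>{..<m}. {..<W i}). ALL i<=m. chain G r i = ka i} * card (hits G (W m) (ka m) (ka (Suc m)))"
proof -
 let ?A = "{r : (\<Pi>\<^sub>E i\<in>{..<m}. {..<W i}). ALL i<=m. chain G r i = ka i}"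
 let ?B = "hits G (W m) (ka m) (ka (Suc m))"
 let ?C = "{r : (\<Pi>\<^sub>E i\<in>{..<Suc m}. {..<W i}). ALL i<=Suc m. chain G r i = ka i}"
 let ?f = "%(r, v). r(m := v)"
 have cc: "chain G (r(m := v)) i = chain G r i" if "i <= m" for r v i
  using that by (intro chain_cong) auto
 have "bij_betw ?f (?A \<times> ?B) ?C"
 proof (rule bij_betw_imageI)
  show "inj_on ?f (?A \<times> ?B)"
  proof (rule inj_onI, clarify)
   fix r v r' v'
   assume r: "r : (\<Pi>\<^sub>E i\<in>{..<m}. {..<W i})" "r' : (\<Pi>\<^sub>E i\<in>{..<m}. {..<W i})" and e: "r(m := v) = r'(m := v')"
   have "r m = undefined" "r' m = undefined" using r by (auto simp: PiE_def extensional_def)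
   hence "r x = r' x" for x using fun_cong[OF e, of x] by (cases "x = m") auto
   moreover have "v = v'" using fun_cong[OF e, of m] by simp
   ultimately show "r = r' & v = v'" by auto
  qed
  show "?f ` (?A \<times> ?B) = ?C"
  proof (intro equalityI subsetI)
   fix r assume "r : ?f ` (?A \<times> ?B)"
   then obtain a v where a: "r = a(m := v)" "a : ?A" "v : ?B" by auto
   have "chain G r i = ka i" if "i <= Suc m" for i
   proof (cases "i = Suc m")
    case True
    thus ?thesis using a cc[of m a v] by (simp add: hits_def)
   next
    case False
    thus ?thesis using a cc[of i a v] that by simp
   qed
   moreover have "r : (\<Pi>\<^sub>E i\<in>{..<Suc m}. {..<W i})"
    using a by (auto simp: PiE_def extensional_def hits_def less_Suc_eq)
   ultimately show "r : ?C" by blast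
  next
   fix r assume r: "r : ?C"
   define a where "a = r(m := undefined)"
   have ra: "r = a(m := r m)" by (simp add: a_def)
   have "a : (\<Pi>\<^sub>E i\<in>{..<m}. {..<W i})" using r by (auto simp: a_def PiE_def extensional_def Pi_def)
   moreover have "chain G a i = ka i" if "i <= m" for i
    using r cc[of i r undefined] that by (simp add: a_def)
   moreover have "r m : ?B"
   proof -
    have rr: "!!i. i <= Suc m ==> chain G r i = ka i" using r by simp
    have "chain G r m = ka m" "chain G r (Suc m) = ka (Suc m)" by (rule rr, simp)+
    hence "next_term G (ka m) (r m) = ka (Suc m)" by simp
    moreover have "r m < W m" using r PiE_mem[of r "{..<Suc m}" "%i. {..<W i}" m] by simp
    ultimately show ?thesis by (simp add: hits_def)
   qed
   ultimately show "r : ?f ` (?A \<times> ?B)" using ra by (intro image_eqI[of _ _ "(a, r m)"]) auto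
  qed
 qed
 hence "card (?A \<times> ?B) = card ?C" by (rule bij_betw_same_card)
 thus ?thesis unfolding card_cartesian_product by (rule sym)
qed

text \<open>Counts multiply by \<open>card_prefix_Suc\<close>, and so do the losses of
  \<open>hits_bound\<close>; the exponent counts only the steps that offer a choice.\<close>

lemma prefix_bound:
 assumes "!!i. i <= m ==> (ka i = {} \<or> subgroup (ka i) G) & ka i <= carrier G"
  and "!!i. i < m ==> card (choices G (ka i)) <= W i"
 shows "card {r : index_space W m. ALL i<=m. chain G r i = ka i}
  <= 2 ^ card {i. i < m & choices G (ka i) ~= {}}
   * card {r : index_space W m. ALL i<=m. chain H r i = ph ` ka i}"
 using assms
proof (induction m)
 case 0
 have "{\<one>\<^bsub>H\<^esub>} = ph ` {\<one>\<^bsub>G\<^esub>}" using one_eq by simp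
 moreover have "ph ` {\<one>\<^bsub>G\<^esub>} = ph ` ka 0 \<longleftrightarrow> {\<one>\<^bsub>G\<^esub>} = ka 0"
  using 0 group.is_monoid[OF GG] by (intro inj_on_image_eq_iff[OF inj]) (auto simp: monoid.one_closed)
 ultimately show ?case by (simp add: index_space_def)
next
 case (Suc m)
 let ?e = "%m. card {i. i < m & choices G (ka i) ~= {}}"
 have "{i. i < Suc m & choices G (ka i) ~= {}}
   = (if choices G (ka m) = {} then {} else {m}) Un {i. i < m & choices G (ka i) ~= {}}"
  by (auto simp: less_Suc_eq)
 hence e: "?e (Suc m) = (if choices G (ka m) = {} then 0 else 1) + ?e m"
  by (auto simp: card_insert_if)
 have IH: "card {r : index_space W m. ALL i<=m. chain G r i = ka i}
  <= 2 ^ ?e m * card {r : index_space W m. ALL i<=m. chain H r i = ph ` ka i}"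
  using Suc by auto
 have hb: "card (hits G (W m) (ka m) (ka (Suc m)))
   <= (if choices G (ka m) = {} then 1 else 2) * card (hits H (W m) (ph ` ka m) (ph ` ka (Suc m)))"
  using Suc.prems(1)[of m] Suc.prems(1)[of "Suc m"] Suc.prems(2)[of m] by (intro hits_bound) auto
 show ?case
  using mult_le_mono[OF IH hb] unfolding index_space_def card_prefix_Suc e
  by (cases "choices G (ka m) = {}") (simp_all add: power_add ac_simps)
qed

text \<open>The distribution of the chain series of a random index is an isomorphism invariant up to a
 factor of at most the group order: a factor 2 is lost for every proper step of the chain.\<close>

lemma matching_indices:
 assumes W: "!!r i. card (choices G (chain G r i)) <= W i"
  and n: "card (carrier G) = Suc m" and I: "I \<subseteq> index_space W m"
 shows "card I <= card (carrier G) *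
  card {r : index_space W m. EX r0:I. map (image ph) (chain_series G r0) = chain_series H r}"
proof -
 let ?n = "card (carrier G)"
 let ?R = "%G' ka. {r : index_space W m. ALL i<=m. chain G' r i = ka i}"
 let ?M = "{r : index_space W m. EX r0:I. map (image ph) (chain_series G r0) = chain_series H r}"
 have finS: "finite (index_space W m)" unfolding index_space_def by (rule finite_PiE) auto
 \<comment> \<open>Indices are grouped by the chain that they produce. The restriction makes two
   chains equal as soon as their terms up to \<open>m\<close> agree.\<close>
 define seq where "seq r = restrict (chain G r) {..m}" for r
 define \<S> where "\<S> = seq ` I"
 have finI: "finite I" using I finS finite_subset by blast
 hence finSS: "finite \<S>" by (simp add: \<S>_def)
 have one: "card (?R G ka) <= ?n * card (?R H (%i. ph ` ka i))" if k: "ka : \<S>" for ka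
 proof -
  obtain r where r: "r : I" "ka = seq r" using k by (auto simp: \<S>_def)
  have ki: "ka i = chain G r i" if "i <= m" for i using r that by (simp add: seq_def)
  obtain l where l: "l < ?n" "2 ^ l <= ?n" "chain G r l = carrier G"
   "!!i. i <= l ==> chain G r i ~= {}" "!!i. i < l ==> chain G r i ~= carrier G" "!!i. l < i ==> chain G r i = {}"
   by (rule chain_length[OF GG finG, of r]) blast
  have "{i. i < m & choices G (ka i) ~= {}} <= {..<l}"
  proof
   fix i assume i: "i : {i. i < m & choices G (ka i) ~= {}}"
   hence ne: "choices G (chain G r i) ~= {}" using ki[of i] by auto
   have "choices G {} = {}" by (simp add: choices_def)
   moreover have "choices G (carrier G) = {}"
    using choices_nonempty_iff[OF GG finG group.subgroup_self[OF GG]] by simp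
   ultimately have "\<not> l < i" "i ~= l" using ne l(3,6) by auto
   thus "i : {..<l}" by simp
  qed
  hence "card {i. i < m & choices G (ka i) ~= {}} <= l" using card_mono[of "{..<l}"] by fastforce
  hence "2 ^ card {i. i < m & choices G (ka i) ~= {}} <= (2::nat) ^ l" by (intro power_increasing) auto
  hence le: "2 ^ card {i. i < m & choices G (ka i) ~= {}} <= ?n" using l(2) by linarith
  have "card (?R G ka) <= 2 ^ card {i. i < m & choices G (ka i) ~= {}} * card (?R H (%i. ph ` ka i))"
  proof (rule prefix_bound)
   fix i assume "i <= m"
   thus "(ka i = {} \<or> subgroup (ka i) G) & ka i <= carrier G"
    using ki chain_subgroup[OF GG finG, of r i] chain_subset[OF GG finG, of r i] by auto
  next
   fix i assume "i < m"
   thus "card (choices G (ka i)) <= W i" using ki[of i] W[of r i] by simp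
  qed
  thus ?thesis using mult_le_mono1[OF le, of "card (?R H (%i. ph ` ka i))"] by linarith
 qed
 have "I \<subseteq> (\<Union>ka\<in>\<S>. ?R G ka)"
 proof
  fix r assume r: "r : I"
  hence "r : ?R G (seq r)" using I by (auto simp: seq_def)
  thus "r : (\<Union>ka\<in>\<S>. ?R G ka)" using r by (auto simp: \<S>_def)
 qed
 hence "card I <= card (\<Union>ka\<in>\<S>. ?R G ka)" using finSS finS by (intro card_mono) auto
 also have "... <= (\<Sum>ka\<in>\<S>. card (?R G ka))" using finSS by (rule card_UN_le)
 also have "... <= (\<Sum>ka\<in>\<S>. ?n * card (?R H (%i. ph ` ka i)))" by (rule sum_mono) (rule one)
 also have "... = ?n * (\<Sum>ka\<in>\<S>. card (?R H (%i. ph ` ka i)))" by (simp add: sum_distrib_left)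
 \<comment> \<open>Different chains of \<open>G\<close> have different images in \<open>H\<close>,
   so their index sets in \<open>H\<close> are disjoint and summing over the chains costs no further
   factor.\<close>
 also have "(\<Sum>ka\<in>\<S>. card (?R H (%i. ph ` ka i))) = card (\<Union>ka\<in>\<S>. ?R H (%i. ph ` ka i))"
 proof (rule card_UN_disjoint[symmetric])
  show "finite \<S>" by fact
  show "ALL ka:\<S>. finite (?R H (%i. ph ` ka i))" using finS by auto
  show "ALL ka:\<S>. ALL ka':\<S>. ka ~= ka' --> ?R H (%i. ph ` ka i) Int ?R H (%i. ph ` ka' i) = {}"
  proof (intro ballI impI, rule ccontr)
   fix ka ka' assume k: "ka : \<S>" "ka' : \<S>" "ka ~= ka'" "?R H (%i. ph ` ka i) Int ?R H (%i. ph ` ka' i) ~= {}"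
   hence im: "ph ` ka i = ph ` ka' i" if "i <= m" for i using that by auto
   obtain r r' where r: "ka = seq r" "ka' = seq r'" using k by (auto simp: \<S>_def)
   have "ka i = ka' i" for i
   proof (cases "i <= m")
    case True
    have "ka i <= carrier G" "ka' i <= carrier G" using r True chain_subset[OF GG finG] by (auto simp: seq_def)
    thus ?thesis using im[OF True] inj_on_image_eq_iff[OF inj] by blast
   qed (simp add: r seq_def)
   thus False using k(3) by auto
  qed
 qed
 finally have main: "card I <= ?n * card (\<Union>ka\<in>\<S>. ?R H (%i. ph ` ka i))" .
 have "(\<Union>ka\<in>\<S>. ?R H (%i. ph ` ka i)) \<subseteq> ?M"
 proof
  fix r assume "r : (\<Union>ka\<in>\<S>. ?R H (%i. ph ` ka i))"
  then obtain r0 where r0: "r0 : I" "r : ?R H (%i. ph ` (seq r0) i)" by (auto simp: \<S>_def)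
  hence "chain H r i = ph ` chain G r0 i" if "i < ?n" for i using that n by (simp add: seq_def)
  hence "map (image ph) (map (chain G r0) [0..<?n]) = map (chain H r) [0..<?n]" by simp
  hence "filter (%A. A ~= {}) (map (image ph) (map (chain G r0) [0..<?n])) = chain_series H r"
   by (simp only: chain_series_def card_eq)
  moreover have "filter (%A. A ~= {}) (map (image ph) xs) = map (image ph) (filter (%A. A ~= {}) xs)" for xs
   by (induction xs) auto
  ultimately have "map (image ph) (chain_series G r0) = chain_series H r" by (simp only: chain_series_def)
  thus "r : ?M" using r0 by auto
 qed
 hence "card (\<Union>ka\<in>\<S>. ?R H (%i. ph ` ka i)) <= card ?M" using finS by (intro card_mono) auto
 thus ?thesis using main by (meson le_trans mult_le_mono2)
qed

end

section \<open>Amplitude amplification\<close>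

text \<open>The index register \<open>Q\<close> inside the whole memory: qubit 0 is constantly 1 and
  all other qubits outside \<open>Q\<close> are 0.\<close>

definition embed :: "nat set => qstate => qstate" where
 "embed Q a = (%B. if 0 : B & B - {0} <= Q then a (B - {0}) else 0)"

lemma hadamard_embed:
 assumes "q : Q" "0 ~: Q"
 shows "hadamard q (embed Q a) = embed Q (hadamard q a)"
proof
 fix B
 have q0: "q ~= 0" using assms by metis
 have 1: "(B - {q}) - {0} = (B - {0}) - {q}" "insert q B - {0} = insert q (B - {0})"
  using q0 by auto
 have 2: "(B - {0}) - {q} <= Q \<longleftrightarrow> B - {0} <= Q" "insert q (B - {0}) <= Q \<longleftrightarrow> B - {0} <= Q"
  using assms by auto
 show "hadamard q (embed Q a) B = embed Q (hadamard q a) B"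
  using q0 assms(1) unfolding hadamard_def embed_def 1 by (auto simp: 2)
qed

lemma sqrt2_mult: "complex_of_real (sqrt 2) * complex_of_real (sqrt 2) = 2"
 by (metis of_real_mult of_real_numeral real_sqrt_mult_self abs_numeral)

lemma hadamard_involution: "hadamard q (hadamard q a) = a"
proof
 fix B
 let ?r = "complex_of_real (sqrt 2)"
 show "hadamard q (hadamard q a) B = a B"
 proof (cases "q : B")
  case True
  have "insert q (B - {q}) = B" using True by auto
  hence "hadamard q (hadamard q a) B = ((a (B - {q}) + a B) / ?r - (a (B - {q}) - a B) / ?r) / ?r"
   using True by (simp add: hadamard_def)
  also have "... = 2 * a B / (?r * ?r)" by (simp add: diff_divide_distrib add_divide_distrib)
  finally show ?thesis by (simp add: sqrt2_mult)
 next
  case False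
  have "insert q B - {q} = B" "insert q (insert q B) = insert q B" using False by auto
  hence "hadamard q (hadamard q a) B = ((a B + a (insert q B)) / ?r + (a B - a (insert q B)) / ?r) / ?r"
   using False by (simp add: hadamard_def)
  also have "... = 2 * a B / (?r * ?r)" by (simp add: diff_divide_distrib add_divide_distrib)
  finally show ?thesis by (simp add: sqrt2_mult)
 qed
qed

lemma hadamard_linear:
 "hadamard q (%B. a B + c * b B) = (%B. hadamard q a B + c * hadamard q b B)"
 by (auto simp: hadamard_def fun_eq_iff algebra_simps add_divide_distrib diff_divide_distrib)

lemma fold_hadamard_linear:
 "fold hadamard qs (%B. a B + c * b B) = (%B. fold hadamard qs a B + c * fold hadamard qs b B)"
 by (induction qs arbitrary: a b) (simp_all add: hadamard_linear)

lemma fold_hadamard_involution: "fold hadamard (rev qs) (fold hadamard qs a) = a"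
 by (induction qs arbitrary: a) (simp_all add: hadamard_involution)

section \<open>Hadamard transform and diffusion\<close>

definition zero_state :: qstate where "zero_state = (%B. if B = {} then 1 else 0)"

lemma fold_hadamard_zero_state:
 "distinct qs ==>
  fold hadamard qs zero_state = (%B. if B <= set qs then 1 / complex_of_real (sqrt 2) ^ length qs else 0)"
proof (induction qs rule: rev_induct)
 case Nil
 thus ?case by (auto simp: zero_state_def)
next
 case (snoc q qs)
 hence "fold hadamard (qs @ [q]) zero_state
   = hadamard q (%B. if B <= set qs then 1 / complex_of_real (sqrt 2) ^ length qs else 0)" by simp
 also have "... = (%B. if B <= set (qs @ [q]) then 1 / complex_of_real (sqrt 2) ^ length (qs @ [q]) else 0)"
 proof
  fix B
  have q: "q ~: set qs" using snoc by simp
  have "B - {q} <= set qs \<longleftrightarrow> B <= set (qs @ [q])" "q : B ==> \<not> B <= set qs"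
   "\<not> insert q B <= set qs" "q ~: B ==> B <= set (qs @ [q]) \<longleftrightarrow> B <= set qs"
   using q by auto
  thus "hadamard q (%B. if B <= set qs then 1 / complex_of_real (sqrt 2) ^ length qs else 0) B
   = (if B <= set (qs @ [q]) then 1 / complex_of_real (sqrt 2) ^ length (qs @ [q]) else 0)"
   by (auto simp: hadamard_def)
 qed
 finally show ?case .
qed

text \<open>The amplitude of the zero string is the inner product with the uniform superposition
  over the subsets of \<open>set qs\<close>.\<close>

lemma fold_hadamard_at_empty:
 "distinct qs ==> fold hadamard qs a {} = (\<Sum>x\<in>Pow (set qs). a x) / complex_of_real (sqrt 2) ^ length qs"
proof (induction qs arbitrary: a)
 case Nil
 thus ?case by simp
next
 case (Cons q qs)
 let ?r = "complex_of_real (sqrt 2)"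
 have q: "q ~: set qs" using Cons by simp
 have "fold hadamard (q # qs) a {} = (\<Sum>x\<in>Pow (set qs). hadamard q a x) / ?r ^ length qs"
  using Cons by simp
 also have "(\<Sum>x\<in>Pow (set qs). hadamard q a x) = (\<Sum>x\<in>Pow (set qs). (a x + a (insert q x)) / ?r)"
  by (rule sum.cong) (use q in "auto simp: hadamard_def")
 also have "... = ((\<Sum>x\<in>Pow (set qs). a x) + (\<Sum>x\<in>Pow (set qs). a (insert q x))) / ?r"
  by (simp add: sum_divide_distrib[symmetric] sum.distrib)
 also have "(\<Sum>x\<in>Pow (set qs). a (insert q x)) = (\<Sum>x\<in>insert q ` Pow (set qs). a x)"
  by (subst sum.reindex) (use q in "auto simp: inj_on_def")
 also have "(\<Sum>x\<in>Pow (set qs). a x) + ... = (\<Sum>x\<in>Pow (set qs) Un insert q ` Pow (set qs). a x)"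
  by (rule sum.union_disjoint[symmetric]) (use q in auto)
 finally show ?case by (simp add: Pow_insert)
qed

definition flip_zero :: "qstate => qstate" where
 "flip_zero a = (%B. if B = {} then - a B else a B)"

text \<open>\<open>flip_zero\<close> subtracts twice the projection to the zero string; conjugated
  by the Hadamard transform it subtracts twice the projection to the uniform superposition. On the
  index register this is the negative of the inversion about the mean, whence the sign of
  \<open>c\<close> alternates in \<open>grover_step\<close>.\<close>

lemma diffusion:
 assumes "distinct qs"
 shows "fold hadamard (rev qs) (flip_zero (fold hadamard qs a))
  = (%B. a B - (if B <= set qs then 2 * (\<Sum>x\<in>Pow (set qs). a x) / 2 ^ length qs else 0))"
proof -
 let ?r = "complex_of_real (sqrt 2)"
 let ?b = "fold hadamard qs a"
 have "flip_zero ?b = (%B. ?b B + (- 2 * ?b {}) * zero_state B)"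
  by (auto simp: flip_zero_def zero_state_def)
 hence "fold hadamard (rev qs) (flip_zero ?b)
   = (%B. a B + (- 2 * ?b {}) * fold hadamard (rev qs) zero_state B)"
  by (simp only: fold_hadamard_linear fold_hadamard_involution)
 also have "... = (%B. a B - (if B <= set qs then 2 * (\<Sum>x\<in>Pow (set qs). a x) / (?r ^ length qs * ?r ^ length qs) else 0))"
  using assms by (auto simp: fold_hadamard_zero_state fold_hadamard_at_empty)
 also have "?r ^ length qs * ?r ^ length qs = 2 ^ length qs"
  by (simp add: power_mult_distrib[symmetric] sqrt2_mult)
 finally show ?thesis .
qed

text \<open>Up to the global factor \<open>c\<close>, the state at angle \<open>al\<close> in the plane spanned by the uniform
 superpositions of the good and of the bad indices; \<open>sin ta\<close> is the square root of the fraction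
 of good indices.\<close>

definition angle_state :: "nat set => (nat set => bool) => real => complex => real => qstate" where
 "angle_state Q good ta c al = (%x. if x <= Q then
   c * complex_of_real ((if good x then sin al / sin ta else cos al / cos ta) / sqrt (2 ^ card Q)) else 0)"

definition flip_good :: "(nat set => bool) => qstate => qstate" where
 "flip_good good a = (%x. if good x then - a x else a x)"

definition grover_angle :: "nat set => (nat set => bool) => real" where
 "grover_angle Q good = arcsin (sqrt (real (card {x. x <= Q & good x}) / 2 ^ card Q))"

text \<open>The assumption \<open>half\<close> keeps the angle at most \<open>pi / 4\<close>. Then
  its cosine does not vanish, and already the first angle tried, \<open>2 * ta\<close>, is not
  beyond \<open>pi / 2\<close>.\<close>

locale grover =
 fixes Q :: "nat set" and good :: "nat set => bool"
 assumes finQ: "finite Q"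
  and half: "2 * card {x. x <= Q & good x} <= 2 ^ card Q"
begin

abbreviation "ta \<equiv> grover_angle Q good"
abbreviation "good_count \<equiv> card {x. x <= Q & good x}"
abbreviation "NN \<equiv> (2::real) ^ card Q"

lemma fraction: "0 <= real good_count / NN" "real good_count / NN <= 1 / 2"
proof -
 have "real (2 * good_count) <= real (2 ^ card Q)" using half by (simp only: of_nat_le_iff)
 thus "real good_count / NN <= 1 / 2" by (simp add: field_simps)
qed simp

lemma sin_theta: "sin ta = sqrt (real good_count / NN)"
proof -
 have "sqrt (real good_count / NN) <= 1" using fraction by (intro real_sqrt_le_1_iff[THEN iffD2]) linarith
 moreover have "0 <= sqrt (real good_count / NN)" by simp
 ultimately show ?thesis unfolding grover_angle_def by (intro sin_arcsin) linarith+
qed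

lemma sin_theta_sq: "(sin ta)\<^sup>2 = real good_count / NN"
 using fraction by (simp add: sin_theta)

lemma theta_ge_0: "0 <= ta"
proof -
 have "sqrt (real good_count / NN) <= 1" using fraction by (intro real_sqrt_le_1_iff[THEN iffD2]) linarith
 moreover have "0 <= sqrt (real good_count / NN)" by simp
 ultimately have "arcsin 0 <= arcsin (sqrt (real good_count / NN))"
  by (intro arcsin_le_arcsin) linarith+
 thus ?thesis by (simp add: grover_angle_def)
qed

lemma theta_le: "ta <= pi / 4"
proof -
 have "sqrt (real good_count / NN) <= sqrt (1 / 2)" using fraction(2) by (rule real_sqrt_le_mono)
 also have "sqrt (1 / 2) = sin (pi / 4)" by (simp add: sin_45 real_sqrt_divide real_div_sqrt field_simps)
 finally have le: "sqrt (real good_count / NN) <= sin (pi / 4)" .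
 have "0 <= sqrt (real good_count / NN)" by simp
 hence "- 1 <= sqrt (real good_count / NN)" by linarith
 hence "arcsin (sqrt (real good_count / NN)) <= arcsin (sin (pi / 4))"
  using le by (intro arcsin_le_arcsin) auto
 also have "... = pi / 4" by (rule arcsin_sin) auto
 finally show ?thesis by (simp add: grover_angle_def)
qed

lemma cos_theta_pos: "cos ta > 0"
 using theta_ge_0 theta_le pi_gt_zero by (intro cos_gt_zero_pi) linarith+

lemma cos_theta_sq: "(cos ta)\<^sup>2 = (NN - real good_count) / NN"
 using sin_theta_sq by (simp add: cos_squared_eq diff_divide_distrib)

lemma card_split: "card {x. x <= Q & \<not> good x} = 2 ^ card Q - good_count"
proof -
 have "{x. x <= Q & \<not> good x} = Pow Q - {x. x <= Q & good x}" by auto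
 moreover have "card (Pow Q - {x. x <= Q & good x}) = card (Pow Q) - good_count"
  using finQ by (intro card_Diff_subset) auto
 ultimately show ?thesis using finQ by (simp add: card_Pow)
qed

lemma good_le: "good_count <= 2 ^ card Q" using half by simp

lemma sum_split:
 fixes u v :: "'a :: real_algebra_1"
 shows "(\<Sum>x\<in>Pow Q. if good x then u else v) = of_real (real good_count) * u + of_real (NN - real good_count) * v"
proof -
 have "Pow Q = {x. x <= Q & good x} Un {x. x <= Q & \<not> good x}" by auto
 hence "(\<Sum>x\<in>Pow Q. if good x then u else v)
   = (\<Sum>x\<in>{x. x <= Q & good x} Un {x. x <= Q & \<not> good x}. if good x then u else v)" by simp
 also have "... = (\<Sum>x\<in>{x. x <= Q & good x}. if good x then u else v)
   + (\<Sum>x\<in>{x. x <= Q & \<not> good x}. if good x then u else v)"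
  by (rule sum.union_disjoint) (use finQ in auto)
 also have "(\<Sum>x\<in>{x. x <= Q & good x}. if good x then u else v) = of_nat good_count * u"
  by (subst sum.cong[of _ _ _ "%_. u"]) auto
 also have "(\<Sum>x\<in>{x. x <= Q & \<not> good x}. if good x then u else v) = of_nat (2 ^ card Q - good_count) * v"
  by (subst sum.cong[of _ _ _ "%_. v"]) (auto simp: card_split)
 finally show ?thesis using good_le by (simp add: of_nat_diff)
qed

lemma no_good: "good_count = 0 ==> x <= Q ==> \<not> good x"
 using finQ by (auto simp: card_eq_0_iff)

text \<open>After the sign flip the sum of the amplitudes is a multiple of
  \<open>cos (al + ta)\<close>. Subtracting twice the mean and applying the addition theorems to
  \<open>(al + ta) + ta\<close> and \<open>(al + ta) - ta\<close> yields the rotation by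
  \<open>2 * ta\<close>.\<close>

lemma grover_step:
 assumes qs: "distinct qs" "set qs = Q"
 shows "fold hadamard (rev qs) (flip_zero (fold hadamard qs (flip_good good (angle_state Q good ta c al))))
  = angle_state Q good ta (- c) (al + 2 * ta)"
proof -
 let ?R = "sqrt NN"
 have len: "length qs = card Q" using qs by (metis distinct_card)
 have RR: "?R * ?R = NN" "?R > 0" "?R ~= 0" by simp_all
 define u where "u = sin al / sin ta / ?R"
 define v where "v = cos al / cos ta / ?R"
 have fg: "flip_good good (angle_state Q good ta c al)
   = (%x. if x <= Q then c * complex_of_real (if good x then - u else v) else 0)"
  by (auto simp: flip_good_def angle_state_def u_def v_def)
 have "(\<Sum>x\<in>Pow Q. flip_good good (angle_state Q good ta c al) x)
   = (\<Sum>x\<in>Pow Q. c * complex_of_real (if good x then - u else v))"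
  unfolding fg by (rule sum.cong) auto
 also have "... = c * complex_of_real (\<Sum>x\<in>Pow Q. if good x then - u else v)"
  by (simp add: sum_distrib_left)
 also have "(\<Sum>x\<in>Pow Q. if good x then - u else v) = real good_count * - u + (NN - real good_count) * v"
  using sum_split[of "- u" v] by simp
 also have "... = ?R * cos (al + ta)"
 proof -
  have g: "real good_count = NN * (sin ta)\<^sup>2" "NN - real good_count = NN * (cos ta)\<^sup>2"
   using sin_theta_sq cos_theta_sq by simp_all
  have "real good_count * - u = - ?R * sin ta * sin al"
   unfolding g(1) u_def using RR by (cases "sin ta = 0") (auto simp: field_simps power2_eq_square)
  moreover have "(NN - real good_count) * v = ?R * cos ta * cos al"
   unfolding g(2) v_def using RR cos_theta_pos by (auto simp: field_simps power2_eq_square)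
  ultimately show ?thesis by (simp add: cos_add algebra_simps)
 qed
 finally have sm: "(\<Sum>x\<in>Pow Q. flip_good good (angle_state Q good ta c al) x)
   = c * complex_of_real (?R * cos (al + ta))" .
 have "fold hadamard (rev qs) (flip_zero (fold hadamard qs (flip_good good (angle_state Q good ta c al))))
  = (%x. if x <= Q then c * complex_of_real ((if good x then - u else v) - 2 * (?R * cos (al + ta)) / NN) else 0)"
  unfolding diffusion[OF qs(1)] qs(2) len sm unfolding fg
  by (auto simp: fun_eq_iff algebra_simps)
 also have "... = angle_state Q good ta (- c) (al + 2 * ta)"
 proof
  fix x
  show "(if x <= Q then c * complex_of_real ((if good x then - u else v) - 2 * (?R * cos (al + ta)) / NN) else 0)
   = angle_state Q good ta (- c) (al + 2 * ta) x"
  proof (cases "x <= Q")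
   case True
   have aux: "a * a = b ==> a ~= 0 ==> 2 * (a * c) / b = 2 * c / a" for a b c :: real
    by (auto simp: field_simps)
   have RN: "2 * (?R * cos (al + ta)) / NN = 2 * cos (al + ta) / ?R"
    by (rule aux[OF RR(1) RR(3)])
   have "(if good x then - u else v) - 2 * cos (al + ta) / ?R
     = - ((if good x then sin (al + 2 * ta) / sin ta else cos (al + 2 * ta) / cos ta) / ?R)"
   proof (cases "good x")
    case g: True
    hence "good_count ~= 0" using no_good True by blast
    hence s: "sin ta ~= 0" using sin_theta by simp
    have "sin (al + 2 * ta) = sin ((al + ta) + ta)" "sin al = sin ((al + ta) - ta)" by (simp_all add: algebra_simps)
    hence "sin (al + 2 * ta) = sin al + 2 * sin ta * cos (al + ta)"
     unfolding sin_add[of "al + ta" ta] sin_diff[of "al + ta" ta] by simp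
    thus ?thesis using g s RR by (simp add: u_def field_simps)
   next
    case g: False
    have "cos (al + 2 * ta) = cos ((al + ta) + ta)" "cos al = cos ((al + ta) - ta)" by (simp_all add: algebra_simps)
    hence ceq: "cos (al + 2 * ta) = 2 * cos ta * cos (al + ta) - cos al"
     unfolding cos_add[of "al + ta" ta] cos_diff[of "al + ta" ta] by simp
    have "cos al / cos ta - 2 * cos (al + ta) = - (cos (al + 2 * ta) / cos ta)"
     unfolding ceq using cos_theta_pos by (simp add: diff_divide_distrib)
    hence "(cos al / cos ta - 2 * cos (al + ta)) / ?R = - (cos (al + 2 * ta) / cos ta) / ?R" by simp
    thus ?thesis using g by (simp add: v_def diff_divide_distrib)
   qed
   thus ?thesis using True RN by (simp add: angle_state_def)
  qed (simp add: angle_state_def)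
 qed
 finally show ?thesis .
qed

lemma uniform_state:
 assumes qs: "distinct qs" "set qs = Q"
 shows "fold hadamard qs zero_state = angle_state Q good ta 1 ta"
proof -
 have len: "length qs = card Q" using qs by (metis distinct_card)
 have "complex_of_real (sqrt 2) ^ card Q = complex_of_real (sqrt NN)"
  by (simp add: real_sqrt_power)
 moreover have "sin ta ~= 0" if "good x" "x <= Q" for x
  using no_good[of x] that by (auto simp: sin_theta)
 ultimately show ?thesis
  using cos_theta_pos unfolding fold_hadamard_zero_state[OF qs(1)] len qs(2)
  by (auto simp: angle_state_def fun_eq_iff)
qed

text \<open>Without good indices \<open>sin ta\<close> is 0 and the first sum is empty whatever the
  angle, hence the case distinction.\<close>

lemma good_probability:
 assumes "cmod c = 1"
 shows "(\<Sum>x | x <= Q & good x. (cmod (angle_state Q good ta c al x))\<^sup>2)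
   = (if good_count = 0 then 0 else (sin al)\<^sup>2)"
  and "(\<Sum>x | x <= Q & \<not> good x. (cmod (angle_state Q good ta c al x))\<^sup>2) = (cos al)\<^sup>2"
proof -
 have cm: "(cmod (c * complex_of_real r))\<^sup>2 = r\<^sup>2" for r
  using assms by (simp add: norm_mult)
 have "(\<Sum>x | x <= Q & good x. (cmod (angle_state Q good ta c al x))\<^sup>2)
   = (\<Sum>x | x <= Q & good x. (sin al / sin ta / sqrt NN)\<^sup>2)"
  by (rule sum.cong) (auto simp: angle_state_def cm simp del: of_real_divide)
 also have "... = real good_count * ((sin al)\<^sup>2 / (sin ta)\<^sup>2 / NN)"
  by (simp add: power_divide power_mult_distrib)
 also have "... = (if good_count = 0 then 0 else (sin al)\<^sup>2)"
  unfolding sin_theta_sq by simp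
 finally show "(\<Sum>x | x <= Q & good x. (cmod (angle_state Q good ta c al x))\<^sup>2)
   = (if good_count = 0 then 0 else (sin al)\<^sup>2)" .
 have "(cos ta)\<^sup>2 > 0" using cos_theta_pos by simp
 hence ne: "NN - real good_count ~= 0" by (metis cos_theta_sq div_0 less_irrefl)
 have "(\<Sum>x | x <= Q & \<not> good x. (cmod (angle_state Q good ta c al x))\<^sup>2)
   = (\<Sum>x | x <= Q & \<not> good x. (cos al / cos ta / sqrt NN)\<^sup>2)"
  by (rule sum.cong) (auto simp: angle_state_def cm simp del: of_real_divide)
 also have "... = real (card {x. x <= Q & \<not> good x}) * ((cos al)\<^sup>2 / (cos ta)\<^sup>2 / NN)"
  by (simp add: power_divide power_mult_distrib)
 also have "real (card {x. x <= Q & \<not> good x}) = NN - real good_count"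
  unfolding card_split using good_le by (simp add: of_nat_diff)
 also have "(NN - real good_count) * ((cos al)\<^sup>2 / (cos ta)\<^sup>2 / NN) = (cos al)\<^sup>2"
  unfolding cos_theta_sq using ne by simp
 finally show "(\<Sum>x | x <= Q & \<not> good x. (cmod (angle_state Q good ta c al x))\<^sup>2) = (cos al)\<^sup>2" .
qed

text \<open>Some doubling of \<open>2 ta\<close> falls into the interval from \<open>\<pi>/4\<close> to \<open>\<pi>/2\<close>.\<close>

lemma doubling_hits:
 assumes "good_count > 0"
 obtains i :: nat where "(cos (2 * 2 ^ i * ta))\<^sup>2 <= 1 / 2" "2 ^ i * sin ta <= 1"
proof -
 have sp: "sin ta > 0" using assms sin_theta by simp
 hence tp: "ta > 0" using theta_ge_0 by (cases "ta = 0") auto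
 \<comment> \<open>\<open>2 * 2 ^ i * ta\<close> is the angle reached from 0 by \<open>2 ^ i\<close>
   iterations. The predecessor of the least such \<open>i\<close> stays below \<open>pi / 4\<close>,
   so doubling cannot pass \<open>pi / 2\<close>.\<close>
 define i where "i = (LEAST i. pi / 4 <= 2 * 2 ^ i * ta)"
 have "EX i::nat. pi / 4 <= 2 * 2 ^ i * ta"
 proof -
  obtain i :: nat where "pi / 4 / (2 * ta) < 2 ^ i" using real_arch_pow[of 2] by auto
  thus ?thesis using tp by (intro exI[of _ i]) (simp add: field_simps)
 qed
 hence i: "pi / 4 <= 2 * 2 ^ i * ta" unfolding i_def by (rule LeastI_ex)
 have up: "2 * 2 ^ i * ta <= pi / 2"
 proof (cases i)
  case 0
  thus ?thesis using theta_le by simp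
 next
  case (Suc j)
  hence "\<not> pi / 4 <= 2 * 2 ^ j * ta" using not_less_Least[of j "%i. pi / 4 <= 2 * 2 ^ i * ta"] unfolding i_def by simp
  thus ?thesis using Suc by simp
 qed
 have "0 <= cos (2 * 2 ^ i * ta)" using up i pi_gt_zero by (intro cos_ge_zero) linarith+
 moreover have "cos (2 * 2 ^ i * ta) <= cos (pi / 4)"
  using i up pi_gt_zero by (intro cos_monotone_0_pi_le) linarith+
 ultimately have "(cos (2 * 2 ^ i * ta))\<^sup>2 <= (cos (pi / 4))\<^sup>2" by (intro power_mono)
 also have "(cos (pi / 4))\<^sup>2 = 1 / 2" by (simp add: cos_45 power_divide)
 finally have 1: "(cos (2 * 2 ^ i * ta))\<^sup>2 <= 1 / 2" .
 have "2 ^ i * sin ta <= 2 ^ i * ta" using sin_x_le_x[OF theta_ge_0] by simp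
 also have "... <= pi / 4" using up by simp
 also have "... <= 1" using pi_less_4 by simp
 finally show thesis using that 1 by blast
qed

end

section \<open>A structured language and its compilation\<close>

text \<open>Big-step semantics: within some number of steps every branch has halted, with final
  configurations distributed as \<open>D\<close>. Finite support allows one number of steps to serve
  all branches.\<close>

definition bstep :: "oracle_fun => prog => config => config pmf => bool" where
 "bstep f P s D \<longleftrightarrow> finite (set_pmf D) & (EX k. run f P k s = map_pmf (Pair Done) D)"

lemma finite_set_pmf_exec: "finite (set_pmf (exec f i s))"
 by (cases i) auto

lemma finite_set_pmf_step: "finite (set_pmf (step f P s))"
 by (induction P arbitrary: s) (auto simp: finite_set_pmf_exec)

lemma run_0 [simp]: "run f P 0 s = return_pmf (P, s)"
 by (simp add: run_def)

lemma run_Suc_last: "run f P (Suc k) s = bind_pmf (run f P k s) (%(P', s'). step f P' s')"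
 by (simp add: run_def)

lemma run_add: "run f P (j + k) s = bind_pmf (run f P j s) (%(P', s'). run f P' k s')"
proof (induction k)
 case 0
 have "(%(P', s'). return_pmf (P', s')) = (%x::prog \<times> config. return_pmf x)" by auto
 thus ?case by (simp add: bind_return_pmf')
next
 case (Suc k)
 have "run f P (j + Suc k) s
   = bind_pmf (bind_pmf (run f P j s) (%(P', s'). run f P' k s')) (%(P', s'). step f P' s')"
  using Suc by (simp add: run_Suc_last)
 also have "... = bind_pmf (run f P j s) (%(P', s'). run f P' (Suc k) s')"
  by (subst bind_assoc_pmf) (auto intro!: bind_pmf_cong simp: run_Suc_last split: prod.splits)
 finally show ?case .
qed

lemma run_1: "run f P (Suc 0) s = step f P s"
 by (simp add: run_Suc_last bind_return_pmf)

lemma run_Suc: "run f P (Suc k) s = bind_pmf (step f P s) (%(P', s'). run f P' k s')"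
 using run_add[of f P 1 k s] by (simp add: run_1)

lemma run_Done [simp]: "run f Done k s = return_pmf (Done, s)"
 by (induction k) (auto simp: run_Suc_last bind_return_pmf)

lemma run_mono:
 assumes "run f P k s = map_pmf (Pair Done) D" "k <= k'"
 shows "run f P k' s = map_pmf (Pair Done) D"
proof -
 have "run f P (k + (k' - k)) s = map_pmf (Pair Done) D"
  unfolding run_add assms(1) by (simp add: bind_map_pmf map_pmf_def[symmetric])
 thus ?thesis using assms(2) by simp
qed

lemma bstep_bind:
 assumes "step f P s = M" and "!!P' s'. (P', s') : set_pmf M ==> bstep f P' s' (E P' s')"
 shows "bstep f P s (bind_pmf M (%(P', s'). E P' s'))"
proof -
 have fin: "finite (set_pmf M)" using finite_set_pmf_step assms(1) by metis
 have "ALL x:set_pmf M. EX k. run f (fst x) k (snd x) = map_pmf (Pair Done) (E (fst x) (snd x))"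
  using assms(2) by (auto simp: bstep_def)
 then obtain k where k: "!!x. x : set_pmf M ==>
   run f (fst x) (k x) (snd x) = map_pmf (Pair Done) (E (fst x) (snd x))" by metis
 \<comment> \<open>The branches may need different numbers of steps; the maximum serves all of them
   since \<open>Done\<close> stays put.\<close>
 define K where "K = Max (k ` set_pmf M)"
 have K: "run f (fst x) K (snd x) = map_pmf (Pair Done) (E (fst x) (snd x))" if "x : set_pmf M" for x
  by (rule run_mono[OF k[OF that]]) (use fin that in "auto simp: K_def")
 have "run f P (Suc K) s = bind_pmf M (%x. map_pmf (Pair Done) (E (fst x) (snd x)))"
  unfolding run_Suc assms(1) by (rule bind_pmf_cong) (use K in "auto split: prod.splits")
 also have "... = map_pmf (Pair Done) (bind_pmf M (%(P', s'). E P' s'))"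
  by (simp add: map_bind_pmf case_prod_beta)
 finally show ?thesis
  using fin assms(2) by (auto simp: bstep_def case_prod_beta)
qed

lemma bstep_return:
 assumes "step f P s = return_pmf (P', s')" and "bstep f P' s' D"
 shows "bstep f P s D"
 using bstep_bind[OF assms(1), of "%_ _. D"] assms(2) by (simp add: bind_return_pmf)

lemma bstep_Done: "bstep f Done s (return_pmf s)"
 by (auto simp: bstep_def intro: exI[of _ 0])

lemma bstep_Instr: "bstep f (Instr i) s (exec f i s)"
 unfolding bstep_def
 by (intro conjI exI[of _ 1] finite_set_pmf_exec) (simp add: run_1)

text \<open>Induction on the number of steps of \<open>P\<close>: the first step of
  \<open>Seq P Q\<close> is one of \<open>P\<close>, and the remaining computations are joined by
  \<open>bstep_bind\<close>.\<close>

lemma bstep_Seq: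
 assumes "bstep f P s D" and "!!s'. s' : set_pmf D ==> bstep f Q s' (E s')"
 shows "bstep f (Seq P Q) s (bind_pmf D E)"
proof -
 have gen: "bstep f (Seq P Q) s (bind_pmf D E)"
  if "run f P k s = map_pmf (Pair Done) D" "!!s'. s' : set_pmf D ==> bstep f Q s' (E s')"
  for k P s D
  using that
 proof (induction k arbitrary: P s D)
  case 0
  hence "map_pmf (Pair Done) D = return_pmf (P, s)" by simp
  moreover from this have "(Done, s') = (P, s)" if "s' : set_pmf D" for s'
   using that by (metis (no_types, lifting) imageI set_map_pmf set_return_pmf singletonD)
  ultimately have "map_pmf snd (map_pmf (Pair Done) D) = return_pmf s" "P = Done"
   using set_pmf_not_empty[of D] by auto
  hence "D = return_pmf s" "P = Done" by (auto simp: map_pmf_comp)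
  with 0 show ?case
   by (auto intro!: bstep_return[of f "Seq Done Q" s Q s] simp: bind_return_pmf)
 next
  case (Suc k)
  show ?case
  proof (cases "P = Done")
   case True
   hence "map_pmf (Pair Done) D = return_pmf (Done, s)" using Suc by simp
   hence "map_pmf snd (map_pmf (Pair Done) D) = return_pmf s" by auto
   hence "D = return_pmf s" by (auto simp: map_pmf_comp)
   with Suc True show ?thesis
    by (auto intro!: bstep_return[of f "Seq Done Q" s Q s] simp: bind_return_pmf)
  next
   case False
   let ?M = "step f P s"
   define Db where "Db x = map_pmf snd (run f (fst x) k (snd x))" for x
   have eq: "map_pmf (Pair Done) D = bind_pmf ?M (%x. run f (fst x) k (snd x))"
    using Suc(2)[symmetric] unfolding run_Suc case_prod_beta' .
   have DD: "D = bind_pmf ?M Db"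
   proof -
    have "map_pmf snd (map_pmf (Pair Done) D) = bind_pmf ?M Db"
     unfolding eq by (simp add: map_bind_pmf Db_def[abs_def])
    thus ?thesis by (simp add: map_pmf_comp)
   qed
   have fin: "run f (fst x) k (snd x) = map_pmf (Pair Done) (Db x)" if "x : set_pmf ?M" for x
   proof -
    have "fst y = Done" if "y : set_pmf (run f (fst x) k (snd x))" for y
    proof -
     have "y : set_pmf (map_pmf (Pair Done) D)" unfolding eq using that \<open>x : set_pmf ?M\<close> by auto
     thus ?thesis by auto
    qed
    hence "map_pmf (%y. (Done, snd y)) (run f (fst x) k (snd x))
      = map_pmf (%y. y) (run f (fst x) k (snd x))"
     by (intro map_pmf_cong) (auto simp: prod_eq_iff)
    thus ?thesis by (simp add: Db_def map_pmf_comp)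
   qed
   have stp: "step f (Seq P Q) s = map_pmf (%(P', s'). (Seq P' Q, s')) ?M"
    using False by simp
   have "bstep f (Seq P' Q) s' (bind_pmf (Db (P', s')) E)" if "(P', s') : set_pmf ?M" for P' s'
    using Suc.IH[of P' s' "Db (P', s')"] fin[OF that] Suc(3) that by (auto simp: DD)
   \<comment> \<open>The continuation in \<open>bstep_bind\<close> depends on the remaining program,
     which has the form \<open>Seq P' Q\<close>; the case expression recovers \<open>P'\<close> from
     it.\<close>
   hence "bstep f (Seq P Q) s (bind_pmf (map_pmf (%(P', s'). (Seq P' Q, s')) ?M)
     (%(P', s'). (%R s'. case R of Seq P'' _ => bind_pmf (Db (P'', s')) E) P' s'))"
    by (intro bstep_bind[OF stp]) auto
   also have "bind_pmf (map_pmf (%(P', s'). (Seq P' Q, s')) ?M)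
     (%(P', s'). (%R s'. case R of Seq P'' _ => bind_pmf (Db (P'', s')) E) P' s') = bind_pmf D E"
    unfolding DD by (simp add: bind_map_pmf bind_assoc_pmf case_prod_beta)
   finally show ?thesis .
  qed
 qed
 show ?thesis using assms gen by (auto simp: bstep_def)
qed

lemma bstep_Seq_return:
 assumes "bstep f P s (return_pmf s')" and "bstep f Q s' D"
 shows "bstep f (Seq P Q) s D"
 using bstep_Seq[OF assms(1), of Q "%_. D"] assms(2) by (simp add: bind_return_pmf)

lemma bstep_Cond:
 assumes "bstep f (if reg s x ~= 0 then P else Q) (tick [reg s x] s) D"
 shows "bstep f (Cond x P Q) s D"
 by (rule bstep_return[OF _ assms]) simp

lemma bstep_While_0:
 "reg s x = 0 ==> bstep f (While x P) s (return_pmf (tick [0] s))"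
 by (rule bstep_return[OF _ bstep_Done]) simp

lemma bstep_While_step:
 "reg s x ~= 0 ==> bstep f (Seq P (While x P)) (tick [reg s x] s) D ==> bstep f (While x P) s D"
 by (rule bstep_return) simp_all

section \<open>Commands, their compilation and their semantics\<close>

datatype aexp = V nat | N nat | Op arith aexp aexp | Ld aexp

fun ev :: "aexp => (nat => nat) => (nat => nat) => nat" where
 "ev (V v) g h = g v"
| "ev (N k) g h = k"
| "ev (Op p a b) g h = eval_arith p (ev a g h) (ev b g h)"
| "ev (Ld a) g h = h (ev a g h)"

fun ecost :: "aexp => (nat => nat) => (nat => nat) => nat" where
 "ecost (V v) g h = 2 + floorlog 2 (g v)"
| "ecost (N k) g h = 1 + floorlog 2 k"
| "ecost (Op p a b) g h =
   ecost a g h + ecost b g h + 1 + floorlog 2 (ev a g h) + floorlog 2 (ev b g h)"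
| "ecost (Ld a) g h = ecost a g h + 1 + floorlog 2 (ev a g h) + floorlog 2 (h (ev a g h))"

datatype cmd =
  Skip
 | Asg nat aexp
 | Sto aexp aexp
 | HadC aexp
 | TC aexp
 | Tof aexp aexp aexp
 | QL aexp aexp aexp aexp
 | Qu aexp aexp aexp
 | Meas nat aexp
 | Sq cmd cmd
 | Ite aexp cmd cmd
 | For bool nat aexp cmd

text \<open>Register \<open>4 v\<close> holds variable \<open>v\<close>, so that register 0 is variable 0; the registers \<open>4 d + 1\<close>
 are a stack of temporaries, \<open>4 v + 2\<close> counts the remaining iterations of the loop over \<open>v\<close>, and
 \<open>4 v + 3\<close> is the constant by which the loop variable is computed from the counter.\<close>

abbreviation (input) var :: "nat => nat" where "var v \<equiv> 4 * v"
abbreviation (input) tmp :: "nat => nat" where "tmp d \<equiv> 4 * d + 1"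
abbreviation (input) cnt :: "nat => nat" where "cnt v \<equiv> 4 * v + 2"
abbreviation (input) lim :: "nat => nat" where "lim v \<equiv> 4 * v + 3"

fun cexp :: "aexp => nat => prog" where
 "cexp (V v) d = Seq (Instr (Literal (tmp d) 0)) (Instr (Arith Plus (tmp d) (var v) (tmp d)))"
| "cexp (N k) d = Instr (Literal (tmp d) k)"
| "cexp (Op p a b) d = Seq (cexp a d) (Seq (cexp b (Suc d))
   (Instr (Arith p (tmp d) (tmp d) (tmp (Suc d)))))"
| "cexp (Ld a) d = Seq (cexp a d) (Instr (Load (tmp d) (tmp d)))"

text \<open>The machine has no copy instruction; a register is copied by adding a zero held in
  \<open>tmp 1\<close>.\<close>

definition move :: "nat => nat => prog" where
 "move x y = Seq (Instr (Literal (tmp 1) 0)) (Instr (Arith Plus x y (tmp 1)))"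

fun comp :: "cmd => prog" where
 "comp Skip = Done"
| "comp (Asg v e) = Seq (cexp e 0) (move (var v) (tmp 0))"
| "comp (Sto a e) = Seq (cexp a 0) (Seq (cexp e 1) (Instr (Store (tmp 0) (tmp 1))))"
| "comp (HadC e) = Seq (cexp e 0) (Instr (Had (tmp 0)))"
| "comp (TC e) = Seq (cexp e 0) (Instr (TGate (tmp 0)))"
| "comp (Tof a b c) = Seq (cexp a 0) (Seq (cexp b 1) (Seq (cexp c 2)
   (Instr (Toffoli (tmp 0) (tmp 1) (tmp 2)))))"
| "comp (QL b a k t) = Seq (cexp b 0) (Seq (cexp a 1) (Seq (cexp k 2) (Seq (cexp t 3)
   (Instr (QLoad (tmp 0) (tmp 1) (tmp 2) (tmp 3))))))"
| "comp (Qu l x y) = Seq (cexp l 0) (Seq (cexp x 1) (Seq (cexp y 2)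
   (Instr (Query (tmp 0) (tmp 1) (tmp 2)))))"
| "comp (Meas v e) = Seq (cexp e 0) (Instr (Measure (var v) (tmp 0)))"
| "comp (Sq c d) = Seq (comp c) (comp d)"
| "comp (Ite e c d) = Seq (cexp e 0) (Cond (tmp 0) (comp c) (comp d))"
| "comp (For up v e c) = Seq (cexp e 0) (Seq (move (cnt v) (tmp 0))
   (Seq (if up then move (lim v) (tmp 0) else Instr (Literal (lim v) 1))
   (Seq (While (cnt v)
    (Seq (Instr (if up then Arith Minus (var v) (lim v) (cnt v)
          else Arith Minus (var v) (cnt v) (lim v)))
    (Seq (comp c)
    (Seq (Instr (Literal (tmp 0) 1)) (Instr (Arith Minus (cnt v) (cnt v) (tmp 0)))))))
   (Instr (Literal (var v) 0)))))"

definition eva :: "aexp => config => nat" where "eva e s = ev e (reg s) (heap s)"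
definition ecs :: "aexp => config => nat" where "ecs e s = ecost e (reg s) (heap s)"
definition spend :: "nat => config => config" where "spend t s = s\<lparr>clock := clock s + t\<rparr>"

primrec for_list :: "(nat => config => config pmf) => nat list => config => config pmf" where
 "for_list g [] s = return_pmf s"
| "for_list g (t # ts) s = bind_pmf (g t s) (for_list g ts)"

text \<open>Loops run in both directions because the inverse of a circuit traverses its loops
  backwards.\<close>

definition range_dir :: "bool => nat => nat list" where
 "range_dir up k = (if up then [0..<k] else rev [0..<k])"

abbreviation fl :: "nat => nat" where "fl \<equiv> floorlog 2"

text \<open>The content of the counter register in the iteration whose loop variable is
  \<open>t\<close>.\<close>

definition remaining :: "bool => nat => nat => nat" where
 "remaining up k t = (if up then k - t else Suc t)"

definition iter_cost :: "bool => nat => nat => nat" where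
 "iter_cost up k t = 2 * fl (remaining up k t) + fl (if up then k else 1) + 2"

text \<open>The clock advances by the exact cost of the compiled code, so that correctness of the
  compiler is an equality of distributions of configurations, clock included.\<close>

fun sem :: "oracle_fun => cmd => config => config pmf" where
 "sem f Skip s = return_pmf s"
| "sem f (Asg v e) s = return_pmf (spend (ecs e s + 2 + fl (eva e s)) (set_reg v (eva e s) s))"
| "sem f (Sto a e) s = return_pmf (spend (ecs a s + ecs e s + 1 + fl (eva a s) + fl (eva e s))
   (s\<lparr>heap := (heap s)(eva a s := eva e s)\<rparr>))"
| "sem f (HadC e) s = return_pmf (spend (ecs e s + 1 + fl (eva e s)) (apply_gate (hadamard (eva e s)) s))"
| "sem f (TC e) s = return_pmf (spend (ecs e s + 1 + fl (eva e s)) (apply_gate (t_gate (eva e s)) s))"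
| "sem f (Tof a b c) s = return_pmf
   (spend (ecs a s + ecs b s + ecs c s + 1 + fl (eva a s) + fl (eva b s) + fl (eva c s))
    (apply_gate (controlled_not {eva a s, eva b s} (eva c s)) s))"
| "sem f (QL b a k t) s = return_pmf
   (spend (ecs b s + ecs a s + ecs k s + ecs t s + 1
     + fl (eva b s) + fl (eva a s) + fl (eva k s) + fl (eva t s) + eva k s)
    (apply_gate (quantum_read (heap s) (eva b s) (eva a s) (eva k s) (eva t s)) s))"
| "sem f (Qu l x y) s = return_pmf
   (spend (ecs l s + ecs x s + ecs y s + 1 + fl (eva l s) + fl (eva x s) + fl (eva y s) + eva l s)
    (apply_gate (oracle_gate f (eva l s) (eva x s) (eva y s)) s))"
| "sem f (Meas v e) s = map_pmf
   (%b. spend (ecs e s + 1 + fl (eva e s))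
      (set_reg v (of_bool b) (apply_gate (collapse (eva e s) b) s)))
   (bernoulli_pmf (outcome_prob (eva e s) True (qst s)))"
| "sem f (Sq c d) s = bind_pmf (sem f c s) (sem f d)"
| "sem f (Ite e c d) s = sem f (if eva e s ~= 0 then c else d) (spend (ecs e s + 1 + fl (eva e s)) s)"
| "sem f (For up v e c) s =
   bind_pmf (for_list (%t s'. map_pmf (spend (fl (remaining up (eva e s) t) + 4))
     (sem f c (spend (iter_cost up (eva e s) t) (set_reg v t s'))))
    (range_dir up (eva e s))
    (spend (ecs e s + 4 + fl (eva e s) + (if up then fl (eva e s) else 0)) s))
   (%s'. return_pmf (spend 2 (set_reg v 0 s')))"

fun loop_vars :: "cmd => nat set" where
 "loop_vars (Sq c d) = loop_vars c Un loop_vars d"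
| "loop_vars (Ite e c d) = loop_vars c Un loop_vars d"
| "loop_vars (For up v e c) = insert v (loop_vars c)"
| "loop_vars _ = {}"

text \<open>A loop inside a loop over the same variable would overwrite the counter and the limit of
  the outer one.\<close>

fun wf_cmd :: "cmd => bool" where
 "wf_cmd (Sq c d) \<longleftrightarrow> wf_cmd c & wf_cmd d"
| "wf_cmd (Ite e c d) \<longleftrightarrow> wf_cmd c & wf_cmd d"
| "wf_cmd (For up v e c) \<longleftrightarrow> wf_cmd c & v ~: loop_vars c"
| "wf_cmd _ \<longleftrightarrow> True"

text \<open>The configuration as commands see it: temporaries, counters and limits are
  forgotten.\<close>

definition absc :: "config => config" where
 "absc s = s\<lparr>reg := (%v. reg s (var v))\<rparr>"

section \<open>Correctness of the compiler\<close>

lemma floorlog_2_0_1 [simp]: "fl 0 = 0" "fl 1 = 1" "fl (Suc 0) = 1"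
 by (auto simp: floorlog_def)

lemma tick_spend: "tick vs s = spend (1 + (\<Sum>v\<leftarrow>vs. fl v)) s"
 by (simp add: tick_def spend_def)

lemma spend_simps [simp]:
 "reg (spend t s) = reg s" "heap (spend t s) = heap s" "qst (spend t s) = qst s"
 "clock (spend t s) = clock s + t" "spend a (spend b s) = spend (b + a) s"
 by (simp_all add: spend_def algebra_simps)

lemma set_reg_simps [simp]:
 "reg (set_reg x v s) = (reg s)(x := v)" "heap (set_reg x v s) = heap s"
 "qst (set_reg x v s) = qst s" "clock (set_reg x v s) = clock s"
 by (simp_all add: set_reg_def)

text \<open>The last conjunct lets the value of a left operand survive in its temporary while the
  right operand is computed one level deeper in the stack.\<close>

lemma cexp_correct:
 "EX g. bstep f (cexp e d) s (return_pmf (spend (ecost e (%v. reg s (var v)) (heap s)) (s\<lparr>reg := g\<rparr>)))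
   & g (tmp d) = ev e (%v. reg s (var v)) (heap s)
   & (ALL x. x mod 4 ~= 1 \<or> x < tmp d --> g x = reg s x)"
proof (induction e arbitrary: d s)
 case (V v)
 let ?s1 = "spend 1 (s\<lparr>reg := (reg s)(tmp d := 0)\<rparr>)"
 let ?s2 = "spend (ecost (V v) (%v. reg s (var v)) (heap s)) (s\<lparr>reg := (reg s)(tmp d := reg s (var v))\<rparr>)"
 have 1: "bstep f (Instr (Literal (tmp d) 0)) s (return_pmf ?s1)"
  using bstep_Instr[of f "Literal (tmp d) 0" s] by (simp add: tick_spend set_reg_def)
 have "var v ~= tmp d" by presburger
 hence 2: "bstep f (Instr (Arith Plus (tmp d) (var v) (tmp d))) ?s1 (return_pmf ?s2)"
  using bstep_Instr[of f "Arith Plus (tmp d) (var v) (tmp d)" ?s1]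
  by (simp add: tick_spend set_reg_def spend_def)
 have "bstep f (cexp (V v) d) s (return_pmf ?s2)"
  using bstep_Seq_return[OF 1 2] by simp
 thus ?case by (intro exI[of _ "(reg s)(tmp d := reg s (var v))"] conjI) (assumption | auto)+
next
 case (N k)
 have "bstep f (cexp (N k) d) s
   (return_pmf (spend (ecost (N k) (%v. reg s (var v)) (heap s)) (s\<lparr>reg := (reg s)(tmp d := k)\<rparr>)))"
  using bstep_Instr[of f "Literal (tmp d) k" s] by (simp add: tick_spend set_reg_def)
 thus ?case by (intro exI[of _ "(reg s)(tmp d := k)"] conjI) (assumption | auto)+
next
 case (Op p a b)
 let ?e = "%v. reg s (var v)"
 obtain g where g: "bstep f (cexp a d) s (return_pmf (spend (ecost a ?e (heap s)) (s\<lparr>reg := g\<rparr>)))"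
  "g (tmp d) = ev a ?e (heap s)" "!!x. x mod 4 ~= 1 \<or> x < tmp d ==> g x = reg s x"
  using Op.IH(1)[of d s] by blast
 let ?s1 = "spend (ecost a ?e (heap s)) (s\<lparr>reg := g\<rparr>)"
 have ge: "(%v. g (var v)) = ?e" using g(3) by auto
 obtain g2 where g2: "bstep f (cexp b (Suc d)) ?s1
    (return_pmf (spend (ecost b ?e (heap s)) (?s1\<lparr>reg := g2\<rparr>)))"
  "g2 (tmp (Suc d)) = ev b ?e (heap s)" "!!x. x mod 4 ~= 1 \<or> x < tmp (Suc d) ==> g2 x = g x"
  using Op.IH(2)[of "Suc d" ?s1] by (auto simp: ge)
 let ?s2 = "spend (ecost b ?e (heap s)) (?s1\<lparr>reg := g2\<rparr>)"
 define g3 where "g3 = g2(tmp d := eval_arith p (ev a ?e (heap s)) (ev b ?e (heap s)))"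
 have g2d: "g2 (tmp d) = ev a ?e (heap s)" using g2(3)[of "tmp d"] g(2) by simp
 let ?s3 = "spend (ecost (Op p a b) ?e (heap s)) (s\<lparr>reg := g3\<rparr>)"
 have 3: "bstep f (Instr (Arith p (tmp d) (tmp d) (tmp (Suc d)))) ?s2 (return_pmf ?s3)"
  using bstep_Instr[of f "Arith p (tmp d) (tmp d) (tmp (Suc d))" ?s2] g2(2) g2d
  by (simp add: tick_spend set_reg_def spend_def g3_def algebra_simps)
 have "bstep f (cexp (Op p a b) d) s (return_pmf ?s3)"
  using bstep_Seq_return[OF g(1) bstep_Seq_return[OF g2(1) 3]] by simp
 thus ?case using g(3) g2(3) by (intro exI[of _ g3] conjI) (assumption | auto simp: g3_def)+
next
 case (Ld a)
 let ?e = "%v. reg s (var v)"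
 obtain g where g: "bstep f (cexp a d) s (return_pmf (spend (ecost a ?e (heap s)) (s\<lparr>reg := g\<rparr>)))"
  "g (tmp d) = ev a ?e (heap s)" "!!x. x mod 4 ~= 1 \<or> x < tmp d ==> g x = reg s x"
  using Ld.IH[of d s] by blast
 let ?s1 = "spend (ecost a ?e (heap s)) (s\<lparr>reg := g\<rparr>)"
 define g3 where "g3 = g(tmp d := heap s (ev a ?e (heap s)))"
 let ?s3 = "spend (ecost (Ld a) ?e (heap s)) (s\<lparr>reg := g3\<rparr>)"
 have 3: "bstep f (Instr (Load (tmp d) (tmp d))) ?s1 (return_pmf ?s3)"
  using bstep_Instr[of f "Load (tmp d) (tmp d)" ?s1] g(2)
  by (simp add: tick_spend set_reg_def spend_def g3_def algebra_simps)
 have "bstep f (cexp (Ld a) d) s (return_pmf ?s3)"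
  using bstep_Seq_return[OF g(1) 3] by simp
 thus ?case using g(3) by (intro exI[of _ g3] conjI) (assumption | auto simp: g3_def)+
qed

definition frame :: "cmd => config => config => bool" where
 "frame c s s' \<longleftrightarrow> (ALL v. v ~: loop_vars c --> reg s' (cnt v) = reg s (cnt v) & reg s' (lim v) = reg s (lim v))"

definition simulates :: "oracle_fun => cmd => config => config pmf => bool" where
 "simulates f c s D \<longleftrightarrow> bstep f (comp c) s D & map_pmf absc D = sem f c (absc s)
   & (ALL s':set_pmf D. frame c s s')"

lemma absc_simps [simp]:
 "heap (absc s) = heap s" "qst (absc s) = qst s" "clock (absc s) = clock s"
 "reg (absc s) = (%v. reg s (var v))"
 by (simp_all add: absc_def)

lemma absc_spend [simp]: "absc (spend t s) = spend t (absc s)"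
 by (simp add: absc_def spend_def)

lemma cexpE:
 obtains g where "bstep f (cexp e d) s (return_pmf (spend (ecs e (absc s)) (s\<lparr>reg := g\<rparr>)))"
  "g (tmp d) = eva e (absc s)" "!!x. x mod 4 ~= 1 \<or> x < tmp d ==> g x = reg s x"
  "(%v. g (var v)) = (%v. reg s (var v))" "!!v. g (var v) = reg s (var v)"
  "!!v. g (cnt v) = reg s (cnt v)" "!!v. g (lim v) = reg s (lim v)"
proof -
 obtain g where g: "bstep f (cexp e d) s (return_pmf (spend (ecs e (absc s)) (s\<lparr>reg := g\<rparr>)))"
  "g (tmp d) = eva e (absc s)" "!!x. x mod 4 ~= 1 \<or> x < tmp d ==> g x = reg s x"
  using cexp_correct[of f e d s] by (auto simp: ecs_def eva_def)
 have "var v mod 4 ~= 1" "cnt v mod 4 ~= 1" "lim v mod 4 ~= 1" for v by presburger+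
 thus ?thesis using g that[OF g] by auto
qed

lemma var_tmp_neq [simp]: "4 * v ~= Suc (4 * d)" "Suc (4 * d) ~= 4 * v" "4 * v = 4 * (w::nat) \<longleftrightarrow> v = w"
 "4 * v ~= Suc (Suc (4 * d))" "4 * v ~= Suc (Suc (Suc (4 * d)))"
 by presburger+

lemma var_num_neq [simp]: "4 * v ~= (5::nat)" "4 * v ~= (9::nat)" "4 * v ~= (13::nat)" "4 * v ~= Suc 0"
 by presburger+

lemma bstep_move:
 assumes "y ~= tmp 1"
 shows "bstep f (move x y) s
   (return_pmf (spend (2 + fl (reg s y)) (s\<lparr>reg := (reg s)(tmp 1 := 0, x := reg s y)\<rparr>)))"
proof -
 let ?s1 = "spend 1 (s\<lparr>reg := (reg s)(tmp 1 := 0)\<rparr>)"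
 have 1: "bstep f (Instr (Literal (tmp 1) 0)) s (return_pmf ?s1)"
  using bstep_Instr[of f "Literal (tmp 1) 0" s] by (simp add: tick_spend set_reg_def)
 have 2: "bstep f (Instr (Arith Plus x y (tmp 1))) ?s1
   (return_pmf (spend (2 + fl (reg s y)) (s\<lparr>reg := (reg s)(tmp 1 := 0, x := reg s y)\<rparr>)))"
  using bstep_Instr[of f "Arith Plus x y (tmp 1)" ?s1] assms
  by (simp add: tick_spend set_reg_def spend_def)
 show ?thesis unfolding move_def by (rule bstep_Seq_return[OF 1 2])
qed

lemma absc_reg:
 assumes "!!v. g (var v) = reg s (var v)"
 shows "absc (s\<lparr>reg := g\<rparr>) = absc s"
 using assms by (simp add: absc_def)

lemma simulatesI:
 assumes "bstep f (comp c) s D" "map_pmf absc D = sem f c (absc s)"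
  "!!s'. s' : set_pmf D ==> frame c s s'"
 shows "EX D. simulates f c s D"
 using assms by (auto simp: simulates_def)

lemma eva_spend [simp]: "eva e (spend t s) = eva e s" "ecs e (spend t s) = ecs e s"
 by (simp_all add: eva_def ecs_def)

text \<open>Induction on the number \<open>m\<close> of iterations left, for which the lists hold
  the values of the loop variable still to come. The bound \<open>N 0\<close> in the frame is a
  placeholder, as only the loop variables count there.\<close>

lemma while_correct:
 fixes f c v up k
 defines "W \<equiv> (While (cnt v)
    (Seq (Instr (if up then Arith Minus (var v) (lim v) (cnt v)
          else Arith Minus (var v) (cnt v) (lim v)))
    (Seq (comp c)
    (Seq (Instr (Literal (tmp 0) 1)) (Instr (Arith Minus (cnt v) (cnt v) (tmp 0)))))))"
  and "g \<equiv> (%t s'. map_pmf (spend (fl (remaining up k t) + 4))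
     (sem f c (spend (iter_cost up k t) (set_reg v t s'))))"
 assumes body: "!!s. EX D. simulates f c s D" and v: "v ~: loop_vars c"
 shows "m <= k ==> reg s (cnt v) = m ==> reg s (lim v) = (if up then k else 1) ==>
  EX D. bstep f W s D
   & map_pmf absc D = map_pmf (spend 1)
      (for_list g (if up then [k - m..<k] else rev [0..<m]) (absc s))
   & (ALL s':set_pmf D. frame (For up v (N 0) c) s s')"
proof (induction m arbitrary: s)
 case 0
 have "bstep f W s (return_pmf (spend 1 s))"
  using bstep_While_0[of s "cnt v" f] 0 unfolding W_def by (auto simp: tick_spend)
 thus ?case
  by (intro exI[of _ "return_pmf (spend 1 s)"]) (auto simp: frame_def)
next
 case (Suc m)
 define t where "t = (if up then k - Suc m else m)"
 have rem: "remaining up k t = Suc m" using Suc.prems by (auto simp: remaining_def t_def)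
 have lst: "(if up then [k - Suc m..<k] else rev [0..<Suc m]) = t # (if up then [k - m..<k] else rev [0..<m])"
  using Suc.prems by (auto simp: t_def upt_conv_Cons Suc_diff_Suc)
 define s1 where "s1 = spend (iter_cost up k t) (s\<lparr>reg := (reg s)(var v := t)\<rparr>)"
 have neq: "cnt v ~= var v" "lim v ~= var v" "!!w. cnt v ~= var w" "!!w. lim v ~= var w" by presburger+
 have 1: "bstep f (Instr (if up then Arith Minus (var v) (lim v) (cnt v)
          else Arith Minus (var v) (cnt v) (lim v))) (tick [Suc m] s) (return_pmf s1)"
  using bstep_Instr[of f "(if up then Arith Minus (var v) (lim v) (cnt v)
          else Arith Minus (var v) (cnt v) (lim v))" "tick [Suc m] s"] Suc.prems rem
  by (simp add: tick_spend s1_def set_reg_def iter_cost_def spend_def t_def mult_2 ac_simps split: if_splits)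
 have abs1: "absc s1 = spend (iter_cost up k t) (set_reg v t (absc s))"
  by (rule config.equality) (auto simp: s1_def)
 obtain Dc where Dc: "simulates f c s1 Dc" using body by blast
 define post where "post s' = spend (fl (Suc m) + 4) (s'\<lparr>reg := (reg s')(tmp 0 := 1, cnt v := m)\<rparr>)" for s'
 have fr: "reg s' (cnt v) = Suc m" "reg s' (lim v) = (if up then k else 1)" if "s' : set_pmf Dc" for s'
  using Dc that v Suc.prems neq unfolding simulates_def frame_def s1_def by auto
 have 2: "bstep f (Seq (Instr (Literal (tmp 0) 1)) (Instr (Arith Minus (cnt v) (cnt v) (tmp 0)))) s'
   (return_pmf (post s'))" if "s' : set_pmf Dc" for s'
 proof -
  have ar: "a + (b + 4) = Suc (Suc (Suc (Suc (a + b))))" for a b :: nat by simp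
  have "bstep f (Instr (Literal (tmp 0) 1)) s' (return_pmf (spend 2 (s'\<lparr>reg := (reg s')(tmp 0 := 1)\<rparr>)))"
   using bstep_Instr[of f "Literal (tmp 0) 1" s'] by (simp add: tick_spend set_reg_def spend_def)
  moreover have "bstep f (Instr (Arith Minus (cnt v) (cnt v) (tmp 0)))
    (spend 2 (s'\<lparr>reg := (reg s')(tmp 0 := 1)\<rparr>)) (return_pmf (post s'))"
   using bstep_Instr[of f "Arith Minus (cnt v) (cnt v) (tmp 0)" "spend 2 (s'\<lparr>reg := (reg s')(tmp 0 := 1)\<rparr>)"]
    fr[OF that] by (simp add: tick_spend set_reg_def spend_def post_def ar)
  ultimately show ?thesis by (rule bstep_Seq_return)
 qed
 have abspost: "absc (post s') = spend (fl (Suc m) + 4) (absc s')" for s'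
  by (rule config.equality) (auto simp: post_def neq[symmetric])
 define P where "P s' D \<longleftrightarrow> bstep f W (post s') D
   & map_pmf absc D = map_pmf (spend 1)
      (for_list g (if up then [k - m..<k] else rev [0..<m]) (absc (post s')))
   & (ALL s'':set_pmf D. frame (For up v (N 0) c) (post s') s'')" for s' D
 have "EX D. P s' D" if "s' : set_pmf Dc" for s'
  unfolding P_def
  by (rule Suc.IH) (use Suc.prems fr[OF that] in "auto simp: post_def")
 then obtain E where E: "!!s'. s' : set_pmf Dc ==> P s' (E s')" by metis
 have bs1: "bstep f (Seq (comp c)
    (Seq (Instr (Literal (tmp 0) 1)) (Instr (Arith Minus (cnt v) (cnt v) (tmp 0))))) s1
    (bind_pmf Dc (%s'. return_pmf (post s')))"
  by (rule bstep_Seq) (use Dc 2 in "auto simp: simulates_def")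
 have bs2: "bstep f (Seq (Instr (if up then Arith Minus (var v) (lim v) (cnt v)
          else Arith Minus (var v) (cnt v) (lim v))) (Seq (comp c)
    (Seq (Instr (Literal (tmp 0) 1)) (Instr (Arith Minus (cnt v) (cnt v) (tmp 0)))))) (tick [Suc m] s)
    (bind_pmf Dc (%s'. return_pmf (post s')))"
  by (rule bstep_Seq_return[OF 1 bs1])
 \<comment> \<open>\<open>bstep_Seq\<close> needs the continuation as a function of the state after
   the body, but \<open>post\<close> may identify states; one preimage is chosen.\<close>
 define E' where "E' x = (SOME D. EX s':set_pmf Dc. post s' = x & D = E s')" for x
 have E': "bstep f W x (E' x) & map_pmf absc (E' x) = map_pmf (spend 1)
      (for_list g (if up then [k - m..<k] else rev [0..<m]) (absc x))
   & (ALL s'':set_pmf (E' x). frame (For up v (N 0) c) x s'')" if "x : post ` set_pmf Dc" for x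
 proof -
  have "EX D. EX s':set_pmf Dc. post s' = x & D = E s'" using that by auto
  hence "EX s':set_pmf Dc. post s' = x & E' x = E s'" unfolding E'_def by (rule someI_ex)
  thus ?thesis using E unfolding P_def by auto
 qed
 have bs3: "bstep f W s (bind_pmf (bind_pmf Dc (%s'. return_pmf (post s'))) E')"
  unfolding W_def
  apply (rule bstep_While_step)
  subgoal using Suc.prems by simp
  subgoal
   apply (rule bstep_Seq)
   subgoal using bs2 Suc.prems by simp
   subgoal for s' using E'[of s'] unfolding W_def by auto
   done
  done
 have "map_pmf absc (bind_pmf (bind_pmf Dc (%s'. return_pmf (post s'))) E')
   = bind_pmf Dc (%s'. map_pmf absc (E' (post s')))"
  by (simp add: map_bind_pmf bind_assoc_pmf bind_return_pmf)
 also have "... = bind_pmf Dc (%s'. map_pmf (spend 1)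
      (for_list g (if up then [k - m..<k] else rev [0..<m]) (spend (fl (Suc m) + 4) (absc s'))))"
  by (rule bind_pmf_cong) (use E' abspost in auto)
 also have "... = bind_pmf (map_pmf absc Dc) (%s'. map_pmf (spend 1)
      (for_list g (if up then [k - m..<k] else rev [0..<m]) (spend (fl (Suc m) + 4) s')))"
  by (simp add: bind_map_pmf)
 also have "map_pmf absc Dc = sem f c (spend (iter_cost up k t) (set_reg v t (absc s)))"
  using Dc by (simp add: simulates_def abs1)
 also have "bind_pmf ... (%s'. map_pmf (spend 1)
      (for_list g (if up then [k - m..<k] else rev [0..<m]) (spend (fl (Suc m) + 4) s')))
   = map_pmf (spend 1) (for_list g (if up then [k - Suc m..<k] else rev [0..<Suc m]) (absc s))"
  unfolding lst by (simp only: for_list.simps) (simp add: map_bind_pmf g_def bind_map_pmf rem)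
 finally have e1: "map_pmf absc (bind_pmf (bind_pmf Dc (%s'. return_pmf (post s'))) E')
   = map_pmf (spend 1) (for_list g (if up then [k - Suc m..<k] else rev [0..<Suc m]) (absc s))" .
 have "frame (For up v (N 0) c) s s''" if "s' : set_pmf Dc" "s'' : set_pmf (E' (post s'))" for s' s''
 proof -
  have n: "cnt u ~= tmp 0" "lim u ~= tmp 0" "lim u ~= cnt w" "cnt u ~= var w" "lim u ~= var w" for u w by presburger+
  have 1: "frame (For up v (N 0) c) (post s') s''" using E' that by auto
  have 2: "frame c s1 s'" using Dc that by (auto simp: simulates_def)
  show ?thesis
   unfolding frame_def
  proof (intro allI impI)
   fix u assume u: "u ~: loop_vars (For up v (N 0) c)"
   hence "reg s'' (cnt u) = reg (post s') (cnt u)" "reg s'' (lim u) = reg (post s') (lim u)"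
    "reg s' (cnt u) = reg s1 (cnt u)" "reg s' (lim u) = reg s1 (lim u)"
    using 1 2 by (auto simp: frame_def)
   thus "reg s'' (cnt u) = reg s (cnt u) & reg s'' (lim u) = reg s (lim u)"
    using u n by (auto simp: post_def s1_def)
  qed
 qed
 thus ?case using bs3 e1
  by (intro exI[of _ "bind_pmf (bind_pmf Dc (%s'. return_pmf (post s'))) E'"])
    (auto simp: bind_assoc_pmf bind_return_pmf)
qed

definition same_ctl :: "config => config => bool" where
 "same_ctl s s' \<longleftrightarrow> (ALL v. reg s' (cnt v) = reg s (cnt v) & reg s' (lim v) = reg s (lim v))"

lemma cexp_abs:
 obtains s' where "bstep f (cexp e d) s (return_pmf s')"
  "absc s' = spend (ecs e (absc s)) (absc s)"
  "reg s' (tmp d) = eva e (absc s)" "!!d'. d' < d ==> reg s' (tmp d') = reg s (tmp d')"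
  "same_ctl s s'"
proof -
 obtain g where g: "bstep f (cexp e d) s (return_pmf (spend (ecs e (absc s)) (s\<lparr>reg := g\<rparr>)))"
  "g (tmp d) = eva e (absc s)" "!!x. x mod 4 ~= 1 \<or> x < tmp d ==> g x = reg s x"
  "(%v. g (var v)) = (%v. reg s (var v))" "!!v. g (var v) = reg s (var v)"
  "!!v. g (cnt v) = reg s (cnt v)" "!!v. g (lim v) = reg s (lim v)"
  by (rule cexpE[of f e d s]) blast
 show ?thesis
 proof (rule that[OF g(1)])
  show "absc (spend (ecs e (absc s)) (s\<lparr>reg := g\<rparr>)) = spend (ecs e (absc s)) (absc s)"
   using g(5) by (simp add: absc_reg)
 qed (use g in "auto simp: same_ctl_def")
qed

lemma abs_apply_gate [simp]: "absc (apply_gate U s) = apply_gate U (absc s)"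
 by (simp add: absc_def apply_gate_def)

lemma apply_gate_simps [simp]:
 "reg (apply_gate U s) = reg s" "heap (apply_gate U s) = heap s" "clock (apply_gate U s) = clock s"
 "qst (apply_gate U s) = U (qst s)"
 by (simp_all add: apply_gate_def)

lemma apply_gate_spend: "apply_gate U (spend t s) = spend t (apply_gate U s)"
 by (simp add: apply_gate_def spend_def)

lemma set_reg_spend: "set_reg x v (spend t s) = spend t (set_reg x v s)"
 by (simp add: set_reg_def spend_def)

lemma abs_set_var: "absc (set_reg (4 * v) a s) = set_reg v a (absc s)"
 by (rule config.equality) auto

lemma abs_set_other:
 assumes "x mod 4 ~= 0"
 shows "absc (set_reg x a s) = absc s"
proof -
 have "4 * v ~= x" for v using assms by auto
 thus ?thesis by (intro config.equality) auto
qed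

lemma same_ctl_trans: "same_ctl s s' ==> same_ctl s' s'' ==> same_ctl s s''"
 by (simp add: same_ctl_def)

lemma same_ctl_simps [simp]:
 "same_ctl s (apply_gate U s') \<longleftrightarrow> same_ctl s s'" "same_ctl s (spend t s') \<longleftrightarrow> same_ctl s s'"
 "same_ctl s (set_reg (4 * v) a s') \<longleftrightarrow> same_ctl s s'"
proof -
 have "4 * u + 2 ~= 4 * v" "4 * u + 3 ~= 4 * v" for u by presburger+
 thus "same_ctl s (set_reg (4 * v) a s') \<longleftrightarrow> same_ctl s s'"
  by (simp add: same_ctl_def)
qed (simp_all add: same_ctl_def)

lemma same_ctl_frame: "same_ctl s s' ==> frame c s s'"
 by (simp add: same_ctl_def frame_def)


lemma comp_correct: "wf_cmd c ==> EX D. simulates f c s D"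
proof (induction c arbitrary: s)
 case Skip
 show ?case by (rule simulatesI[of _ _ _ "return_pmf s"]) (auto simp: bstep_Done frame_def)
next
 case (Asg v e)
 obtain s1 where s1: "bstep f (cexp e 0) s (return_pmf s1)"
  "absc s1 = spend (ecs e (absc s)) (absc s)"
  "reg s1 (tmp 0) = eva e (absc s)" "same_ctl s s1"
  by (rule cexp_abs[of f e 0 s]) blast
 let ?s2 = "spend (2 + fl (reg s1 (tmp 0))) (set_reg (var v) (reg s1 (tmp 0)) (set_reg (tmp 1) 0 s1))"
 have 2: "bstep f (move (var v) (tmp 0)) s1 (return_pmf ?s2)"
  using bstep_move[of "tmp 0" f "var v" s1] by (simp add: set_reg_def)
 show ?case
 proof (rule simulatesI)
  show "bstep f (comp (Asg v e)) s (return_pmf ?s2)"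
   unfolding comp.simps by (rule bstep_Seq_return[OF s1(1) 2])
  show "map_pmf absc (return_pmf ?s2) = sem f (Asg v e) (absc s)"
   using s1(2,3) by (simp add: abs_set_var abs_set_other set_reg_spend)
  have "4 * v + 2 ~= (5::nat)" "4 * v + 3 ~= (5::nat)" for v by presburger+
  hence "same_ctl s1 (set_reg (tmp 1) 0 s1)" by (simp add: same_ctl_def)
  hence "same_ctl s1 ?s2" by simp
  thus "frame (Asg v e) s s'" if "s' : set_pmf (return_pmf ?s2)" for s'
   using that same_ctl_trans[OF s1(4)] by (simp add: same_ctl_frame)
 qed
next
 case (Sto a e)
 obtain s1 where s1: "bstep f (cexp a 0) s (return_pmf s1)"
  "absc s1 = spend (ecs a (absc s)) (absc s)"
  "reg s1 (tmp 0) = eva a (absc s)" "same_ctl s s1"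
  by (rule cexp_abs[of f a 0 s]) blast
 obtain s2 where s2: "bstep f (cexp e 1) s1 (return_pmf s2)"
  "absc s2 = spend (ecs e (absc s1)) (absc s1)"
  "reg s2 (tmp 1) = eva e (absc s1)" "!!d'. d' < 1 ==> reg s2 (tmp d') = reg s1 (tmp d')" "same_ctl s1 s2"
  by (rule cexp_abs[of f e 1 s1]) blast
 have v: "reg s2 (tmp 0) = eva a (absc s)" "reg s2 (tmp 1) = eva e (absc s)"
  using s1 s2(1-3) s2(4)[of 0] by simp_all
 have ab: "absc s2 = spend (ecs a (absc s) + ecs e (absc s)) (absc s)"
  using s1 s2 by simp
 let ?s3 = "tick [reg s2 (tmp 0), reg s2 (tmp 1)] (s2\<lparr>heap := (heap s2)(reg s2 (tmp 0) := reg s2 (tmp 1))\<rparr>)"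
 have h: "heap s2 = heap s" using ab by (metis absc_simps(1) spend_simps(2))
 show ?case
 proof (rule simulatesI)
  show "bstep f (comp (Sto a e)) s (return_pmf ?s3)"
   unfolding comp.simps
   by (rule bstep_Seq_return[OF s1(1)], rule bstep_Seq_return[OF s2(1)])
     (use bstep_Instr[of f "Store (tmp 0) (tmp 1)" s2] in simp)
  have "absc ?s3 = spend (1 + fl (eva a (absc s)) + fl (eva e (absc s)))
    ((absc s2)\<lparr>heap := (heap s)(eva a (absc s) := eva e (absc s))\<rparr>)"
   using v h by (simp add: tick_spend absc_def spend_def)
  thus "map_pmf absc (return_pmf ?s3) = sem f (Sto a e) (absc s)"
   by (simp add: ab spend_def algebra_simps)
  have "same_ctl s2 ?s3" by (simp add: same_ctl_def tick_spend)
  hence "same_ctl s ?s3" by (rule same_ctl_trans[OF same_ctl_trans[OF s1(4) s2(5)]])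
  thus "frame (Sto a e) s s'" if "s' : set_pmf (return_pmf ?s3)" for s'
   using that by (simp add: same_ctl_frame)
 qed
next
 case (HadC e)
 obtain s1 where s1: "bstep f (cexp e 0) s (return_pmf s1)"
  "absc s1 = spend (ecs e (absc s)) (absc s)"
  "reg s1 (tmp 0) = eva e (absc s)" "same_ctl s s1"
  by (rule cexp_abs[of f e 0 s]) blast
 show ?case
 proof (rule simulatesI)
  show "bstep f (comp (HadC e)) s (exec f (Had (tmp 0)) s1)"
   unfolding comp.simps by (rule bstep_Seq_return[OF s1(1) bstep_Instr])
 qed (use s1 in "auto simp: tick_spend apply_gate_spend intro!: same_ctl_frame")
next
 case (TC e)
 obtain s1 where s1: "bstep f (cexp e 0) s (return_pmf s1)"
  "absc s1 = spend (ecs e (absc s)) (absc s)"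
  "reg s1 (tmp 0) = eva e (absc s)" "same_ctl s s1"
  by (rule cexp_abs[of f e 0 s]) blast
 show ?case
 proof (rule simulatesI)
  show "bstep f (comp (TC e)) s (exec f (TGate (tmp 0)) s1)"
   unfolding comp.simps by (rule bstep_Seq_return[OF s1(1) bstep_Instr])
 qed (use s1 in "auto simp: tick_spend apply_gate_spend intro!: same_ctl_frame")
next
 case (Meas v e)
 obtain s1 where s1: "bstep f (cexp e 0) s (return_pmf s1)"
  "absc s1 = spend (ecs e (absc s)) (absc s)"
  "reg s1 (tmp 0) = eva e (absc s)" "same_ctl s s1"
  by (rule cexp_abs[of f e 0 s]) blast
 have q: "qst s1 = qst s" using s1(2) by (metis absc_simps(2) spend_simps(3))
 show ?case
 proof (rule simulatesI)
  show "bstep f (comp (Meas v e)) s (exec f (Measure (var v) (tmp 0)) s1)"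
   unfolding comp.simps by (rule bstep_Seq_return[OF s1(1) bstep_Instr])
 qed (use s1 q in \<open>auto simp: tick_spend apply_gate_spend set_reg_spend abs_set_var map_pmf_comp
    intro!: same_ctl_frame\<close>)
next
 case (Tof a b c)
 obtain s1 where s1: "bstep f (cexp a 0) s (return_pmf s1)"
  "absc s1 = spend (ecs a (absc s)) (absc s)"
  "reg s1 (tmp 0) = eva a (absc s)" "same_ctl s s1"
  by (rule cexp_abs[of f a 0 s]) blast
 obtain s2 where s2: "bstep f (cexp b 1) s1 (return_pmf s2)"
  "absc s2 = spend (ecs b (absc s1)) (absc s1)"
  "reg s2 (tmp 1) = eva b (absc s1)" "!!d'. d' < 1 ==> reg s2 (tmp d') = reg s1 (tmp d')" "same_ctl s1 s2"
  by (rule cexp_abs[of f b 1 s1]) blast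
 obtain s3 where s3: "bstep f (cexp c 2) s2 (return_pmf s3)"
  "absc s3 = spend (ecs c (absc s2)) (absc s2)"
  "reg s3 (tmp 2) = eva c (absc s2)" "!!d'. d' < 2 ==> reg s3 (tmp d') = reg s2 (tmp d')" "same_ctl s2 s3"
  by (rule cexp_abs[of f c 2 s2]) blast
 have v: "reg s3 (tmp 0) = eva a (absc s)" "reg s3 (tmp 1) = eva b (absc s)"
  "reg s3 (tmp 2) = eva c (absc s)"
  using s1 s2(1-3) s3(1-3) s2(4)[of 0] s3(4)[of 0] s3(4)[of 1] by simp_all
 have sc: "same_ctl s s3" by (rule same_ctl_trans[OF same_ctl_trans[OF s1(4) s2(5)] s3(5)])
 show ?case
 proof (rule simulatesI)
  show "bstep f (comp (Tof a b c)) s (exec f (Toffoli (tmp 0) (tmp 1) (tmp 2)) s3)"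
   unfolding comp.simps
   by (rule bstep_Seq_return[OF s1(1)], rule bstep_Seq_return[OF s2(1)],
     rule bstep_Seq_return[OF s3(1) bstep_Instr])
  show "map_pmf absc (exec f (Toffoli (tmp 0) (tmp 1) (tmp 2)) s3) = sem f (Tof a b c) (absc s)"
   using v s1(2) s2(2) s3(2) by (simp add: tick_spend apply_gate_spend algebra_simps)
 qed (use sc in "auto simp: tick_spend intro!: same_ctl_frame")
next
 case (Qu a b c)
 obtain s1 where s1: "bstep f (cexp a 0) s (return_pmf s1)"
  "absc s1 = spend (ecs a (absc s)) (absc s)"
  "reg s1 (tmp 0) = eva a (absc s)" "same_ctl s s1"
  by (rule cexp_abs[of f a 0 s]) blast
 obtain s2 where s2: "bstep f (cexp b 1) s1 (return_pmf s2)"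
  "absc s2 = spend (ecs b (absc s1)) (absc s1)"
  "reg s2 (tmp 1) = eva b (absc s1)" "!!d'. d' < 1 ==> reg s2 (tmp d') = reg s1 (tmp d')" "same_ctl s1 s2"
  by (rule cexp_abs[of f b 1 s1]) blast
 obtain s3 where s3: "bstep f (cexp c 2) s2 (return_pmf s3)"
  "absc s3 = spend (ecs c (absc s2)) (absc s2)"
  "reg s3 (tmp 2) = eva c (absc s2)" "!!d'. d' < 2 ==> reg s3 (tmp d') = reg s2 (tmp d')" "same_ctl s2 s3"
  by (rule cexp_abs[of f c 2 s2]) blast
 have v: "reg s3 (tmp 0) = eva a (absc s)" "reg s3 (tmp 1) = eva b (absc s)"
  "reg s3 (tmp 2) = eva c (absc s)"
  using s1 s2(1-3) s3(1-3) s2(4)[of 0] s3(4)[of 0] s3(4)[of 1] by simp_all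
 have sc: "same_ctl s s3" by (rule same_ctl_trans[OF same_ctl_trans[OF s1(4) s2(5)] s3(5)])
 show ?case
 proof (rule simulatesI)
  show "bstep f (comp (Qu a b c)) s (exec f (Query (tmp 0) (tmp 1) (tmp 2)) s3)"
   unfolding comp.simps
   by (rule bstep_Seq_return[OF s1(1)], rule bstep_Seq_return[OF s2(1)],
     rule bstep_Seq_return[OF s3(1) bstep_Instr])
  show "map_pmf absc (exec f (Query (tmp 0) (tmp 1) (tmp 2)) s3) = sem f (Qu a b c) (absc s)"
   using v s1(2) s2(2) s3(2) by (simp add: tick_spend apply_gate_spend algebra_simps sum_list_replicate)
 qed (use sc in "auto simp: tick_spend intro!: same_ctl_frame")
next
 case (QL a b c e)
 obtain s1 where s1: "bstep f (cexp a 0) s (return_pmf s1)"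
  "absc s1 = spend (ecs a (absc s)) (absc s)"
  "reg s1 (tmp 0) = eva a (absc s)" "same_ctl s s1"
  by (rule cexp_abs[of f a 0 s]) blast
 obtain s2 where s2: "bstep f (cexp b 1) s1 (return_pmf s2)"
  "absc s2 = spend (ecs b (absc s1)) (absc s1)"
  "reg s2 (tmp 1) = eva b (absc s1)" "!!d'. d' < 1 ==> reg s2 (tmp d') = reg s1 (tmp d')" "same_ctl s1 s2"
  by (rule cexp_abs[of f b 1 s1]) blast
 obtain s3 where s3: "bstep f (cexp c 2) s2 (return_pmf s3)"
  "absc s3 = spend (ecs c (absc s2)) (absc s2)"
  "reg s3 (tmp 2) = eva c (absc s2)" "!!d'. d' < 2 ==> reg s3 (tmp d') = reg s2 (tmp d')" "same_ctl s2 s3"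
  by (rule cexp_abs[of f c 2 s2]) blast
 obtain s4 where s4: "bstep f (cexp e 3) s3 (return_pmf s4)"
  "absc s4 = spend (ecs e (absc s3)) (absc s3)"
  "reg s4 (tmp 3) = eva e (absc s3)" "!!d'. d' < 3 ==> reg s4 (tmp d') = reg s3 (tmp d')" "same_ctl s3 s4"
  by (rule cexp_abs[of f e 3 s3]) blast
 have v: "reg s4 (tmp 0) = eva a (absc s)" "reg s4 (tmp 1) = eva b (absc s)"
  "reg s4 (tmp 2) = eva c (absc s)" "reg s4 (tmp 3) = eva e (absc s)"
  using s1 s2(1-3) s3(1-3) s4(1-3) s2(4)[of 0] s3(4)[of 0] s3(4)[of 1] s4(4)[of 0] s4(4)[of 1] s4(4)[of 2]
  by simp_all
 have h: "heap s4 = heap s" using s4(2) s3(2) s2(2) s1(2) by (metis absc_simps(1) spend_simps(2))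
 have sc: "same_ctl s s4"
  by (rule same_ctl_trans[OF same_ctl_trans[OF same_ctl_trans[OF s1(4) s2(5)] s3(5)] s4(5)])
 show ?case
 proof (rule simulatesI)
  show "bstep f (comp (QL a b c e)) s (exec f (QLoad (tmp 0) (tmp 1) (tmp 2) (tmp 3)) s4)"
   unfolding comp.simps
   by (rule bstep_Seq_return[OF s1(1)], rule bstep_Seq_return[OF s2(1)],
     rule bstep_Seq_return[OF s3(1)], rule bstep_Seq_return[OF s4(1) bstep_Instr])
  show "map_pmf absc (exec f (QLoad (tmp 0) (tmp 1) (tmp 2) (tmp 3)) s4) = sem f (QL a b c e) (absc s)"
   using v h s1(2) s2(2) s3(2) s4(2)
   by (simp add: tick_spend apply_gate_spend algebra_simps sum_list_replicate)
 qed (use sc in "auto simp: tick_spend intro!: same_ctl_frame")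
next
 case (Sq c d)
 obtain D where D: "simulates f c s D" using Sq by auto
 have "ALL s'. EX D. simulates f d s' D" using Sq by auto
 then obtain E where E: "!!s'. simulates f d s' (E s')" by metis
 show ?case
 proof (rule simulatesI)
  show "bstep f (comp (Sq c d)) s (bind_pmf D E)"
   unfolding comp.simps by (rule bstep_Seq) (use D E in "auto simp: simulates_def")
  have "map_pmf absc (bind_pmf D E) = bind_pmf (map_pmf absc D) (sem f d)"
   using E by (simp add: map_bind_pmf simulates_def bind_map_pmf)
  thus "map_pmf absc (bind_pmf D E) = sem f (Sq c d) (absc s)"
   using D by (simp add: simulates_def)
 qed (use D E in "force simp: simulates_def frame_def")
next
 case (Ite e c d)
 obtain s1 where s1: "bstep f (cexp e 0) s (return_pmf s1)"
  "absc s1 = spend (ecs e (absc s)) (absc s)"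
  "reg s1 (tmp 0) = eva e (absc s)" "same_ctl s s1"
  by (rule cexp_abs[of f e 0 s]) blast
 let ?s2 = "tick [reg s1 (tmp 0)] s1"
 obtain D where D: "simulates f (if reg s1 (tmp 0) ~= 0 then c else d) ?s2 D" using Ite by (cases "reg s1 (tmp 0) ~= 0") auto
 show ?case
 proof (rule simulatesI)
  show "bstep f (comp (Ite e c d)) s D"
   unfolding comp.simps
   by (rule bstep_Seq_return[OF s1(1)], rule bstep_Cond)
     (use D in "auto simp: simulates_def split: if_splits")
  show "map_pmf absc D = sem f (Ite e c d) (absc s)"
   using D s1 by (auto simp: simulates_def tick_spend split: if_splits)
  show "frame (Ite e c d) s s'" if "s' : set_pmf D" for s'
   using D s1(4) that by (auto simp: simulates_def frame_def tick_spend same_ctl_def split: if_splits)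
 qed
next
 case (For up v e c)
 obtain s1 where s1: "bstep f (cexp e 0) s (return_pmf s1)"
  "absc s1 = spend (ecs e (absc s)) (absc s)"
  "reg s1 (tmp 0) = eva e (absc s)" "same_ctl s s1"
  by (rule cexp_abs[of f e 0 s]) blast
 define k where "k = eva e (absc s)"
 have k: "reg s1 (tmp 0) = k" using s1(3) by (simp add: k_def)
 have n: "4 * u + 2 ~= (5::nat)" "4 * u + 3 ~= (5::nat)" "4 * u + 2 ~= 4 * w + (3::nat)" "4 * u + 3 ~= 4 * w + (2::nat)"
  "4 * u + 2 ~= (1::nat)" "4 * u + 3 ~= (1::nat)" "4 * u + 3 ~= 4 * w" "4 * u + 2 ~= 4 * w" for u w :: nat
  by presburger+
 define s2 where "s2 = spend (2 + fl k) (set_reg (cnt v) k (set_reg (tmp 1) 0 s1))"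
 have 2: "bstep f (move (cnt v) (tmp 0)) s1 (return_pmf s2)"
  using bstep_move[of "tmp 0" f "cnt v" s1] k by (simp add: set_reg_def s2_def)
 define s3 where "s3 = (if up then spend (2 + fl k) (set_reg (lim v) k (set_reg (tmp 1) 0 s2))
   else spend 2 (set_reg (lim v) 1 s2))"
 have s2t: "reg s2 (tmp 0) = k" using k n(5)[of v] by (auto simp: s2_def)
 have 3: "bstep f (if up then move (lim v) (tmp 0) else Instr (Literal (lim v) 1)) s2 (return_pmf s3)"
  using bstep_move[of "tmp 0" f "lim v" s2] s2t bstep_Instr[of f "Literal (lim v) 1" s2]
  by (auto simp: set_reg_def s3_def tick_spend spend_def)
 have r3: "reg s3 (cnt v) = k" "reg s3 (lim v) = (if up then k else 1)"
  using n by (auto simp: s3_def s2_def)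
 have m: "(4 * u + 2) mod 4 ~= (0::nat)" "(4 * u + 3) mod 4 ~= (0::nat)" for u by presburger+
 have ab2: "absc s2 = spend (ecs e (absc s) + (2 + fl k)) (absc s)"
  unfolding s2_def absc_spend using m by (simp add: abs_set_other s1)
 have ab3: "absc s3 = spend (ecs e (absc s) + 4 + fl k + (if up then fl k else 0)) (absc s)"
  using m by (auto simp: s3_def abs_set_other ab2)
 have body: "!!s. EX D. simulates f c s D" and vn: "v ~: loop_vars c" using For by auto
 define W where "W = While (cnt v)
    (Seq (Instr (if up then Arith Minus (var v) (lim v) (cnt v)
          else Arith Minus (var v) (cnt v) (lim v)))
    (Seq (comp c)
    (Seq (Instr (Literal (tmp 0) 1)) (Instr (Arith Minus (cnt v) (cnt v) (tmp 0))))))"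
 define g where "g = (%t s'. map_pmf (spend (fl (remaining up k t) + 4))
     (sem f c (spend (iter_cost up k t) (set_reg v t s'))))"
 obtain D where D: "bstep f W s3 D"
  "map_pmf absc D = map_pmf (spend 1) (for_list g (if up then [k - k..<k] else rev [0..<k]) (absc s3))"
  "!!s'. s' : set_pmf D ==> frame (For up v (N 0) c) s3 s'"
  using while_correct[OF body vn, of k k s3 up] r3 unfolding W_def g_def by auto
 have rd: "(if up then [k - k..<k] else rev [0..<k]) = range_dir up k" by (simp add: range_dir_def)
 let ?fin = "%s'. return_pmf (spend 1 (set_reg (var v) 0 s'))"
 have 4: "bstep f (Instr (Literal (var v) 0)) s' (?fin s')" for s'
  using bstep_Instr[of f "Literal (var v) 0" s'] by (simp add: tick_spend)
 show ?case
 proof (rule simulatesI)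
  show "bstep f (comp (For up v e c)) s (bind_pmf D ?fin)"
   unfolding comp.simps W_def[symmetric]
   by (rule bstep_Seq_return[OF s1(1)], rule bstep_Seq_return[OF 2], rule bstep_Seq_return[OF 3],
     rule bstep_Seq[OF D(1) 4])
  have spend2: "spend (Suc (Suc 0)) s = spend 2 s" for s by (simp add: numeral_2_eq_2)
  have "map_pmf absc (bind_pmf D ?fin)
    = bind_pmf (map_pmf absc D) (%s'. return_pmf (spend 1 (set_reg v 0 s')))"
   by (simp add: map_bind_pmf bind_map_pmf abs_set_var)
  also have "... = sem f (For up v e c) (absc s)"
   unfolding D(2) rd by (simp add: spend2 bind_map_pmf ab3 k_def g_def set_reg_spend)
  finally show "map_pmf absc (bind_pmf D ?fin) = sem f (For up v e c) (absc s)" .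
  show "frame (For up v e c) s s'" if s': "s' : set_pmf (bind_pmf D ?fin)" for s'
  proof -
   have "EX s'':set_pmf D. s' = spend 1 (set_reg (var v) 0 s'')" using s' by simp
   then obtain s'' where s'': "s'' : set_pmf D" "s' = spend 1 (set_reg (var v) 0 s'')" by blast
   have fr: "frame (For up v (N 0) c) s3 s''" using D(3) s''(1) .
   show ?thesis unfolding frame_def
   proof (intro allI impI)
    fix u assume u: "u ~: loop_vars (For up v e c)"
    hence a: "reg s'' (cnt u) = reg s3 (cnt u) & reg s'' (lim u) = reg s3 (lim u)"
     using fr by (auto simp: frame_def)
    have b: "reg s1 (cnt u) = reg s (cnt u) & reg s1 (lim u) = reg s (lim u)"
     using s1(4) by (auto simp: same_ctl_def)
    have "u ~= v" using u by simp
    thus "reg s' (cnt u) = reg s (cnt u) & reg s' (lim u) = reg s (lim u)"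
     using a b n s''(2) by (auto simp: s3_def s2_def)
   qed
  qed
 qed
qed

section \<open>Reversible circuits\<close>

text \<open>The permutation of basis states behind the gate. It is an involution, so the gate acts
  on a state by composition with it.\<close>

definition tof_map :: "nat => nat => nat => nat set => nat set" where
 "tof_map a b c B = (if c ~= a & c ~= b & a : B & b : B then sym_diff B {c} else B)"

definition address :: "nat => nat => nat set => nat" where
 "address a k B = (\<Sum>i | i < k & a + i : B. 2 ^ i)"

definition read_map :: "(nat => nat) => nat => nat => nat => nat => nat set => nat set" where
 "read_map h b a k t B = (if t ~: {a..<a + k} & h (b + address a k B) ~= 0 then sym_diff B {t} else B)"

definition query_map :: "oracle_fun => nat => nat => nat => nat set => nat set" where
 "query_map f l x y B = (if {x..<x + l} Int {y..<y + l} ~= {} then B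
   else sym_diff B ((+) y ` (f l {k. k < l & x + k : B} Int {..<l})))"

lemma tof_map_gate: "controlled_not {a, b} c \<psi> = \<psi> \<circ> tof_map a b c"
 by (auto simp: controlled_not_def xor_gate_def tof_map_def fun_eq_iff)

lemma read_map_gate: "quantum_read h b a k t \<psi> = \<psi> \<circ> read_map h b a k t"
 by (auto simp: quantum_read_def xor_gate_def read_map_def fun_eq_iff address_def)

lemma query_map_gate: "oracle_gate f l x y \<psi> = \<psi> \<circ> query_map f l x y"
 by (auto simp: oracle_gate_def xor_gate_def query_map_def fun_eq_iff)

lemma sym_diff_cancel: "sym_diff (sym_diff B C) C = B" by auto

lemma tof_map_involution: "tof_map a b c (tof_map a b c B) = B"
 by (auto simp: tof_map_def)

lemma address_cong: "(!!i. i < k ==> a + i : B \<longleftrightarrow> a + i : B') ==> address a k B = address a k B'"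
 unfolding address_def by (rule sum.cong) auto

lemma read_map_involution: "read_map h b a k t (read_map h b a k t B) = B"
proof (cases "t : {a..<a + k}")
 case False
 hence "address a k (sym_diff B {t}) = address a k B" by (intro address_cong) auto
 thus ?thesis using False unfolding read_map_def by (simp add: sym_diff_cancel del: Diff_insert)
qed (simp add: read_map_def)

lemma query_map_involution: "query_map f l x y (query_map f l x y B) = B"
proof (cases "{x..<x + l} Int {y..<y + l} = {}")
 case True
 let ?Y = "(+) y ` (f l {k. k < l & x + k : B} Int {..<l})"
 have "x + k ~: ?Y" if "k < l" for k
 proof
  assume "x + k : ?Y"
  hence "x + k : {y..<y + l}" by auto
  moreover have "x + k : {x..<x + l}" using that by auto
  ultimately show False using True by blast
 qed
 hence "{k. k < l & x + k : sym_diff B ?Y} = {k. k < l & x + k : B}" by auto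
 thus ?thesis unfolding query_map_def using True sym_diff_cancel by simp
qed (simp add: query_map_def)

text \<open>A circuit is unrolled into a list of permutations that depends only on registers and
  memory, never on the qubits; therefore one list serves all branches of a superposition.\<close>

fun gates :: "oracle_fun => cmd => (nat => nat) => (nat => nat) => (nat set => nat set) list" where
 "gates f (Tof a b c) g h = [tof_map (ev a g h) (ev b g h) (ev c g h)]"
| "gates f (QL b a k t) g h = [read_map h (ev b g h) (ev a g h) (ev k g h) (ev t g h)]"
| "gates f (Qu l x y) g h = [query_map f (ev l g h) (ev x g h) (ev y g h)]"
| "gates f (Sq c d) g h = gates f c g h @ gates f d g h"
| "gates f (Ite e c d) g h = (if ev e g h ~= 0 then gates f c g h else gates f d g h)"
| "gates f (For up v e c) g h = concat (map (%t. gates f c (g(v := t)) h) (range_dir up (ev e g h)))"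
| "gates f _ g h = []"

fun reversible :: "cmd => bool" where
 "reversible Skip \<longleftrightarrow> True"
| "reversible (Tof a b c) \<longleftrightarrow> True"
| "reversible (QL b a k t) \<longleftrightarrow> True"
| "reversible (Qu l x y) \<longleftrightarrow> True"
| "reversible (Sq c d) \<longleftrightarrow> reversible c & reversible d"
| "reversible (Ite e c d) \<longleftrightarrow> reversible c & reversible d"
| "reversible (For up v e c) \<longleftrightarrow> reversible c"
| "reversible _ \<longleftrightarrow> False"

text \<open>Every gate is its own inverse, so inversion merely reverses the order, which for a loop
  means its direction.\<close>

fun invc :: "cmd => cmd" where
 "invc (Sq c d) = Sq (invc d) (invc c)"
| "invc (Ite e c d) = Ite e (invc c) (invc d)"
| "invc (For up v e c) = For (\<not> up) v e (invc c)"
| "invc c = c"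

definition runs :: "(nat set => nat set) list => nat set => nat set" where
 "runs gs B = fold (%g B. g B) gs B"

definition act :: "(nat set => nat set) list => qstate => qstate" where
 "act gs \<psi> = fold (%g \<psi>. \<psi> \<circ> g) gs \<psi>"

lemma runs_simps [simp]:
 "runs [] B = B" "runs (g # gs) B = runs gs (g B)"
 "runs (gs @ gs') B = runs gs' (runs gs B)"
 by (simp_all add: runs_def)

lemma act_simps [simp]:
 "act [] \<psi> = \<psi>" "act (g # gs) \<psi> = act gs (\<psi> \<circ> g)"
 "act (gs @ gs') \<psi> = act gs' (act gs \<psi>)"
 by (simp_all add: act_def)

text \<open>The new amplitude at \<open>B\<close> is the old one at the preimage of
  \<open>B\<close>; for involutive gates the preimage is found by running them in reverse
  order.\<close>

lemma act_eq: "act gs \<psi> = \<psi> \<circ> runs (rev gs)"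
 by (induction gs arbitrary: \<psi>) (auto simp: fun_eq_iff)

lemma gates_involution: "g : set (gates f c e h) ==> g (g B) = B"
 by (induction c arbitrary: e)
   (auto simp: tof_map_involution read_map_involution query_map_involution split: if_splits)

lemma runs_rev:
 assumes "!!g B. g : set gs ==> g (g B) = B"
 shows "runs (rev gs) (runs gs B) = B"
 using assms by (induction gs arbitrary: B) auto

lemma runs_inverse: "runs (rev (gates f c g h)) (runs (gates f c g h) B) = B"
 by (rule runs_rev) (rule gates_involution)

lemma runs_inverse': "runs (gates f c g h) (runs (rev (gates f c g h)) B) = B"
proof -
 have "runs (rev (rev (gates f c g h))) (runs (rev (gates f c g h)) B) = B"
  by (rule runs_rev) (simp add: gates_involution)
 thus ?thesis by simp
qed

lemma rev_range_dir: "range_dir (\<not> up) k = rev (range_dir up k)"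
 by (simp add: range_dir_def)

lemma gates_inverse: "gates f (invc c) g h = rev (gates f c g h)"
 by (induction c arbitrary: g) (simp_all add: rev_range_dir rev_concat rev_map comp_def)

lemma invc_props [simp]:
 "reversible (invc c) = reversible c" "loop_vars (invc c) = loop_vars c"
 "wf_cmd (invc c) = wf_cmd c"
proof -
 show 1: "reversible (invc c) = reversible c" by (induction c) auto
 show 2: "loop_vars (invc c) = loop_vars c" for c by (induction c) auto
 show "wf_cmd (invc c) = wf_cmd c" by (induction c) (auto simp: 2)
qed

section \<open>Costs of expressions and circuits\<close>

fun bits_of :: "aexp => nat" where
 "bits_of (V v) = 1"
| "bits_of (N k) = fl k"
| "bits_of (Op p a b) = bits_of a + bits_of b + 1"
| "bits_of (Ld a) = 1"

fun exp_size :: "aexp => nat" where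
 "exp_size (V v) = 3"
| "exp_size (N k) = 1 + fl k"
| "exp_size (Op p a b) = exp_size a + exp_size b + 1 + bits_of a + bits_of b"
| "exp_size (Ld a) = exp_size a + 2 + bits_of a"

lemma fl_le_iff: "fl m <= k \<longleftrightarrow> m < 2 ^ k"
 using floorlog_leD[of 2 m k] floorlog_leI[of m 2 k] by auto

lemma fl_le_self: "fl m <= m"
 unfolding fl_le_iff by (rule less_exp)

lemma fl_mono: "m <= k ==> fl m <= fl k"
 using floorlog_mono by blast

definition bdd :: "nat => (nat => nat) => (nat => nat) => bool" where
 "bdd w g h \<longleftrightarrow> (ALL v. g v < 2 ^ w) & (ALL a. h a < 2 ^ w)"

lemma fl_ev:
 assumes "bdd w g h" "w + 2 <= X"
 shows "fl (ev e g h) <= bits_of e * X"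
proof (induction e)
 case (V v)
 have "fl (g v) <= w" unfolding fl_le_iff using assms by (simp add: bdd_def)
 thus ?case using assms by simp
next
 case (N k)
 thus ?case using assms by simp
next
 case (Op p a b)
 let ?x = "ev a g h" and ?y = "ev b g h"
 have "?x < 2 ^ (bits_of a * X)" "?y < 2 ^ (bits_of b * X)" using Op fl_le_iff by blast+
 hence x: "?x + 1 <= 2 ^ (bits_of a * X)" and y: "?y + 1 <= 2 ^ (bits_of b * X)" by simp_all
 \<comment> \<open>A single estimate covers all four operations, so the number of digits is at most
   additive.\<close>
 have "eval_arith p ?x ?y + 1 <= (?x + 1) * (?y + 1)"
 proof (cases p)
  case Divide
  thus ?thesis using div_le_dividend[of ?x ?y] by (simp add: add_increasing2)
 qed simp_all
 also have "... <= 2 ^ (bits_of a * X) * 2 ^ (bits_of b * X)" by (rule mult_le_mono[OF x y])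
 also have "... <= 2 ^ ((bits_of a + bits_of b + 1) * X)"
  by (simp add: power_add[symmetric] algebra_simps)
 finally show ?case unfolding fl_le_iff by simp
next
 case (Ld a)
 have "fl (h (ev a g h)) <= w" unfolding fl_le_iff using assms by (simp add: bdd_def)
 thus ?case using assms by simp
qed

lemma ecost_le:
 assumes "bdd w g h" "w + 2 <= X"
 shows "ecost e g h <= exp_size e * X"
proof (induction e)
 case (V v)
 have "fl (g v) <= w" unfolding fl_le_iff using assms by (simp add: bdd_def)
 thus ?case using assms by simp
next
 case (N k)
 have "(1 + fl k) * 1 <= (1 + fl k) * X" using assms by (intro mult_le_mono2) simp
 thus ?case by simp
next
 case (Op p a b)
 thus ?case using fl_ev[OF assms, of a] fl_ev[OF assms, of b] assms by (simp add: algebra_simps)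
next
 case (Ld a)
 have "fl (h (ev a g h)) <= w" unfolding fl_le_iff using assms by (simp add: bdd_def)
 thus ?case using Ld fl_ev[OF assms, of a] assms by (simp add: algebra_simps)
qed

definition full_size :: "aexp => nat" where "full_size e = exp_size e + bits_of e"

text \<open>Together with \<open>cdepth\<close> this gives the cost bound
  \<open>csize c * X ^ cdepth c\<close>: polynomial in a quantity \<open>X\<close> that bounds word
  lengths, lengths of reads and queries, and numbers of iterations. Its degree grows with the
  nesting of loops, and both numbers depend on the syntax only.\<close>

fun csize :: "cmd => nat" where
 "csize Skip = 0"
| "csize (Asg v e) = full_size e + 2"
| "csize (Sto a e) = full_size a + full_size e + 4"
| "csize (HadC e) = full_size e + 2"
| "csize (TC e) = full_size e + 2"
| "csize (Meas v e) = full_size e + 2"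
| "csize (Tof a b c) = full_size a + full_size b + full_size c + 1"
| "csize (QL a b c d) = full_size a + full_size b + full_size c + full_size d + 2"
| "csize (Qu a b c) = full_size a + full_size b + full_size c + 2"
| "csize (Sq c d) = csize c + csize d"
| "csize (Ite e c d) = full_size e + 2 + csize c + csize d"
| "csize (For up v e c) = full_size e + csize c + 20"

fun cdepth :: "cmd => nat" where
 "cdepth (Sq c d) = max (cdepth c) (cdepth d)"
| "cdepth (Ite e c d) = max (cdepth c) (cdepth d)"
| "cdepth (For up v e c) = Suc (cdepth c)"
| "cdepth _ = 1"

fun bound_exps :: "cmd => aexp set" where
 "bound_exps (QL a b k t) = {k}"
| "bound_exps (Qu l x y) = {l}"
| "bound_exps (Sq c d) = bound_exps c Un bound_exps d"
| "bound_exps (Ite e c d) = bound_exps c Un bound_exps d"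
| "bound_exps (For up v e c) = insert e (bound_exps c)"
| "bound_exps _ = {}"

lemma invc_size [simp]:
 "csize (invc c) = csize c" "cdepth (invc c) = cdepth c"
 "bound_exps (invc c) = bound_exps c"
 by (induction c) auto

text \<open>Loop bounds and lengths are variables that the command does not change, so that they are
 bounded throughout the execution if they are bounded at its start.\<close>

definition bounds_ok :: "nat => cmd => (nat => nat) => bool" where
 "bounds_ok L c g \<longleftrightarrow> (ALL e:bound_exps c. EX u. e = V u & u ~: loop_vars c & g u <= L)"

lemma bounds_ok_mono:
 assumes "bounds_ok L c g" "bound_exps c' \<subseteq> bound_exps c" "loop_vars c' <= loop_vars c"
  "!!u. u ~: loop_vars c ==> g' u = g u"
 shows "bounds_ok L c' g'"
 unfolding bounds_ok_def
proof
 fix e assume "e : bound_exps c'"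
 hence "e : bound_exps c" using assms(2) by blast
 then obtain u where "e = V u" "u ~: loop_vars c" "g u <= L" using assms(1) unfolding bounds_ok_def by blast
 thus "EX u. e = V u & u ~: loop_vars c' & g' u <= L" using assms(3,4) by auto
qed

lemma fl_eva: "bdd w (reg s) (heap s) ==> w + 2 <= X ==> fl (eva e s) <= bits_of e * X"
 unfolding eva_def by (rule fl_ev)

lemma ecs_le: "bdd w (reg s) (heap s) ==> w + 2 <= X ==> ecs e s <= exp_size e * X"
 unfolding ecs_def by (rule ecost_le)

lemma bdd_upd: "bdd w g h ==> k < 2 ^ w ==> bdd w (g(v := k)) h"
 by (simp add: bdd_def)

text \<open>A circuit has a certain outcome and changes nothing but qubits and clock. Its loop
  variables must be 0 beforehand because a loop leaves 0 behind.\<close>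

lemma sem_reversible:
 assumes "reversible c" "wf_cmd c" "!!v. v : loop_vars c ==> reg s v = 0"
  "bdd w (reg s) (heap s)" "bounds_ok L c (reg s)" "w + L + 2 <= X"
 shows "EX t <= csize c * X ^ cdepth c.
  sem f c s = return_pmf (spend t (s\<lparr>qst := act (gates f c (reg s) (heap s)) (qst s)\<rparr>))"
 using assms
proof (induction c arbitrary: s)
 case Skip
 have "spend 0 (s\<lparr>qst := qst s\<rparr>) = s" by (simp add: spend_def)
 thus ?case by (intro exI[of _ 0]) simp
next
 case (Tof a b c)
 have X: "w + 2 <= X" using Tof by simp
 note e = ecs_le[OF Tof.prems(4) X] and fe = fl_eva[OF Tof.prems(4) X]
 show ?case
  apply (intro exI[of _ "ecs a s + ecs b s + ecs c s + 1 + fl (eva a s) + fl (eva b s) + fl (eva c s)"] conjI)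
  subgoal using e[of a] e[of b] e[of c] fe[of a] fe[of b] fe[of c] X by (simp add: full_size_def algebra_simps)
  apply (simp add: apply_gate_def tof_map_gate eva_def comp_def)
  done
next
 case (QL a b c d)
 have X: "w + 2 <= X" using QL by simp
 note e = ecs_le[OF QL.prems(4) X] and fe = fl_eva[OF QL.prems(4) X]
 have l: "eva c s <= X" using QL.prems(5,6) by (auto simp: bounds_ok_def eva_def)
 show ?case
  apply (intro exI[of _ "ecs a s + ecs b s + ecs c s + ecs d s + 1
     + fl (eva a s) + fl (eva b s) + fl (eva c s) + fl (eva d s) + eva c s"] conjI)
  subgoal using e[of a] e[of b] e[of c] e[of d] fe[of a] fe[of b] fe[of c] fe[of d] X l
   by (simp add: full_size_def algebra_simps)
  apply (simp add: apply_gate_def read_map_gate eva_def comp_def)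
  done
next
 case (Qu a b c)
 have X: "w + 2 <= X" using Qu by simp
 note e = ecs_le[OF Qu.prems(4) X] and fe = fl_eva[OF Qu.prems(4) X]
 have l: "eva a s <= X" using Qu.prems(5,6) by (auto simp: bounds_ok_def eva_def)
 show ?case
  apply (intro exI[of _ "ecs a s + ecs b s + ecs c s + 1 + fl (eva a s) + fl (eva b s) + fl (eva c s) + eva a s"] conjI)
  subgoal using e[of a] e[of b] e[of c] fe[of a] fe[of b] fe[of c] X l by (simp add: full_size_def algebra_simps)
  apply (simp add: apply_gate_def query_map_gate eva_def comp_def)
  done
next
 case (Sq c d)
 have X1: "X >= 1" using Sq.prems by simp
 have bo: "bounds_ok L c (reg s)" "bounds_ok L d (reg s)" by (rule bounds_ok_mono[OF Sq.prems(5)]; simp)+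
 obtain t where t: "t <= csize c * X ^ cdepth c"
  "sem f c s = return_pmf (spend t (s\<lparr>qst := act (gates f c (reg s) (heap s)) (qst s)\<rparr>))"
  using Sq.IH(1)[of s] Sq.prems bo by auto
 let ?s = "spend t (s\<lparr>qst := act (gates f c (reg s) (heap s)) (qst s)\<rparr>)"
 obtain t' where t': "t' <= csize d * X ^ cdepth d"
  "sem f d ?s = return_pmf (spend t' (?s\<lparr>qst := act (gates f d (reg s) (heap s)) (qst ?s)\<rparr>))"
  using Sq.IH(2)[of ?s] Sq.prems bo by auto
 have "t + t' <= csize (Sq c d) * X ^ cdepth (Sq c d)"
 proof -
  have "csize c * X ^ cdepth c <= csize c * X ^ cdepth (Sq c d)"
   "csize d * X ^ cdepth d <= csize d * X ^ cdepth (Sq c d)"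
   using X1 by (auto intro!: mult_le_mono2 power_increasing)
  thus ?thesis using t(1) t'(1) unfolding csize.simps add_mult_distrib by linarith
 qed
 moreover have "sem f (Sq c d) s
   = return_pmf (spend (t + t') (s\<lparr>qst := act (gates f (Sq c d) (reg s) (heap s)) (qst s)\<rparr>))"
 proof -
  have "sem f (Sq c d) s = sem f d ?s" using t(2) by (simp add: bind_return_pmf)
  also note t'(2)
  finally show ?thesis by (simp add: spend_def)
 qed
 ultimately show ?case by blast
next
 case (Ite e c d)
 have X: "w + 2 <= X" and X1: "X >= 1" using Ite by simp_all
 have bo: "bounds_ok L c (reg s)" "bounds_ok L d (reg s)" by (rule bounds_ok_mono[OF Ite.prems(5)]; simp)+
 let ?s = "spend (ecs e s + 1 + fl (eva e s)) s"
 let ?c = "if eva e s ~= 0 then c else d"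
 obtain t where t: "t <= csize ?c * X ^ cdepth ?c"
  "sem f ?c ?s = return_pmf (spend t (?s\<lparr>qst := act (gates f ?c (reg s) (heap s)) (qst s)\<rparr>))"
  using Ite.IH(1)[of ?s] Ite.IH(2)[of ?s] Ite.prems bo by (cases "eva e s ~= 0") auto
 have "csize ?c * X ^ cdepth ?c <= (csize c + csize d) * X ^ cdepth (Ite e c d)"
  using X1 by (auto intro!: mult_le_mono power_increasing)
 moreover have "ecs e s + 1 + fl (eva e s) <= (full_size e + 1) * X"
  using ecs_le[OF Ite.prems(4) X, of e] fl_eva[OF Ite.prems(4) X, of e] X by (simp add: full_size_def algebra_simps)
 moreover have "(full_size e + 1) * X <= (full_size e + 1) * X ^ cdepth (Ite e c d)"
 proof -
  have "cdepth c >= 1" for c by (induction c) auto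
  hence "X ^ 1 <= X ^ cdepth (Ite e c d)" using X1 by (intro power_increasing) (auto simp: le_max_iff_disj)
  thus ?thesis by (intro mult_le_mono2) simp
 qed
 ultimately have "ecs e s + 1 + fl (eva e s) + t <= csize (Ite e c d) * X ^ cdepth (Ite e c d)"
  using t(1) by (simp add: algebra_simps)
 thus ?case using t(2)
  by (intro exI[of _ "ecs e s + 1 + fl (eva e s) + t"]) (auto simp: eva_def spend_def algebra_simps)
next
 case (For up v e c)
 have X: "w + 2 <= X" and X1: "X >= 1" using For by simp_all
 define k where "k = eva e s"
 obtain u where u: "e = V u" "u ~= v" "u ~: loop_vars c" "reg s u <= L" using For.prems(5) by (auto simp: bounds_ok_def)
 hence k: "k = reg s u" by (simp add: k_def eva_def)
 have kw: "k < 2 ^ w" using For.prems(4) by (simp add: k bdd_def)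
 have kX: "k <= X" using u k For.prems(6) by simp
 have v0: "reg s v = 0" using For.prems by simp
 define tc where "tc = csize c * X ^ cdepth c"
 define G where "G = (%t s'. map_pmf (spend (fl (remaining up k t) + 4))
     (sem f c (spend (iter_cost up k t) (set_reg v t s'))))"
 have body: "EX t'<=tc + 11 * X. G t s' = return_pmf (spend t' (s'\<lparr>reg := (reg s)(v := t),
    qst := act (gates f c ((reg s)(v := t)) (heap s)) (qst s')\<rparr>))"
  if s': "EX z. reg s' = (reg s)(v := z)" "heap s' = heap s" and t: "t < k" for s' t
 proof -
  let ?s = "spend (iter_cost up k t) (set_reg v t s')"
  have r: "reg ?s = (reg s)(v := t)" "heap ?s = heap s" using s' by auto
  have bo: "bounds_ok L c (reg ?s)" unfolding r by (rule bounds_ok_mono[OF For.prems(5)]) auto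
  have lv: "reg ?s u = 0" if "u : loop_vars c" for u
   using For.prems(2) For.prems(3)[of u] that unfolding r by auto
  have bd: "bdd w (reg ?s) (heap ?s)"
   unfolding r using For.prems(4) t kw by (intro bdd_upd) auto
  have "EX t'<=tc. sem f c ?s = return_pmf (spend t' (?s\<lparr>qst := act (gates f c (reg ?s) (heap ?s)) (qst ?s)\<rparr>))"
   unfolding tc_def using For.prems(1,2,6) by (intro For.IH lv bd bo) auto
  then obtain t' where t': "t' <= tc" "sem f c ?s = return_pmf (spend t' (?s\<lparr>qst := act (gates f c (reg ?s) (heap ?s)) (qst ?s)\<rparr>))"
   by blast
  have rem: "remaining up k t <= k" using t by (auto simp: remaining_def)
  have "fl (remaining up k t) <= X" "fl k <= X" "fl (if up then k else 1) <= X"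
   using fl_le_self[of k] fl_mono[OF rem] kX X by auto
  hence "iter_cost up k t + t' + (fl (remaining up k t) + 4) <= tc + 11 * X"
   using t'(1) X unfolding iter_cost_def by linarith
  thus ?thesis using t'(2) r unfolding G_def
   by (intro exI[of _ "iter_cost up k t + t' + (fl (remaining up k t) + 4)"])
     (auto simp: spend_def set_reg_def algebra_simps)
 qed
 have loop: "EX t'<=length ts * (tc + 11 * X). EX z. for_list G ts s' = return_pmf (spend t' (s'\<lparr>reg := (reg s)(v := z),
    qst := act (concat (map (%t. gates f c ((reg s)(v := t)) (heap s)) ts)) (qst s')\<rparr>))"
  if "EX z. reg s' = (reg s)(v := z)" "heap s' = heap s" "set ts <= {..<k}" for s' ts
  using that
 proof (induction ts arbitrary: s')
  case Nil
  then obtain z where "reg s' = (reg s)(v := z)" by blast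
  hence "spend 0 (s'\<lparr>reg := (reg s)(v := z), qst := qst s'\<rparr>) = s'" by (simp add: spend_def)
  thus ?case
   apply -
   apply (rule exI[of _ 0], rule conjI)
   apply simp
   subgoal by (rule exI[of _ z]) (simp del: fun_upd_apply)
   done
 next
  case (Cons t ts)
  obtain t1 where t1: "t1 <= tc + 11 * X" "G t s' = return_pmf (spend t1 (s'\<lparr>reg := (reg s)(v := t),
    qst := act (gates f c ((reg s)(v := t)) (heap s)) (qst s')\<rparr>))"
   using body[OF Cons.prems(1,2), of t] Cons.prems(3) by (simp del: fun_upd_apply) blast
  let ?s = "spend t1 (s'\<lparr>reg := (reg s)(v := t),
    qst := act (gates f c ((reg s)(v := t)) (heap s)) (qst s')\<rparr>)"
  have e1: "EX z. reg ?s = (reg s)(v := z)" by (rule exI[of _ t]) simp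
  have e2: "heap ?s = heap s" "set ts <= {..<k}" using Cons.prems by auto
  obtain t2 z where t2: "t2 <= length ts * (tc + 11 * X)" "for_list G ts ?s = return_pmf (spend t2 (?s\<lparr>reg := (reg s)(v := z),
    qst := act (concat (map (%t. gates f c ((reg s)(v := t)) (heap s)) ts)) (qst ?s)\<rparr>))"
   using Cons.IH[OF e1 e2] by blast
  thus ?case using t1
   apply -
   apply (rule exI[of _ "t1 + t2"], rule conjI)
   apply simp
   subgoal by (rule exI[of _ z]) (simp add: bind_return_pmf spend_def del: fun_upd_apply)
   done
 qed
 let ?s0 = "spend (ecs e s + 4 + fl k + (if up then fl k else 0)) s"
 have e0: "EX z. reg ?s0 = (reg s)(v := z)" "heap ?s0 = heap s"
  using v0 by (auto intro!: exI[of _ 0] simp del: fun_upd_apply simp: fun_upd_idem)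
 have "set (range_dir up k) <= {..<k}" by (auto simp: range_dir_def)
 then obtain t' z where t': "t' <= length (range_dir up k) * (tc + 11 * X)"
  "for_list G (range_dir up k) ?s0 = return_pmf (spend t' (?s0\<lparr>reg := (reg s)(v := z),
    qst := act (concat (map (%t. gates f c ((reg s)(v := t)) (heap s)) (range_dir up k))) (qst s)\<rparr>))"
  using loop[OF e0(1) e0(2)] by (simp del: fun_upd_apply) blast
 define T where "T = ecs e s + 4 + fl k + (if up then fl k else 0) + t' + 2"
 have "sem f (For up v e c) s = return_pmf (spend T (s\<lparr>qst := act (gates f (For up v e c) (reg s) (heap s)) (qst s)\<rparr>))"
 proof -
  have "sem f (For up v e c) s
    = bind_pmf (for_list G (range_dir up k) ?s0) (%s'. return_pmf (spend 2 (set_reg v 0 s')))"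
   by (simp only: sem.simps G_def k_def)
  also note t'(2)
  also note bind_return_pmf
  finally have e1: "sem f (For up v e c) s = return_pmf (spend 2 (set_reg v 0 (spend t' (?s0\<lparr>reg := (reg s)(v := z),
    qst := act (concat (map (%t. gates f c ((reg s)(v := t)) (heap s)) (range_dir up k))) (qst s)\<rparr>))))" .
  have ek: "ev e (reg s) (heap s) = k" by (simp add: k_def eva_def)
  show ?thesis unfolding e1
   apply (rule arg_cong[of _ _ return_pmf])
   apply (rule config.equality)
   using v0 by (simp_all add: T_def ek fun_upd_idem)
 qed
 moreover have "T <= csize (For up v e c) * X ^ cdepth (For up v e c)"
 proof -
  have len: "length (range_dir up k) = k" by (simp add: range_dir_def)
  have 1: "t' <= X * (tc + 11 * X)"
   using t'(1) unfolding len by (rule order_trans) (rule mult_le_mono1[OF kX])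
  have 2: "ecs e s <= exp_size e * X" using ecs_le[OF For.prems(4) X] .
  have "fl k <= X" using fl_le_self[of k] kX by simp
  hence 3: "T <= exp_size e * X + 8 * X + X * (tc + 11 * X)"
   using 1 2 X unfolding T_def by auto
  have "cdepth c >= 1" by (induction c) auto
  hence p: "X ^ 2 <= X ^ Suc (cdepth c)" using X1 by (intro power_increasing) auto
  have "X * 1 <= X * X" using X1 by (intro mult_le_mono2)
  hence p1: "X <= X ^ Suc (cdepth c)" using p by (simp add: power2_eq_square)
  have "exp_size e * X <= exp_size e * X ^ Suc (cdepth c)" "8 * X <= 8 * X ^ Suc (cdepth c)"
   by (rule mult_le_mono2[OF p1])+
  moreover have "X * (tc + 11 * X) <= (csize c + 11) * X ^ Suc (cdepth c)"
  proof -
   have "X * (tc + 11 * X) = csize c * X ^ Suc (cdepth c) + 11 * X ^ 2"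
    by (simp add: tc_def power2_eq_square algebra_simps)
   also have "... <= csize c * X ^ Suc (cdepth c) + 11 * X ^ Suc (cdepth c)" using p by linarith
   finally show ?thesis by (simp only: add_mult_distrib)
  qed
  ultimately have "T <= exp_size e * X ^ Suc (cdepth c) + 8 * X ^ Suc (cdepth c)
    + (csize c + 11) * X ^ Suc (cdepth c)" using 3 by linarith
  also have "... = (exp_size e + 8 + (csize c + 11)) * X ^ Suc (cdepth c)"
   by (simp only: add_mult_distrib)
  also have "... <= csize (For up v e c) * X ^ cdepth (For up v e c)"
   unfolding cdepth.simps csize.simps by (rule mult_le_mono1) (simp add: full_size_def)
  finally show ?thesis .
 qed
 ultimately show ?case by blast
qed auto

section \<open>Hoare triples with time bounds\<close>

type_synonym assertion = "(nat => nat) => (nat => nat) => qstate => bool"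

text \<open>The word bound \<open>bdd w\<close> is part of every triple because the cost of an
  instruction depends on the lengths of the values involved.\<close>

definition triple ::
  "oracle_fun => nat => assertion => cmd => assertion => nat => bool" where
 "triple f w P c Q t \<longleftrightarrow> (ALL s. P (reg s) (heap s) (qst s) & bdd w (reg s) (heap s) -->
   (ALL s':set_pmf (sem f c s). Q (reg s') (heap s') (qst s') & bdd w (reg s') (heap s')
    & clock s' <= clock s + t))"

lemma triple_conseq:
 assumes "triple f w P' c Q' t'" "!!g h q. P g h q ==> P' g h q" "!!g h q. Q' g h q ==> Q g h q" "t' <= t"
 shows "triple f w P c Q t"
 using assms unfolding triple_def by (meson add_left_mono le_trans)

lemma triple_pre: "(!!g h q. P g h q ==> triple f w (%g' h' q'. g' = g & h' = h & q' = q) c Q t) ==> triple f w P c Q t"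
 unfolding triple_def by blast

lemma triple_Skip: "triple f w P Skip P 0"
 by (simp add: triple_def)

lemma triple_Sq:
 assumes "triple f w P c Q t" "triple f w Q d R t'"
 shows "triple f w P (Sq c d) R (t + t')"
 unfolding triple_def
proof (intro allI impI ballI)
 fix s s'' assume s: "P (reg s) (heap s) (qst s) & bdd w (reg s) (heap s)" and "s'' : set_pmf (sem f (Sq c d) s)"
 then obtain s' where s': "s' : set_pmf (sem f c s)" "s'' : set_pmf (sem f d s')" by auto
 have 1: "Q (reg s') (heap s') (qst s') & bdd w (reg s') (heap s') & clock s' <= clock s + t"
  using assms(1) s s'(1) unfolding triple_def by blast
 hence "R (reg s'') (heap s'') (qst s'') & bdd w (reg s'') (heap s'') & clock s'' <= clock s' + t'"
  using assms(2) s'(2) unfolding triple_def by blast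
 thus "R (reg s'') (heap s'') (qst s'') & bdd w (reg s'') (heap s'') & clock s'' <= clock s + (t + t')"
  using 1 by linarith
qed

definition unit_cost :: "nat => aexp => nat" where "unit_cost w e = (full_size e + 2) * (w + 2)"

lemma unit_cost:
 assumes "bdd w (reg s) (heap s)"
 shows "ecs e s + 2 + fl (eva e s) <= unit_cost w e"
 using ecs_le[OF assms, of "w + 2" e] fl_eva[OF assms, of "w + 2" e]
 by (simp add: unit_cost_def full_size_def algebra_simps)

lemma triple_Asg:
 assumes "!!g h q. P g h q ==> ev e g h < 2 ^ w & Q (g(v := ev e g h)) h q"
 shows "triple f w P (Asg v e) Q (unit_cost w e)"
 unfolding triple_def using assms unit_cost by (auto simp: eva_def bdd_upd)

lemma triple_Sto:
 assumes "!!g h q. P g h q ==> ev e g h < 2 ^ w & Q g (h(ev a g h := ev e g h)) q"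
 shows "triple f w P (Sto a e) Q (unit_cost w a + unit_cost w e)"
 unfolding triple_def
proof (intro allI impI ballI)
 fix s s' assume s: "P (reg s) (heap s) (qst s) & bdd w (reg s) (heap s)" and s': "s' : set_pmf (sem f (Sto a e) s)"
 hence "clock s' = clock s + (ecs a s + ecs e s + 1 + fl (eva a s) + fl (eva e s))" by simp
 moreover have "ecs a s + ecs e s + 1 + fl (eva a s) + fl (eva e s) <= unit_cost w a + unit_cost w e"
  using unit_cost[of w s a] unit_cost[of w s e] s by linarith
 ultimately show "Q (reg s') (heap s') (qst s') & bdd w (reg s') (heap s')
    & clock s' <= clock s + (unit_cost w a + unit_cost w e)"
  using s s' assms[of "reg s" "heap s" "qst s"] by (auto simp: eva_def bdd_def)
qed

lemma triple_HadC:
 assumes "!!g h q. P g h q ==> Q g h (hadamard (ev e g h) q)"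
 shows "triple f w P (HadC e) Q (unit_cost w e)"
 unfolding triple_def using assms unit_cost[of w _ e] by (fastforce simp: eva_def)

lemma triple_TC:
 assumes "!!g h q. P g h q ==> Q g h (t_gate (ev e g h) q)"
 shows "triple f w P (TC e) Q (unit_cost w e)"
 unfolding triple_def using assms unit_cost[of w _ e] by (fastforce simp: eva_def)

lemma triple_Meas:
 assumes "!!g h q b. P g h q ==> b : set_pmf (bernoulli_pmf (outcome_prob (ev e g h) True q)) ==>
   Q (g(v := of_bool b)) h (collapse (ev e g h) b q)" and "w >= 1"
 shows "triple f w P (Meas v e) Q (unit_cost w e)"
 unfolding triple_def
proof (intro allI impI ballI)
 fix s s' assume s: "P (reg s) (heap s) (qst s) & bdd w (reg s) (heap s)" and "s' : set_pmf (sem f (Meas v e) s)"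
 then obtain b where b: "b : set_pmf (bernoulli_pmf (outcome_prob (eva e s) True (qst s)))"
  "s' = spend (ecs e s + 1 + fl (eva e s)) (set_reg v (of_bool b) (apply_gate (collapse (eva e s) b) s))" by auto
 have "(of_bool b :: nat) < 2 ^ w" using one_less_power[of "2::nat" w] assms(2) by (cases b) simp_all
 moreover have "Q ((reg s)(v := of_bool b)) (heap s) (collapse (ev e (reg s) (heap s)) b (qst s))"
  using assms(1)[of "reg s" "heap s" "qst s" b] s b(1) by (simp add: eva_def)
 ultimately show "Q (reg s') (heap s') (qst s') & bdd w (reg s') (heap s') & clock s' <= clock s + unit_cost w e"
  using s b unit_cost[of w s e] by (auto simp: eva_def bdd_upd)
qed

lemma triple_Ite:
 assumes "triple f w (%g h q. P g h q & ev e g h ~= 0) c Q t" "triple f w (%g h q. P g h q & ev e g h = 0) d Q t"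
 shows "triple f w P (Ite e c d) Q (unit_cost w e + t)"
 unfolding triple_def
proof (intro allI impI ballI)
 fix s s' assume s: "P (reg s) (heap s) (qst s) & bdd w (reg s) (heap s)" and s': "s' : set_pmf (sem f (Ite e c d) s)"
 let ?s = "spend (ecs e s + 1 + fl (eva e s)) s"
 have "Q (reg s') (heap s') (qst s') & bdd w (reg s') (heap s') & clock s' <= clock ?s + t"
 proof (cases "eva e s = 0")
  case True
  hence "s' : set_pmf (sem f d ?s)" using s' by simp
  thus ?thesis using assms(2) s True unfolding triple_def
   by (elim allE[of _ ?s]) (auto simp: eva_def)
 next
  case False
  hence "s' : set_pmf (sem f c ?s)" using s' by simp
  thus ?thesis using assms(1) s False unfolding triple_def
   by (elim allE[of _ ?s]) (auto simp: eva_def)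
 qed
 thus "Q (reg s') (heap s') (qst s') & bdd w (reg s') (heap s') & clock s' <= clock s + (unit_cost w e + t)"
  using unit_cost[of w s e] s by auto
qed

definition loop_cost :: "nat => aexp => nat => nat => nat" where
 "loop_cost w e k t = (full_size e + 10) * (w + 2) + k * (t + 6 * (w + 2))"

text \<open>The loop variable is 0 before and after a loop, and the body may assume any value for it that
 the invariant does not mention.\<close>

lemma triple_For:
 assumes body: "!!t. t < k ==> triple f w (%g h q. EX g'. I t g' h q & g = g'(v := t)) c
   (%g h q. I (Suc t) (g(v := 0)) h q) tc"
  and pre: "!!g h q. P g h q ==> ev e g h = k & k < 2 ^ w & I 0 g h q & g v = 0"
  and post: "!!g h q. I k g h q ==> g v = 0 ==> Q g h q"
 shows "triple f w P (For True v e c) Q (loop_cost w e k tc)"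
 unfolding triple_def
proof (intro allI impI ballI)
 fix s s' assume s: "P (reg s) (heap s) (qst s) & bdd w (reg s) (heap s)" and s': "s' : set_pmf (sem f (For True v e c) s)"
 have k: "eva e s = k" "k < 2 ^ w" "I 0 (reg s) (heap s) (qst s)" "reg s v = 0"
  using pre s by (auto simp: eva_def)
 define G where "G = (%t s'. map_pmf (spend (fl (remaining True k t) + 4))
     (sem f c (spend (iter_cost True k t) (set_reg v t s'))))"
 have loop: "ALL s':set_pmf (for_list G [a..<k] s1). I k ((reg s')(v := 0)) (heap s') (qst s')
   & bdd w (reg s') (heap s') & clock s' <= clock s1 + (k - a) * (tc + 6 * (w + 2))"
  if "a <= k" "I a ((reg s1)(v := 0)) (heap s1) (qst s1)" "bdd w (reg s1) (heap s1)" for a s1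
  using that
 proof (induction "k - a" arbitrary: a s1)
  case 0
  thus ?case by simp
 next
  case (Suc d)
  hence a: "a < k" "d = k - Suc a" by auto
  have l: "[a..<k] = a # [Suc a..<k]" using a by (simp add: upt_conv_Cons)
  show ?case
  proof
   fix s' assume "s' : set_pmf (for_list G [a..<k] s1)"
   then obtain s2 where s2: "s2 : set_pmf (G a s1)" "s' : set_pmf (for_list G [Suc a..<k] s2)" unfolding l by auto
   let ?s = "spend (iter_cost True k a) (set_reg v a s1)"
   obtain s3 where s3: "s3 : set_pmf (sem f c ?s)" "s2 = spend (fl (remaining True k a) + 4) s3"
    using s2(1) unfolding G_def by auto
   have "EX g'. I a g' (heap ?s) (qst ?s) & reg ?s = g'(v := a)"
    using Suc.prems by (intro exI[of _ "(reg s1)(v := 0)"]) simp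
   moreover have "bdd w (reg ?s) (heap ?s)" using Suc.prems a k(2) by (auto intro: bdd_upd)
   ultimately have r: "I (Suc a) ((reg s3)(v := 0)) (heap s3) (qst s3) & bdd w (reg s3) (heap s3) & clock s3 <= clock ?s + tc"
    using body[OF a(1)] s3(1) unfolding triple_def by blast
   have "fl k <= w" using k(2) fl_le_iff by blast
   moreover have "fl (remaining True k a) <= fl k" using a by (intro fl_mono) (auto simp: remaining_def)
   ultimately have "iter_cost True k a + (fl (remaining True k a) + 4) <= 6 * (w + 2)"
    by (simp add: iter_cost_def)
   hence c2: "clock s2 <= clock s1 + (tc + 6 * (w + 2))" using r s3(2) by simp
   have "I k ((reg s')(v := 0)) (heap s') (qst s')
    & bdd w (reg s') (heap s') & clock s' <= clock s2 + (k - Suc a) * (tc + 6 * (w + 2))"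
    using Suc.hyps(1)[OF a(2), of s2] a r s3(2) s2(2) by auto
   moreover have "(k - a) * (tc + 6 * (w + 2)) = (tc + 6 * (w + 2)) + (k - Suc a) * (tc + 6 * (w + 2))"
    using a by (metis Suc_diff_Suc mult_Suc)
   ultimately show "I k ((reg s')(v := 0)) (heap s') (qst s')
    & bdd w (reg s') (heap s') & clock s' <= clock s1 + (k - a) * (tc + 6 * (w + 2))"
    using c2 by linarith
  qed
 qed
 let ?s0 = "spend (ecs e s + 4 + fl k + fl k) s"
 obtain s1 where s1: "s1 : set_pmf (for_list G [0..<k] ?s0)" "s' = spend 2 (set_reg v 0 s1)"
  using s' k(1) unfolding G_def by (auto simp: range_dir_def)
 have "(reg s)(v := 0) = reg s" using k(4) by auto
 hence r: "I k ((reg s1)(v := 0)) (heap s1) (qst s1)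
   & bdd w (reg s1) (heap s1) & clock s1 <= clock ?s0 + k * (tc + 6 * (w + 2))"
  using loop[of 0 ?s0] s1(1) k(3) s by auto
 have fk: "fl k <= w" using k(2) fl_le_iff by blast
 have "ecs e s + 4 + fl k + fl k + 2 <= (full_size e + 10) * (w + 2)"
  using ecs_le[of w s "w + 2" e] s fk by (simp add: full_size_def algebra_simps)
 hence "clock s' <= clock s + loop_cost w e k tc" using r s1(2) by (simp add: loop_cost_def)
 moreover have "Q (reg s') (heap s') (qst s')" using post[of "(reg s1)(v := 0)" "heap s1" "qst s1"] r s1(2) by simp
 moreover have "bdd w (reg s') (heap s')" using r s1(2) by (auto intro: bdd_upd)
 ultimately show "Q (reg s') (heap s') (qst s') & bdd w (reg s') (heap s') & clock s' <= clock s + loop_cost w e k tc"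
  by blast
qed

lemma triple_circuit:
 assumes "reversible c" "wf_cmd c"
  and "!!g h q. P g h q ==> (ALL v:loop_vars c. g v = 0) & bounds_ok L c g & Q g h (act (gates f c g h) q)"
 shows "triple f w P c Q (csize c * (w + L + 2) ^ cdepth c)"
 unfolding triple_def
proof (intro allI impI ballI)
 fix s s' assume s: "P (reg s) (heap s) (qst s) & bdd w (reg s) (heap s)" and s': "s' : set_pmf (sem f c s)"
 have p: "(ALL v:loop_vars c. reg s v = 0) & bounds_ok L c (reg s)
   & Q (reg s) (heap s) (act (gates f c (reg s) (heap s)) (qst s))" using assms(3) s by blast
 then obtain t where "t <= csize c * (w + L + 2) ^ cdepth c"
  "sem f c s = return_pmf (spend t (s\<lparr>qst := act (gates f c (reg s) (heap s)) (qst s)\<rparr>))"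
  using sem_reversible[OF assms(1,2), of s w L "w + L + 2" f] s by blast
 thus "Q (reg s') (heap s') (qst s') & bdd w (reg s') (heap s')
   & clock s' <= clock s + csize c * (w + L + 2) ^ cdepth c"
  using s s' p by auto
qed

section \<open>A circuit for the chain of subgroups\<close>

text \<open>Their values are given by \<open>ideal\<close>: \<open>WK\<close> holds the terms of the
  chain, \<open>WN\<close> the rounds of the normal closures, \<open>WZ\<close> the failures of
  minimality, \<open>WE\<close> the absence of the identity, \<open>WT\<close> and \<open>WU\<close>
  the choices and their complement, \<open>WO\<close> a unary counter and \<open>WP\<close> the
  position of the selected choice.\<close>

datatype wire = WK nat nat | WN nat nat nat nat nat | WZ nat nat nat | WE nat | WT nat nat
 | WU nat nat | WO nat nat nat | WP nat nat

text \<open>The leading coordinate distinguishes the constructors. It is positive, so that as the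
  leading digit in radix \<open>D\<close> it moves all wires above \<open>D ^ 6\<close> and keeps
  the qubits below free for the index and the oracle strings.\<close>

fun coords :: "wire => nat list" where
 "coords (WK i y) = [1, i, y, 0, 0, 0]"
| "coords (WN i x j t y) = [2, i, x, j, t, y]"
| "coords (WZ i x y) = [3, i, x, y, 0, 0]"
| "coords (WE i) = [4, i, 0, 0, 0, 0]"
| "coords (WT i x) = [5, i, x, 0, 0, 0]"
| "coords (WU i x) = [6, i, x, 0, 0, 0]"
| "coords (WO i t k) = [7, i, t, k, 0, 0]"
| "coords (WP i t) = [8, i, t, 0, 0, 0]"

definition radix :: "nat => nat list => nat" where
 "radix D xs = foldl (%a x. a * D + x) 0 xs"

text \<open>The last factor \<open>D\<close> reserves a block per wire: the wire itself, then
  \<open>D - 1\<close> scratch qubits.\<close>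

definition enc :: "nat => wire => nat" where "enc D w = radix D (coords w) * D"

definition wire_ok :: "nat => wire => bool" where "wire_ok D w \<longleftrightarrow> (ALL c:set (coords w). c < D)"

lemma radix_inj:
 assumes "length xs = length ys" "ALL x:set xs. x < D" "ALL y:set ys. y < D" "radix D xs = radix D ys"
 shows "xs = ys"
 using assms
proof (induction xs arbitrary: ys rule: rev_induct)
 case (snoc x xs)
 then obtain y ys' where y: "ys = ys' @ [y]" by (metis length_0_conv length_Suc_conv_rev length_append_singleton)
 have e: "radix D xs * D + x = radix D ys' * D + y" using snoc.prems(4) by (simp add: radix_def y)
 have l: "x < D" "y < D" using snoc.prems by (auto simp: y)
 have "x = y" using arg_cong[OF e, of "%z. z mod D"] l by simp
 moreover from this have "radix D xs = radix D ys'" using e l by simp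
 ultimately show ?case using snoc.IH[of ys'] snoc.prems by (simp add: y)
qed simp

lemma coords_length: "length (coords w) = 6" by (cases w) auto

lemma coords_inj: "coords w = coords w' ==> w = w'" by (cases w; cases w') auto

lemma block_disjoint:
 assumes "wire_ok D w" "wire_ok D w'" "a < D" "b < D" "enc D w + a = enc D w' + b"
 shows "w = w' & a = b"
proof -
 have "a = b" using arg_cong[OF assms(5), of "%z. z mod D"] assms(3,4) by (simp add: enc_def)
 moreover from this have "radix D (coords w) = radix D (coords w')" using assms by (auto simp: enc_def)
 ultimately show ?thesis using radix_inj[of "coords w" "coords w'" D] coords_inj assms(1,2)
  by (auto simp: coords_length wire_ok_def)
qed

lemma enc_ge: "D ^ 6 <= enc D w"
proof -
 obtain t a b c d e where c: "coords w = [Suc t, a, b, c, d, e]" by (cases w) auto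
 have "enc D w = D ^ 6 + t * D ^ 6 + a * D ^ 5 + b * D ^ 4 + c * D ^ 3 + d * D ^ 2 + e * D"
  unfolding enc_def c radix_def by (simp add: eval_nat_numeral algebra_simps)
 thus ?thesis by simp
qed

section \<open>Expressions and nodes of the circuit\<close>

definition wexp :: "aexp list => aexp" where
 "wexp es = Op Times (foldl (%a x. Op Plus (Op Times a (V 8)) x) (N 0) es) (V 8)"

definition "eK i y = wexp [N 1, i, y, N 0, N 0, N 0]"
definition "eN i x j t y = wexp [N 2, i, x, j, t, y]"
definition "eZ i x y = wexp [N 3, i, x, y, N 0, N 0]"
definition "eE i = wexp [N 4, i, N 0, N 0, N 0, N 0]"
definition "eT i x = wexp [N 5, i, x, N 0, N 0, N 0]"
definition "eU i x = wexp [N 6, i, x, N 0, N 0, N 0]"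
definition "eO i t k = wexp [N 7, i, t, k, N 0, N 0]"
definition "eP i t = wexp [N 8, i, t, N 0, N 0, N 0]"

lemma ev_wires [simp]:
 "ev (eK i y) g h = enc (g 8) (WK (ev i g h) (ev y g h))"
 "ev (eN i x j t y) g h = enc (g 8) (WN (ev i g h) (ev x g h) (ev j g h) (ev t g h) (ev y g h))"
 "ev (eZ i x y) g h = enc (g 8) (WZ (ev i g h) (ev x g h) (ev y g h))"
 "ev (eE i) g h = enc (g 8) (WE (ev i g h))"
 "ev (eT i x) g h = enc (g 8) (WT (ev i g h) (ev x g h))"
 "ev (eU i x) g h = enc (g 8) (WU (ev i g h) (ev x g h))"
 "ev (eO i t k) g h = enc (g 8) (WO (ev i g h) (ev t g h) (ev k g h))"
 "ev (eP i t) g h = enc (g 8) (WP (ev i g h) (ev t g h))"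
 by (simp_all add: eK_def eN_def eZ_def eE_def eT_def eU_def eO_def eP_def wexp_def enc_def radix_def)

text \<open>Tests by truncated subtraction, nonzero for true.\<close>

definition "eq_exp a b = Op Minus (N 1) (Op Plus (Op Minus a b) (Op Minus b a))"
definition "less_exp a b = Op Minus b a"
definition "mod_exp a b = Op Minus a (Op Times (Op Divide a b) b)"
definition "mult_exp u v = Ld (Op Plus (Op Plus (V 10) (Op Times u (V 1))) v)"

lemma ev_exps [simp]:
 "(ev (eq_exp a b) g h ~= 0) = (ev a g h = ev b g h)"
 "(ev (eq_exp a b) g h = 0) = (ev a g h ~= ev b g h)"
 "(0 < ev (eq_exp a b) g h) = (ev a g h = ev b g h)"
 "(0 < ev (less_exp a b) g h) = (ev a g h < ev b g h)"
 "(ev (less_exp a b) g h = 0) = (\<not> ev a g h < ev b g h)"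
 "ev (mod_exp a b) g h = ev a g h mod ev b g h"
 "ev (mult_exp u v) g h = h (g 10 + ev u g h * g 1 + ev v g h)"
 by (auto simp: eq_exp_def less_exp_def mod_exp_def mult_exp_def minus_div_mult_eq_mod)

text \<open>The tuple \<open>(u, off, c, a, b)\<close> stands for the conjunctions of wires
  \<open>a\<close> and \<open>b\<close> over all values of variable 26 below variable
  \<open>u\<close> that satisfy \<open>c\<close>. The conjunction for \<open>q\<close> is computed
  into scratch qubit \<open>off + q\<close>.\<close>

type_synonym clause = "nat \<times> aexp \<times> aexp \<times> aexp \<times> aexp"

fun clause_cmd :: "aexp => clause => cmd" where
 "clause_cmd w (u, off, c, a, b) = For True 26 (V u)
   (Ite c (Tof a b (Op Plus (Op Plus (Op Plus w (N 1)) off) (V 26))) Skip)"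

fun clauses_cmd :: "aexp => clause list => cmd" where
 "clauses_cmd w [] = Skip"
| "clauses_cmd w (cl # cls) = Sq (clause_cmd w cl) (clauses_cmd w cls)"

text \<open>The wire becomes the disjunction (or, if negated, its complement) of conjunctions that are
 first computed into the scratch qubits behind it. A read of the memory at the address held by the
 scratch qubits tests whether they are all 0, as only cell 0 of the memory region is nonzero.\<close>

definition node :: "bool => aexp => clause list => cmd" where
 "node neg w cls = Sq (clauses_cmd w cls) (Sq (QL (V 7) (Op Plus w (N 1)) (V 9) w)
   (if neg then Skip else Tof (N 0) (N 0) w))"

type_synonym sclause = "nat \<times> nat \<times> (nat => bool) \<times> (nat => nat) \<times> (nat => nat)"

fun clause_gates :: "nat => sclause => (nat set => nat set) list" where
 "clause_gates w (Q, off, c, A, B) =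
   concat (map (%q. if c q then [tof_map (A q) (B q) (w + 1 + off + q)] else []) [0..<Q])"

fun clause_sem :: "(nat => nat) => (nat => nat) => clause => sclause" where
 "clause_sem g h (u, off, c, a, b) = (g u, ev off g h, (%q. ev c (g(26 := q)) h ~= 0),
   (%q. ev a (g(26 := q)) h), (%q. ev b (g(26 := q)) h))"

fun fires :: "nat set => sclause => bool" where
 "fires S (Q, off, c, A, B) \<longleftrightarrow> (EX q<Q. c q & A q : S & B q : S)"

fun controls_avoid :: "nat set => sclause => bool" where
 "controls_avoid Z (Q, off, c, A, B) \<longleftrightarrow> (ALL q<Q. c q --> A q ~: Z & B q ~: Z)"

text \<open>The clauses occupy consecutive, disjoint ranges of scratch qubits from \<open>o1\<close>
  up to \<open>lm\<close>.\<close>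

fun offsets_ok :: "nat => nat => sclause list => bool" where
 "offsets_ok o1 lm [] \<longleftrightarrow> o1 <= lm"
| "offsets_ok o1 lm ((Q, off, c, A, B) # cls) \<longleftrightarrow> o1 <= off & offsets_ok (off + Q) lm cls"

lemma offsets_ok_le: "offsets_ok o1 lm cls ==> o1 <= lm"
 by (induction o1 lm cls rule: offsets_ok.induct) auto

lemma clause_gates_eq:
 assumes "!!q. ev w (g(26 := q)) h = wv" "!!q. ev off (g(26 := q)) h = ev off g h"
 shows "gates f (clause_cmd w (u, off, c, a, b)) g h = clause_gates wv (clause_sem g h (u, off, c, a, b))"
proof -
 have 1: "gates f (clause_cmd w (u, off, c, a, b)) g h = concat (map (%t. if ev c (g(26 := t)) h ~= 0
   then [tof_map (ev a (g(26 := t)) h) (ev b (g(26 := t)) h) (wv + 1 + ev off g h + t)] else []) [0..<g u])"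
  by (simp only: clause_cmd.simps gates.simps ev.simps eval_arith.simps assms range_dir_def if_True fun_upd_same)
 show ?thesis unfolding 1 by (simp only: clause_sem.simps clause_gates.simps)
qed

lemma controls_avoid_mono:
 assumes "controls_avoid Z (Q', off, c, A, B)" "Z' \<subseteq> Z" "Q <= Q'"
 shows "controls_avoid Z' (Q, off', c, A, B)"
 unfolding controls_avoid.simps
proof (intro allI impI)
 fix q assume "q < Q" "c q"
 hence "A q ~: Z & B q ~: Z" using assms(1,3) by simp
 thus "A q ~: Z' & B q ~: Z'" using assms(2) by auto
qed

lemma fires_avoid:
 assumes "controls_avoid Z cl" "F \<subseteq> Z"
 shows "fires (S Un F) cl = fires S cl"
proof -
 obtain Q off c A B where cl: "cl = (Q, off, c, A, B)" by (cases cl)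
 have "(A q : S Un F \<longleftrightarrow> A q : S) & (B q : S Un F \<longleftrightarrow> B q : S)" if "q < Q" "c q" for q
  using assms that unfolding cl by auto
 thus ?thesis unfolding cl fires.simps by blast
qed

lemma clause_run:
 assumes "S Int {w + 1 + off..<w + 1 + off + Q} = {}"
  and "controls_avoid {w + 1 + off..<w + 1 + off + Q} (Q, off, c, A, B)"
 shows "runs (clause_gates w (Q, off, c, A, B)) S
  = S Un {w + 1 + off + q | q. q < Q & c q & A q : S & B q : S}"
 using assms
proof (induction Q)
 case (Suc Q)
 let ?S = "S Un {w + 1 + off + q | q. q < Q & c q & A q : S & B q : S}"
 have IH: "runs (clause_gates w (Q, off, c, A, B)) S = ?S"
 proof (rule Suc.IH)
  have sub: "{w + 1 + off..<w + 1 + off + Q} <= {w + 1 + off..<w + 1 + off + Suc Q}" by auto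
  thus "S Int {w + 1 + off..<w + 1 + off + Q} = {}" using Suc.prems(1) by blast
  show "controls_avoid {w + 1 + off..<w + 1 + off + Q} (Q, off, c, A, B)"
   by (rule controls_avoid_mono[OF Suc.prems(2) sub]) simp
 qed
 have "runs (clause_gates w (Suc Q, off, c, A, B)) S
   = runs (if c Q then [tof_map (A Q) (B Q) (w + 1 + off + Q)] else []) ?S"
  using IH by simp
 also have "... = S Un {w + 1 + off + q | q. q < Suc Q & c q & A q : S & B q : S}"
 proof (cases "c Q")
  case True
  have av: "A Q ~: {w + 1 + off..<w + 1 + off + Suc Q}" "B Q ~: {w + 1 + off..<w + 1 + off + Suc Q}"
   using Suc.prems(2) True by auto
  have "w + 1 + off + Q ~: S" using Suc.prems(1) by auto
  hence nin: "w + 1 + off + Q ~: ?S" by auto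
  have A: "A Q : ?S \<longleftrightarrow> A Q : S" "B Q : ?S \<longleftrightarrow> B Q : S" using av by auto
  have ne: "w + 1 + off + Q ~= A Q" "w + 1 + off + Q ~= B Q" using av by auto
  have "tof_map (A Q) (B Q) (w + 1 + off + Q) ?S
    = (if A Q : S & B Q : S then insert (w + 1 + off + Q) ?S else ?S)"
   unfolding tof_map_def A using nin ne by auto
  thus ?thesis using True by (auto simp: less_Suc_eq)
 next
  case False
  thus ?thesis by (auto simp: less_Suc_eq)
 qed
 finally show ?case .
qed simp

text \<open>No control lies in the block of the wire under construction, so the scratch qubits set
  by earlier clauses do not influence whether later ones fire.\<close>

lemma clauses_run:
 assumes "offsets_ok o1 lm cls" "S Int {w + 1 + o1..<w + 1 + lm} = {}"
  and "!!cl. cl : set cls ==> controls_avoid {w..<w + 1 + lm} cl"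
 shows "EX F. runs (concat (map (clause_gates w) cls)) S = S Un F & F <= {w + 1 + o1..<w + 1 + lm}
  & (F ~= {} \<longleftrightarrow> (EX cl:set cls. fires S cl))"
 using assms
proof (induction o1 lm cls arbitrary: S rule: offsets_ok.induct)
 case (2 o1 lm Q off c A B cls)
 have le: "o1 <= off" "off + Q <= lm" using 2(2) offsets_ok_le by auto
 define F1 where "F1 = {w + 1 + off + q | q. q < Q & c q & A q : S & B q : S}"
 have r1: "runs (clause_gates w (Q, off, c, A, B)) S = S Un F1"
  unfolding F1_def
 proof (rule clause_run)
  have "{w + 1 + off..<w + 1 + off + Q} <= {w + 1 + o1..<w + 1 + lm}" using le by auto
  thus "S Int {w + 1 + off..<w + 1 + off + Q} = {}" using 2(3) by blast
  show "controls_avoid {w + 1 + off..<w + 1 + off + Q} (Q, off, c, A, B)"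
   by (rule controls_avoid_mono[OF 2(4)[of "(Q, off, c, A, B)"]]) (use le in auto)
 qed
 have F1: "F1 <= {w + 1 + off..<w + 1 + off + Q}" by (auto simp: F1_def)
 have "EX F. runs (concat (map (clause_gates w) cls)) (S Un F1) = (S Un F1) Un F
   & F <= {w + 1 + (off + Q)..<w + 1 + lm} & (F ~= {} \<longleftrightarrow> (EX cl:set cls. fires (S Un F1) cl))"
 proof (rule 2(1))
  show "offsets_ok (off + Q) lm cls" using 2(2) by simp
  show "(S Un F1) Int {w + 1 + (off + Q)..<w + 1 + lm} = {}" 
  proof -
   have "{w + 1 + (off + Q)..<w + 1 + lm} <= {w + 1 + o1..<w + 1 + lm}" using le by auto
   moreover have "F1 Int {w + 1 + (off + Q)..<w + 1 + lm} = {}" using F1 by fastforce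
   ultimately show ?thesis using 2(3) by blast
  qed
  show "!!cl. cl : set cls ==> controls_avoid {w..<w + 1 + lm} cl" using 2(4) by simp
 qed
 then obtain F where F: "runs (concat (map (clause_gates w) cls)) (S Un F1) = (S Un F1) Un F"
  "F <= {w + 1 + (off + Q)..<w + 1 + lm}" "F ~= {} \<longleftrightarrow> (EX cl:set cls. fires (S Un F1) cl)" by blast
 have same: "fires (S Un F1) cl \<longleftrightarrow> fires S cl" if "cl : set cls" for cl
 proof -
  have "controls_avoid {w..<w + 1 + lm} cl" using 2(4) that by simp
  moreover have "F1 <= {w..<w + 1 + lm}" using F1 le by auto
  ultimately show ?thesis by (rule fires_avoid)
 qed
 have ne: "F1 ~= {} \<longleftrightarrow> fires S (Q, off, c, A, B)" by (auto simp: F1_def)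
 show ?case
 proof (intro exI[of _ "F1 Un F"] conjI)
  show "runs (concat (map (clause_gates w) ((Q, off, c, A, B) # cls))) S = S Un (F1 Un F)"
   using r1 F(1) by (simp del: clause_gates.simps add: Un_assoc)
  have "{w + 1 + off..<w + 1 + off + Q} <= {w + 1 + o1..<w + 1 + lm}"
   "{w + 1 + (off + Q)..<w + 1 + lm} <= {w + 1 + o1..<w + 1 + lm}" using le by auto
  thus "F1 Un F <= {w + 1 + o1..<w + 1 + lm}" using F1 F(2) by blast
  show "F1 Un F ~= {} \<longleftrightarrow> (EX cl:set ((Q, off, c, A, B) # cls). fires S cl)"
   using ne F(3) same by auto
 qed
qed simp

lemma address_eq_0: "address a k B = 0 \<longleftrightarrow> (ALL i<k. a + i ~: B)"
 unfolding address_def by (auto simp: sum_eq_0_iff)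

text \<open>The scratch qubits \<open>F\<close> are nonempty exactly if some clause fires, so the
  read at \<open>zc\<close> returns the negated disjunction. They stay dirty and are restored only
  by the inverse of the whole circuit.\<close>

lemma node_run:
 assumes w: "!!q. ev w (g(26 := q)) h = wv" "ev w g h = wv" and D: "g 9 = D - 1" "D >= 2" "g 7 = zc"
  and h: "h zc ~= 0" "!!a. a > 0 ==> h (zc + a) = 0"
  and off: "!!u off c a b q. (u, off, c, a, b) : set cls ==> ev off (g(26 := q)) h = ev off g h"
  and ok: "offsets_ok 0 (D - 1) (map (clause_sem g h) cls)"
  and S: "S Int {wv..<wv + D} = {}" "0 : S"
  and av: "!!cl. cl : set cls ==> controls_avoid {wv..<wv + D} (clause_sem g h cl)"
 shows "EX F. runs (gates f (node neg w cls) g h) S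
   = S Un F Un (if neg \<longleftrightarrow> \<not> (EX cl:set cls. fires S (clause_sem g h cl)) then {wv} else {})
   & F <= {wv + 1..<wv + D}"
proof -
 let ?cs = "map (clause_sem g h) cls"
 have g: "gates f (clauses_cmd w cls) g h = concat (map (clause_gates wv) ?cs)"
  using off
 proof (induction cls)
  case (Cons cl cls)
  obtain u off c a b where cl: "cl = (u, off, c, a, b)" by (cases cl)
  have "gates f (clause_cmd w cl) g h = clause_gates wv (clause_sem g h cl)"
   unfolding cl by (rule clause_gates_eq[OF w(1)], rule Cons.prems[of u off c a b]) (simp add: cl)
  moreover have "gates f (clauses_cmd w cls) g h = concat (map (clause_gates wv) (map (clause_sem g h) cls))"
   by (rule Cons.IH) (erule Cons.prems[OF list.set_intros(2)])
  ultimately show ?case by (simp del: clause_cmd.simps clause_sem.simps clause_gates.simps map_map)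
 qed simp
 have wD: "wv + 1 + (D - 1) = wv + D" using D by simp
 have "EX F. runs (concat (map (clause_gates wv) ?cs)) S = S Un F & F <= {wv + 1 + 0..<wv + 1 + (D - 1)}
  & (F ~= {} \<longleftrightarrow> (EX cl:set ?cs. fires S cl))"
  by (rule clauses_run[OF ok]) (use S av wD in auto)
 then obtain F where F: "runs (concat (map (clause_gates wv) ?cs)) S = S Un F"
  "F <= {wv + 1..<wv + D}" "F ~= {} \<longleftrightarrow> (EX cl:set cls. fires S (clause_sem g h cl))" unfolding wD by auto
 have "address (wv + 1) (D - 1) (S Un F) = 0 \<longleftrightarrow> F = {}"
 proof -
  have "wv + 1 + i ~: S" if "i < D - 1" for i using S(1) that by auto
  moreover have "EX i<D - 1. y = wv + 1 + i" if "y : F" for y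
  proof -
   have "wv + 1 <= y" "y < wv + D" using F(2) that by auto
   thus ?thesis by (intro exI[of _ "y - wv - 1"]) auto
  qed
  ultimately show ?thesis unfolding address_eq_0 by blast
 qed
 hence z: "h (zc + address (wv + 1) (D - 1) (S Un F)) ~= 0 \<longleftrightarrow> F = {}"
  using h by (metis add.right_neutral gr0I)
 have wn: "wv ~: S Un F" using S F D by auto
 have rd: "read_map h zc (wv + 1) (D - 1) wv (S Un F) = S Un F Un (if F = {} then {wv} else {})"
  unfolding read_map_def using z wn by auto
 have w0: "wv ~= 0" using S D by auto
 have "runs (gates f (node neg w cls) g h) S
   = S Un F Un (if neg \<longleftrightarrow> F = {} then {wv} else {})"
  unfolding node_def using g F(1) w(2) D rd w0 wn S(2)
  by (auto simp: tof_map_def)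
 thus ?thesis using F(2,3) by (intro exI[of _ F]) auto
qed

section \<open>The circuit, one command per kind of wire\<close>

definition "init_cmd = For True 24 (V 1) (node False (eK (N 0) (V 24)) [(18, N 0, eq_exp (V 24) (V 11), N 0, N 0)])"

text \<open>Variable 18 is 1, so a clause over it is one conjunction. A repeated wire stands for
  itself, and the control \<open>N 0\<close> elsewhere is the constant qubit.\<close>

definition "e_cmd = node True (eE (V 20)) [(18, N 0, N 1, eK (V 20) (V 11), eK (V 20) (V 11))]"

definition "n0_cmd = For True 24 (V 1)
 (node False (eN (V 20) (V 21) (N 0) (V 1) (V 24)) [(18, N 0, N 1, N 0, N 0)])"

definition "n1_cmd = For True 24 (V 1)
 (node False (eN (V 20) (V 21) (Op Plus (V 22) (N 1)) (N 0) (V 24))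
  [(18, N 0, N 1, eK (V 20) (V 24), eK (V 20) (V 24)), (18, N 1, eq_exp (V 21) (V 24), N 0, N 0)])"

text \<open>The two clauses are the two halves of \<open>cstep\<close>. Variable 17 is
  \<open>n * n\<close>: quotient and remainder of the clause variable by \<open>n\<close> run
  through all pairs, the two factors of a product in the first clause and the conjugating element
  and its argument in the second.\<close>

definition "n2_cmd = For True 23 (V 1) (For True 24 (V 1)
 (node False (eN (V 20) (V 21) (Op Plus (V 22) (N 1)) (Op Plus (V 23) (N 1)) (V 24))
  [(17, N 0, eq_exp (mult_exp (Op Divide (V 26) (V 1)) (mod_exp (V 26) (V 1))) (V 24),
    eN (V 20) (V 21) (Op Plus (V 22) (N 1)) (V 23) (Op Divide (V 26) (V 1)),
    eN (V 20) (V 21) (Op Plus (V 22) (N 1)) (V 23) (mod_exp (V 26) (V 1))),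
   (17, V 17, eq_exp (mult_exp (V 24) (Op Divide (V 26) (V 1)))
     (mult_exp (Op Divide (V 26) (V 1)) (mod_exp (V 26) (V 1))),
    eN (V 20) (V 21) (V 22) (V 1) (Op Divide (V 26) (V 1)),
    eN (V 20) (V 21) (Op Plus (V 22) (N 1)) (V 23) (mod_exp (V 26) (V 1)))]))"

definition "n_cmd = For True 21 (V 1) (Sq n0_cmd (For True 22 (V 1) (Sq n1_cmd n2_cmd)))"

definition "z_cmd = For True 21 (V 1) (For True 24 (V 1)
 (node True (eZ (V 20) (V 21) (V 24))
  [(18, N 0, N 1, eK (V 20) (V 24), eK (V 20) (V 24)),
   (18, N 1, N 1, eN (V 20) (V 24) (V 1) (V 1) (V 21), eN (V 20) (V 24) (V 1) (V 1) (V 21))]))"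

text \<open>A negated node: its clauses list the reasons why an element is not a choice, namely that
  its closure is not minimal, that it is not the smallest of its coset, that it lies in the term, or
  that the term is empty.\<close>

definition "t_cmd = For True 21 (V 1)
 (node True (eT (V 20) (V 21))
  [(1, N 0, N 1, eN (V 20) (V 21) (V 1) (V 1) (V 26), eZ (V 20) (V 21) (V 26)),
   (1, V 1, less_exp (mult_exp (V 21) (V 26)) (V 21), eK (V 20) (V 26), eK (V 20) (V 26)),
   (18, V 13, N 1, eK (V 20) (V 21), eK (V 20) (V 21)),
   (18, Op Plus (V 13) (N 1), N 1, eE (V 20), eE (V 20))])"

text \<open>Conjunctions have positive controls only, so the complement of the choices needs wires
  of its own.\<close>

definition "u_cmd = For True 21 (V 1)
 (node True (eU (V 20) (V 21)) [(18, N 0, N 1, eT (V 20) (V 21), eT (V 20) (V 21))])"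

text \<open>Moving the base of the read from \<open>zc\<close> down by \<open>k\<close> makes it
  test whether the number in the index bits of this choice equals \<open>k\<close>. This converts
  the number from binary to unary.\<close>

definition "o0_cmd = For True 25 (V 13)
 (QL (Op Minus (V 7) (V 25)) (Op Plus (N 4) (Op Times (V 20) (V 1))) (V 1) (eO (V 20) (N 0) (V 25)))"

text \<open>The elements are passed cyclically and the unary counter drops by one at each choice. A
  choice met at counter 0 has the rank \<open>r i mod card (opts i)\<close>, so the reduction needs
  no division. As \<open>r i < 2 * n\<close>, passing \<open>2 * n\<close> rounds suffices.\<close>

definition "o_cmd = For True 23 (V 14) (Sq
 (For True 25 (V 13) (node False (eO (V 20) (Op Plus (V 23) (N 1)) (V 25))
  [(18, N 0, less_exp (Op Plus (V 25) (N 1)) (V 13),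
    eT (V 20) (mod_exp (V 23) (V 1)), eO (V 20) (V 23) (Op Plus (V 25) (N 1))),
   (18, N 1, N 1, eU (V 20) (mod_exp (V 23) (V 1)), eO (V 20) (V 23) (V 25))]))
 (node False (eP (V 20) (V 23))
  [(18, N 0, N 1, eT (V 20) (mod_exp (V 23) (V 1)), eO (V 20) (V 23) (N 0))]))"

definition "k_cmd = For True 24 (V 1)
 (node False (eK (Op Plus (V 20) (N 1)) (V 24))
  [(14, N 0, N 1, eP (V 20) (V 26), eN (V 20) (mod_exp (V 26) (V 1)) (V 1) (V 1) (V 24))])"

definition "level_cmd = Sq e_cmd (Sq n_cmd (Sq z_cmd (Sq t_cmd (Sq u_cmd (Sq o0_cmd (Sq o_cmd k_cmd))))))"

definition "chain_cmd = Sq init_cmd (For True 20 (V 12) level_cmd)"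

section \<open>Values of the wires and the invariant of the circuit\<close>

definition visits :: "nat => nat set => nat => nat" where
 "visits n T t = card {t'. t' < t & t' mod n : T}"

lemma visits_Suc: "visits n T (Suc t) = visits n T t + (if t mod n : T then 1 else 0)"
proof -
 have "{t'. t' < Suc t & t' mod n : T} = {t'. t' < t & t' mod n : T} Un (if t mod n : T then {t} else {})"
  by (auto simp: less_Suc_eq)
 thus ?thesis unfolding visits_def by (auto simp: card_insert_if)
qed

lemma visits_0 [simp]: "visits n T 0 = 0" by (simp add: visits_def)

text \<open>Each of the \<open>a\<close> full rounds meets all of \<open>T\<close>, the final
  partial round the elements below \<open>b\<close>.\<close>

lemma visits_eq:
 assumes "T <= {..<n}" "b <= n"
 shows "visits n T (a * n + b) = a * card T + rank T b"
 using assms(2)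
proof (induction a arbitrary: b)
 case 0
 have "{t'. t' < b & t' mod n : T} = {y : T. y < b}" using 0 by auto
 thus ?case by (simp add: visits_def rank_def)
next
 case (Suc a)
 have r0: "rank T 0 = 0" by (simp add: rank_def)
 have rn: "rank T n = card T" unfolding rank_def using assms(1) by (intro arg_cong[of _ _ card]) auto
 have gen: "visits n T (Suc a * n + b) = Suc a * card T + rank T b" if "b <= n" for b
  using that
 proof (induction b)
  case 0
  have "visits n T (a * n + n) = a * card T + rank T n" using Suc.IH[of n] by simp
  thus ?case using r0 rn by (simp add: add.commute)
 next
  case (Suc b)
  have b: "b < n" using Suc by simp
  have "(Suc a * n + b) mod n = b" using b by (metis mod_less mod_mult_self3)
  hence "visits n T (Suc a * n + Suc b) = Suc a * card T + rank T b + (if b : T then 1 else 0)"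
   using visits_Suc[of n T "Suc a * n + b"] Suc by (simp del: mult_Suc)
  moreover have "{y : T. y < Suc b} = {y : T. y < b} Un (if b : T then {b} else {})" by (auto simp: less_Suc_eq)
  hence "rank T (Suc b) = rank T b + (if b : T then 1 else 0)" by (auto simp: rank_def)
  ultimately show ?case by simp
 qed
 thus ?case using Suc.prems by simp
qed

text \<open>\<open>D\<close> exceeds all coordinates, which go up to \<open>2 * n * n\<close>, and
  leaves enough scratch qubits for the largest node. The cell \<open>zc\<close> is isolated among
  zeros: everything above it for zero tests with long addresses, and \<open>2 * n\<close> cells
  below it for the shifted reads. \<open>low\<close> is the content of the qubits below the wires,
  with the constant qubit and the index.\<close>

locale circuit =
 fixes n D zc TB :: nat and h :: "nat => nat" and G :: "nat monoid" (structure)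
  and low :: "nat set" and r :: "nat => nat" and f :: oracle_fun
 assumes n2: "n >= 2" and D_def: "D = 4 * n * n + 4"
  and grp: "group G" and carr: "carrier G = {..<n}"
  and tab: "!!u v. u < n ==> v < n ==> h (TB + u * n + v) = u \<otimes> v"
  and zc: "h zc ~= 0" "!!a. a > 0 ==> h (zc + a) = 0" "!!k. 0 < k ==> k <= 2 * n ==> h (zc - k) = 0" "zc >= 2 * n"
  and low: "low <= {..<D ^ 6}" "0 : low"
  and r_def: "!!i. r i = address (4 + i * n) n low" and r_bound: "!!i. r i < 2 * n"
begin

definition genv :: "(nat => nat) => bool" where
 "genv g \<longleftrightarrow> g 1 = n & g 7 = zc & g 8 = D & g 9 = D - 1 & g 10 = TB & g 11 = \<one> & g 12 = n - 1
  & g 13 = 2 * n & g 14 = 2 * n * n & g 17 = n * n & g 18 = 1"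

abbreviation "term_set i \<equiv> chain G r i"
abbreviation "opts i \<equiv> choices G (chain G r i)"

text \<open>\<open>stage i x j n\<close> is term \<open>j\<close> of the descent; smaller values of
  the last argument are the rounds of the normal closure that lead to it.\<close>

definition stage :: "nat => nat => nat => nat => nat set" where
 "stage i x j t = (case j of 0 => {..<n}
   | Suc j' => (cstep G (descent G (insert x (term_set i)) j') ^^ t) (insert x (term_set i)))"

fun ideal :: "wire => bool" where
 "ideal (WK i y) \<longleftrightarrow> y : term_set i"
| "ideal (WN i x j t y) \<longleftrightarrow> y : stage i x j t"
| "ideal (WZ i x y) \<longleftrightarrow> y ~: term_set i & x ~: sn_closure G (term_set i) y"
| "ideal (WE i) \<longleftrightarrow> \<one> ~: term_set i"
| "ideal (WT i x) \<longleftrightarrow> x : opts i"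
| "ideal (WU i x) \<longleftrightarrow> x ~: opts i"
| "ideal (WO i t k) \<longleftrightarrow> r i = k + visits n (opts i) t"
| "ideal (WP i t) \<longleftrightarrow> t mod n : opts i & r i = visits n (opts i) t"

lemma n_pos: "0 < n" using n2 by simp

lemma fin: "finite (carrier G)" by (simp add: carr)

lemma one_lt: "\<one> < n"
 using monoid.one_closed[OF group.is_monoid[OF grp]] carr by auto

lemma term_sub: "term_set i <= {..<n}"
 using chain_subset[OF grp fin, of r i] carr by auto

lemma opts_sub: "opts i <= {..<n}"
 using choices_subset(2)[OF grp fin, of "term_set i"] carr by auto

lemma stage_descent: "stage i x j n = descent G (insert x (term_set i)) j"
 by (cases j) (auto simp: stage_def normal_closure_def carr)

lemma stage_sub: "x < n ==> stage i x j t <= {..<n}"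
 using term_sub[of i] by (cases j; cases t) (auto simp: stage_def cstep_def carr)

lemma stage_closure: "stage i x n n = sn_closure G (term_set i) x"
 unfolding stage_descent sn_closure_def by (simp add: carr)

lemma stage_Suc: "stage i x (Suc j) (Suc t) = cstep G (stage i x j n) (stage i x (Suc j) t)"
 unfolding stage_descent by (simp add: stage_def)

lemma big: "n * n + n * n <= D - 1" "2 * n * n <= D - 1" "2 * n + 2 <= D - 1" "1 <= D - 1" "2 <= D - 1" "2 <= D" "8 < D" "2 * n * n < D" "n < D" "2 * n < D"
proof -
 have 1: "2 * n <= n * n" using n2 by simp
 have 2: "4 <= n * n" using mult_le_mono[OF n2 n2] by simp
 have D: "D = 4 * (n * n) + 4" using D_def by simp
 have 3: "2 * n * n = 2 * (n * n)" by simp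
 show "n * n + n * n <= D - 1" "2 * n * n <= D - 1" "2 * n + 2 <= D - 1" "1 <= D - 1" "2 <= D - 1" "2 <= D" "8 < D" "2 * n * n < D" "n < D" "2 * n < D"
  unfolding 3 D using 1 2 n2 by linarith+
qed

lemma wire_ok_simps [simp]:
 "i <= n ==> y <= n ==> wire_ok D (WK i y)"
 "i <= n ==> x <= n ==> j <= n ==> t <= n ==> y <= n ==> wire_ok D (WN i x j t y)"
 "i <= n ==> x <= n ==> y <= n ==> wire_ok D (WZ i x y)"
 "i <= n ==> wire_ok D (WE i)"
 "i <= n ==> x <= n ==> wire_ok D (WT i x)"
 "i <= n ==> x <= n ==> wire_ok D (WU i x)"
 "i <= n ==> t <= 2 * n * n ==> k <= 2 * n ==> wire_ok D (WO i t k)"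
 "i <= n ==> t <= 2 * n * n ==> wire_ok D (WP i t)"
 using big unfolding wire_ok_def by auto

text \<open>Wires in \<open>Dn\<close> carry their values while their scratch qubits are arbitrary;
  the blocks of all other wires are still 0.\<close>

definition state :: "wire set => nat set => bool" where
 "state Dn B \<longleftrightarrow> B Int {..<D ^ 6} = low & (ALL w. wire_ok D w -->
   (if w : Dn then (enc D w : B \<longleftrightarrow> ideal w) else B Int {enc D w..<enc D w + D} = {}))"

definition aval :: "nat => bool" where
 "aval a \<longleftrightarrow> a = 0 \<or> (EX w. wire_ok D w & a = enc D w & ideal w)"

definition known :: "wire set => nat => bool" where
 "known Dn a \<longleftrightarrow> a = 0 \<or> (EX w:Dn. wire_ok D w & a = enc D w)"

lemma enc_pos: "enc D w ~= 0"
 using enc_ge[of D w] big by (metis le_0_eq power_eq_0_iff not_numeral_le_zero)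

lemma enc_eq: "wire_ok D w ==> wire_ok D w' ==> enc D w = enc D w' \<longleftrightarrow> w = w'"
 using block_disjoint[of D w w' 0 0] big by auto

lemma aval_simps [simp]: "aval 0" "wire_ok D w ==> aval (enc D w) = ideal w"
 using enc_pos[of w] by (auto simp: aval_def enc_eq)

lemma known_simps [simp]: "known Dn 0" "wire_ok D w ==> known Dn (enc D w) \<longleftrightarrow> w : Dn"
 using enc_pos[of w] by (auto simp: known_def enc_eq)

lemma state_known:
 assumes "state Dn B" "known Dn a"
 shows "a : B \<longleftrightarrow> aval a"
proof (cases "a = 0")
 case True
 have "0 : B" using assms(1) low by (auto simp: state_def)
 thus ?thesis using True by simp
next
 case False
 then obtain w where "w : Dn" "wire_ok D w" "a = enc D w" using assms(2) by (auto simp: known_def)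
 thus ?thesis using assms(1) unfolding state_def by simp
qed

definition ct :: "(nat => nat) => cmd => wire set => wire set => bool" where
 "ct g c Dn Dn' \<longleftrightarrow> (ALL B. state Dn B --> state Dn' (runs (gates f c g h) B))"

lemma ct_Sq: "ct g c A B ==> ct g d B C ==> ct g (Sq c d) A C"
 by (simp add: ct_def)

lemma ct_For:
 assumes "ev e g h = k" "!!t. t < k ==> ct (g(v := t)) c (Dn t) (Dn (Suc t))" "A = Dn 0" "B = Dn k"
 shows "ct g (For True v e c) A B"
proof -
 have "state (Dn m) (runs (concat (map (%t. gates f c (g(v := t)) h) [0..<m])) S)" if "m <= k" "state (Dn 0) S" for m S
  using that
 proof (induction m)
  case (Suc m)
  hence "state (Dn m) (runs (concat (map (%t. gates f c (g(v := t)) h) [0..<m])) S)" by (simp del: fun_upd_apply)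
  hence "state (Dn (Suc m)) (runs (gates f c (g(v := m)) h) (runs (concat (map (%t. gates f c (g(v := t)) h) [0..<m])) S))"
   using assms(2)[of m] Suc.prems unfolding ct_def by (simp del: fun_upd_apply)
  thus ?case by (simp del: fun_upd_apply)
 qed simp
 thus ?thesis unfolding ct_def using assms by (simp add: range_dir_def del: fun_upd_apply)
qed

fun afires :: "sclause => bool" where
 "afires (Q, off, c, A, B) \<longleftrightarrow> (EX q<Q. c q & aval (A q) & aval (B q))"

fun sources_known :: "wire set => sclause => bool" where
 "sources_known Dn (Q, off, c, A, B) \<longleftrightarrow> (ALL q<Q. c q --> known Dn (A q) & known Dn (B q))"

lemma known_avoid:
 assumes "known Dn a" "wire_ok D w" "w ~: Dn"
 shows "a ~: {enc D w..<enc D w + D}"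
proof
 assume a: "a : {enc D w..<enc D w + D}"
 show False
 proof (cases "a = 0")
  case True
  thus False using a enc_pos[of w] by auto
 next
  case False
  then obtain w' where w': "w' : Dn" "wire_ok D w'" "a = enc D w'" using assms(1) by (auto simp: known_def)
  hence "enc D w' + 0 = enc D w + (a - enc D w)" "a - enc D w < D" using a by auto
  thus False using block_disjoint[of D w' w 0 "a - enc D w"] w' assms big by auto
 qed
qed

text \<open>If all sources are already computed, correctness of a node reduces to the assumption
  \<open>ideal\<close>, a statement about sets without any qubits.\<close>

lemma ct_node:
 assumes g: "genv g"
  and w: "!!q. ev w (g(26 := q)) h = enc D wr" "ev w g h = enc D wr" "wire_ok D wr" "wr ~: Dn"
  and off: "ALL (u, off, c, a, b):set cls. ALL q. ev off (g(26 := q)) h = ev off g h"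
  and ok: "offsets_ok 0 (D - 1) (map (clause_sem g h) cls)"
  and src: "ALL cl:set cls. sources_known Dn (clause_sem g h cl)"
  and ideal: "ideal wr \<longleftrightarrow> (neg \<longleftrightarrow> \<not> (EX cl:set cls. afires (clause_sem g h cl)))"
  and Dn': "Dn' = insert wr Dn"
 shows "ct g (node neg w cls) Dn Dn'"
 unfolding ct_def
proof (intro allI impI)
 fix S assume S: "state Dn S"
 let ?Z = "{enc D wr..<enc D wr + D}"
 have g9: "g 9 = D - 1" "g 7 = zc" using g by (auto simp: genv_def)
 have "EX F. runs (gates f (node neg w cls) g h) S
   = S Un F Un (if neg \<longleftrightarrow> \<not> (EX cl:set cls. fires S (clause_sem g h cl)) then {enc D wr} else {})
   & F <= {enc D wr + 1..<enc D wr + D}"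
 proof (rule node_run[OF w(1,2) g9(1) _ g9(2) zc(1,2) _ ok])
  show "2 <= D" using big by simp
  show "!!u off c a b q. (u, off, c, a, b) : set cls ==> ev off (g(26 := q)) h = ev off g h" using off by blast
  show "S Int ?Z = {}" using S w unfolding state_def by auto
  show "0 : S" using S low by (auto simp: state_def)
  fix cl assume cl: "cl : set cls"
  obtain Q off c A B where e: "clause_sem g h cl = (Q, off, c, A, B)" by (cases "clause_sem g h cl")
  show "controls_avoid ?Z (clause_sem g h cl)"
   unfolding e controls_avoid.simps
  proof (intro allI impI)
   fix q assume "q < Q" "c q"
   hence "known Dn (A q)" "known Dn (B q)" using src cl e by fastforce+
   thus "A q ~: ?Z & B q ~: ?Z" using known_avoid[OF _ w(3,4)] by blast
  qed
 qed
 then obtain F where F: "runs (gates f (node neg w cls) g h) S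
   = S Un F Un (if neg \<longleftrightarrow> \<not> (EX cl:set cls. fires S (clause_sem g h cl)) then {enc D wr} else {})"
  "F <= {enc D wr + 1..<enc D wr + D}" by blast
 have "fires S (clause_sem g h cl) = afires (clause_sem g h cl)" if cl: "cl : set cls" for cl
 proof -
  obtain Q off c A B where e: "clause_sem g h cl = (Q, off, c, A, B)" by (cases "clause_sem g h cl")
  have "(A q : S \<longleftrightarrow> aval (A q)) & (B q : S \<longleftrightarrow> aval (B q))" if "q < Q" "c q" for q
   using src cl e that state_known[OF S] by fastforce
  thus ?thesis unfolding e fires.simps afires.simps by blast
 qed
 hence "(neg \<longleftrightarrow> \<not> (EX cl:set cls. fires S (clause_sem g h cl))) \<longleftrightarrow> ideal wr" using ideal by simp
 hence R: "runs (gates f (node neg w cls) g h) S = S Un F Un (if ideal wr then {enc D wr} else {})"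
  (is "?R = _") using F(1) by simp
 have in_Z: "y : ?Z" if "y : F Un (if ideal wr then {enc D wr} else {})" for y
  using that F(2) big by (auto split: if_splits)
 show "state Dn' ?R"
  unfolding state_def Dn'
 proof (intro conjI allI impI)
  have "y >= D ^ 6" if "y : ?Z" for y using that enc_ge[of D wr] by auto
  hence "?R Int {..<D ^ 6} = S Int {..<D ^ 6}" unfolding R using in_Z by fastforce
  thus "?R Int {..<D ^ 6} = low" using S by (simp add: state_def)
  fix w' assume w': "wire_ok D w'"
  show "if w' : insert wr Dn then (enc D w' : ?R \<longleftrightarrow> ideal w') else ?R Int {enc D w'..<enc D w' + D} = {}"
  proof (cases "w' = wr")
   case True
   have "enc D wr ~: S" using S w big unfolding state_def by force
   thus ?thesis unfolding R True using F(2) by auto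
  next
   case False
   have disj: "y ~: ?Z" if "y : {enc D w'..<enc D w' + D}" for y
   proof
    assume "y : ?Z"
    hence "enc D w' + (y - enc D w') = enc D wr + (y - enc D wr)" "y - enc D w' < D" "y - enc D wr < D"
     using that by auto
    thus False using block_disjoint[OF w' w(3)] False by blast
   qed
   have "?R Int {enc D w'..<enc D w' + D} = S Int {enc D w'..<enc D w' + D}"
    unfolding R using disj in_Z by blast
   moreover have "enc D w' : {enc D w'..<enc D w' + D}" using big by simp
   ultimately show ?thesis using S w' False unfolding state_def by (metis (no_types, lifting) IntD1 IntI insert_iff)
  qed
 qed
qed

end

text \<open>The number of levels after which a wire is available. It certifies that the wires of the
  current level are still untouched.\<close>

fun made :: "wire => nat" where
 "made (WK i y) = i"
| "made (WN i x j t y) = Suc i"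
| "made (WZ i x y) = Suc i"
| "made (WE i) = Suc i"
| "made (WT i x) = Suc i"
| "made (WU i x) = Suc i"
| "made (WO i t k) = Suc i"
| "made (WP i t) = Suc i"

section \<open>Correctness of one level\<close>

context circuit begin

lemma genvD:
 assumes "genv g"
 shows "g 1 = n" "g (Suc 0) = n" "g 7 = zc" "g 8 = D" "g 9 = D - 1" "g 10 = TB" "g 11 = \<one>" "g 12 = n - 1"
  "g 13 = 2 * n" "g 14 = 2 * n * n" "g 17 = n * n" "g 18 = 1"
 using assms by (auto simp: genv_def)

lemma genv_upd [simp]: "v >= 20 ==> genv (g(v := t)) = genv g"
 by (auto simp: genv_def)

lemma pair_lt: "q < n * n ==> q div n < n & q mod n < n"
 using n_pos by (simp add: less_mult_imp_div_less)

lemma ex_pair: "(EX q<n * n. P (q div n) (q mod n)) \<longleftrightarrow> (EX u<n. EX v<n. P u v)"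
proof
 assume "EX q<n * n. P (q div n) (q mod n)"
 thus "EX u<n. EX v<n. P u v" using pair_lt by blast
next
 assume "EX u<n. EX v<n. P u v"
 then obtain u v where uv: "u < n" "v < n" "P u v" by blast
 have "u * n + v < Suc u * n" using uv by simp
 also have "... <= n * n" using uv by (intro mult_le_mono1) simp
 finally have "u * n + v < n * n" .
 moreover have "(u * n + v) div n = u" "(u * n + v) mod n = v" using uv n_pos by simp_all
 ultimately show "EX q<n * n. P (q div n) (q mod n)" using uv(3) by (intro exI[of _ "u * n + v"]) simp
qed

lemma cstep_iff:
 assumes "S <= {..<n}" "A <= {..<n}" "y < n"
 shows "y : cstep G S A \<longleftrightarrow>
  (EX u<n. EX v<n. h (TB + u * n + v) = y & u : A & v : A)
  \<or> (EX s<n. EX u<n. h (TB + y * n + s) = h (TB + s * n + u) & s : S & u : A)"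
proof -
 have 1: "(EX u:A. EX v:A. u \<otimes> v = y) \<longleftrightarrow> (EX u<n. EX v<n. h (TB + u * n + v) = y & u : A & v : A)"
 proof
  assume "EX u:A. EX v:A. u \<otimes> v = y"
  then obtain u v where uv: "u : A" "v : A" "u \<otimes> v = y" by blast
  hence "u < n" "v < n" using assms(2) by auto
  thus "EX u<n. EX v<n. h (TB + u * n + v) = y & u : A & v : A" using uv tab[of u v] by auto
 next
  assume "EX u<n. EX v<n. h (TB + u * n + v) = y & u : A & v : A"
  then obtain u v where "u < n" "v < n" "h (TB + u * n + v) = y" "u : A" "v : A" by blast
  thus "EX u:A. EX v:A. u \<otimes> v = y" using tab[of u v] by auto
 qed
 have 2: "(EX s:S. EX u:A. y \<otimes> s = s \<otimes> u) \<longleftrightarrow> (EX s<n. EX u<n. h (TB + y * n + s) = h (TB + s * n + u) & s : S & u : A)"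
 proof
  assume "EX s:S. EX u:A. y \<otimes> s = s \<otimes> u"
  then obtain s u where su: "s : S" "u : A" "y \<otimes> s = s \<otimes> u" by blast
  hence l: "s < n" "u < n" using assms by auto
  hence "h (TB + y * n + s) = h (TB + s * n + u)" using su tab[of y s] tab[of s u] assms(3) by simp
  thus "EX s<n. EX u<n. h (TB + y * n + s) = h (TB + s * n + u) & s : S & u : A"
   using su l by blast
 next
  assume "EX s<n. EX u<n. h (TB + y * n + s) = h (TB + s * n + u) & s : S & u : A"
  then obtain s u where "s < n" "u < n" "h (TB + y * n + s) = h (TB + s * n + u)" "s : S" "u : A" by blast
  thus "EX s:S. EX u:A. y \<otimes> s = s \<otimes> u" using tab[of y s] tab[of s u] assms(3) by auto
 qed
 show ?thesis unfolding cstep_def using 1 2 assms(3) carr by auto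
qed

text \<open>The disjuncts match the clauses of \<open>t_cmd\<close> one by one.\<close>

lemma choices_iff:
 assumes "x < n"
 shows "x : opts i \<longleftrightarrow> \<not> ((EX y<n. y : stage i x n n & y ~: term_set i & x ~: sn_closure G (term_set i) y)
  \<or> (EX z<n. h (TB + x * n + z) < x & z : term_set i) \<or> x : term_set i \<or> \<one> ~: term_set i)"
proof -
 have sub: "sn_closure G (term_set i) x <= {..<n}" using stage_sub[OF assms, of i n n] stage_closure by simp
 have 1: "(ALL y:sn_closure G (term_set i) x. y : term_set i \<or> x : sn_closure G (term_set i) y)
  \<longleftrightarrow> \<not> (EX y<n. y : stage i x n n & y ~: term_set i & x ~: sn_closure G (term_set i) y)"
  unfolding stage_closure using sub by auto
 have 2: "(ALL z:term_set i. x <= x \<otimes> z) \<longleftrightarrow> \<not> (EX z<n. h (TB + x * n + z) < x & z : term_set i)"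
 proof -
  have "h (TB + x * n + z) = x \<otimes> z" if "z : term_set i" for z using tab[of x z] assms term_sub[of i] that by auto
  thus ?thesis using term_sub[of i] by (metis linorder_not_le lessThan_iff subsetD)
 qed
 show ?thesis unfolding choices_def reps_def min_above_def using 1 2 assms carr by auto
qed

lemma next_iff:
 "y : term_set (Suc i) \<longleftrightarrow>
   (EX t<2 * n * n. (t mod n : opts i & r i = visits n (opts i) t) & y : stage i (t mod n) n n)"
proof
 assume "y : term_set (Suc i)"
 then obtain x where x: "x : opts i" "rank (opts i) x = r i mod card (opts i)" "y : sn_closure G (term_set i) x"
  by (auto simp: next_term_def)
 have xn: "x < n" using x(1) opts_sub by auto
 let ?c = "card (opts i)"
 \<comment> \<open>After \<open>r i div ?c\<close> full rounds, each meeting \<open>?c\<close>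
   choices, the remaining count is the rank of \<open>x\<close>, which is met at counter 0 in the
   next round.\<close>
 let ?t = "r i div ?c * n + x"
 have "r i div ?c <= 2 * n - 1" using r_bound[of i] div_le_dividend[of "r i" ?c] by linarith
 hence "r i div ?c * n + x < (2 * n - 1) * n + n" using xn by (intro add_le_less_mono mult_le_mono1) auto
 also have "... = 2 * n * n" using n_pos by (simp add: algebra_simps)
 finally have "?t < 2 * n * n" .
 moreover have "?t mod n = x" using xn by simp
 moreover have "visits n (opts i) ?t = r i"
  using visits_eq[where T = "opts i" and b = x and a = "r i div ?c", OF opts_sub] xn x(2) by simp
 ultimately show "EX t<2 * n * n. (t mod n : opts i & r i = visits n (opts i) t) & y : stage i (t mod n) n n"
  using x by (intro exI[of _ ?t]) (simp add: stage_closure)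
next
 assume "EX t<2 * n * n. (t mod n : opts i & r i = visits n (opts i) t) & y : stage i (t mod n) n n"
 then obtain t where t: "t mod n : opts i" "r i = visits n (opts i) t" "y : sn_closure G (term_set i) (t mod n)"
  by (auto simp: stage_closure)
 have "visits n (opts i) t = t div n * card (opts i) + rank (opts i) (t mod n)"
  using visits_eq[where T = "opts i" and b = "t mod n" and a = "t div n", OF opts_sub] n_pos by (simp add: less_imp_le)
 moreover have "rank (opts i) (t mod n) < card (opts i)"
  using rank_bij[OF finite_choices[OF grp fin, of "term_set i"]] t(1) by (auto simp: bij_betw_def)
 ultimately have "rank (opts i) (t mod n) = r i mod card (opts i)" using t(2) by simp
 thus "y : term_set (Suc i)" using t by (auto simp: next_term_def)
qed

lemma ct_init: "genv g ==> ct g init_cmd {} {WK 0 y | y. y < n}"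
 unfolding init_cmd_def
 apply (rule ct_For[where k = n and Dn = "%t. {WK 0 y | y. y < t}"])
 apply (simp add: genvD)
 subgoal for t
  by (rule ct_node[where wr = "WK 0 t"]) (use big in "auto simp: genvD less_Suc_eq")
 by auto

context
 fixes i :: nat and A0 :: "wire set" and g :: "nat => nat"
 assumes i: "i < n - 1" and A0: "!!w. w : A0 ==> made w <= i" and KA: "!!y. y < n ==> WK i y : A0"
  and g: "genv g" "g 20 = i"
begin

lemma not_A0 [simp]: "WN i x j t y ~: A0" "WZ i x y ~: A0" "WE i ~: A0" "WT i x ~: A0" "WU i x ~: A0"
 "WO i t k ~: A0" "WP i t ~: A0" "WK (Suc i) y ~: A0"
 using A0 by fastforce+

lemma i_le [simp]: "i <= n" "Suc i <= n" using i by auto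

definition "S1 = insert (WE i) A0"
text \<open>Stage 0 is the whole group in every round; only its wires with round number
  \<open>n\<close> are made, since the next stage reads those.\<close>

definition "NW m = {WN i x 0 n y | x y. x < m & y < n} Un {WN i x (Suc j) t y | x j t y. x < m & j < n & t <= n & y < n}"
definition "S2 = S1 Un NW n"
definition "S3 = S2 Un {WZ i x y | x y. x < n & y < n}"
definition "S4 = S3 Un {WT i x | x. x < n}"
definition "S5 = S4 Un {WU i x | x. x < n}"
definition "S6 = S5 Un {WO i 0 k | k. k < 2 * n}"
definition "S7 = S6 Un {WO i (Suc t) k | t k. t < 2 * n * n & k < 2 * n} Un {WP i t | t. t < 2 * n * n}"
definition "S8 = S7 Un {WK (Suc i) y | y. y < n}"

lemma ct_e: "ct g e_cmd A0 S1"
 unfolding e_cmd_def S1_def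
 by (rule ct_node[where wr = "WE i"]) (use big g KA one_lt in "auto simp: genvD")

lemma ct_n0:
 assumes "x < n" "g' = g(21 := x)" "!!y. WN i x 0 n y ~: A"
 shows "ct g' n0_cmd A (A Un {WN i x 0 n y | y. y < n})"
 unfolding n0_cmd_def
 apply (rule ct_For[where k = n and Dn = "%m. A Un {WN i x 0 n y | y. y < m}"])
 subgoal using assms g by (simp add: genvD)
 subgoal for y
  by (rule ct_node[where wr = "WN i x 0 n y"]) (use big g assms in "auto simp: genvD less_Suc_eq stage_def")
 by auto

lemma ct_n1:
 assumes "x < n" "j < n" "g' = g(21 := x, 22 := j)" "!!y. WN i x (Suc j) 0 y ~: A" "A0 \<subseteq> A"
 shows "ct g' n1_cmd A (A Un {WN i x (Suc j) 0 y | y. y < n})"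
 unfolding n1_cmd_def
 apply (rule ct_For[where k = n and Dn = "%m. A Un {WN i x (Suc j) 0 y | y. y < m}"])
 subgoal using assms g by (simp add: genvD)
 subgoal for y
  by (rule ct_node[where wr = "WN i x (Suc j) 0 y"])
    (use big g assms KA in "auto simp: genvD less_Suc_eq stage_def")
 by auto

lemma ct_n2:
 assumes x: "x < n" and j: "j < n" and g': "g' = g(21 := x, 22 := j)" and A: "!!t y. WN i x (Suc j) (Suc t) y ~: A"
  and A1: "!!y. y < n ==> WN i x (Suc j) 0 y : A" and A2: "!!y. y < n ==> WN i x j n y : A"
 shows "ct g' n2_cmd A (A Un {WN i x (Suc j) (Suc t) y | t y. t < n & y < n})"
 unfolding n2_cmd_def
 apply (rule ct_For[where k = n and Dn = "%m. A Un {WN i x (Suc j) (Suc t) y | t y. t < m & y < n}"])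
 subgoal using g' g by (simp add: genvD)
 subgoal for t
  apply (rule ct_For[where k = n and Dn = "%m. A Un {WN i x (Suc j) (Suc t') y | t' y. t' < t & y < n}
    Un {WN i x (Suc j) (Suc t) y | y. y < m}"])
  subgoal using g' g by (simp add: genvD)
  subgoal for y
  proof -
   assume t: "t < n" and y: "y < n"
   let ?Dn = "A Un {WN i x (Suc j) (Suc t') y | t' y. t' < t & y < n} Un {WN i x (Suc j) (Suc t) y' | y'. y' < y}"
   have prev: "WN i x (Suc j) t u : ?Dn" if "u < n" for u using A1[OF that] that by (cases t) auto
   have Sj: "WN i x j n u : ?Dn" if "u < n" for u using A2[OF that] by simp
   have fr: "WN i x (Suc j) (Suc t) y ~: ?Dn" using A by auto
   have wk: "wire_ok D (WN i x a b (q div n))" "wire_ok D (WN i x a b (q mod n))"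
    if "q < n * n" "a <= n" "b <= n" for q a b
    using pair_lt[OF that(1)] that x by simp_all
   have kn: "known ?Dn (enc D (WN i x (Suc j) t (q div n)))" "known ?Dn (enc D (WN i x (Suc j) t (q mod n)))"
    "known ?Dn (enc D (WN i x j n (q div n)))" if "q < n * n" for q
    using wk[OF that, of "Suc j" t] wk[OF that, of j n] pair_lt[OF that] prev Sj j t
    by (simp_all only: known_simps)
   have av: "aval (enc D (WN i x (Suc j) t (q div n))) = (q div n : stage i x (Suc j) t)"
    "aval (enc D (WN i x (Suc j) t (q mod n))) = (q mod n : stage i x (Suc j) t)"
    "aval (enc D (WN i x j n (q div n))) = (q div n : stage i x j n)" if "q < n * n" for q
    using wk[OF that, of "Suc j" t] wk[OF that, of j n] j t by simp_all
   have id: "y : stage i x (Suc j) (Suc t) \<longleftrightarrow>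
     (EX q<n * n. h (TB + q div n * n + q mod n) = y & q div n : stage i x (Suc j) t & q mod n : stage i x (Suc j) t)
     \<or> (EX q<n * n. h (TB + y * n + q div n) = h (TB + q div n * n + q mod n) & q div n : stage i x j n & q mod n : stage i x (Suc j) t)"
    unfolding stage_Suc cstep_iff[OF stage_sub[OF x] stage_sub[OF x] y]
    using ex_pair[of "%u v. h (TB + u * n + v) = y & u : stage i x (Suc j) t & v : stage i x (Suc j) t"]
     ex_pair[of "%s u. h (TB + y * n + s) = h (TB + s * n + u) & s : stage i x j n & u : stage i x (Suc j) t"]
    by simp
   show ?thesis
    apply (rule ct_node[where wr = "WN i x (Suc j) (Suc t) y"])
    subgoal using g g' by simp
    subgoal using g g' by (simp add: genvD)
    subgoal using g g' by (simp add: genvD)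
    subgoal using x j t y by simp
    apply (rule fr)
    apply simp
    subgoal using big g g' by (simp add: genvD)
    subgoal using g g' kn by (simp add: genvD del: known_simps)
    subgoal using g g' av id by (simp add: genvD del: aval_simps cong: conj_cong) blast
    subgoal by (auto simp: less_Suc_eq)
    done
  qed
  subgoal by auto
  subgoal by (auto simp: less_Suc_eq)
  done
 by auto

lemma ct_n: "ct g n_cmd S1 S2"
 unfolding n_cmd_def S2_def
 apply (rule ct_For[where k = n and Dn = "%m. S1 Un NW m"])
 subgoal using g by (simp add: genvD)
 subgoal for x
  apply (rule ct_Sq)
   apply (rule ct_n0[where x = x])
  subgoal by assumption
  apply simp
  subgoal by (auto simp: S1_def NW_def)
  apply (rule ct_For[where k = n and Dn = "%m. S1 Un NW x Un {WN i x 0 n y | y. y < n}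
    Un {WN i x (Suc j) t y | j t y. j < m & t <= n & y < n}"])
  subgoal using g by (simp add: genvD)
  subgoal for j
  proof -
   assume x: "x < n" and j: "j < n"
   let ?A = "S1 Un NW x Un {WN i x 0 n y | y. y < n} Un {WN i x (Suc j') t y | j' t y. j' < j & t <= n & y < n}"
   let ?B = "?A Un {WN i x (Suc j) 0 y | y. y < n}"
   have 1: "ct (g(21 := x, 22 := j)) n1_cmd ?A ?B"
    by (rule ct_n1[OF x j refl]) (auto simp: S1_def NW_def)
   have 2: "ct (g(21 := x, 22 := j)) n2_cmd ?B (?B Un {WN i x (Suc j) (Suc t) y | t y. t < n & y < n})"
   proof (rule ct_n2[OF x j refl])
    show "WN i x (Suc j) (Suc t) y ~: ?B" for t y by (auto simp: S1_def NW_def)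
    show "WN i x (Suc j) 0 y : ?B" if "y < n" for y using that by auto
    show "WN i x j n y : ?B" if "y < n" for y using that j by (cases j) auto
   qed
   have "{WN i x (Suc j') t y | j' t y. j' < Suc j & t <= n & y < n} =
     {WN i x (Suc j') t y | j' t y. j' < j & t <= n & y < n} Un {WN i x (Suc j) 0 y | y. y < n}
     Un {WN i x (Suc j) (Suc t) y | t y. t < n & y < n}" (is "?L = ?R")
   proof (intro equalityI subsetI)
    fix w assume "w : ?L"
    then obtain j' t y where w: "w = WN i x (Suc j') t y" "j' < Suc j" "t <= n" "y < n" by blast
    thus "w : ?R" by (cases t) (auto simp: less_Suc_eq)
   qed (auto simp: less_Suc_eq)
   note eqL = this
   have e: "S1 Un NW x Un {WN i x 0 n y | y. y < n} Un {WN i x (Suc j') t y | j' t y. j' < Suc j & t <= n & y < n}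
     = ?B Un {WN i x (Suc j) (Suc t) y | t y. t < n & y < n}" unfolding eqL by (simp only: Un_assoc)
   show ?thesis unfolding e by (rule ct_Sq[OF 1 2])
  qed
  subgoal by auto
  subgoal by (auto simp: NW_def less_Suc_eq)
  done
 by (auto simp: NW_def)

lemma NW_mem: "x < n ==> y < n ==> WN i x n n y : NW n"
proof -
 assume xy: "x < n" "y < n"
 obtain m where m: "n = Suc m" using n_pos gr0_implies_Suc by blast
 hence "m < n" by simp
 hence "WN i x (Suc m) n y : NW n" unfolding NW_def using xy by blast
 thus ?thesis using m by simp
qed

lemma ct_z: "ct g z_cmd S2 S3"
 unfolding z_cmd_def S3_def
 apply (rule ct_For[where k = n and Dn = "%m. S2 Un {WZ i x y | x y. x < m & y < n}"])
 subgoal using g by (simp add: genvD)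
 subgoal for x
  apply (rule ct_For[where k = n and Dn = "%m. S2 Un {WZ i x' y | x' y. x' < x & y < n} Un {WZ i x y | y. y < m}"])
  subgoal using g by (simp add: genvD)
  subgoal for y
   by (rule ct_node[where wr = "WZ i x y"])
     (use big g KA NW_mem in "auto simp: genvD less_Suc_eq S2_def S1_def NW_def[of n] stage_closure")
  by (auto simp: less_Suc_eq)
 by auto

lemma ct_t: "ct g t_cmd S3 S4"
 unfolding t_cmd_def S4_def
 apply (rule ct_For[where k = n and Dn = "%m. S3 Un {WT i x | x. x < m}"])
 subgoal using g by (simp add: genvD)
 subgoal for x
  apply (rule ct_node[where wr = "WT i x"])
  subgoal using g by simp
  subgoal using g by (simp add: genvD)
  subgoal using g by (simp add: genvD)
  apply simp
  subgoal by (auto simp: S3_def S2_def S1_def NW_def)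
  apply simp
  subgoal using big g by (simp add: genvD)
  subgoal using g KA NW_mem by (simp add: genvD S3_def S2_def S1_def)
  subgoal using g choices_iff[of x i] by (simp add: genvD cong: conj_cong)
  subgoal by (auto simp: less_Suc_eq)
  done
 by auto

lemma ct_u: "ct g u_cmd S4 S5"
 unfolding u_cmd_def S5_def
 apply (rule ct_For[where k = n and Dn = "%m. S4 Un {WU i x | x. x < m}"])
 subgoal using g by (simp add: genvD)
 subgoal for x
  by (rule ct_node[where wr = "WU i x"])
    (use big g in "auto simp: genvD less_Suc_eq S4_def S3_def S2_def S1_def NW_def")
 by auto

lemma ct_k: "ct g k_cmd S7 S8"
 unfolding k_cmd_def S8_def
 apply (rule ct_For[where k = n and Dn = "%m. S7 Un {WK (Suc i) y | y. y < m}"])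
 subgoal using g by (simp add: genvD)
 subgoal for y
  apply (rule ct_node[where wr = "WK (Suc i) y"])
  subgoal using g by simp
  subgoal using g by (simp add: genvD)
  subgoal using g by (simp add: genvD)
  apply simp
  subgoal by (auto simp: S7_def S6_def S5_def S4_def S3_def S2_def S1_def NW_def)
  apply simp
  subgoal using big g by (simp add: genvD)
  subgoal using g NW_mem n_pos by (simp add: genvD S7_def S6_def S5_def S4_def S3_def S2_def less_imp_le)
  subgoal using g next_iff[of y i] n_pos by (auto simp add: genvD less_imp_le simp del: chain.simps cong: conj_cong)
  subgoal by (auto simp: less_Suc_eq)
  done
 by auto

lemma ct_o: "ct g o_cmd S6 S7"
 unfolding o_cmd_def S7_def
 apply (rule ct_For[where k = "2 * n * n" and Dn = "%m. S6 Un {WO i (Suc t) k | t k. t < m & k < 2 * n} Un {WP i t | t. t < m}"])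
 subgoal using g by (simp add: genvD)
 subgoal for t
 proof -
  assume t: "t < 2 * n * n"
  let ?A = "S6 Un {WO i (Suc t') k | t' k. t' < t & k < 2 * n} Un {WP i t' | t'. t' < t}"
  have tm: "t mod n < n" using n_pos by simp
  have T: "WT i (t mod n) : ?A" "WU i (t mod n) : ?A" using tm by (auto simp: S6_def S5_def S4_def)
  have O: "WO i t k : ?A" if "k < 2 * n" for k using that by (cases t) (auto simp: S6_def)
  have fr: "WO i (Suc t) k ~: ?A" "WP i t ~: ?A" for k
   by (auto simp: S6_def S5_def S4_def S3_def S2_def S1_def NW_def)
  have c1: "ct (g(23 := t)) (For True 25 (V 13) (node False (eO (V 20) (Op Plus (V 23) (N 1)) (V 25))
   [(18, N 0, less_exp (Op Plus (V 25) (N 1)) (V 13),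
     eT (V 20) (mod_exp (V 23) (V 1)), eO (V 20) (V 23) (Op Plus (V 25) (N 1))),
    (18, N 1, N 1, eU (V 20) (mod_exp (V 23) (V 1)), eO (V 20) (V 23) (V 25))]))
   ?A (?A Un {WO i (Suc t) k | k. k < 2 * n})"
   apply (rule ct_For[where k = "2 * n" and Dn = "%m. ?A Un {WO i (Suc t) k | k. k < m}"])
   subgoal using g by (simp add: genvD)
   subgoal for k
    apply (rule ct_node[where wr = "WO i (Suc t) k"])
    subgoal using g by simp
    subgoal using g by (simp add: genvD)
    subgoal using g by (simp add: genvD)
    subgoal using t by simp
    subgoal using fr by auto
    apply simp
    subgoal using big g by (simp add: genvD)
    subgoal using g T O t tm by (simp add: genvD less_imp_le)
    subgoal using g t tm r_bound[of i] visits_Suc[of n "opts i" t] by (auto simp add: genvD less_imp_le)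
    subgoal by (auto simp: less_Suc_eq)
    done
   by auto
  have c2: "ct (g(23 := t)) (node False (eP (V 20) (V 23))
   [(18, N 0, N 1, eT (V 20) (mod_exp (V 23) (V 1)), eO (V 20) (V 23) (N 0))])
   (?A Un {WO i (Suc t) k | k. k < 2 * n}) (insert (WP i t) (?A Un {WO i (Suc t) k | k. k < 2 * n}))"
   apply (rule ct_node[where wr = "WP i t"])
   subgoal using g by simp
   subgoal using g by (simp add: genvD)
   subgoal using g by (simp add: genvD)
   subgoal using t by simp
   subgoal using fr by auto
   apply simp
   subgoal using big g by (simp add: genvD)
   subgoal using g T O[of 0] n_pos t tm by (simp add: genvD less_imp_le)
   subgoal using g t tm by (simp add: genvD less_imp_le)
   apply simp
   done
  have e: "insert (WP i t) (?A Un {WO i (Suc t) k | k. k < 2 * n})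
    = S6 Un {WO i (Suc t') k | t' k. t' < Suc t & k < 2 * n} Un {WP i t' | t'. t' < Suc t}"
  proof -
   have "{WO i (Suc t') k | t' k. t' < Suc t & k < 2 * n}
     = {WO i (Suc t') k | t' k. t' < t & k < 2 * n} Un {WO i (Suc t) k | k. k < 2 * n}"
    by (auto simp: less_Suc_eq)
   moreover have "{WP i t' | t'. t' < Suc t} = insert (WP i t) {WP i t' | t'. t' < t}" by (auto simp: less_Suc_eq)
   ultimately show ?thesis by (simp only: Un_insert_right Un_insert_left Un_ac)
  qed
  show ?thesis using ct_Sq[OF c1 c2] unfolding e .
 qed
 by auto

lemma low_region: "4 + i * n + n <= D ^ 6"
proof -
 have "Suc i * n <= n * n" using i by (intro mult_le_mono1) simp
 hence "4 + i * n + n <= D" unfolding D_def by simp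
 also have "D = D ^ 1" by simp
 also have "D ^ 1 <= D ^ 6" using big by (intro power_increasing) auto
 finally show ?thesis .
qed

lemma ct_o0: "ct g o0_cmd S5 S6"
 unfolding o0_cmd_def S6_def
 apply (rule ct_For[where k = "2 * n" and Dn = "%m. S5 Un {WO i 0 k | k. k < m}"])
 subgoal using g by (simp add: genvD)
 subgoal for k
  unfolding ct_def
 proof (intro allI impI)
  fix S assume k: "k < 2 * n" and S: "state (S5 Un {WO i 0 k' | k'. k' < k}) S"
  let ?w = "WO i 0 k"
  have ok: "wire_ok D ?w" using k by simp
  have fr: "?w ~: S5 Un {WO i 0 k' | k'. k' < k}" by (auto simp: S5_def S4_def S3_def S2_def S1_def NW_def)
  have lowS: "S Int {..<D ^ 6} = low" using S by (simp add: state_def)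
  have "address (4 + i * n) n S = address (4 + i * n) n low"
  proof (rule address_cong)
   fix j assume "j < n"
   hence "4 + i * n + j < D ^ 6" using low_region by simp
   thus "4 + i * n + j : S \<longleftrightarrow> 4 + i * n + j : low" using lowS by blast
  qed
  hence ad: "address (4 + i * n) n S = r i" using r_def by simp
  \<comment> \<open>The read hits \<open>zc\<close> exactly for \<open>r i = k\<close>; otherwise it
    ends at one of the zero cells within \<open>2 * n\<close> below \<open>zc\<close> or at one
    above it.\<close>
  have hz: "h (zc - k + r i) ~= 0 \<longleftrightarrow> r i = k"
  proof (cases "r i" k rule: linorder_cases)
   case less
   hence "zc - k + r i = zc - (k - r i)" using zc(4) k by simp
   thus ?thesis using zc(3)[of "k - r i"] less k by simp
  next
   case equal
   thus ?thesis using zc(1,4) k by simp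
  next
   case greater
   hence "zc - k + r i = zc + (r i - k)" using zc(4) k by simp
   thus ?thesis using zc(2)[of "r i - k"] greater by simp
  qed
  have nt: "enc D ?w ~: {4 + i * n..<4 + i * n + n}" using enc_ge[of D ?w] low_region by auto
  have nS: "S Int {enc D ?w..<enc D ?w + D} = {}" using S ok fr unfolding state_def by presburger
  hence nS1: "enc D ?w ~: S" using big by auto
  have eR: "gates f (QL (Op Minus (V 7) (V 25)) (Op Plus (N 4) (Op Times (V 20) (V 1))) (V 1) (eO (V 20) (N 0) (V 25)))
    (g(25 := k)) h = [read_map h (zc - k) (4 + i * n) n (enc D ?w)]" using g by (simp add: genvD)
  have rd: "read_map h (zc - k) (4 + i * n) n (enc D ?w) S = S Un (if r i = k then {enc D ?w} else {})"
   unfolding read_map_def ad using hz nt nS1 by (cases "r i = k") auto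
  have R: "runs (gates f (QL (Op Minus (V 7) (V 25)) (Op Plus (N 4) (Op Times (V 20) (V 1))) (V 1) (eO (V 20) (N 0) (V 25)))
    (g(25 := k)) h) S = S Un (if r i = k then {enc D ?w} else {})" (is "?R = _")
   unfolding eR using rd by simp
  show "state (S5 Un {WO i 0 k' | k'. k' < Suc k}) ?R"
  proof -
   have e: "S5 Un {WO i 0 k' | k'. k' < Suc k} = insert ?w (S5 Un {WO i 0 k' | k'. k' < k})" by (auto simp: less_Suc_eq)
   show ?thesis unfolding R e state_def
   proof (intro conjI allI impI)
    show "(S Un (if r i = k then {enc D ?w} else {})) Int {..<D ^ 6} = low"
     using lowS enc_ge[of D ?w] by auto
    fix w' assume w': "wire_ok D w'"
    show "if w' : insert ?w (S5 Un {WO i 0 k' | k'. k' < k})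
      then (enc D w' : S Un (if r i = k then {enc D ?w} else {})) = ideal w'
      else (S Un (if r i = k then {enc D ?w} else {})) Int {enc D w'..<enc D w' + D} = {}"
    proof (cases "w' = ?w")
     case True
     thus ?thesis using nS1 by auto
    next
     case False
     have "enc D ?w ~: {enc D w'..<enc D w' + D}"
     proof
      assume "enc D ?w : {enc D w'..<enc D w' + D}"
      hence "enc D w' + (enc D ?w - enc D w') = enc D ?w + 0" "enc D ?w - enc D w' < D" by auto
      thus False using block_disjoint[OF w' ok, of "enc D ?w - enc D w'" 0] False big by auto
     qed
     moreover have "enc D w' ~= enc D ?w" using enc_eq[OF w' ok] False by simp
     ultimately show ?thesis using S w' False unfolding state_def by auto
    qed
   qed
  qed
 qed
 by auto

lemma ct_level: "ct g level_cmd A0 S8"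
 unfolding level_cmd_def
 by (rule ct_Sq[OF ct_e] ct_Sq[OF ct_n] ct_Sq[OF ct_z] ct_Sq[OF ct_t] ct_Sq[OF ct_u] ct_Sq[OF ct_o0] ct_Sq[OF ct_o] ct_k)+

lemma S8_props: "A0 \<subseteq> S8" "!!y. y < n ==> WK (Suc i) y : S8" "!!w. w : S8 ==> made w <= Suc i"
proof -
 show "A0 \<subseteq> S8" by (auto simp: S8_def S7_def S6_def S5_def S4_def S3_def S2_def S1_def)
 show "!!y. y < n ==> WK (Suc i) y : S8" by (auto simp: S8_def)
 show "made w <= Suc i" if "w : S8" for w
  using that A0 by (auto simp: S8_def S7_def S6_def S5_def S4_def S3_def S2_def S1_def NW_def le_SucI)
qed

end

lemma chain_correct:
 assumes g: "genv g" and S: "state {} S"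
 shows "EX Dn. state Dn (runs (gates f chain_cmd g h) S) & (ALL i<n. ALL y<n. WK i y : Dn)"
proof -
 define P where "P m Dn \<longleftrightarrow> (ALL w:Dn. made w <= m) & (ALL i<=m. ALL y<n. WK i y : Dn)" for m and Dn :: "wire set"
 have step: "EX Dn'. ct (g(20 := i)) level_cmd Dn Dn' & P (Suc i) Dn'" if "i < n - 1" "P i Dn" for i Dn
 proof -
  have a: "i < n - 1" "!!w. w : Dn ==> made w <= i" "!!y. y < n ==> WK i y : Dn" "genv (g(20 := i))" "(g(20 := i)) 20 = i"
   using that g by (auto simp: P_def)
  have "ct (g(20 := i)) level_cmd Dn (S8 i Dn)" by (rule ct_level[OF a])
  moreover have "P (Suc i) (S8 i Dn)"
   unfolding P_def using S8_props[OF a] that(2) by (auto simp: P_def le_Suc_eq)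
  ultimately show ?thesis by blast
 qed
 have "EX Dn. state Dn (runs (gates f init_cmd g h @ concat (map (%t. gates f level_cmd (g(20 := t)) h) [0..<m])) S) & P m Dn"
  if "m <= n - 1" for m
  using that
 proof (induction m)
  case 0
  have "state {WK 0 y | y. y < n} (runs (gates f init_cmd g h) S)"
   using ct_init[OF g] S unfolding ct_def by blast
  thus ?case by (intro exI[of _ "{WK 0 y | y. y < n}"]) (auto simp: P_def)
 next
  case (Suc m)
  obtain Dn where Dn: "state Dn (runs (gates f init_cmd g h @ concat (map (%t. gates f level_cmd (g(20 := t)) h) [0..<m])) S)" "P m Dn"
   using Suc.IH Suc.prems by (auto simp del: fun_upd_apply)
  obtain Dn' where "ct (g(20 := m)) level_cmd Dn Dn'" "P (Suc m) Dn'" using step[of m Dn] Suc Dn by auto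
  thus ?case using Dn(1) unfolding ct_def by (intro exI[of _ Dn']) (simp del: fun_upd_apply)
 qed
 note all = this
 obtain Dn where
  Dn: "state Dn (runs (gates f init_cmd g h @ concat (map (%t. gates f level_cmd (g(20 := t)) h) [0..<n - 1])) S)" "P (n - 1) Dn"
  using all[of "n - 1"] by blast
 moreover have "gates f chain_cmd g h = gates f init_cmd g h @ concat (map (%t. gates f level_cmd (g(20 := t)) h) [0..<n - 1])"
  unfolding chain_cmd_def using g by (simp add: genvD range_dir_def del: fun_upd_apply)
 ultimately show ?thesis using n_pos by (intro exI[of _ Dn]) (auto simp: P_def simp del: fun_upd_apply)
qed

end

section \<open>The canonical form of the chain\<close>

lemma triple_index_inj:
 fixes n :: nat
 assumes "(i * n + j) * n + a = (i' * n + j') * n + a'" "j < n" "j' < n" "a < n" "a' < n"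
 shows "i = i' & j = j' & a = a'"
proof -
 have "a = a'" using arg_cong[OF assms(1), of "%z. z mod n"] assms(4,5) by (metis mod_less mod_mult_self3)
 hence e: "i * n + j = i' * n + j'" using assms by simp
 hence "j = j'" using arg_cong[OF e, of "%z. z mod n"] assms(2,3) by (metis mod_less mod_mult_self3)
 thus ?thesis using e assms \<open>a = a'\<close> by auto
qed

lemma pair_index_inj:
 fixes n :: nat
 assumes "i * n + a = i' * n + a'" "a < n" "a' < n"
 shows "i = i' & a = a'"
proof -
 have "a = a'" using arg_cong[OF assms(1), of "%z. z mod n"] assms(2,3) by (metis mod_less mod_mult_self3)
 thus ?thesis using assms by auto
qed

lemma pair_index_lt:
 fixes n :: nat
 assumes "i < m" "a < n"
 shows "i * n + a < m * n"
proof -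
 have "i * n + a < Suc i * n" using assms by simp
 also have "... <= m * n" using assms by (intro mult_le_mono1) simp
 finally show ?thesis .
qed

text \<open>The conditions under which the encoding is injective: with terms nonempty and at most
  \<open>n\<close> in number, the padding by empty sets reveals the length of the series.\<close>

definition series_ok :: "nat => series => bool" where
 "series_ok n S \<longleftrightarrow> length (fst S) = n & (ALL r:set (fst S). length r = n) & (ALL i<n. ALL j<n. fst S ! i ! j < n)
   & length (snd S) <= n & (ALL A:set (snd S). A ~= {} & A <= {..<n})"

lemma table_entry_lt:
 assumes "group_table n M" "i < n" "j < n"
 shows "M ! i ! j < n"
proof -
 have "i \<otimes>\<^bsub>table_group M\<^esub> j : carrier (table_group M)"
  using assms by (intro monoid.m_closed[OF group.is_monoid]) (auto simp: group_table_def table_group_def)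
 thus ?thesis using assms(1) by (auto simp: group_table_def table_group_def)
qed

text \<open>Covers a series itself, with the identity as \<open>\<psi>\<close>, and its canonical
  form. The terms grow strictly from one element on, which bounds their number by
  \<open>n\<close>.\<close>

lemma series_ok_comp:
 assumes "group_table n M" "subnormal_series (table_group M) Gs" "length Gs = length Hs"
  and inj: "!!i. i < length Gs ==> Hs ! i = \<psi> ` (Gs ! i)" "\<psi> ` carrier (table_group M) <= {..<n}"
  and M': "group_table n M'"
 shows "series_ok n (M', Hs)"
proof -
 have c: "carrier (table_group M) = {..<n}" using assms(1) by (auto simp: group_table_def table_group_def)
 have sg: "subgroup A (table_group M)" if "A : set Gs" for A using assms(2) that by (auto simp: subnormal_series_def)
 have sub: "Gs ! i <= {..<n}" "Gs ! i ~= {}" if "i < length Gs" for i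
  using subgroup.subset[OF sg, of "Gs ! i"] subgroup.one_closed[OF sg, of "Gs ! i"] that c by auto
 have card: "i < card (Gs ! i)" if "i < length Gs" for i
  using that
 proof (induction i)
  case 0
  thus ?case using sub[of 0] by (metis card_gt_0_iff finite_lessThan finite_subset)
 next
  case (Suc i)
  have "Gs ! i \<subset> Gs ! Suc i" using assms(2) Suc.prems by (auto simp: subnormal_series_def)
  hence "card (Gs ! i) < card (Gs ! Suc i)"
   using sub[of "Suc i"] Suc.prems by (intro psubset_card_mono) (auto intro: finite_subset)
  thus ?case using Suc by simp
 qed
 have "length Gs <= n"
 proof (cases "length Gs")
  case (Suc m)
  hence "m < card (Gs ! m)" using card[of m] by simp
  moreover have "card (Gs ! m) <= card {..<n}" using sub[of m] Suc by (intro card_mono) auto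
  ultimately show ?thesis using Suc by simp
 qed simp
 moreover have "A ~= {} & A <= {..<n}" if A: "A : set Hs" for A
 proof -
  obtain i where i: "i < length Hs" "A = Hs ! i" using A by (metis in_set_conv_nth)
  hence "A = \<psi> ` (Gs ! i)" using inj(1)[of i] assms(3) by simp
  thus ?thesis using sub[of i] i inj(2) assms(3) c by auto
 qed
 ultimately show ?thesis using M' table_entry_lt[OF M'] assms(3) by (auto simp: series_ok_def group_table_def)
qed

lemma comp_series_ok: "comp_series n S ==> series_ok n S"
proof -
 assume S: "comp_series n S"
 hence g: "group_table n (fst S)" by (simp add: comp_series_def)
 hence "id ` carrier (table_group (fst S)) <= {..<n}" by (auto simp: group_table_def table_group_def)
 hence "series_ok n (fst S, snd S)"
  using S g by (intro series_ok_comp[of n "fst S" "snd S" _ id]) (auto simp: comp_series_def composition_series_def)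
 thus ?thesis by simp
qed

lemma encode_table_iff:
 assumes "series_ok n S" "i < n" "j < n" "a < n"
 shows "(i * n + j) * n + a : encode_series n S \<longleftrightarrow> fst S ! i ! j = a"
proof -
 have "i * n + j < n * n" using pair_index_lt assms by blast
 hence lt: "(i * n + j) * n + a < n ^ 3" using pair_index_lt[of "i * n + j" "n * n" a n] assms by (simp add: power3_eq_cube)
 show ?thesis
 proof
  assume "(i * n + j) * n + a : encode_series n S"
  then obtain i' j' where ij: "i' < n" "j' < n" "(i * n + j) * n + a = (i' * n + j') * n + fst S ! i' ! j'"
   using lt unfolding encode_series_def by fastforce
  hence "fst S ! i' ! j' < n" using assms(1) by (simp add: series_ok_def)
  thus "fst S ! i ! j = a" using triple_index_inj[OF ij(3)] assms ij by blast
 qed (use assms in "auto simp: encode_series_def")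
qed

lemma encode_terms_iff:
 assumes "series_ok n S" "i < n" "x < n"
 shows "n ^ 3 + i * n + x : encode_series n S \<longleftrightarrow> i < length (snd S) & x : snd S ! i"
proof
 assume "n ^ 3 + i * n + x : encode_series n S"
 moreover have "n ^ 3 + i * n + x ~= (i' * n + j') * n + fst S ! i' ! j'" if "i' < n" "j' < n" for i' j'
 proof -
  have "i' * n + j' < n * n" "fst S ! i' ! j' < n" using pair_index_lt assms that by (auto simp: series_ok_def)
  hence "(i' * n + j') * n + fst S ! i' ! j' < n ^ 3"
   using pair_index_lt[of "i' * n + j'" "n * n"] by (simp add: power3_eq_cube)
  thus ?thesis by simp
 qed
 ultimately obtain i' x' where i': "i' < length (snd S)" "x' : snd S ! i'" "i * n + x = i' * n + x'"
  unfolding encode_series_def by auto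
 hence "x' < n" using assms(1) by (auto simp: series_ok_def dest!: nth_mem)
 thus "i < length (snd S) & x : snd S ! i" using pair_index_inj[OF i'(3)] i' assms by auto
qed (auto simp: encode_series_def)

lemma encode_series_inj:
 assumes "series_ok n S" "series_ok n S'" "encode_series n S = encode_series n S'"
 shows "S = S'"
proof (rule prod_eqI)
 show "fst S = fst S'"
 proof (rule nth_equalityI)
  show l: "length (fst S) = length (fst S')" using assms by (simp add: series_ok_def)
  fix i assume i: "i < length (fst S)"
  hence i': "i < n" using assms(1) by (simp add: series_ok_def)
  show "fst S ! i = fst S' ! i"
  proof (rule nth_equalityI)
   have len: "length (fst S ! i) = n" "length (fst S' ! i) = n" using i l assms by (auto simp: series_ok_def)
   thus "length (fst S ! i) = length (fst S' ! i)" by simp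
   fix j assume "j < length (fst S ! i)"
   hence j: "j < n" using len by simp
   have a: "fst S ! i ! j < n" using assms(1) i' j by (simp add: series_ok_def)
   show "fst S ! i ! j = fst S' ! i ! j"
    using encode_table_iff[OF assms(1) i' j a] encode_table_iff[OF assms(2) i' j a] assms(3) by simp
  qed
 qed
 have iff: "i < length (snd S) & x : snd S ! i \<longleftrightarrow> i < length (snd S') & x : snd S' ! i" if "i < n" "x < n" for i x
  using encode_terms_iff[OF assms(1) that] encode_terms_iff[OF assms(2) that] assms(3) by simp
 have nonempty: "EX x<n. x : snd Z ! i" "i < n" if "series_ok n Z" "i < length (snd Z)" for Z :: series and i
 proof -
  have "snd Z ! i ~= {} & snd Z ! i <= {..<n}" "length (snd Z) <= n" using that by (auto simp: series_ok_def)
  thus "EX x<n. x : snd Z ! i" "i < n" using that(2) by auto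
 qed
 have li: "i < length (snd S) \<longleftrightarrow> i < length (snd S')" for i
  using nonempty[OF assms(1), of i] nonempty[OF assms(2), of i] iff[of i] by blast
 have l: "length (snd S) = length (snd S')" using li by (metis linorder_neqE_nat less_irrefl)
 show "snd S = snd S'"
 proof (rule nth_equalityI[OF l])
  fix i assume i: "i < length (snd S)"
  have "snd S ! i <= {..<n}" "snd S' ! i <= {..<n}" "i < n" using assms(1,2) i l nonempty(2)[OF assms(1) i] by (auto simp: series_ok_def)
  thus "snd S ! i = snd S' ! i" using iff[of i] i l by auto
 qed
qed

lemma code_length_inj: "code_length m = code_length n ==> m = n"
proof (rule ccontr)
 assume e: "code_length m = code_length n" and "m ~= n"
 then consider "m < n" | "n < m" by linarith
 thus False
 proof cases
  case 1
  hence "m ^ 3 < n ^ 3" "m ^ 2 < n ^ 2" by (auto intro: power_strict_mono)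
  thus False using e by (simp add: code_length_def)
 next
  case 2
  hence "n ^ 3 < m ^ 3" "n ^ 2 < m ^ 2" by (auto intro: power_strict_mono)
  thus False using e by (simp add: code_length_def)
 qed
qed

lemma canonization_oracle_eq:
 assumes "comp_series n S"
 shows "canonization_oracle Can (code_length n) (encode_series n S) = encode_series n (Can S)"
proof -
 have "{encode_series n' (Can S') | n' S'. comp_series n' S' & code_length n' = code_length n & encode_series n' S' = encode_series n S}
   = {encode_series n (Can S)}"
 proof (intro equalityI subsetI)
  fix X assume "X : {encode_series n' (Can S') | n' S'. comp_series n' S' & code_length n' = code_length n & encode_series n' S' = encode_series n S}"
  then obtain n' S' where s: "X = encode_series n' (Can S')" "comp_series n' S'" "code_length n' = code_length n"
   "encode_series n' S' = encode_series n S" by blast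
  hence "n' = n" using code_length_inj by blast
  hence "S' = S" using encode_series_inj[of n S' S] comp_series_ok s assms by blast
  thus "X : {encode_series n (Can S)}" using s \<open>n' = n\<close> by simp
 qed (use assms in blast)
 thus ?thesis unfolding canonization_oracle_def by simp
qed

lemma canonization_ok:
 assumes "canonization Can" "comp_series n S"
 shows "series_ok n (Can S)"
proof -
 obtain M \<psi> where M: "group_table n M" "\<psi> : iso (table_group (fst S)) (table_group M)" "Can S = (M, map (image \<psi>) (snd S))"
  using assms unfolding canonization_def by blast
 have "\<psi> ` carrier (table_group (fst S)) <= {..<n}"
  using M(1,2) by (auto simp: iso_def hom_def group_table_def table_group_def)
 thus ?thesis unfolding M(3)
  using assms(2) M(1) by (intro series_ok_comp[of n "fst S" "snd S" _ \<psi>]) (auto simp: comp_series_def composition_series_def)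
qed

lemma canonical_codes_iff:
 assumes "canonization Can" "comp_series n S" "comp_series n S'"
 shows "encode_series n (Can S) = encode_series n (Can S') \<longleftrightarrow> series_iso S S'"
 using encode_series_inj[OF canonization_ok[OF assms(1,2)] canonization_ok[OF assms(1,3)]] assms
 unfolding canonization_def by metis

lemma encode_lt:
 assumes "series_ok n S" "k : encode_series n S"
 shows "k < code_length n"
proof -
 have "k < n ^ 3 + n ^ 2"
  using assms(2) unfolding encode_series_def
 proof (elim UnE CollectE exE conjE)
  fix i j assume k: "k = (i * n + j) * n + fst S ! i ! j" "i < n" "j < n"
  hence "i * n + j < n * n" "fst S ! i ! j < n" using pair_index_lt assms by (auto simp: series_ok_def)
  hence "(i * n + j) * n + fst S ! i ! j < n ^ 3"
   using pair_index_lt[of "i * n + j" "n * n"] by (simp add: power3_eq_cube)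
  thus ?thesis using k by simp
 next
  fix i x assume k: "k = n ^ 3 + i * n + x" "i < length (snd S)" "x : snd S ! i"
  hence "i < n" "x < n" using assms(1) by (auto simp: series_ok_def dest!: nth_mem)
  hence "i * n + x < n * n" using pair_index_lt by blast
  thus ?thesis using k by (simp add: power2_eq_square)
 qed
 thus ?thesis by (simp add: code_length_def)
qed

section \<open>Copying the series and querying the oracle\<close>

lemma run_For:
 assumes "ev e g h = k" "!!t. t < k ==> runs (gates f c (g(v := t)) h) (S t) = S (Suc t)"
 shows "runs (gates f (For True v e c) g h) (S 0) = S k"
proof -
 have "runs (concat (map (%t. gates f c (g(v := t)) h) [0..<m])) (S 0) = S m" if "m <= k" for m
  using that by (induction m) (use assms(2) in "simp_all del: fun_upd_apply")
 thus ?thesis using assms(1) by (simp add: range_dir_def del: fun_upd_apply)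
qed

text \<open>\<open>D * D\<close> is at least the length of a code, so the input string from
  \<open>D * D\<close> on and the output string from \<open>2 * D * D\<close> on are disjoint, and
  both end below the wires because of \<open>3 * (D * D) <= D ^ 6\<close>.\<close>

definition "x_base = Op Times (V 8) (V 8)"
definition "y_base = Op Times (N 2) x_base"

definition "copy1_cmd = For True 20 (V 1) (For True 21 (V 1) (Tof (N 0) (N 0)
 (Op Plus (Op Plus x_base (Op Times (Op Plus (Op Times (V 20) (V 1)) (V 21)) (V 1))) (mult_exp (V 20) (V 21)))))"

definition "copy2_cmd = For True 20 (V 1) (For True 24 (V 1) (Tof (eK (V 20) (V 24)) (eK (V 20) (V 24))
 (Op Plus (Op Plus (Op Plus x_base (Op Times (V 17) (V 1))) (Op Times (V 20) (V 1))) (V 24))))"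

definition "query_cmd = Qu (V 4) x_base y_base"

definition "series_cmd = Sq chain_cmd (Sq copy1_cmd (Sq copy2_cmd query_cmd))"

context circuit begin

lemma copy1_run:
 assumes g: "genv g" and S: "0 : S" "S Int {D * D..<D * D + n ^ 3} = {}"
 shows "runs (gates f copy1_cmd g h) S = S Un {D * D + (i * n + j) * n + i \<otimes> j | i j. i < n & j < n}"
proof -
 define S1 where "S1 i j = S Un {D * D + (i' * n + j') * n + i' \<otimes> j' | i' j'. i' < i & j' < n}
   Un {D * D + (i * n + j') * n + i \<otimes> j' | j'. j' < j}" for i j
 have ent: "u \<otimes> v < n" if "u < n" "v < n" for u v
  using monoid.m_closed[OF group.is_monoid[OF grp], of u v] that carr by auto
 have inner: "runs (gates f (For True 21 (V 1) (Tof (N 0) (N 0)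
  (Op Plus (Op Plus x_base (Op Times (Op Plus (Op Times (V 20) (V 1)) (V 21)) (V 1))) (mult_exp (V 20) (V 21))))) (g(20 := i)) h) (S1 i 0) = S1 i n"
  if i: "i < n" for i
 proof (rule run_For)
  show "ev (V 1) (g(20 := i)) h = n" using g by (simp add: genvD)
  fix j assume j: "j < n"
  let ?t = "D * D + (i * n + j) * n + i \<otimes> j"
  have "(i * n + j) * n + i \<otimes> j < n ^ 3"
   using pair_index_lt[of "i * n + j" "n * n" "i \<otimes> j" n] pair_index_lt[OF i j] ent[OF i j] by (simp add: power3_eq_cube)
  hence tS: "?t ~: S" using S(2) by auto
  have t1: "?t ~= D * D + (i' * n + j') * n + i' \<otimes> j'" if "i' < n" "j' < n" "i' ~= i \<or> j' ~= j" for i' j'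
   using triple_index_inj[of i n j "i \<otimes> j" i' j' "i' \<otimes> j'"] ent[OF i j] ent[OF that(1,2)] j that by auto
  have nin: "?t ~: S1 i j"
  proof
   assume "?t : S1 i j"
   then consider i' j' where "?t = D * D + (i' * n + j') * n + i' \<otimes> j'" "i' < i" "j' < n"
    | j' where "?t = D * D + (i * n + j') * n + i \<otimes> j'" "j' < j" using tS unfolding S1_def by blast
   thus False
   proof cases
    case (1 i' j')
    thus False using t1[of i' j'] i by auto
   next
    case (2 j')
    thus False using t1[of i j'] i j by auto
   qed
  qed
  have t0: "?t ~= 0" using big by simp
  have "gates f (Tof (N 0) (N 0) (Op Plus (Op Plus x_base (Op Times (Op Plus (Op Times (V 20) (V 1)) (V 21)) (V 1))) (mult_exp (V 20) (V 21)))) ((g(20 := i))(21 := j)) h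
    = [tof_map 0 0 ?t]" using g i j tab[OF i j] by (simp add: genvD x_base_def)
  moreover have "tof_map 0 0 ?t (S1 i j) = insert ?t (S1 i j)"
   using nin t0 S(1) by (auto simp: tof_map_def S1_def)
  moreover have "insert ?t (S1 i j) = S1 i (Suc j)" unfolding S1_def by (auto simp: less_Suc_eq)
  ultimately show "runs (gates f (Tof (N 0) (N 0) (Op Plus (Op Plus x_base (Op Times (Op Plus (Op Times (V 20) (V 1)) (V 21)) (V 1))) (mult_exp (V 20) (V 21)))) ((g(20 := i))(21 := j)) h) (S1 i j) = S1 i (Suc j)"
   by simp
 qed
 have eq: "S1 i n = S1 (Suc i) 0" for i unfolding S1_def by (auto simp: less_Suc_eq)
 have "runs (gates f copy1_cmd g h) (S1 0 0) = S1 n 0"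
  unfolding copy1_cmd_def
  by (rule run_For[where S = "%i. S1 i 0"]) (use g inner eq in "simp_all add: genvD del: fun_upd_apply gates.simps")
 moreover have "S1 0 0 = S" "S1 n 0 = S Un {D * D + (i * n + j) * n + i \<otimes> j | i j. i < n & j < n}"
  unfolding S1_def by auto
 ultimately show ?thesis by simp
qed

lemma copy2_run:
 assumes g: "genv g" and S: "S Int {D * D + n ^ 3..<D * D + n ^ 3 + n ^ 2} = {}"
  and K: "!!i y. i < n ==> y < n ==> enc D (WK i y) : S \<longleftrightarrow> y : term_set i"
  and lt: "D * D + n ^ 3 + n ^ 2 <= D ^ 6"
 shows "runs (gates f copy2_cmd g h) S = S Un {D * D + n ^ 3 + i * n + y | i y. i < n & y : term_set i}"
proof -
 define S1 where "S1 i j = S Un {D * D + n ^ 3 + i' * n + y | i' y. i' < i & y : term_set i'}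
   Un {D * D + n ^ 3 + i * n + y | y. y < j & y : term_set i}" for i j
 have big_t: "D * D + n ^ 3 + i * n + y < D ^ 6" if "i < n" "y < n" for i y
  using pair_index_lt[OF that] lt by (simp add: power2_eq_square)
 have inner: "runs (gates f (For True 24 (V 1) (Tof (eK (V 20) (V 24)) (eK (V 20) (V 24))
 (Op Plus (Op Plus (Op Plus x_base (Op Times (V 17) (V 1))) (Op Times (V 20) (V 1))) (V 24)))) (g(20 := i)) h) (S1 i 0) = S1 i n"
  if i: "i < n" for i
 proof (rule run_For)
  show "ev (V 1) (g(20 := i)) h = n" using g by (simp add: genvD)
  fix j assume j: "j < n"
  let ?t = "D * D + n ^ 3 + i * n + j"
  have "i * n + j < n ^ 2" using pair_index_lt[OF i j] by (simp add: power2_eq_square)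
  hence tS: "?t ~: S" using S by auto
  have t1: "?t ~= D * D + n ^ 3 + i' * n + y" if "i' < n" "y < n" "i' ~= i \<or> y ~= j" for i' y
   using pair_index_inj[of i n j i' y] j that by auto
  have nin: "?t ~: S1 i j"
  proof
   assume "?t : S1 i j"
   then consider i' y where "?t = D * D + n ^ 3 + i' * n + y" "i' < i" "y : term_set i'"
    | y where "?t = D * D + n ^ 3 + i * n + y" "y < j" using tS unfolding S1_def by blast
   thus False
   proof cases
    case (1 i' y)
    hence "y < n" using term_sub[of i'] by auto
    thus False using t1[of i' y] 1 i by auto
   qed simp
  qed
  have enS: "enc D (WK i j) : S1 i j \<longleftrightarrow> j : term_set i"
  proof -
   have "enc D (WK i j) ~= D * D + n ^ 3 + i' * n + y" if "i' < n" "y < n" for i' y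
    using enc_ge[of D "WK i j"] big_t[OF that] by simp
   note ne1 = this
   have "enc D (WK i j) : S" if inS1: "enc D (WK i j) : S1 i j"
   proof (rule ccontr)
    assume "enc D (WK i j) ~: S"
    then consider i' y where "enc D (WK i j) = D * D + n ^ 3 + i' * n + y" "i' < i" "y : term_set i'"
     | y where "enc D (WK i j) = D * D + n ^ 3 + i * n + y" "y : term_set i"
     using inS1 unfolding S1_def by blast
    thus False
    proof cases
     case (1 i' y)
     thus False using ne1[of i' y] i term_sub[of i'] by auto
    next
     case (2 y)
     thus False using ne1[of i y] i term_sub[of i] by auto
    qed
   qed
   hence "enc D (WK i j) : S1 i j \<longleftrightarrow> enc D (WK i j) : S" by (auto simp: S1_def)
   thus ?thesis using K[OF i j] by simp
  qed
  have ne: "?t ~= enc D (WK i j)" using enc_ge[of D "WK i j"] big_t[OF i j] by simp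
  have "gates f (Tof (eK (V 20) (V 24)) (eK (V 20) (V 24))
 (Op Plus (Op Plus (Op Plus x_base (Op Times (V 17) (V 1))) (Op Times (V 20) (V 1))) (V 24))) ((g(20 := i))(24 := j)) h
    = [tof_map (enc D (WK i j)) (enc D (WK i j)) ?t]"
   using g by (simp add: genvD x_base_def power3_eq_cube)
  moreover have "tof_map (enc D (WK i j)) (enc D (WK i j)) ?t (S1 i j) = S1 i (Suc j)"
  proof (cases "j : term_set i")
   case True
   hence "tof_map (enc D (WK i j)) (enc D (WK i j)) ?t (S1 i j) = insert ?t (S1 i j)"
    using nin ne enS by (auto simp: tof_map_def)
   also have "... = S1 i (Suc j)" using True unfolding S1_def by (auto simp: less_Suc_eq)
   finally show ?thesis .
  next
   case False
   hence "tof_map (enc D (WK i j)) (enc D (WK i j)) ?t (S1 i j) = S1 i j"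
    using enS by (auto simp: tof_map_def)
   also have "... = S1 i (Suc j)" using False unfolding S1_def by (auto simp: less_Suc_eq)
   finally show ?thesis .
  qed
  ultimately show "runs (gates f (Tof (eK (V 20) (V 24)) (eK (V 20) (V 24))
 (Op Plus (Op Plus (Op Plus x_base (Op Times (V 17) (V 1))) (Op Times (V 20) (V 1))) (V 24))) ((g(20 := i))(24 := j)) h) (S1 i j) = S1 i (Suc j)"
   by simp
 qed
 have eq: "S1 i n = S1 (Suc i) 0" for i unfolding S1_def using term_sub[of i] by (auto simp: less_Suc_eq)
 have "runs (gates f copy2_cmd g h) (S1 0 0) = S1 n 0"
  unfolding copy2_cmd_def
  by (rule run_For[where S = "%i. S1 i 0"]) (use g inner eq in "simp_all add: genvD del: fun_upd_apply gates.simps")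
 moreover have "S1 0 0 = S" "S1 n 0 = S Un {D * D + n ^ 3 + i * n + y | i y. i < n & y : term_set i}"
  unfolding S1_def by auto
 ultimately show ?thesis by simp
qed

text \<open>Wires and the copied query are left as garbage, so only the preserved low qubits and the
  answer of the oracle are described; the inverse circuit removes the rest.\<close>

lemma series_correct:
 assumes g: "genv g" "g 4 = n ^ 3 + n ^ 2" and low2: "low <= {..<D * D}"
 shows "runs (gates f series_cmd g h) low Int {..<D * D} = low"
  and "!!k. k < n ^ 3 + n ^ 2 ==> 2 * (D * D) + k : runs (gates f series_cmd g h) low \<longleftrightarrow>
   k : f (n ^ 3 + n ^ 2) ({(i * n + j) * n + i \<otimes> j | i j. i < n & j < n} Un {n ^ 3 + i * n + y | i y. i < n & y : term_set i})"
proof -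
 let ?l = "n ^ 3 + n ^ 2"
 let ?C1 = "{(i * n + j) * n + i \<otimes> j | i j. i < n & j < n}"
 let ?C2 = "{n ^ 3 + i * n + y | i y. i < n & y : term_set i}"
 have lD: "?l <= D * D"
 proof -
  have "n ^ 3 + n ^ 2 <= (n * n) * (n * n) + (n * n) * (n * n)"
  proof (rule add_mono)
   have "n * n * n * 1 <= n * n * n * n" using n_pos by (intro mult_le_mono2) simp
   thus "n ^ 3 <= (n * n) * (n * n)" by (simp add: power3_eq_cube algebra_simps)
   have "n * n * 1 <= n * n * (n * n)" using n_pos by (intro mult_le_mono2) simp
   thus "n ^ 2 <= (n * n) * (n * n)" by (simp add: power2_eq_square)
  qed
  also have "... <= D * D" unfolding D_def by (simp add: algebra_simps)
  finally show ?thesis .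
 qed
 have D3: "3 * (D * D) <= D ^ 6"
 proof -
  have "3 * (D * D) <= (D * D * D * D) * (D * D)"
  proof (rule mult_le_mono1)
   have "2 * 2 * 2 * 2 <= D * D * D * D" using big(6) by (intro mult_le_mono) auto
   thus "3 <= D * D * D * D" by simp
  qed
  thus ?thesis by (simp add: eval_nat_numeral algebra_simps)
 qed
 have "low Int {enc D w..<enc D w + D} = {}" for w
  using low2 D3 enc_ge[of D w] by fastforce
 hence st0: "state {} low" using low unfolding state_def by auto
 obtain Dn where Dn: "state Dn (runs (gates f chain_cmd g h) low)" "!!i y. i < n ==> y < n ==> WK i y : Dn"
  using chain_correct[OF g(1) st0] by blast
 define S1 where "S1 = runs (gates f chain_cmd g h) low"
 have S1low: "S1 Int {..<D ^ 6} = low" using Dn(1) by (simp add: state_def S1_def)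
 have S1e: "z ~: S1" if "D * D <= z" "z < 3 * (D * D)" for z
 proof
  assume "z : S1"
  hence "z : low" using S1low that D3 by auto
  thus False using low2 that by auto
 qed
 have ent: "u \<otimes> v < n" if "u < n" "v < n" for u v
  using monoid.m_closed[OF group.is_monoid[OF grp], of u v] that carr by auto
 have C1: "c < n ^ 3" if "c : ?C1" for c
 proof -
  obtain i j where ij: "c = (i * n + j) * n + i \<otimes> j" "i < n" "j < n" using \<open>c : ?C1\<close> by blast
  thus ?thesis using pair_index_lt[of "i * n + j" "n * n" "i \<otimes> j" n] pair_index_lt[OF ij(2,3)] ent[OF ij(2,3)]
   by (simp add: power3_eq_cube)
 qed
 have C2: "n ^ 3 <= c & c < ?l" if "c : ?C2" for c
 proof -
  obtain i y where iy: "c = n ^ 3 + i * n + y" "i < n" "y : term_set i" using \<open>c : ?C2\<close> by blast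
  hence "y < n" using term_sub[of i] by auto
  hence "i * n + y < n * n" using pair_index_lt iy by blast
  thus ?thesis using iy by (simp add: power2_eq_square)
 qed
 define S2 where "S2 = S1 Un {D * D + (i * n + j) * n + i \<otimes> j | i j. i < n & j < n}"
 define S3 where "S3 = S2 Un {D * D + n ^ 3 + i * n + y | i y. i < n & y : term_set i}"
 have r2: "runs (gates f copy1_cmd g h) S1 = S2"
  unfolding S2_def
 proof (rule copy1_run[OF g(1)])
  show "0 : S1" using S1low low by blast
  show "S1 Int {D * D..<D * D + n ^ 3} = {}" using S1e lD by fastforce
 qed
 have S2e: "S2 = S1 Un (+) (D * D) ` ?C1" unfolding S2_def by (auto simp: add.assoc)
 have S3e: "S3 = S1 Un (+) (D * D) ` (?C1 Un ?C2)" 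
 proof -
  have "{D * D + n ^ 3 + i * n + y | i y. i < n & y : term_set i} = (+) (D * D) ` ?C2" by (auto simp: add.assoc)
  thus ?thesis unfolding S3_def S2e by (simp only: image_Un Un_assoc)
 qed
 have r3: "runs (gates f copy2_cmd g h) S2 = S3"
  unfolding S3_def
 proof (rule copy2_run[OF g(1)])
  show "S2 Int {D * D + n ^ 3..<D * D + n ^ 3 + n ^ 2} = {}"
  proof (rule ccontr)
   assume "S2 Int {D * D + n ^ 3..<D * D + n ^ 3 + n ^ 2} ~= {}"
   then obtain z where z: "z : S2" "D * D + n ^ 3 <= z" "z < D * D + n ^ 3 + n ^ 2" by auto
   hence "z ~: S1" using S1e[of z] lD by simp
   then obtain c where "c : ?C1" "z = D * D + c" using z(1) unfolding S2e by blast
   thus False using C1 z by fastforce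
  qed
  show le: "D * D + n ^ 3 + n ^ 2 <= D ^ 6" using lD D3 by simp
  fix i y assume iy: "i < n" "y < n"
  have "enc D (WK i y) : S1 \<longleftrightarrow> y : term_set i" using Dn iy unfolding state_def S1_def by simp
  moreover have "enc D (WK i y) ~: (+) (D * D) ` ?C1"
  proof
   assume "enc D (WK i y) : (+) (D * D) ` ?C1"
   then obtain c where "c : ?C1" "enc D (WK i y) = D * D + c" by blast
   thus False using C1[of c] enc_ge[of D "WK i y"] le by simp
  qed
  ultimately show "enc D (WK i y) : S2 \<longleftrightarrow> y : term_set i" unfolding S2e by blast
 qed
 have inp: "{k. k < ?l & D * D + k : S3} = ?C1 Un ?C2"
 proof (intro equalityI subsetI)
  fix k assume "k : {k. k < ?l & D * D + k : S3}"
  hence k: "k < ?l" "D * D + k : S3" by auto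
  hence "D * D + k ~: S1" using S1e[of "D * D + k"] lD by simp
  thus "k : ?C1 Un ?C2" using k(2) unfolding S3e by auto
 next
  fix k assume k: "k : ?C1 Un ?C2"
  hence "k < ?l" using C1[of k] C2[of k] by fastforce
  thus "k : {k. k < ?l & D * D + k : S3}" using k unfolding S3e by blast
 qed
 have dj: "{D * D..<D * D + ?l} Int {2 * (D * D)..<2 * (D * D) + ?l} = {}" using lD by auto
 let ?F = "(+) (2 * (D * D)) ` (f ?l (?C1 Un ?C2) Int {..<?l})"
 have "gates f query_cmd g h = [query_map f ?l (D * D) (2 * (D * D))]"
  using g by (simp add: query_cmd_def x_base_def y_base_def genvD)
 hence R: "runs (gates f series_cmd g h) low = sym_diff S3 ?F"
  unfolding series_cmd_def using r2 r3 S1_def dj inp by (simp add: query_map_def)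
 show "runs (gates f series_cmd g h) low Int {..<D * D} = low"
 proof -
  have "D * D <= D ^ 6" using D3 by simp
  hence "S1 Int {..<D * D} = low" using S1low low2 by auto
  thus ?thesis unfolding R S3e by auto
 qed
 fix k assume k: "k < ?l"
 have "2 * (D * D) + k ~: S3"
 proof
  assume "2 * (D * D) + k : S3"
  moreover have "2 * (D * D) + k ~: S1" using S1e[of "2 * (D * D) + k"] k lD by simp
  ultimately obtain c where "c : ?C1 Un ?C2" "2 * (D * D) + k = D * D + c" unfolding S3e by blast
  thus False using C1[of c] C2[of c] lD by fastforce
 qed
 thus "2 * (D * D) + k : runs (gates f series_cmd g h) low \<longleftrightarrow> k : f ?l (?C1 Un ?C2)"
  unfolding R using k by auto
qed

end

section \<open>Exact executions and failure probabilities\<close>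

text \<open>Executions with a certain outcome. The entire preparation is of this kind, even the
  reading of canonical forms.\<close>

definition exact :: "oracle_fun => nat => cmd => (nat => nat) => (nat => nat) => qstate
  => (nat => nat) => (nat => nat) => qstate => nat => bool" where
 "exact f w c g h q g' h' q' t \<longleftrightarrow>
   triple f w (%g1 h1 q1. g1 = g & h1 = h & q1 = q) c (%g1 h1 q1. g1 = g' & h1 = h' & q1 = q') t"

lemma exact_Skip: "exact f w Skip g h q g h q 0"
 unfolding exact_def by (rule triple_Skip)

lemma exact_Sq: "exact f w c g h q g1 h1 q1 t ==> exact f w d g1 h1 q1 g2 h2 q2 t' ==> exact f w (Sq c d) g h q g2 h2 q2 (t + t')"
 unfolding exact_def by (rule triple_Sq)

lemma exact_le: "exact f w c g h q g' h' q' t' ==> t' <= t ==> exact f w c g h q g' h' q' t"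
 unfolding exact_def by (erule triple_conseq) auto

lemma exact_Asg: "ev e g h = k ==> k < 2 ^ w ==> exact f w (Asg v e) g h q (g(v := k)) h q (unit_cost w e)"
 unfolding exact_def by (rule triple_Asg) auto

lemma exact_Sto: "ev a g h = k ==> ev e g h = m ==> m < 2 ^ w ==> exact f w (Sto a e) g h q g (h(k := m)) q (unit_cost w a + unit_cost w e)"
 unfolding exact_def by (rule triple_Sto) auto

lemma exact_HadC: "ev e g h = k ==> exact f w (HadC e) g h q g h (hadamard k q) (unit_cost w e)"
 unfolding exact_def by (rule triple_HadC) auto

lemma exact_TC: "ev e g h = k ==> exact f w (TC e) g h q g h (t_gate k q) (unit_cost w e)"
 unfolding exact_def by (rule triple_TC) auto

lemma exact_Ite:
 assumes "ev e g h ~= 0 ==> exact f w c g h q g' h' q' t" "ev e g h = 0 ==> exact f w d g h q g' h' q' t"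
 shows "exact f w (Ite e c d) g h q g' h' q' (unit_cost w e + t)"
 unfolding exact_def
proof (rule triple_Ite)
 show "triple f w (%g1 h1 q1. (g1 = g & h1 = h & q1 = q) & ev e g1 h1 ~= 0) c (%g1 h1 q1. g1 = g' & h1 = h' & q1 = q') t"
 proof (cases "ev e g h = 0")
  case True
  thus ?thesis unfolding triple_def by (intro allI impI) auto
 next
  case False
  from assms(1)[OF this] show ?thesis unfolding exact_def by (rule triple_conseq) auto
 qed
 show "triple f w (%g1 h1 q1. (g1 = g & h1 = h & q1 = q) & ev e g1 h1 = 0) d (%g1 h1 q1. g1 = g' & h1 = h' & q1 = q') t"
 proof (cases "ev e g h = 0")
  case False
  thus ?thesis unfolding triple_def by (intro allI impI) auto
 next
  case True
  from assms(2)[OF this] show ?thesis unfolding exact_def by (rule triple_conseq) auto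
 qed
qed

lemma exact_For:
 assumes "ev e (G 0) (Hp 0) = k" "k < 2 ^ w" "!!t. t <= k ==> G t v = 0"
  and body: "!!t. t < k ==> EX x. exact f w c ((G t)(v := t)) (Hp t) (Qs t) ((G (Suc t))(v := x)) (Hp (Suc t)) (Qs (Suc t)) tc"
 shows "exact f w (For True v e c) (G 0) (Hp 0) (Qs 0) (G k) (Hp k) (Qs k) (loop_cost w e k tc)"
 unfolding exact_def
proof (rule triple_For[where I = "%t g1 h1 q1. t <= k --> g1 = G t & h1 = Hp t & q1 = Qs t"])
 fix t assume t: "t < k"
 then obtain x where "exact f w c ((G t)(v := t)) (Hp t) (Qs t) ((G (Suc t))(v := x)) (Hp (Suc t)) (Qs (Suc t)) tc"
  using body by blast
 thus "triple f w (%g h q. EX g'. (t <= k --> g' = G t & h = Hp t & q = Qs t) & g = g'(v := t)) c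
   (%g h q. Suc t <= k --> g(v := 0) = G (Suc t) & h = Hp (Suc t) & q = Qs (Suc t)) tc"
  unfolding exact_def
 proof (rule triple_conseq)
  fix g h q assume "g = (G (Suc t))(v := x) & h = Hp (Suc t) & q = Qs (Suc t)"
  thus "Suc t <= k --> g(v := 0) = G (Suc t) & h = Hp (Suc t) & q = Qs (Suc t)"
   using assms(3)[of "Suc t"] by (auto simp: fun_upd_idem)
 qed (use t in auto)
qed (use assms in auto)

lemma exact_circuit:
 assumes "reversible c" "wf_cmd c" "ALL v:loop_vars c. g v = 0" "bounds_ok L c g" "w + L + 2 <= X"
 shows "exact f w c g h q g h (act (gates f c g h) q) (csize c * X ^ cdepth c)"
proof -
 have "triple f w (%g1 h1 q1. g1 = g & h1 = h & q1 = q) c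
   (%g1 h1 q1. g1 = g & h1 = h & q1 = act (gates f c g h) q) (csize c * (w + L + 2) ^ cdepth c)"
  by (rule triple_circuit[OF assms(1,2)]) (use assms(3,4) in auto)
 moreover have "csize c * (w + L + 2) ^ cdepth c <= csize c * X ^ cdepth c"
  using assms(5) by (intro mult_le_mono2 power_mono) auto
 ultimately show ?thesis unfolding exact_def by - (erule triple_conseq, auto)
qed

definition basis :: "nat set => qstate" where "basis B = (%B'. if B' = B then 1 else 0)"

lemma act_basis: "act (gates f c g h) (basis B) = basis (runs (gates f c g h) B)"
proof
 fix B'
 have "runs (rev (gates f c g h)) B' = B \<longleftrightarrow> B' = runs (gates f c g h) B"
  using runs_inverse runs_inverse' by metis
 thus "act (gates f c g h) (basis B) B' = basis (runs (gates f c g h) B) B'"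
  by (simp add: act_eq basis_def)
qed

lemma outcome_prob_basis: "outcome_prob x b (basis B) = (if (x : B) = b then 1 else 0)"
proof -
 have "{B'. basis B B' ~= 0 & (x : B') = b} = (if (x : B) = b then {B} else {})" by (auto simp: basis_def)
 thus ?thesis unfolding outcome_prob_def by (auto simp: basis_def)
qed

lemma collapse_basis: "(x : B) = b ==> collapse x b (basis B) = basis B"
proof -
 assume e: "(x : B) = b"
 hence "outcome_prob x b (basis B) = 1" by (simp add: outcome_prob_basis)
 thus ?thesis using e unfolding collapse_def by (auto simp: basis_def fun_eq_iff)
qed

text \<open>Measuring a basis state is deterministic, which is why the collected codes can be read
  out and stored with no error.\<close>

lemma exact_Meas_basis:
 assumes "ev e g h = x" "w >= 1"
 shows "exact f w (Meas v e) g h (basis B) (g(v := of_bool (x : B))) h (basis B) (unit_cost w e)"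
 unfolding exact_def
proof (rule triple_Meas[OF _ assms(2)])
 fix g1 h1 q1 b
 assume a: "g1 = g & h1 = h & q1 = basis B" "b : set_pmf (bernoulli_pmf (outcome_prob (ev e g1 h1) True q1))"
 have "(x : B) = b"
 proof (cases "x : B")
  case True
  hence "b : set_pmf (bernoulli_pmf 1)" using a assms(1) outcome_prob_basis[of x True B] by simp
  thus ?thesis using True by (cases b) (auto simp: set_pmf_iff)
 next
  case False
  hence "b : set_pmf (bernoulli_pmf 0)" using a assms(1) outcome_prob_basis[of x True B] by simp
  thus ?thesis using False by (cases b) (auto simp: set_pmf_iff)
 qed
 thus "g1(v := of_bool b) = g(v := of_bool (x : B)) & h1 = h & collapse (ev e g1 h1) b q1 = basis B"
  using a assms(1) collapse_basis by auto
qed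

section \<open>Failure probabilities\<close>

definition fail_prob :: "config pmf => real" where
 "fail_prob M = measure_pmf.prob M {s. reg s 0 = 0}"

definition fails :: "oracle_fun => nat => assertion => cmd => real => bool" where
 "fails f w P c dl \<longleftrightarrow> (ALL s. P (reg s) (heap s) (qst s) & bdd w (reg s) (heap s) --> fail_prob (sem f c s) <= dl)"

lemma fail_prob_le_1: "fail_prob M <= 1" and fail_prob_ge_0: "0 <= fail_prob M"
 unfolding fail_prob_def by (auto simp: measure_pmf.prob_le_1)

lemma fail_prob_integrable: "integrable (measure_pmf M) (%s. fail_prob (K s))"
 by (rule measure_pmf.integrable_const_bound[where B = 1])
   (auto simp: fail_prob_le_1 fail_prob_ge_0)

lemma fail_prob_bind: "fail_prob (bind_pmf M K) = measure_pmf.expectation M (%s. fail_prob (K s))"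
proof -
 have "ennreal (fail_prob (bind_pmf M K)) = (\<integral>\<^sup>+s. ennreal (fail_prob (K s)) \<partial>measure_pmf M)"
  unfolding fail_prob_def measure_pmf.emeasure_eq_measure[symmetric] by simp
 also have "... = ennreal (measure_pmf.expectation M (%s. fail_prob (K s)))"
  by (rule nn_integral_eq_integral[OF fail_prob_integrable]) (simp add: fail_prob_ge_0)
 finally show ?thesis
  by (subst (asm) ennreal_inj) (auto simp: fail_prob_ge_0 intro!: integral_nonneg)
qed

text \<open>The error is one-sided: once register 0 is nonzero it stays so, hence a later command
  can fail only where the earlier one did, and the bounds multiply.\<close>

lemma fail_prob_bind_le:
 assumes "!!s. s : set_pmf M ==> reg s 0 ~= 0 ==> fail_prob (K s) = 0"
  and "!!s. s : set_pmf M ==> reg s 0 = 0 ==> fail_prob (K s) <= dl"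
 shows "fail_prob (bind_pmf M K) <= fail_prob M * dl"
proof -
 have "fail_prob (bind_pmf M K) = measure_pmf.expectation M (%s. fail_prob (K s))" by (rule fail_prob_bind)
 also have "... <= measure_pmf.expectation M (%s. indicator {s. reg s 0 = 0} s * dl)"
 proof (rule integral_mono_AE)
  show "integrable (measure_pmf M) (%s. fail_prob (K s))" by (rule fail_prob_integrable)
  show "integrable (measure_pmf M) (%s. indicator {s. reg s 0 = 0} s * dl)"
   by (rule measure_pmf.integrable_const_bound[where B = "\<bar>dl\<bar>"]) (auto simp: indicator_def)
  show "AE s in measure_pmf M. fail_prob (K s) <= indicator {s. reg s 0 = 0} s * dl"
   unfolding AE_measure_pmf_iff using assms by (auto simp: indicator_def)
 qed
 also have "... = fail_prob M * dl" by (simp add: fail_prob_def)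
 finally show ?thesis .
qed

lemma fail_prob_0: "(!!s. s : set_pmf M ==> reg s 0 ~= 0) ==> fail_prob M = 0"
proof -
 assume "!!s. s : set_pmf M ==> reg s 0 ~= 0"
 hence "set_pmf M Int {s. reg s 0 = 0} = {}" by blast
 thus ?thesis unfolding fail_prob_def measure_pmf_zero_iff .
qed

lemma fails_Sq:
 assumes "fails f w P c dl" "triple f w P c Q t" "fails f w (%g h q. Q g h q & g 0 = 0) d dl'"
  and "triple f w (%g h q. Q g h q & g 0 ~= 0) d (%g h q. g 0 ~= 0) t'" "dl' >= 0"
 shows "fails f w P (Sq c d) (dl * dl')"
 unfolding fails_def
proof (intro allI impI)
 fix s :: config assume s: "P (reg s) (heap s) (qst s) & bdd w (reg s) (heap s)"
 have Q: "Q (reg s') (heap s') (qst s') & bdd w (reg s') (heap s')" if "s' : set_pmf (sem f c s)" for s' :: config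
  using assms(2) s that unfolding triple_def by blast
 have "fail_prob (sem f (Sq c d) s) <= fail_prob (sem f c s) * dl'"
  unfolding sem.simps
 proof (rule fail_prob_bind_le)
  fix s' assume s': "s' : set_pmf (sem f c s)"
  show "fail_prob (sem f d s') = 0" if "reg s' 0 ~= 0"
   using assms(4) Q[OF s'] that unfolding triple_def by (intro fail_prob_0) blast
  show "fail_prob (sem f d s') <= dl'" if "reg s' 0 = 0"
   using assms(3) Q[OF s'] that unfolding fails_def by blast
 qed
 also have "... <= dl * dl'" using assms(1,5) s unfolding fails_def by (intro mult_right_mono) auto
 finally show "fail_prob (sem f (Sq c d) s) <= dl * dl'" .
qed

lemma fails_exact_first:
 assumes "triple f w P c Q t" "fails f w Q d dl"
 shows "fails f w P (Sq c d) dl"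
 unfolding fails_def
proof (intro allI impI)
 fix s :: config assume s: "P (reg s) (heap s) (qst s) & bdd w (reg s) (heap s)"
 have "fail_prob (sem f d s') <= dl" if "s' : set_pmf (sem f c s)" for s'
  using assms s that unfolding triple_def fails_def by blast
 hence "measure_pmf.expectation (sem f c s) (%s'. fail_prob (sem f d s')) <= measure_pmf.expectation (sem f c s) (%_. dl)"
  by (intro integral_mono_AE fail_prob_integrable) (auto simp: AE_measure_pmf_iff)
 thus "fail_prob (sem f (Sq c d) s) <= dl" by (simp add: fail_prob_bind)
qed

lemma fails_For:
 fixes dl :: "nat => real"
 assumes body: "!!t. t < k ==> triple f w (%g h q. EX g'. I t g' h q & g = g'(v := t)) c (%g h q. I (Suc t) (g(v := 0)) h q) tc"
  and fb: "!!t. t < k ==> fails f w (%g h q. EX g'. I t g' h q & g = g'(v := t) & g 0 = 0) c (dl t)"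
  and keep: "!!t. t < k ==> triple f w (%g h q. EX g'. I t g' h q & g = g'(v := t) & g 0 ~= 0) c (%g h q. g 0 ~= 0) tc"
  and pre: "!!g h q. P g h q ==> ev e g h = k & k < 2 ^ w & I 0 g h q & g v = 0"
  and d0: "!!t. t < k ==> 0 <= dl t" and v: "v ~= 0"
 shows "fails f w (%g h q. P g h q & g 0 = 0) (For True v e c) (\<Prod>t<k. dl t)"
 unfolding fails_def
proof (intro allI impI)
 fix s :: config assume s: "(P (reg s) (heap s) (qst s) & reg s 0 = 0) & bdd w (reg s) (heap s)"
 have k: "eva e s = k" "k < 2 ^ w" "I 0 (reg s) (heap s) (qst s)" "reg s v = 0"
  using pre s by (auto simp: eva_def)
 define G where "G = (%t s'. map_pmf (spend (fl (remaining True k t) + 4))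
     (sem f c (spend (iter_cost True k t) (set_reg v t s'))))"
 have loop: "(reg (s1::config) 0 = 0 --> fail_prob (for_list G [a..<k] s1) <= (\<Prod>t\<in>{a..<k}. dl t))
   & (reg s1 0 ~= 0 --> fail_prob (for_list G [a..<k] s1) = 0)"
  if "a <= k" "I a ((reg s1)(v := 0)) (heap s1) (qst s1)" "bdd w (reg s1) (heap s1)" for a s1
  using that
 proof (induction "k - a" arbitrary: a s1)
  case 0
  thus ?case by (auto simp: fail_prob_le_1 intro!: fail_prob_0)
 next
  case (Suc d)
  hence a: "a < k" "d = k - Suc a" by auto
  have l: "[a..<k] = a # [Suc a..<k]" using a by (simp add: upt_conv_Cons)
  let ?s = "spend (iter_cost True k a) (set_reg v a s1)"
  have pre1: "I a ((reg s1)(v := 0)) (heap ?s) (qst ?s)" "reg ?s = ((reg s1)(v := 0))(v := a)"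
   using Suc.prems by simp_all
  have bd: "bdd w (reg ?s) (heap ?s)" using Suc.prems a k(2) by (auto intro: bdd_upd)
  have r0: "reg ?s 0 = reg s1 0" using v by simp
  have post: "I (Suc a) ((reg s3)(v := 0)) (heap s3) (qst s3) & bdd w (reg s3) (heap s3)" if "s3 : set_pmf (sem f c ?s)" for s3 :: config
   using body[OF a(1)] pre1 bd that unfolding triple_def by blast
  have fpG: "fail_prob (G a s1) = fail_prob (sem f c ?s)"
   unfolding G_def fail_prob_def by (simp add: vimage_def)
  have IH: "(reg (s2::config) 0 = 0 --> fail_prob (for_list G [Suc a..<k] s2) <= (\<Prod>t\<in>{Suc a..<k}. dl t))
   & (reg s2 0 ~= 0 --> fail_prob (for_list G [Suc a..<k] s2) = 0)" if s2: "s2 : set_pmf (G a s1)" for s2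
  proof -
   obtain s3 where s3: "s3 : set_pmf (sem f c ?s)" "s2 = spend (fl (remaining True k a) + 4) s3"
    using s2 unfolding G_def by auto
   show ?thesis by (rule Suc.hyps(1)[OF a(2)]) (use a post[OF s3(1)] s3(2) in auto)
  qed
  have b: "fail_prob (for_list G [a..<k] s1) <= fail_prob (G a s1) * (\<Prod>t\<in>{Suc a..<k}. dl t)"
   unfolding l for_list.simps by (rule fail_prob_bind_le) (use IH in auto)
  have p0: "0 <= (\<Prod>t\<in>{Suc a..<k}. dl t)" using d0 by (intro prod_nonneg) auto
  show ?case
  proof (intro conjI impI)
   assume z: "reg s1 0 = 0"
   have z': "reg ?s 0 = 0" using r0 z by (rule trans)
   have "fail_prob (sem f c ?s) <= dl a"
    using fb[OF a(1)] pre1 bd z' unfolding fails_def by blast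
   hence "fail_prob (G a s1) * (\<Prod>t\<in>{Suc a..<k}. dl t) <= dl a * (\<Prod>t\<in>{Suc a..<k}. dl t)"
    using fpG p0 by (intro mult_right_mono) auto
   also have "... = (\<Prod>t\<in>{a..<k}. dl t)" using a by (simp add: prod.atLeast_Suc_lessThan)
   finally show "fail_prob (for_list G [a..<k] s1) <= (\<Prod>t\<in>{a..<k}. dl t)" using b by simp
  next
   assume z: "reg s1 0 ~= 0"
   have "reg ?s 0 ~= 0" unfolding r0 by (rule z)
   hence "EX g'. I a g' (heap ?s) (qst ?s) & reg ?s = g'(v := a) & reg ?s 0 ~= 0"
    using pre1 by (intro exI[of _ "(reg s1)(v := 0)"] conjI)
   hence "reg s3 0 ~= 0" if "s3 : set_pmf (sem f c ?s)" for s3 :: config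
    using keep[OF a(1), unfolded triple_def, rule_format, of ?s] bd that by blast
   hence "fail_prob (G a s1) = 0" unfolding fpG by (rule fail_prob_0)
   thus "fail_prob (for_list G [a..<k] s1) = 0" using b fail_prob_ge_0[of "for_list G [a..<k] s1"] by simp
  qed
 qed
 let ?s0 = "spend (ecs e s + 4 + fl k + fl k) s"
 have "(reg s)(v := 0) = reg s" using k(4) by auto
 hence "fail_prob (for_list G [0..<k] ?s0) <= (\<Prod>t\<in>{0..<k}. dl t)"
  using loop[of 0 ?s0] k(3) s by simp
 moreover have "fail_prob (sem f (For True v e c) s) = fail_prob (for_list G [0..<k] ?s0)"
 proof -
  have "sem f (For True v e c) s = map_pmf (%s'. spend 2 (set_reg v 0 s')) (for_list G [0..<k] ?s0)"
   unfolding sem.simps k(1) G_def by (simp add: range_dir_def map_pmf_def)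
  thus ?thesis using v unfolding fail_prob_def by (simp add: vimage_def)
 qed
 ultimately show "fail_prob (sem f (For True v e c) s) <= (\<Prod>t<k. dl t)" by (simp add: lessThan_atLeast0)
qed

section \<open>The algorithm\<close>

fun seqs :: "cmd list => cmd" where
 "seqs [] = Skip"
| "seqs (c # cs) = Sq c (seqs cs)"

lemma cdepth_pos: "1 <= cdepth c"
 by (induction c) auto

section \<open>Executions at a cost fixed by the syntax\<close>

locale machine =
 fixes f :: oracle_fun and w L X :: nat
 assumes wX: "w + L + 2 <= X" and w1: "1 <= w"
begin

abbreviation "cost c \<equiv> csize c * X ^ cdepth c"

text \<open>The cost need not be tracked: it is determined by \<open>c\<close> as long as no loop
  exceeds \<open>X\<close> iterations.\<close>

definition ex :: "cmd => (nat => nat) => (nat => nat) => qstate => (nat => nat) => (nat => nat) => qstate => bool" where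
 "ex c g h q g' h' q' \<longleftrightarrow> exact f w c g h q g' h' q' (cost c)"

lemma X1: "1 <= X" and wX2: "w + 2 <= X" using wX by auto

lemma X_pow: "a <= b ==> X ^ a <= X ^ b"
 by (rule power_increasing[OF _ X1])

lemma cost_Sq: "cost c + cost d <= cost (Sq c d)"
proof -
 have "cost c <= csize c * X ^ cdepth (Sq c d)"
  "cost d <= csize d * X ^ cdepth (Sq c d)"
  by (rule mult_le_mono2, rule X_pow, simp)+
 thus ?thesis unfolding csize.simps add_mult_distrib by linarith
qed

lemma cost_unit: "unit_cost w e <= (full_size e + 2) * X ^ 1"
 unfolding unit_cost_def power_one_right by (rule mult_le_mono2[OF wX2])

lemma cost_Ite:
 assumes "t <= (csize c + csize d) * X ^ cdepth (Ite e c d)"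
 shows "unit_cost w e + t <= cost (Ite e c d)"
proof -
 have "(full_size e + 2) * X ^ 1 <= (full_size e + 2) * X ^ cdepth (Ite e c d)"
  by (rule mult_le_mono2, rule X_pow) (use cdepth_pos[of c] in simp)
 hence "unit_cost w e + t <= (full_size e + 2) * X ^ cdepth (Ite e c d) + (csize c + csize d) * X ^ cdepth (Ite e c d)"
  using cost_unit[of e] assms by linarith
 also have "... = cost (Ite e c d)"
  unfolding add_mult_distrib[symmetric] by (simp add: add.assoc)
 finally show ?thesis .
qed

lemma cost_For:
 assumes "k <= X"
 shows "loop_cost w e k (cost c) <= cost (For up v e c)"
proof -
 let ?d = "Suc (cdepth c)"
 have d: "1 <= cdepth c" by (rule cdepth_pos)
 have 1: "(full_size e + 10) * (w + 2) <= (full_size e + 10) * X ^ ?d"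
  using le_trans[OF wX2] X_pow[of 1 ?d] by (intro mult_le_mono2) simp
 have 2: "k * (cost c + 6 * (w + 2)) <= X * (cost c + 6 * X)"
  using assms wX2 by (intro mult_le_mono) auto
 have "X ^ 2 <= X ^ ?d" by (rule X_pow) (use d in simp)
 hence 3: "X * (cost c + 6 * X) <= csize c * X ^ ?d + 6 * X ^ ?d"
  by (simp add: power2_eq_square algebra_simps)
 have "loop_cost w e k (cost c) <= (full_size e + 10) * X ^ ?d + (csize c * X ^ ?d + 6 * X ^ ?d)"
  unfolding loop_cost_def using 1 2 3 by linarith
 also have "... = (full_size e + 10 + (csize c + 6)) * X ^ ?d" unfolding add_mult_distrib ..
 also have "... <= cost (For up v e c)"
  unfolding csize.simps cdepth.simps by (rule mult_le_mono1) simp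
 finally show ?thesis .
qed

lemma ex_Skip: "ex Skip g h q g h q"
 unfolding ex_def by (rule exact_le[OF exact_Skip]) simp

lemma ex_Sq: "ex c g h q g1 h1 q1 ==> ex d g1 h1 q1 g2 h2 q2 ==> ex (Sq c d) g h q g2 h2 q2"
 unfolding ex_def by (rule exact_le[OF exact_Sq cost_Sq])

lemma ex_Asg: "ev e g h = k ==> k < 2 ^ w ==> ex (Asg v e) g h q (g(v := k)) h q"
 unfolding ex_def by (rule exact_le[OF exact_Asg]) (use cost_unit in simp_all)

lemma ex_Asg_Sq: "ev e g h = k ==> k < 2 ^ w ==> ex c (g(v := k)) h q g' h' q' ==> ex (Sq (Asg v e) c) g h q g' h' q'"
 by (rule ex_Sq[OF ex_Asg])

lemma ex_Sto: "ev a g h = k ==> ev e g h = m ==> m < 2 ^ w ==> ex (Sto a e) g h q g (h(k := m)) q"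
 unfolding ex_def
 by (rule exact_le[OF exact_Sto]) (use cost_unit[of a] cost_unit[of e] in "simp_all add: algebra_simps")

lemma ex_HadC: "ev e g h = k ==> ex (HadC e) g h q g h (hadamard k q)"
 unfolding ex_def by (rule exact_le[OF exact_HadC]) (use cost_unit in simp_all)

lemma ex_TC: "ev e g h = k ==> ex (TC e) g h q g h (t_gate k q)"
 unfolding ex_def by (rule exact_le[OF exact_TC]) (use cost_unit in simp_all)

lemma ex_Meas_basis:
 "ev e g h = x ==> ex (Meas v e) g h (basis B) (g(v := of_bool (x : B))) h (basis B)"
 unfolding ex_def by (rule exact_le[OF exact_Meas_basis]) (use cost_unit w1 in simp_all)

lemma ex_circuit:
 assumes "reversible c" "wf_cmd c" "ALL v:loop_vars c. g v = 0" "bounds_ok L c g"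
 shows "ex c g h q g h (act (gates f c g h) q)"
 unfolding ex_def by (rule exact_circuit[OF assms wX])

lemma ex_Ite:
 assumes "ev e g h ~= 0 ==> ex c g h q g' h' q'" "ev e g h = 0 ==> ex d g h q g' h' q'"
 shows "ex (Ite e c d) g h q g' h' q'"
proof -
 let ?T = "(csize c + csize d) * X ^ cdepth (Ite e c d)"
 have "cost c <= ?T" "cost d <= ?T"
  by (rule mult_le_mono, simp, rule X_pow, simp)+
 thus ?thesis unfolding ex_def
  by (intro exact_le[OF exact_Ite[where t = ?T] cost_Ite]) (use assms exact_le in "auto simp: ex_def")
qed

lemma ex_For:
 assumes "ev e (G 0) (Hp 0) = k" "k <= X" "k < 2 ^ w" "!!t. t <= k ==> G t v = 0"
  and body: "!!t. t < k ==> EX x. ex c ((G t)(v := t)) (Hp t) (Qs t) ((G (Suc t))(v := x)) (Hp (Suc t)) (Qs (Suc t))"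
  and "g = G 0" "h = Hp 0" "q = Qs 0" "g' = G k" "h' = Hp k" "q' = Qs k"
 shows "ex (For True v e c) g h q g' h' q'"
 unfolding ex_def assms(6-)
 by (rule exact_le[OF exact_For[where G = G and Hp = Hp and Qs = Qs] cost_For])
   (use assms in "auto simp: ex_def")

end

text \<open>Variables: 0 answer (at the start \<open>n\<close>), 1 \<open>n\<close>, 2 \<open>p\<close>, 3 number \<open>b\<close> of index bits, 4 length \<open>l\<close> of a
 code, 5 \<open>2 ^ l\<close>, 7 address of the cell used for zero tests, 8 radix \<open>D\<close> of wire numbers and base of
 the table of stored codes, 10 base and 11 identity of the current multiplication table, 15 \<open>2 ^ s\<close>
 and 16 \<open>s\<close>, where \<open>s\<close> is about \<open>b / 3\<close>, 37 \<open>2 ^ s * n\<close>, 39 number of repetitions, 41 number of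
 iterations; 9, 12, 13, 14, 17, 18, 19, 36, 42 are further constants, 20 to 29 and 40 loop variables.
 Qubits: 0 is constantly 1, 1 is the result of the test, 2 and 3 are ancillas, bit \<open>k\<close> of choice \<open>i\<close>
 is qubit \<open>4 + i * n + k\<close>, qubit \<open>4 + n * n\<close> is an additional index bit which keeps the fraction of good
 indices below one half, the oracle reads from \<open>D * D\<close> on and writes from \<open>2 * D * D\<close> on.\<close>

definition "pos_base = Op Times (N 2) (V 17)"
text \<open>The positions of the index bits are listed in memory behind the two tables; this is the
  qubit of index bit \<open>u\<close>.\<close>

definition "pos_exp u = Op Plus (N 4) (Ld (Op Plus pos_base u))"

definition "assign_cmd R = seqs [Asg 1 (V 0), Asg 0 (N 0), Asg 17 (Op Times (V 1) (V 1)),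
 Asg 4 (Op Plus (Op Times (V 17) (V 1)) (V 17)),
 Asg 8 (Op Plus (Op Times (Op Times (N 4) (V 1)) (V 1)) (N 4)), Asg 9 (Op Minus (V 8) (N 1)),
 Asg 12 (Op Minus (V 1) (N 1)), Asg 13 (Op Times (N 2) (V 1)), Asg 14 (Op Times (Op Times (N 2) (V 1)) (V 1)),
 Asg 18 (N 1), Asg 42 (Op Plus (V 17) (N 1)), Asg 39 (N R)]"

text \<open>The least divisor above 1 is automatically prime, so no primality test is made.\<close>

definition "prime_cmd = For True 20 (V 1) (Ite (V 2) Skip
 (Ite (mod_exp (V 1) (Op Plus (V 20) (N 2))) Skip (Asg 2 (Op Plus (V 20) (N 2)))))"

definition "pow_cmd v c = Sq (Asg v (N 1)) (For True 20 (V c) (Asg v (Op Times (N 2) (V v))))"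

definition "zero_cmd = seqs [pow_cmd 5 4, Asg 7 (Op Plus (Op Plus (V 8) (V 5)) (V 13)), Sto (V 7) (N 1)]"

text \<open>Variable 31 runs through \<open>p ^ i * 2 ^ k\<close>. Choice \<open>i\<close> receives
  bit \<open>k\<close> as long as this is at most \<open>n\<close>, the fewest bits whose range
  exceeds \<open>n / p ^ i\<close>.\<close>

definition "row_cmd = For True 21 (V 1) (Sq (Ite (less_exp (V 1) (V 31)) Skip
  (Sq (Sto (Op Plus pos_base (V 3)) (Op Plus (Op Times (V 20) (V 1)) (V 21))) (Asg 3 (Op Plus (V 3) (N 1)))))
 (Asg 31 (Op Times (N 2) (V 31))))"

definition "pos_cmd = seqs [Asg 30 (N 1), For True 20 (V 12) (seqs [Asg 31 (V 30), row_cmd, Asg 31 (N 0),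
  Asg 30 (Op Times (V 30) (V 2))]), Sto (Op Plus pos_base (V 3)) (V 17)]"

text \<open>\<open>s\<close> is a third of \<open>b\<close> rounded up. The final read has an empty
  address (variable 19 is 0) and hits the nonzero cell \<open>zc\<close>; it sets the constant qubit
  0, which afterwards turns Toffoli gates into negations.\<close>

definition "sizes_cmd = seqs [Asg 16 (Op Divide (Op Plus (V 3) (N 2)) (N 3)), pow_cmd 15 16,
 Asg 37 (Op Times (V 15) (V 1)), Asg 36 (Op Plus (V 3) (N 1)), QL (V 7) (N 0) (V 19) (N 0)]"

definition "setup_cmd R = seqs [assign_cmd R, prime_cmd, zero_cmd, pos_cmd, sizes_cmd]"

definition "ident_cmd = For True 20 (V 1) (Ite (eq_exp (mult_exp (V 20) (V 20)) (V 20)) (Asg 11 (V 20)) Skip)"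

text \<open>The index qubits are flipped, so a second run restores them.\<close>

definition "bits_cmd = Sq (Asg 32 (V 27)) (For True 20 (V 16) (seqs [
 Ite (mod_exp (V 32) (N 2)) (Tof (N 0) (N 0) (pos_exp (V 20))) Skip, Asg 32 (Op Divide (V 32) (N 2))]))"

definition "read_cmd = seqs [Asg 35 (N 1), For True 20 (V 4) (seqs [Meas 33 (Op Plus y_base (V 20)),
  Asg 34 (Op Plus (V 34) (Op Times (V 33) (V 35))), Asg 35 (Op Times (N 2) (V 35)), Asg 33 (N 0)]), Asg 35 (N 0)]"

text \<open>The circuit of the search is reused on a basis state; the code read from the output
  qubits becomes the address of the cell to be marked.\<close>

definition "entry_cmd = seqs [bits_cmd, series_cmd, read_cmd, invc series_cmd, bits_cmd,
 Sto (Op Plus (V 8) (V 34)) (N 1), Asg 34 (N 0)]"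

definition "collect_cmd = For True 27 (V 15) entry_cmd"

text \<open>The answer of the oracle, still in superposition, is the address of one read of the
  table of codes. The Toffoli gate adds the condition on the additional index bit.\<close>

definition "test_cmd = Sq series_cmd (Sq (QL (V 8) y_base (V 4) (N 2)) (Tof (N 2) (Op Plus (N 4) (V 17)) (N 1)))"

definition "z_gate_cmd e = seqs [TC e, TC e, TC e, TC e]"
definition "had_cmd = For True 20 (V 36) (HadC (pos_exp (V 20)))"
definition "had_rev_cmd = For True 20 (V 36) (HadC (pos_exp (Op Minus (V 3) (V 20))))"
text \<open>The qubits from 4 on serve as an address of \<open>n * n + 1\<close> bits, which is 0
  only if all index bits are 0.\<close>

definition "zero_test_cmd = QL (V 7) (N 4) (V 42) (N 3)"

definition "grover_cmd = seqs [test_cmd, z_gate_cmd (N 1), invc test_cmd, had_cmd,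
 zero_test_cmd, z_gate_cmd (N 3), zero_test_cmd, had_rev_cmd]"

text \<open>Only the result of the test is measured. A negative outcome leaves the uniform
  superposition of the bad indices, that is angle 0, from which the next round starts with no
  reset.\<close>

definition "meas_cmd = seqs [test_cmd, Meas 38 (N 1), invc test_cmd, Ite (V 38) (Asg 0 (N 1)) Skip]"

definition "round_cmd = Sq (For True 40 (V 41) grover_cmd) meas_cmd"

definition "pass_cmd = Sq (Asg 41 (N 1)) (For True 29 (V 4) (Ite (less_exp (V 37) (V 41)) Skip
 (Sq (Ite (V 0) Skip round_cmd) (Asg 41 (Op Times (N 2) (V 41))))))"

definition "search_cmd = For True 28 (V 39) pass_cmd"

text \<open>The measurement before the search takes the uniform superposition to angle 0 unless it
  already succeeds, so that all rounds start alike.\<close>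

definition "iso_cmd R = seqs [setup_cmd R, Asg 10 (N 0), ident_cmd, collect_cmd, Asg 10 (V 17), ident_cmd,
 had_cmd, meas_cmd, search_cmd]"

section \<open>Side conditions of the circuits\<close>

lemma reversible_node: "reversible (node neg w cls)" "wf_cmd (node neg w cls)" "loop_vars (node neg w cls) <= {26}"
proof -
 have "reversible (clauses_cmd w cls) & wf_cmd (clauses_cmd w cls) & loop_vars (clauses_cmd w cls) <= {26}"
  by (induction cls) auto
 thus "reversible (node neg w cls)" "wf_cmd (node neg w cls)" "loop_vars (node neg w cls) <= {26}"
  unfolding node_def by auto
qed

lemma loop_vars_node: "v : loop_vars (node neg w cls) ==> v = 26"
 using reversible_node(3) by blast

lemma bound_node: "bound_exps (node neg w cls) \<subseteq> insert (V 9) ((%cl. V (fst cl)) ` set cls)"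
proof -
 have "bound_exps (clauses_cmd w cls) = (%cl. V (fst cl)) ` set cls" by (induction cls) auto
 thus ?thesis unfolding node_def by auto
qed

lemmas chain_defs = chain_cmd_def init_cmd_def level_cmd_def e_cmd_def n_cmd_def n0_cmd_def n1_cmd_def n2_cmd_def
 z_cmd_def t_cmd_def u_cmd_def o0_cmd_def o_cmd_def k_cmd_def

lemma series_cmd_wf: "reversible series_cmd" "wf_cmd series_cmd" "loop_vars series_cmd <= {20, 21, 22, 23, 24, 25, 26}"
 "bound_exps series_cmd <= V ` {1, 4, 9, 12, 13, 14, 17, 18}"
proof -
 show "reversible series_cmd"
  unfolding series_cmd_def copy1_cmd_def copy2_cmd_def query_cmd_def chain_defs by (simp add: reversible_node)
 show "wf_cmd series_cmd"
  unfolding series_cmd_def copy1_cmd_def copy2_cmd_def query_cmd_def chain_defs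
  by (auto simp: reversible_node dest!: loop_vars_node)
 show "loop_vars series_cmd <= {20, 21, 22, 23, 24, 25, 26}"
  unfolding series_cmd_def copy1_cmd_def copy2_cmd_def query_cmd_def chain_defs
  by (auto dest!: loop_vars_node)
 show "bound_exps series_cmd <= V ` {1, 4, 9, 12, 13, 14, 17, 18}"
  unfolding series_cmd_def copy1_cmd_def copy2_cmd_def query_cmd_def chain_defs
  by (auto dest!: bound_node[THEN subsetD])
qed

lemma test_cmd_wf: "reversible test_cmd" "wf_cmd test_cmd" "loop_vars test_cmd <= {20, 21, 22, 23, 24, 25, 26}"
 "bound_exps test_cmd <= V ` {1, 4, 9, 12, 13, 14, 17, 18}"
 using series_cmd_wf unfolding test_cmd_def by auto

text \<open>Variables that receive measured results change between a circuit and its inverse. Not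
  being read by the circuit, they do not alter its gates.\<close>

fun unr :: "nat => aexp => bool" where
 "unr v (V u) \<longleftrightarrow> u ~= v"
| "unr v (N k) \<longleftrightarrow> True"
| "unr v (Op p a b) \<longleftrightarrow> unr v a & unr v b"
| "unr v (Ld a) \<longleftrightarrow> unr v a"

fun unread :: "nat => cmd => bool" where
 "unread v (Tof a b c) \<longleftrightarrow> unr v a & unr v b & unr v c"
| "unread v (QL b a k t) \<longleftrightarrow> unr v b & unr v a & unr v k & unr v t"
| "unread v (Qu l x y) \<longleftrightarrow> unr v l & unr v x & unr v y"
| "unread v (Sq c d) \<longleftrightarrow> unread v c & unread v d"
| "unread v (Ite e c d) \<longleftrightarrow> unr v e & unread v c & unread v d"
| "unread v (For up u e c) \<longleftrightarrow> u ~= v & unr v e & unread v c"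
| "unread v _ \<longleftrightarrow> True"

lemma ev_unread: "unr v e ==> ev e (g(v := k)) h = ev e g h"
 by (induction e) auto

lemma gates_unread: "unread v c ==> gates f c (g(v := k)) h = gates f c g h"
proof (induction c arbitrary: g)
 case (For up u e c)
 hence "gates f c (g(v := k, u := t)) h = gates f c (g(u := t)) h" for t
  using For.IH[of "g(u := t)"] by (simp add: fun_upd_twist del: fun_upd_apply)
 thus ?case using For.prems by (simp add: ev_unread del: fun_upd_apply)
qed (simp_all add: ev_unread del: fun_upd_apply)

lemma unread_wires [simp]:
 "v ~= 8 ==> unr v (eK i y) = (unr v i & unr v y)"
 "v ~= 8 ==> unr v (eN i x j t y) = (unr v i & unr v x & unr v j & unr v t & unr v y)"
 "v ~= 8 ==> unr v (eZ i x y) = (unr v i & unr v x & unr v y)"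
 "v ~= 8 ==> unr v (eE i) = unr v i"
 "v ~= 8 ==> unr v (eT i x) = (unr v i & unr v x)"
 "v ~= 8 ==> unr v (eU i x) = (unr v i & unr v x)"
 "v ~= 8 ==> unr v (eO i t k) = (unr v i & unr v t & unr v k)"
 "v ~= 8 ==> unr v (eP i t) = (unr v i & unr v t)"
 "unr v (eq_exp a b) = (unr v a & unr v b)"
 "unr v (less_exp a b) = (unr v a & unr v b)"
 "unr v (mod_exp a b) = (unr v a & unr v b)"
 "unr v (mult_exp a b) = (v ~: {1, 10} & unr v a & unr v b)"
 by (auto simp: eK_def eN_def eZ_def eE_def eT_def eU_def eO_def eP_def wexp_def eq_exp_def less_exp_def mod_exp_def mult_exp_def)

lemma test_cmd_unread:
 assumes "26 < v"
 shows "unread v series_cmd" "unread v test_cmd"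
proof -
 have v: "u ~= v" "v ~= u" if "u <= 26" for u using that assms by auto
 show "unread v series_cmd"
  unfolding series_cmd_def copy1_cmd_def copy2_cmd_def query_cmd_def chain_defs node_def clauses_cmd.simps clause_cmd.simps
   x_base_def y_base_def by (simp add: v)
 thus "unread v test_cmd" by (simp add: v test_cmd_def y_base_def x_base_def)
qed

lemma iso_cmd_wf: "wf_cmd (iso_cmd R)"
 using series_cmd_wf(2) test_cmd_wf(2) series_cmd_wf(3) test_cmd_wf(3)
 unfolding iso_cmd_def setup_cmd_def assign_cmd_def prime_cmd_def zero_cmd_def pow_cmd_def pos_cmd_def row_cmd_def
  sizes_cmd_def ident_cmd_def collect_cmd_def entry_cmd_def bits_cmd_def read_cmd_def had_cmd_def meas_cmd_def
  search_cmd_def pass_cmd_def round_cmd_def grover_cmd_def z_gate_cmd_def zero_test_cmd_def had_rev_cmd_def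
 by auto

section \<open>Preparation of the memory\<close>

lemma (in machine) ex_cong:
 "ex c g h q g1 h1 q1 ==> g1 = g2 ==> h1 = h2 ==> q1 = q2 ==> ex c g h q g2 h2 q2"
 by simp

definition write_list :: "(nat => nat) => nat => nat list => nat => nat" where
 "write_list h b xs = (%a. if b <= a & a < b + length xs then xs ! (a - b) else h a)"

lemma write_list_Nil [simp]: "write_list h b [] = h"
 by (auto simp: write_list_def)

lemma write_list_snoc: "(write_list h b xs)(b + length xs := x) = write_list h b (xs @ [x])"
 by (auto simp: write_list_def fun_eq_iff nth_append)

lemma poly_bounds:
 fixes n :: nat
 assumes "2 <= n"
 shows "n <= 20 * n ^ 3" "n * n <= 20 * n ^ 3" "n * n * n + n * n <= 20 * n ^ 3" "4 * n * n + 4 <= 20 * n ^ 3"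
  "2 * n <= 20 * n ^ 3" "2 * n * n <= 20 * n ^ 3" "n * n + 1 <= 20 * n ^ 3" "1 <= 20 * n ^ 3" "n + 2 <= 20 * n ^ 3"
  "n * n + n + n <= 20 * n ^ 3" "n * n * n + n * n + 2 * n + 6 <= 20 * n ^ 3" "4 * n * n + n * n * n + n * n + 2 * n + 6 <= 20 * n ^ 3"
proof -
 have a: "n * n <= n ^ 3" using assms by (simp add: power3_eq_cube)
 have b: "n <= n * n" using assms by simp
 have c: "1 <= n" using assms by simp
 have d: "n * n * n = n ^ 3" by (simp add: power3_eq_cube)
 have e: "4 * n * n = 4 * (n * n)" "2 * n * n = 2 * (n * n)" by simp_all
 show "n <= 20 * n ^ 3" "n * n <= 20 * n ^ 3" "n * n * n + n * n <= 20 * n ^ 3" "4 * n * n + 4 <= 20 * n ^ 3"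
  "2 * n <= 20 * n ^ 3" "2 * n * n <= 20 * n ^ 3" "n * n + 1 <= 20 * n ^ 3" "1 <= 20 * n ^ 3" "n + 2 <= 20 * n ^ 3"
  "n * n + n + n <= 20 * n ^ 3" "n * n * n + n * n + 2 * n + 6 <= 20 * n ^ 3" "4 * n * n + n * n * n + n * n + 2 * n + 6 <= 20 * n ^ 3"
  unfolding d e using a b c by linarith+
qed

locale instance_data =
 fixes n R :: nat and TG TH :: table and Can :: "series => series"
 assumes n2: "2 <= n" and TG: "group_table n TG" and TH: "group_table n TH" and Can: "canonization Can"
begin

definition "f = canonization_oracle Can"
text \<open>Words must hold the address \<open>zc\<close> beyond \<open>2 ^ l\<close>, so their
  length exceeds \<open>l\<close>, of order \<open>n ^ 3\<close>, and also the number
  \<open>R\<close> of repetitions. The factor 20 covers all estimates of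
  \<open>poly_bounds\<close>.\<close>

definition "w = 20 * n ^ 3 + R"
definition "L = 20 * n ^ 3"
definition "X = w + L + 2"

sublocale machine f w L X
 by unfold_locales (use poly_bounds(8)[OF n2] in "simp_all add: X_def w_def")

definition "p = smallest_prime_divisor n"
definition "D = 4 * n * n + 4"
definition "l = n ^ 3 + n ^ 2"
definition "zc = D + 2 ^ l + 2 * n"
definition "irow i = map (%k. i * n + k) (filter (%k. p ^ i * 2 ^ k <= n) [0..<n])"
definition "ps = concat (map irow [0..<n - 1])"
definition "b0 = length ps"
definition "s = (b0 + 2) div 3"
definition "h_in = (%a. if a < length (concat TG @ concat TH) then (concat TG @ concat TH) ! a else 0)"
definition "hS = write_list (h_in(zc := 1)) (2 * (n * n)) (ps @ [n * n])"
text \<open>The prepared memory with exactly the codes in \<open>A\<close> marked.\<close>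

definition "hm A = (%a. if D <= a & a < D + 2 ^ l & a - D : A then 1 else hS a)"

definition base :: "(nat => nat) => bool" where
 "base g \<longleftrightarrow> g 1 = n & g 2 = p & g 3 = b0 & g 4 = l & g 7 = zc & g 8 = D & g 9 = D - 1 & g 12 = n - 1
   & g 13 = 2 * n & g 14 = 2 * n * n & g 15 = 2 ^ s & g 16 = s & g 17 = n * n & g 18 = 1 & g 19 = 0
   & g 36 = b0 + 1 & g 37 = 2 ^ s * n & g 39 = R & g 42 = n * n + 1
   & (ALL v:{20, 21, 22, 23, 24, 25, 26}. g v = 0)"

lemmas pb = poly_bounds[OF n2]

lemma l_eq: "l = n * n * n + n * n" by (simp add: l_def power3_eq_cube power2_eq_square)

lemma small_lt: "a <= 20 * n ^ 3 ==> a < 2 ^ w" for a :: nat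
 by (rule le_less_trans[OF _ less_exp]) (simp add: w_def)

lemma small_pow: "a < 2 ^ b ==> b <= 20 * n ^ 3 ==> a < 2 ^ w" for a :: nat
 by (erule less_le_trans, rule power_increasing) (simp_all add: w_def)

lemma small_X: "a <= 20 * n ^ 3 ==> a <= X" by (simp add: X_def L_def)

lemma R_lt: "R < 2 ^ w" "R <= X"
 by (rule le_less_trans[OF _ less_exp]) (simp_all add: X_def w_def)

lemma p_props: "prime p" "p dvd n" "2 <= p" "p <= n" "!!d. 2 <= d ==> d dvd n ==> p <= d"
proof -
 have "EX q. prime q & q dvd n" using n2 prime_factor_nat[of n] by auto
 hence *: "prime p & p dvd n" unfolding p_def smallest_prime_divisor_def by (rule LeastI_ex)
 thus "prime p" "p dvd n" by auto
 thus "2 <= p" "p <= n" using n2 prime_ge_2_nat dvd_imp_le[of p n] by auto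
 fix d assume d: "2 <= d" "d dvd n"
 then obtain q where q: "prime q" "q dvd d" using prime_factor_nat[of d] by auto
 hence "p <= q" unfolding p_def smallest_prime_divisor_def using d by (intro Least_le) (auto intro: dvd_trans)
 also have "q <= d" using q d by (intro dvd_imp_le) auto
 finally show "p <= d" .
qed

definition g_in :: "nat => nat" where "g_in = (%_. 0)(0 := n)"
definition "gA = g_in(1 := n, 0 := 0, 17 := n * n, 4 := l, 8 := D, 9 := D - 1, 12 := n - 1, 13 := 2 * n,
  14 := 2 * n * n, 18 := 1, 42 := n * n + 1, 39 := R)"

lemma ex_assign: "ex (assign_cmd R) g_in h q gA h q"
 unfolding assign_cmd_def seqs.simps gA_def
 apply (rule ex_Asg_Sq)
  apply (simp add: g_in_def)
  apply (rule small_lt, rule pb)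
 apply (rule ex_Asg_Sq[where k = 0])
  apply simp
  apply simp
 apply (rule ex_Asg_Sq[where k = "n * n"])
  apply simp
  apply (rule small_lt, rule pb)
 apply (rule ex_Asg_Sq[where k = l])
  apply (simp add: l_eq)
  apply (rule small_lt, unfold l_eq, rule pb)
 apply (rule ex_Asg_Sq[where k = D])
  apply (simp add: D_def)
  apply (rule small_lt, unfold D_def, rule pb)
 apply (rule ex_Asg_Sq[where k = "4 * n * n + 4 - 1"])
  apply simp
  apply (rule small_lt, rule order_trans[OF _ pb(4)], simp)
 apply (rule ex_Asg_Sq[where k = "n - 1"])
  apply simp
  apply (rule small_lt, rule order_trans[OF _ pb(1)], simp)
 apply (rule ex_Asg_Sq[where k = "2 * n"])
  apply simp
  apply (rule small_lt, rule pb)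
 apply (rule ex_Asg_Sq[where k = "2 * n * n"])
  apply simp
  apply (rule small_lt, rule pb)
 apply (rule ex_Asg_Sq[where k = 1])
  apply simp
  apply (rule small_lt, rule pb)
 apply (rule ex_Asg_Sq[where k = "n * n + 1"])
  apply simp
  apply (rule small_lt, rule pb)
 apply (rule ex_Asg_Sq[where k = R])
  apply simp
  apply (rule R_lt)
 apply (rule ex_Skip)
 done

lemma ex_prime:
 assumes g: "g 1 = n" "g 2 = 0" "g 20 = 0"
 shows "ex prime_cmd g h q (g(2 := p)) h q"
 unfolding prime_cmd_def
proof (rule ex_For[where k = n and G = "%t. g(2 := if p < t + 2 then p else 0)" and Hp = "%_. h" and Qs = "%_. q"])
 show "n <= X" "n < 2 ^ w" using small_X[OF pb(1)] small_lt[OF pb(1)] by auto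
 fix t assume t: "t < n"
 let ?G = "%t. g(2 := if p < t + 2 then p else 0)"
 have "ex (Ite (V 2) Skip (Ite (mod_exp (V 1) (Op Plus (V 20) (N 2))) Skip (Asg 2 (Op Plus (V 20) (N 2)))))
   ((?G t)(20 := t)) h q ((?G (Suc t))(20 := t)) h q"
 proof (rule ex_Ite)
  assume "ev (V 2) ((?G t)(20 := t)) h ~= 0"
  hence "p < t + 2" by (auto split: if_splits)
  hence "?G t = ?G (Suc t)" by simp
  thus "ex Skip ((?G t)(20 := t)) h q ((?G (Suc t))(20 := t)) h q" by (simp only:) (rule ex_Skip)
 next
  assume "ev (V 2) ((?G t)(20 := t)) h = 0"
  hence pt: "t + 2 <= p" using p_props(3) by (auto split: if_splits)
  show "ex (Ite (mod_exp (V 1) (Op Plus (V 20) (N 2))) Skip (Asg 2 (Op Plus (V 20) (N 2)))) ((?G t)(20 := t)) h q ((?G (Suc t))(20 := t)) h q"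
  proof (rule ex_Ite)
   assume "ev (mod_exp (V 1) (Op Plus (V 20) (N 2))) ((?G t)(20 := t)) h ~= 0"
   hence "n mod (t + 2) ~= 0" using g by simp
   hence "\<not> (t + 2) dvd n" by (simp add: dvd_eq_mod_eq_0)
   hence "p ~= t + 2" using p_props(2) by auto
   hence "?G t = ?G (Suc t)" using pt by auto
   thus "ex Skip ((?G t)(20 := t)) h q ((?G (Suc t))(20 := t)) h q" by (simp only:) (rule ex_Skip)
  next
   assume "ev (mod_exp (V 1) (Op Plus (V 20) (N 2))) ((?G t)(20 := t)) h = 0"
   hence "n mod (t + 2) = 0" using g by simp
   hence "p <= t + 2" by (intro p_props(5)) (auto simp: dvd_eq_mod_eq_0)
   hence pe: "p = t + 2" using pt by simp
   show "ex (Asg 2 (Op Plus (V 20) (N 2))) ((?G t)(20 := t)) h q ((?G (Suc t))(20 := t)) h q"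
    apply (rule ex_cong)
      apply (rule ex_Asg[where k = p])
    apply (simp add: pe)
    subgoal using small_lt[OF order_trans[OF p_props(4) pb(1)]] .
    by (auto simp: pe fun_eq_iff)
  qed
 qed
 thus "EX x. ex (Ite (V 2) Skip (Ite (mod_exp (V 1) (Op Plus (V 20) (N 2))) Skip (Asg 2 (Op Plus (V 20) (N 2)))))
   ((?G t)(20 := t)) h q ((?G (Suc t))(20 := x)) h q" by blast
qed (use g p_props in "auto simp: fun_eq_iff")

lemma ex_pow:
 assumes "g c = m" "g 20 = 0" "v ~= 20" "c ~= v" "m <= 20 * n ^ 3 - 1"
 shows "ex (pow_cmd v c) g h q (g(v := 2 ^ m)) h q"
 unfolding pow_cmd_def
proof (rule ex_Asg_Sq[where k = 1])
 have mw: "m < 20 * n ^ 3" using assms(5) pb(8) by linarith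
 show "1 < (2::nat) ^ w" by (rule small_lt) (rule pb)
 show "ex (For True 20 (V c) (Asg v (Op Times (N 2) (V v)))) (g(v := 1)) h q (g(v := 2 ^ m)) h q"
 proof (rule ex_For[where k = m and G = "%t. g(v := 2 ^ t)" and Hp = "%_. h" and Qs = "%_. q"])
  show "m <= X" "m < 2 ^ w" using small_X[of m] small_lt[of m] mw by auto
  fix t assume t: "t < m"
  have "ex (Asg v (Op Times (N 2) (V v))) ((g(v := 2 ^ t))(20 := t)) h q ((g(v := 2 ^ Suc t))(20 := t)) h q"
   apply (rule ex_cong)
     apply (rule ex_Asg[where k = "2 ^ Suc t"])
   subgoal using assms by simp
   subgoal unfolding w_def using t mw by (intro power_strict_increasing) auto
   using assms by (auto simp: fun_eq_iff)
  thus "EX x. ex (Asg v (Op Times (N 2) (V v))) ((g(v := 2 ^ t))(20 := t)) h q ((g(v := 2 ^ Suc t))(20 := x)) h q" by blast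
 qed (use assms in auto)
qed simp

lemma zc_lt: "zc < 2 ^ w"
proof -
 have "D + 2 * n < 2 ^ (D + 2 * n)" by (rule less_exp)
 also have "... <= 2 ^ (l + D + 2 * n)" by (rule power_increasing) auto
 finally have "D + 2 * n < 2 ^ (l + D + 2 * n)" .
 moreover have "(2::nat) ^ l <= 2 ^ (l + D + 2 * n)" by (rule power_increasing) auto
 ultimately have "zc < 2 ^ Suc (l + D + 2 * n)" unfolding zc_def power_Suc by linarith
 thus ?thesis
  by (rule small_pow) (use pb(12) in "simp add: l_eq D_def")
qed

lemma ex_zero:
 assumes "g 4 = l" "g 8 = D" "g 13 = 2 * n" "g 20 = 0"
 shows "ex zero_cmd g h q (g(5 := 2 ^ l, 7 := zc)) (h(zc := 1)) q"
 unfolding zero_cmd_def seqs.simps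
 apply (rule ex_Sq)
  apply (rule ex_pow[where m = l])
 subgoal using assms by simp
 subgoal using assms by simp
 apply simp
 apply simp
 subgoal using pb(11) by (simp add: l_eq)
 apply (rule ex_Asg_Sq[where k = zc])
 subgoal using assms by (simp add: zc_def)
 apply (rule zc_lt)
 apply (rule ex_Sq)
  apply (rule ex_Sto[where k = zc and m = 1])
 apply simp
 apply simp
 subgoal by (rule small_lt) (rule pb)
 by (rule ex_Skip)

definition "irows i = concat (map irow [0..<i])"
definition "ipart i k = map (%k. i * n + k) (filter (%k. p ^ i * 2 ^ k <= n) [0..<k])"

lemma rows_Suc: "irows (Suc i) = irows i @ ipart i n"
 by (simp add: irows_def irow_def ipart_def)

lemma part_Suc: "ipart i (Suc k) = ipart i k @ (if p ^ i * 2 ^ k <= n then [i * n + k] else [])"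
 by (simp add: ipart_def)

lemma part_len: "length (ipart i k) <= k"
proof -
 have "length (filter P [0..<k]) <= k" for P using length_filter_le[of P "[0..<k]"] by simp
 thus ?thesis by (simp add: ipart_def)
qed

lemma rows_len: "length (irows i) <= i * n"
proof (induction i)
 case (Suc i)
 thus ?case using part_len[of i n] by (simp add: rows_Suc)
qed (simp add: irows_def)

lemma p_pow: "i <= n ==> k <= n ==> p ^ i * 2 ^ k < 2 ^ w"
proof -
 assume i: "i <= n" and k: "k <= n"
 have "p ^ i <= n ^ i" using p_props(4) by (rule power_mono) simp
 also have "n ^ i <= (2 ^ n) ^ i" by (rule power_mono) (simp_all add: less_imp_le)
 also have "... = 2 ^ (n * i)" by (simp add: power_mult)
 also have "... <= 2 ^ (n * n)" using i by (intro power_increasing) auto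
 finally have "p ^ i * 2 ^ k <= 2 ^ (n * n) * 2 ^ n" using k by (intro mult_le_mono power_increasing) auto
 also have "... = 2 ^ (n * n + n)" by (simp add: power_add)
 also have "... < 2 ^ (n * n + n + n)" using n2 by (intro power_strict_increasing) auto
 finally show ?thesis by (rule small_pow) (rule pb)
qed

lemma ex_row:
 assumes g: "g 1 = n" "g 17 = n * n" "g 20 = i" "g 3 = length (irows i)" "g 31 = p ^ i" "g 21 = 0" and i: "i < n - 1"
 shows "ex row_cmd g (write_list h (2 * (n * n)) (irows i)) q
  (g(3 := length (irows (Suc i)), 31 := p ^ i * 2 ^ n)) (write_list h (2 * (n * n)) (irows (Suc i))) q"
 unfolding row_cmd_def
proof (rule ex_For[where k = n and G = "%t. g(3 := length (irows i @ ipart i t), 31 := p ^ i * 2 ^ t)"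
   and Hp = "%t. write_list h (2 * (n * n)) (irows i @ ipart i t)" and Qs = "%_. q"])
 show "n <= X" "n < 2 ^ w" using small_X[OF pb(1)] small_lt[OF pb(1)] by auto
 fix t assume t: "t < n"
 let ?G = "%t. g(3 := length (irows i @ ipart i t), 31 := p ^ i * 2 ^ t)"
 let ?Hp = "%t. write_list h (2 * (n * n)) (irows i @ ipart i t)"
 let ?c1 = "Ite (less_exp (V 1) (V 31)) Skip
  (Sq (Sto (Op Plus pos_base (V 3)) (Op Plus (Op Times (V 20) (V 1)) (V 21))) (Asg 3 (Op Plus (V 3) (N 1))))"
 let ?g1 = "((?G t)(3 := length (irows i @ ipart i (Suc t))))(21 := t)"
 have lenb: "length (irows i @ ipart i (Suc t)) <= n * n"
 proof -
  have "length (irows i @ ipart i (Suc t)) <= i * n + Suc t" using rows_len[of i] part_len[of i "Suc t"] by simp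
  also have "... <= Suc i * n" using t by simp
  also have "... <= n * n" using i by (intro mult_le_mono1) simp
  finally show ?thesis .
 qed
 have 1: "ex ?c1 ((?G t)(21 := t)) (?Hp t) q ?g1 (?Hp (Suc t)) q"
 proof (rule ex_Ite)
  assume "ev (less_exp (V 1) (V 31)) ((?G t)(21 := t)) (?Hp t) ~= 0"
  hence "\<not> p ^ i * 2 ^ t <= n" using g by simp
  hence "ipart i (Suc t) = ipart i t" by (simp add: part_Suc)
  thus "ex Skip ((?G t)(21 := t)) (?Hp t) q ?g1 (?Hp (Suc t)) q"
   by (intro ex_cong[OF ex_Skip]) (auto simp: fun_eq_iff)
 next
  assume "ev (less_exp (V 1) (V 31)) ((?G t)(21 := t)) (?Hp t) = 0"
  hence "p ^ i * 2 ^ t <= n" using g by simp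
  hence ps: "ipart i (Suc t) = ipart i t @ [i * n + t]" by (simp add: part_Suc)
  have it: "i * n + t <= n * n" using pair_index_lt[of i n t n] i t by linarith
  show "ex (Sq (Sto (Op Plus pos_base (V 3)) (Op Plus (Op Times (V 20) (V 1)) (V 21))) (Asg 3 (Op Plus (V 3) (N 1))))
   ((?G t)(21 := t)) (?Hp t) q ?g1 (?Hp (Suc t)) q"
   apply (rule ex_cong)
     apply (rule ex_Sq)
     apply (rule ex_Sto[where k = "2 * (n * n) + length (irows i @ ipart i t)" and m = "i * n + t"])
   subgoal using g by (simp add: pos_base_def)
   subgoal using g by simp
   subgoal using small_lt[OF order_trans[OF it pb(2)]] .
     apply (rule ex_Asg[where k = "length (irows i @ ipart i (Suc t))"])
   subgoal using g ps by simp
   subgoal using small_lt[OF order_trans[OF lenb pb(2)]] .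
   subgoal by (auto simp: fun_eq_iff)
   subgoal unfolding write_list_snoc ps by simp
   apply simp
   done
 qed
 have "ex (Sq ?c1 (Asg 31 (Op Times (N 2) (V 31)))) ((?G t)(21 := t)) (?Hp t) q ((?G (Suc t))(21 := t)) (?Hp (Suc t)) q"
  apply (rule ex_cong)
    apply (rule ex_Sq[OF 1])
    apply (rule ex_Asg[where k = "p ^ i * 2 ^ Suc t"])
  apply simp
  subgoal using p_pow[of i "Suc t"] i t by simp
  by (auto simp: fun_eq_iff)
 thus "EX x. ex (Sq ?c1 (Asg 31 (Op Times (N 2) (V 31)))) ((?G t)(21 := t)) (?Hp t) q ((?G (Suc t))(21 := x)) (?Hp (Suc t)) q"
  by blast
qed (use g in "auto simp: fun_eq_iff ipart_def[of i 0] rows_Suc")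

lemma ps_rows: "ps = irows (n - 1)" by (simp add: ps_def irows_def)

lemma b0_le: "b0 <= n * n"
 using rows_len[of "n - 1"] unfolding b0_def ps_rows by (meson diff_le_self le_trans mult_le_mono1)

lemma ex_pos:
 assumes g: "g 1 = n" "g 2 = p" "g 12 = n - 1" "g 17 = n * n" "g 3 = 0" "g 31 = 0" "g 20 = 0" "g 21 = 0"
 shows "ex pos_cmd g h q (g(30 := p ^ (n - 1), 3 := b0)) (write_list h (2 * (n * n)) (ps @ [n * n])) q"
 unfolding pos_cmd_def seqs.simps
proof (rule ex_Asg_Sq[where k = 1])
 show "1 < (2::nat) ^ w" by (rule small_lt) (rule pb)
 let ?G = "%i. g(30 := p ^ i, 3 := length (irows i))"
 let ?Hp = "%i. write_list h (2 * (n * n)) (irows i)"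
 have loop: "ex (For True 20 (V 12) (Sq (Asg 31 (V 30)) (Sq row_cmd (Sq (Asg 31 (N 0)) (Sq (Asg 30 (Op Times (V 30) (V 2))) Skip)))))
   (g(30 := 1)) h q (g(30 := p ^ (n - 1), 3 := b0)) (?Hp (n - 1)) q"
 proof (rule ex_For[where k = "n - 1" and G = ?G and Hp = ?Hp and Qs = "%_. q"])
  show "n - 1 <= X" "n - 1 < 2 ^ w" using small_X[OF pb(1)] small_lt[OF pb(1)] by auto
  fix i assume i: "i < n - 1"
  have "ex (Sq (Asg 31 (V 30)) (Sq row_cmd (Sq (Asg 31 (N 0)) (Sq (Asg 30 (Op Times (V 30) (V 2))) Skip))))
   ((?G i)(20 := i)) (?Hp i) q ((?G (Suc i))(20 := i)) (?Hp (Suc i)) q"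
   apply (rule ex_cong)
     apply (rule ex_Asg_Sq[where k = "p ^ i"])
   apply simp
   subgoal using p_pow[of i 0] i by simp
     apply (rule ex_Sq)
     apply (rule ex_row[where i = i, OF _ _ _ _ _ _ i])
   subgoal using g by simp
   subgoal using g by simp
   apply simp
   apply simp
   apply simp
   subgoal using g by simp
     apply (rule ex_Asg_Sq[where k = 0])
   apply simp
   apply simp
     apply (rule ex_Asg_Sq[where k = "p ^ Suc i"])
   subgoal using g by simp
   subgoal using p_pow[of "Suc i" 0] i by simp
     apply (rule ex_Skip)
   using g by (auto simp: fun_eq_iff)
  thus "EX x. ex (Sq (Asg 31 (V 30)) (Sq row_cmd (Sq (Asg 31 (N 0)) (Sq (Asg 30 (Op Times (V 30) (V 2))) Skip))))
   ((?G i)(20 := i)) (?Hp i) q ((?G (Suc i))(20 := x)) (?Hp (Suc i)) q" by blast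
 qed (use g in "auto simp: fun_eq_iff irows_def[of 0] b0_def ps_rows")
 show "ex (Sq (For True 20 (V 12) (Sq (Asg 31 (V 30)) (Sq row_cmd (Sq (Asg 31 (N 0)) (Sq (Asg 30 (Op Times (V 30) (V 2))) Skip)))))
   (Sq (Sto (Op Plus pos_base (V 3)) (V 17)) Skip))
   (g(30 := 1)) h q (g(30 := p ^ (n - 1), 3 := b0)) (write_list h (2 * (n * n)) (ps @ [n * n])) q"
  apply (rule ex_cong)
    apply (rule ex_Sq[OF loop])
    apply (rule ex_Sq)
    apply (rule ex_Sto[where k = "2 * (n * n) + length (irows (n - 1))" and m = "n * n"])
  subgoal using g by (simp add: pos_base_def b0_def ps_rows)
  subgoal using g by simp
  subgoal using small_lt[OF pb(2)] .
    apply (rule ex_Skip)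
  apply simp
  subgoal unfolding write_list_snoc ps_rows by simp
  apply simp
  done
qed simp

lemma s_le: "s <= n * n"
proof -
 have "4 <= n * n" using mult_le_mono[OF n2 n2] by simp
 thus ?thesis using b0_le unfolding s_def by linarith
qed

lemma ex_sizes:
 assumes g: "g 1 = n" "g 3 = b0" "g 7 = zc" "g 19 = 0" "g 20 = 0" and h: "h zc ~= 0"
 shows "ex sizes_cmd g h (basis {}) (g(16 := s, 15 := 2 ^ s, 37 := 2 ^ s * n, 36 := b0 + 1)) h (basis {0})"
 unfolding sizes_cmd_def seqs.simps
 apply (rule ex_cong)
   apply (rule ex_Asg_Sq[where k = s])
 subgoal using g by (simp add: s_def)
 subgoal using small_lt[OF order_trans[OF s_le pb(2)]] .
   apply (rule ex_Sq)
   apply (rule ex_pow[where m = s])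
 apply simp
 subgoal using g by simp
 apply simp
 apply simp
 subgoal using s_le pb(7) by linarith
   apply (rule ex_Asg_Sq[where k = "2 ^ s * n"])
 subgoal using g by simp
 subgoal
 proof -
  have "2 ^ s * n < 2 ^ s * 2 ^ n" by simp
  also have "... = 2 ^ (s + n)" by (simp add: power_add)
  finally show ?thesis by (rule small_pow) (use s_le pb(10) in linarith)
 qed
   apply (rule ex_Asg_Sq[where k = "b0 + 1"])
 subgoal using g by simp
 subgoal using small_lt[of "b0 + 1"] b0_le pb(7) by linarith
   apply (rule ex_Sq)
   apply (rule ex_circuit)
 apply simp
 apply simp
 apply simp
 subgoal using g by (simp add: bounds_ok_def)
   apply (rule ex_Skip)
 subgoal by (auto simp: fun_eq_iff)
 apply simp
 subgoal
 proof -
  have "read_map h zc 0 0 0 {} = {0}" using h by (simp add: read_map_def address_def)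
  thus ?thesis unfolding act_basis using g by simp
 qed
 done

lemmas num_eq_simps = num.simps numeral_eq_iff zero_neq_numeral numeral_eq_one_iff one_eq_numeral_iff
 numeral_neq_zero zero_neq_one one_neq_zero refl

lemma ex_setup: "EX g. ex (setup_cmd R) g_in h_in (basis {}) g hS (basis {0}) & base g & g 0 = 0 & (ALL v:{10, 11, 27, 28, 29, 32, 33, 34, 35, 38, 40, 41}. g v = 0)"
proof -
 let ?g1 = "gA(2 := p)"
 let ?g2 = "?g1(5 := 2 ^ l, 7 := zc)"
 let ?g3 = "?g2(30 := p ^ (n - 1), 3 := b0)"
 let ?g4 = "?g3(16 := s, 15 := 2 ^ s, 37 := 2 ^ s * n, 36 := b0 + 1)"
 have zcD: "2 * (n * n) + (n * n + 1) <= zc" unfolding zc_def D_def by simp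
 have hz: "hS zc ~= 0"
 proof -

  have "\<not> zc < 2 * (n * n) + length (ps @ [n * n])" using b0_le zcD by (simp add: b0_def)
  thus ?thesis by (simp add: hS_def write_list_def)
 qed
 have "ex (setup_cmd R) g_in h_in (basis {}) ?g4 hS (basis {0})"
  unfolding setup_cmd_def seqs.simps
  apply (rule ex_Sq[OF ex_assign])
  apply (rule ex_Sq[OF ex_prime])
  apply (simp add: gA_def)
  apply (simp add: gA_def g_in_def)
  apply (simp add: gA_def g_in_def)
  apply (rule ex_Sq[OF ex_zero])
  apply (simp add: gA_def)
  apply (simp add: gA_def)
  apply (simp add: gA_def)
  apply (simp add: gA_def g_in_def)
  apply (rule ex_Sq[OF ex_pos])
  apply (simp add: gA_def)
  apply (simp add: gA_def)
  apply (simp add: gA_def)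
  apply (simp add: gA_def)
  apply (simp add: gA_def g_in_def)
  apply (simp add: gA_def g_in_def)
  apply (simp add: gA_def g_in_def)
  apply (simp add: gA_def g_in_def)
  apply (rule ex_Sq)
   apply (unfold hS_def[symmetric])
   apply (rule ex_sizes)
  apply (simp add: gA_def)
  apply (simp add: gA_def)
  apply (simp add: gA_def)
  apply (simp add: gA_def g_in_def)
  apply (simp add: gA_def g_in_def)
  apply (rule hz)
  by (rule ex_Skip)
 moreover have "base ?g4" unfolding base_def gA_def g_in_def ball_simps(7,5)
  by (intro conjI TrueI; simp only: fun_upd_apply num_eq_simps if_True if_False)
 moreover have "?g4 0 = 0 & (ALL v:{10, 11, 27, 28, 29, 32, 33, 34, 35, 38, 40, 41}. ?g4 v = 0)"
  unfolding gA_def g_in_def ball_simps(7,5)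
  by (intro conjI TrueI; simp only: fun_upd_apply num_eq_simps if_True if_False)
 ultimately show ?thesis by blast
qed

end

section \<open>Collecting canonical forms\<close>

lemma concat_rect:
 assumes "ALL r:set M. length r = n"
 shows "length (concat M) = length M * n" "u < length M ==> v < n ==> concat M ! (u * n + v) = M ! u ! v"
proof -
 have "length (concat M) = length M * n & (u < length M --> v < n --> concat M ! (u * n + v) = M ! u ! v)" for u
  using assms
 proof (induction M arbitrary: u)
  case (Cons a M)
  thus ?case by (cases u) (auto simp: nth_append)
 qed simp
 thus "length (concat M) = length M * n" "u < length M ==> v < n ==> concat M ! (u * n + v) = M ! u ! v" by auto
qed

text \<open>Distinct powers of two sum to less than twice the largest. This gives the bound
  \<open>2 * n\<close> on the number of a choice, which sizes the unary counters.\<close>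

lemma sum_powers_less:
 assumes "finite S" "!!k. k : S ==> 2 ^ k <= m" "m > 0"
 shows "(\<Sum>k\<in>S. 2 ^ k) < 2 * (m::nat)"
proof (cases "S = {}")
 case False
 have "S <= {0..<Suc (Max S)}" using assms(1) by (auto simp: less_Suc_eq_le)
 hence "(\<Sum>k\<in>S. 2 ^ k) <= (\<Sum>k\<in>{0..<Suc (Max S)}. (2::nat) ^ k)" by (intro sum_mono2) auto
 also have "... = 2 ^ Suc (Max S) - 1" by (rule sum_power2)
 also have "... < 2 * 2 ^ Max S" by simp
 also have "... <= 2 * m" using assms(2)[OF Max_in[OF assms(1) False]] by simp
 finally show ?thesis .
qed (use assms in simp)

lemma sum_powers_lt: "A <= {..<k} ==> (\<Sum>i\<in>A. 2 ^ i) < (2::nat) ^ k"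
proof -
 assume "A <= {..<k}"
 hence "(\<Sum>i\<in>A. 2 ^ i) <= (\<Sum>i\<in>{0..<k}. (2::nat) ^ i)" by (intro sum_mono2) auto
 thus ?thesis using sum_power2[of k] by (simp add: le_less_trans)
qed

lemma address_lt: "address a k B < 2 ^ k"
 unfolding address_def by (rule sum_powers_lt) auto

lemma address_Suc: "address a (Suc k) B = address a k B + of_bool (a + k : B) * 2 ^ k"
proof -
 have "{i. i < Suc k & a + i : B} = {i. i < k & a + i : B} Un (if a + k : B then {k} else {})"
  by (auto simp: less_Suc_eq)
 thus ?thesis unfolding address_def by (subst sum.union_disjoint[symmetric] | auto)+
qed

context instance_data
begin

abbreviation "posl \<equiv> ps @ [n * n]"

definition "Q = (+) 4 ` set posl"

text \<open>The table together with its address in memory; the same circuit serves both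
  groups.\<close>

definition "sel T TB \<longleftrightarrow> T = TG & TB = 0 \<or> T = TH & TB = n * n"

lemma h_in_tab: "u < n ==> v < n ==> h_in (u * n + v) = TG ! u ! v"
 "u < n ==> v < n ==> h_in (n * n + u * n + v) = TH ! u ! v" "2 * (n * n) <= a ==> h_in a = 0"
proof -
 have G: "length TG = n" "ALL r:set TG. length r = n" and H: "length TH = n" "ALL r:set TH. length r = n"
  using TG TH by (auto simp: group_table_def)
 have len: "length (concat TG) = n * n" "length (concat TH) = n * n" using concat_rect(1) G H by metis+
 show "h_in a = 0" if "2 * (n * n) <= a" using that len by (simp add: h_in_def)
 assume uv: "u < n" "v < n"
 hence lt: "u * n + v < n * n" by (rule pair_index_lt)
 thus "h_in (u * n + v) = TG ! u ! v"
  using concat_rect(2)[OF G(2)] uv G len by (simp add: h_in_def nth_append)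
 have "h_in (n * n + (u * n + v)) = TH ! u ! v"
  using lt concat_rect(2)[OF H(2)] uv H len by (simp add: h_in_def nth_append)
 thus "h_in (n * n + u * n + v) = TH ! u ! v" by (simp add: add.assoc)
qed

lemma D_gt: "2 * (n * n) + (b0 + 1) <= D" "D + 2 ^ l <= zc" "D <= zc"
 using b0_le by (auto simp: D_def zc_def)

lemma hm_low: "a < 2 * (n * n) ==> hm A a = h_in a"
 using D_gt by (auto simp: hm_def hS_def write_list_def)

lemma hm_pos: "u <= b0 ==> hm A (2 * (n * n) + u) = posl ! u"
 using D_gt by (auto simp: hm_def hS_def write_list_def b0_def)

lemma hm_high: "D <= a ==> hm A a = (if a < D + 2 ^ l then of_bool (a - D : A) else of_bool (a = zc))"
 using D_gt h_in_tab(3)[of a] by (auto simp: hm_def hS_def write_list_def b0_def)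

lemma hm_upd: "a < 2 ^ l ==> (hm A)(D + a := 1) = hm (insert a A)"
 by (auto simp: hm_def fun_eq_iff)

lemma hm_empty: "hS = hm {}"
 by (auto simp: hm_def)

lemma sel_tab: "sel T TB ==> u < n ==> v < n ==> hm A (TB + u * n + v) = T ! u ! v"
 and sel_table: "sel T TB ==> group_table n T"
proof -
 assume s: "sel T TB"
 thus "group_table n T" using TG TH by (auto simp: sel_def)
 assume uv: "u < n" "v < n"
 have "u * n + v < n * n" by (rule pair_index_lt[OF uv])
 hence "hm A (TB + u * n + v) = h_in (TB + u * n + v)" using s by (intro hm_low) (auto simp: sel_def)
 thus "hm A (TB + u * n + v) = T ! u ! v" using s h_in_tab(1,2)[OF uv] by (auto simp: sel_def)
qed

lemma sel_group: "sel T TB ==> group (table_group T)" "sel T TB ==> carrier (table_group T) = {..<n}"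
 "sel T TB ==> finite (carrier (table_group T))" "sel T TB ==> card (carrier (table_group T)) = n"
 using sel_table by (auto simp: group_table_def table_group_def)

lemma irows_props: "distinct (irows i) & (ALL x:set (irows i). x < i * n)"
proof (induction i)
 case (Suc i)
 thus ?case by (fastforce simp: rows_Suc ipart_def distinct_map inj_on_def)
qed (simp add: irows_def)

lemma set_irows: "set (irows i) = {a * n + k | a k. a < i & k < n & p ^ a * 2 ^ k <= n}"
proof (induction i)
 case (Suc i)
 thus ?case by (auto simp: rows_Suc ipart_def less_Suc_eq)
qed (simp add: irows_def)

lemma ps_lt: "x : set ps ==> x < n * n"
 using irows_props[of "n - 1"] unfolding ps_rows by (meson diff_le_self less_le_trans mult_le_mono1)

lemma distinct_posl: "distinct posl"
 using irows_props[of "n - 1"] ps_lt by (auto simp: ps_rows)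

lemma len_posl: "length posl = b0 + 1" by (simp add: b0_def)

lemma Q_props: "Q <= {4..4 + n * n}" "finite Q" "card Q = b0 + 1"
proof -
 show "Q <= {4..4 + n * n}" unfolding Q_def using ps_lt by (auto simp: less_imp_le)
 show "finite Q" by (simp add: Q_def)
 have "card Q = card (set posl)" unfolding Q_def by (rule card_image, rule inj_onI) simp
 thus "card Q = b0 + 1" using distinct_card[OF distinct_posl] len_posl by simp
qed

definition "idx x i = address (4 + i * n) n x"

lemma idx_bit:
 assumes "x <= Q" "k < n" "4 + i * n + k : x"
 shows "2 ^ k <= n"
proof -
 have "i * n + k : set posl" using assms by (auto simp: Q_def)
 then consider "i * n + k = n * n" | a k' where "i * n + k = a * n + k'" "k' < n" "p ^ a * 2 ^ k' <= n"
  by (auto simp: ps_rows set_irows)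
 thus ?thesis
 proof cases
  \<comment> \<open>The additional index bit is bit 0 in the range of the nonexistent choice
    \<open>n\<close>.\<close>
  case 1
  hence "i * n + k = n * n + 0" by simp
  hence "k = 0" using pair_index_inj[of i n k n 0] assms(2) n2 by simp
  thus ?thesis using n2 by simp
 next
  case 2
  hence "k = k'" using pair_index_inj[of i n k a k'] assms(2) by simp
  moreover have "2 ^ k' <= n" by (rule order_trans[OF _ 2(3)]) (use p_props(3) in simp)
  ultimately show ?thesis by simp
 qed
qed

lemma idx_bound: "x <= Q ==> idx x i < 2 * n"
 unfolding idx_def address_def by (rule sum_powers_less) (use idx_bit n2 in auto)

lemma Q_lt: "x <= Q ==> insert 0 x <= {..<D}"
proof -
 assume "x <= Q"
 hence "x <= {4..4 + n * n}" using Q_props(1) by (rule subset_trans)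
 also have "... <= {..<D}" using n2 by (auto simp: D_def intro: le_less_trans)
 finally show ?thesis by (simp add: D_def)
qed

lemma circuit_inst:
 assumes s: "sel T TB" and x: "x <= Q"
 shows "circuit n D zc TB (hm A) (table_group T) (insert 0 x) (idx x)"
proof (rule circuit.intro)
 show "2 <= n" "D = 4 * n * n + 4" by (simp_all add: n2 D_def)
 show "group (table_group T)" by (rule sel_group(1)[OF s])
 show "carrier (table_group T) = {..<n}" by (rule sel_group(2)[OF s])
 show "hm A (TB + u * n + v) = u \<otimes>\<^bsub>table_group T\<^esub> v" if "u < n" "v < n" for u v
  using sel_tab[OF s that] by (simp add: table_group_def)
 show "hm A zc ~= 0" "!!a. 0 < a ==> hm A (zc + a) = 0" using D_gt by (simp_all add: hm_high)
 show "hm A (zc - k) = 0" if "0 < k" "k <= 2 * n" for k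
  using that by (subst hm_high) (auto simp: zc_def)
 show "2 * n <= zc" by (simp add: zc_def)
 have "insert 0 x <= {..<D}" by (rule Q_lt[OF x])
 moreover have "D <= D ^ 6" using self_le_power[of D 6] by (simp add: D_def)
 ultimately show "insert 0 x <= {..<D ^ 6}" by auto
 show "idx x i = address (4 + i * n) n (insert 0 x)" for i
  unfolding idx_def by (rule address_cong) auto
qed (use idx_bound[OF x] in auto)

definition "ser T x = (T, chain_series (table_group T) (idx x))"
definition "canon T x = encode_series n (Can (ser T x))"
text \<open>The canonical form read as a binary number, which is its offset in the table of
  codes.\<close>

definition code :: "table => nat set => nat" where "code T x = (\<Sum>k\<in>canon T x. 2 ^ k)"
definition "env T TB g \<longleftrightarrow> sel T TB & base g & g 10 = TB & g 11 = \<one>\<^bsub>table_group T\<^esub>"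

lemma comp_ser: "sel T TB ==> comp_series n (ser T x)"
 using sel_table chain_series_composition[OF sel_group(1,3)] by (simp add: comp_series_def ser_def)

lemma canon_lt: "sel T TB ==> canon T x <= {..<l}"
 using encode_lt[OF canonization_ok[OF Can comp_ser]] by (auto simp: canon_def l_def code_length_def)

lemma code_lt: "sel T TB ==> code T x < 2 ^ l"
 unfolding code_def by (rule sum_powers_lt[OF canon_lt])

lemma code_eq_iff:
 assumes "sel T TB" "sel T' TB'"
 shows "code T x = code T' x' \<longleftrightarrow> series_iso (ser T x) (ser T' x')"
proof -
 have "code T x = code T' x' \<longleftrightarrow> canon T x = canon T' x'"
  using set_encode_eq[of "canon T x" "canon T' x'"] finite_subset[OF canon_lt] assms
  by (auto simp: code_def set_encode_def)
 thus ?thesis unfolding canon_def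
  using canonical_codes_iff[OF Can comp_ser[OF assms(1)] comp_ser[OF assms(2)]] by simp
qed

text \<open>Beyond the whole group the chain is empty, just like the padding of the encoding, so the
  circuit can copy all \<open>n\<close> terms without knowing the length of the series.\<close>

lemma encode_ser:
 assumes s: "sel T TB"
 shows "encode_series n (ser T x) = {(i * n + j) * n + i \<otimes>\<^bsub>table_group T\<^esub> j | i j. i < n & j < n}
  Un {n ^ 3 + i * n + y | i y. i < n & y : chain (table_group T) (idx x) i}"
proof -
 obtain m where m: "m < card (carrier (table_group T))" "!!i. i <= m ==> chain (table_group T) (idx x) i ~= {}"
  "!!i. m < i ==> chain (table_group T) (idx x) i = {}"
  by (rule chain_length[OF sel_group(1)[OF s] sel_group(3)[OF s], where r = "idx x"]) blast
 have c: "chain_series (table_group T) (idx x) = map (chain (table_group T) (idx x)) [0..<Suc m]"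
  by (rule chain_series_eq) (use sel_group s m in auto)
 have "i < Suc m & y : chain_series (table_group T) (idx x) ! i \<longleftrightarrow> i < n & y : chain (table_group T) (idx x) i" for i y
  using m unfolding c sel_group(4)[OF s] by (cases "i < Suc m") (auto simp del: upt_Suc)
 thus ?thesis unfolding encode_series_def ser_def c by (auto simp: table_group_def simp del: upt_Suc)
qed

lemma series_run:
 assumes e: "env T TB g" and x: "x <= Q"
 shows "runs (gates f series_cmd g (hm A)) (insert 0 x) Int {..<D * D} = insert 0 x"
  and "address (2 * (D * D)) l (runs (gates f series_cmd g (hm A)) (insert 0 x)) = code T x"
proof -
 have s: "sel T TB" using e by (simp add: env_def)
 interpret circuit n D zc TB "hm A" "table_group T" "insert 0 x" "idx x" f by (rule circuit_inst[OF s x])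
 have g: "genv g" "g 4 = n ^ 3 + n ^ 2" using e by (auto simp: genv_def env_def base_def l_def)
 have "insert 0 x <= {..<D}" by (rule Q_lt[OF x])
 moreover have "D <= D * D" by simp
 ultimately have low2: "insert 0 x <= {..<D * D}" by (meson lessThan_subset_iff subset_trans)
 let ?B = "runs (gates f series_cmd g (hm A)) (insert 0 x)"
 show "?B Int {..<D * D} = insert 0 x" by (rule series_correct(1)[OF g low2])
 have o: "canonization_oracle Can (code_length n) (encode_series n (ser T x)) = canon T x"
  unfolding canon_def by (rule canonization_oracle_eq[OF comp_ser[OF s]])
 have "2 * (D * D) + k : ?B \<longleftrightarrow> k : canon T x" if "k < l" for k
  using series_correct(2)[OF g low2, of k] that o
  unfolding encode_ser[OF s] code_length_def f_def[symmetric] l_def[symmetric] by (simp only:)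
 hence "{k. k < l & 2 * (D * D) + k : ?B} = canon T x" using canon_lt[OF s] by auto
 thus "address (2 * (D * D)) l ?B = code T x" by (simp add: address_def code_def)
qed

lemma base_upd: "v : {0, 10, 11, 27, 28, 29, 32, 33, 34, 35, 38, 40, 41} ==> base (g(v := k)) = base g"
proof -
 assume "v : {0, 10, 11, 27, 28, 29, 32, 33, 34, 35, 38, 40, 41}"
 hence "(g(v := k)) u = g u" if "u : {1, 2, 3, 4, 7, 8, 9, 12, 13, 14, 15, 16, 17, 18, 19, 20, 21, 22, 23, 24, 25, 26, 36, 37, 39, 42}" for u
  using that by (intro fun_upd_other) (elim insertE emptyE; simp)
 thus ?thesis unfolding base_def by (simp del: fun_upd_apply)
qed

text \<open>The identity is the only idempotent of a group, so comparing \<open>t * t\<close> with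
  \<open>t\<close> finds it.\<close>

lemma ex_ident:
 assumes s: "sel T TB" and g: "base g" "g 10 = TB" "g 11 = y"
 shows "ex ident_cmd g (hm A) q (g(11 := \<one>\<^bsub>table_group T\<^esub>)) (hm A) q"
proof -
 interpret G: group "table_group T" by (rule sel_group(1)[OF s])
 let ?o = "\<one>\<^bsub>table_group T\<^esub>"
 have o: "?o < n" using G.one_closed sel_group(2)[OF s] by simp
 have idem: "T ! t ! t = t \<longleftrightarrow> t = ?o" if "t < n" for t
 proof -
  have "t : carrier (table_group T)" using sel_group(2)[OF s] that by simp
  from G.l_cancel_one[OF this this] show ?thesis by (simp add: table_group_def)
 qed
 let ?G = "%t. g(11 := if ?o < t then ?o else y)"
 let ?c = "Ite (eq_exp (mult_exp (V 20) (V 20)) (V 20)) (Asg 11 (V 20)) Skip"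
 show ?thesis unfolding ident_cmd_def
 proof (rule ex_For[where k = n and G = ?G and Hp = "%_. hm A" and Qs = "%_. q"])
  show "n <= X" "n < 2 ^ w" using small_X[OF pb(1)] small_lt[OF pb(1)] by auto
  fix t assume t: "t < n"
  have v: "ev (mult_exp (V 20) (V 20)) ((?G t)(20 := t)) (hm A) = T ! t ! t"
   using sel_tab[OF s t t, of A] g by (simp add: base_def)
  have "ex ?c ((?G t)(20 := t)) (hm A) q ((?G (Suc t))(20 := t)) (hm A) q"
  proof (rule ex_Ite)
   assume "ev (eq_exp (mult_exp (V 20) (V 20)) (V 20)) ((?G t)(20 := t)) (hm A) ~= 0"
   hence "t = ?o" using v idem[OF t] by (simp del: fun_upd_apply) simp
   thus "ex (Asg 11 (V 20)) ((?G t)(20 := t)) (hm A) q ((?G (Suc t))(20 := t)) (hm A) q"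
    using small_lt[OF order_trans[OF less_imp_le[OF t] pb(1)]]
    by (intro ex_cong[OF ex_Asg[where k = t]]) (auto simp: fun_eq_iff)
  next
   assume "ev (eq_exp (mult_exp (V 20) (V 20)) (V 20)) ((?G t)(20 := t)) (hm A) = 0"
   hence "t ~= ?o" using v idem[OF t] by (simp del: fun_upd_apply) simp
   hence "?G (Suc t) = ?G t" by auto
   thus "ex Skip ((?G t)(20 := t)) (hm A) q ((?G (Suc t))(20 := t)) (hm A) q"
    by (simp only:) (rule ex_Skip)
  qed
  thus "EX x. ex ?c ((?G t)(20 := t)) (hm A) q ((?G (Suc t))(20 := x)) (hm A) q" by blast
 qed (use g o in "auto simp: base_def fun_eq_iff")
qed

lemma ex_gates:
 assumes g: "base g" and c: "reversible c" "wf_cmd c" "loop_vars c <= {20, 21, 22, 23, 24, 25, 26}"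
  "bound_exps c <= V ` {1, 4, 9, 12, 13, 14, 17, 18}"
 shows "ex c g h q g h (act (gates f c g h) q)"
  and "ex (invc c) g h q g h (act (rev (gates f c g h)) q)"
proof -
 have lv: "ALL v:loop_vars c. g v = 0" using g c(3) by (auto simp: base_def)
 have lL: "l <= L" "D <= L" using pb(3,4) by (simp_all add: l_eq D_def L_def)
 have gL: "g v <= L" if "v : {1, 4, 9, 12, 13, 14, 17, 18}" for v
  using that g lL pb by (auto simp: base_def L_def)
 have "EX u. e = V u & u ~: loop_vars c & g u <= L" if e: "e : bound_exps c" for e
 proof -
  obtain u where u: "e = V u" "u : {1, 4, 9, 12, 13, 14, 17, 18}" using c(4) e by blast
  moreover have "u ~: loop_vars c" using u(2) c(3) by auto
  ultimately show ?thesis using gL by blast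
 qed
 hence bd: "bounds_ok L c g" "bounds_ok L (invc c) g" by (auto simp: bounds_ok_def)
 show "ex c g h q g h (act (gates f c g h) q)" by (rule ex_circuit[OF c(1,2) lv bd(1)])
 show "ex (invc c) g h q g h (act (rev (gates f c g h)) q)"
  unfolding gates_inverse[symmetric] by (rule ex_circuit) (use c lv bd in auto)
qed

text \<open>The binary digits of \<open>z\<close> placed on the first \<open>t\<close> index bits.
  For \<open>t = s\<close> these are the indices of \<open>G\<close> whose canonical forms are
  stored.\<close>

definition zset :: "nat => nat => nat set" where "zset t z = {4 + posl ! u | u. u < t & odd (z div 2 ^ u)}"

lemma b0_pos: "1 <= b0"
proof -
 have "0 : set ps" unfolding ps_rows set_irows using n2 by (intro CollectI exI[of _ 0]) auto
 hence "ps ~= []" by auto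
 thus ?thesis by (cases ps) (auto simp: b0_def)
qed

lemma s_le_b0: "s <= b0" using b0_pos by (simp add: s_def)

lemma posl_nth_inj: "u <= b0 ==> v <= b0 ==> posl ! u = posl ! v \<longleftrightarrow> u = v"
 using nth_eq_iff_index_eq[OF distinct_posl] by (simp add: b0_def)

lemma zset_Suc: "zset (Suc t) z = zset t z Un (if odd (z div 2 ^ t) then {4 + posl ! t} else {})"
 by (auto simp: zset_def less_Suc_eq)

lemma zset_subset: "t <= b0 ==> zset t z \<subseteq> (+) 4 ` set ps"
 by (fastforce simp: zset_def b0_def nth_append)

lemma zset_Q: "t <= b0 ==> zset t z <= Q"
 using zset_subset by (auto simp: Q_def)

lemma ex_bits:
 assumes g: "base g" "g 27 = z" "g 32 = 0" and z: "z < 2 ^ s" and B: "0 : B"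
 shows "ex bits_cmd g (hm A) (basis B) g (hm A) (basis (sym_diff B (zset s z)))"
proof -
 let ?G = "%t. g(32 := z div 2 ^ t)" and ?Q = "%t. basis (sym_diff B (zset t z))"
 let ?t = "Tof (N 0) (N 0) (pos_exp (V 20))"
 let ?c = "Sq (Ite (mod_exp (V 32) (N 2)) ?t Skip) (Sq (Asg 32 (Op Divide (V 32) (N 2))) Skip)"
 have zw: "z < 2 ^ w" by (rule small_pow[OF z]) (use s_le pb(2) in linarith)
 have loop: "ex (For True 20 (V 16) ?c) (g(32 := z)) (hm A) (basis B) g (hm A) (basis (sym_diff B (zset s z)))"
 proof (rule ex_For[where k = s and G = ?G and Hp = "%_. hm A" and Qs = ?Q])
  have "s <= 20 * n ^ 3" using s_le pb(2) by linarith
  thus "s <= X" "s < 2 ^ w" using small_X small_lt by auto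
  fix t assume t: "t < s"
  have tb: "t <= b0" using t s_le_b0 by simp
  have nz: "4 + posl ! t ~: zset t z" using posl_nth_inj tb by (auto simp: zset_def)
  have z0: "0 ~: zset t z" by (auto simp: zset_def)
  let ?g = "(?G t)(20 := t)"
  have pe: "ev (pos_exp (V 20)) ?g (hm A) = 4 + posl ! t"
   using hm_pos[OF tb, of A] g by (simp add: pos_exp_def pos_base_def base_def)
  have 1: "ex (Ite (mod_exp (V 32) (N 2)) ?t Skip) ?g (hm A) (?Q t) ?g (hm A) (?Q (Suc t))"
  proof (rule ex_Ite)
   assume "ev (mod_exp (V 32) (N 2)) ?g (hm A) ~= 0"
   hence "odd (z div 2 ^ t)" by (simp add: odd_iff_mod_2_eq_one)
   hence "sym_diff B (zset (Suc t) z) = sym_diff (sym_diff B (zset t z)) {4 + posl ! t}"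
    using nz by (auto simp: zset_Suc)
   hence "runs (gates f ?t ?g (hm A)) (sym_diff B (zset t z)) = sym_diff B (zset (Suc t) z)"
    using B z0 by (simp add: pe tof_map_def del: fun_upd_apply)
   thus "ex ?t ?g (hm A) (?Q t) ?g (hm A) (?Q (Suc t))"
    by (intro ex_cong[OF ex_circuit]) (auto simp: act_basis bounds_ok_def simp del: gates.simps fun_upd_apply)
  next
   assume "ev (mod_exp (V 32) (N 2)) ?g (hm A) = 0"
   hence "even (z div 2 ^ t)" by (simp add: even_iff_mod_2_eq_zero)
   hence "?Q (Suc t) = ?Q t" by (simp add: zset_Suc)
   thus "ex Skip ?g (hm A) (?Q t) ?g (hm A) (?Q (Suc t))" by (simp only:) (rule ex_Skip)
  qed
  have "z div 2 ^ Suc t < 2 ^ w" using zw by (meson div_le_dividend le_less_trans)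
  moreover have "z div 2 ^ t div 2 = z div 2 ^ Suc t" unfolding power_Suc2 by (rule div_mult2_eq[symmetric])
  ultimately have "ex ?c ?g (hm A) (?Q t) ((?G (Suc t))(20 := t)) (hm A) (?Q (Suc t))"
   by (intro ex_cong[OF ex_Sq[OF 1 ex_Sq[OF ex_Asg[where k = "z div 2 ^ Suc t"] ex_Skip]]]) (auto simp: fun_eq_iff)
  thus "EX x. ex ?c ?g (hm A) (?Q t) ((?G (Suc t))(20 := x)) (hm A) (?Q (Suc t))" by blast
 qed (use g z in "auto simp: base_def fun_eq_iff zset_def")
 show ?thesis unfolding bits_cmd_def seqs.simps
  by (rule ex_Asg_Sq[where k = z, OF _ zw loop]) (use g in simp)
qed

lemma pow_lt_w: "t <= l ==> (2::nat) ^ t < 2 ^ w"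
 using pb(11) by (intro power_strict_increasing) (auto simp: w_def l_eq)

lemma ex_read:
 assumes g: "base g" "g 33 = 0" "g 34 = 0" "g 35 = 0"
 shows "ex read_cmd g h (basis B) (g(34 := address (2 * (D * D)) l B)) h (basis B)"
proof -
 let ?G = "%t. g(34 := address (2 * (D * D)) t B, 35 := 2 ^ t)"
 let ?c = "Sq (Meas 33 (Op Plus y_base (V 20))) (Sq (Asg 34 (Op Plus (V 34) (Op Times (V 33) (V 35))))
  (Sq (Asg 35 (Op Times (N 2) (V 35))) (Sq (Asg 33 (N 0)) Skip)))"
 have loop: "ex (For True 20 (V 4) ?c) (g(35 := 1)) h (basis B) (?G l) h (basis B)"
 proof (rule ex_For[where k = l and G = ?G and Hp = "%_. h" and Qs = "%_. basis B"])
  show "l <= X" "l < 2 ^ w" using small_X[of l] small_lt[of l] pb(3) by (auto simp: l_eq)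
  fix t assume t: "t < l"
  have aw: "address (2 * (D * D)) (Suc t) B < 2 ^ w"
   using less_trans[OF address_lt pow_lt_w[of "Suc t"]] t by simp
  have "ex ?c ((?G t)(20 := t)) h (basis B) ((?G (Suc t))(20 := t)) h (basis B)"
   apply (rule ex_cong)
     apply (rule ex_Sq)
     apply (rule ex_Meas_basis[where x = "2 * (D * D) + t"])
   subgoal using g by (simp add: y_base_def x_base_def base_def)
     apply (rule ex_Asg_Sq[where k = "address (2 * (D * D)) (Suc t) B"])
   apply (simp add: address_Suc)
   apply (rule aw)
     apply (rule ex_Asg_Sq[where k = "2 ^ Suc t"])
   apply simp
   subgoal using pow_lt_w[of "Suc t"] t by simp
     apply (rule ex_Asg_Sq[where k = 0])
   apply simp
   apply simp
     apply (rule ex_Skip)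
   using g by (auto simp: fun_eq_iff)
  thus "EX x. ex ?c ((?G t)(20 := t)) h (basis B) ((?G (Suc t))(20 := x)) h (basis B)" by blast
 qed (use g in "auto simp: base_def fun_eq_iff address_def[of _ 0]")
 show ?thesis unfolding read_cmd_def seqs.simps
  apply (rule ex_cong)
    apply (rule ex_Asg_Sq[where k = 1])
  apply simp
  subgoal using pow_lt_w[of 0] by simp
    apply (rule ex_Sq[OF loop])
    apply (rule ex_Asg_Sq[where k = 0])
  apply simp
  apply simp
    apply (rule ex_Skip)
  using g by (auto simp: fun_eq_iff)
qed

lemma ex_entry:
 assumes e: "env T TB g" and g: "g 27 = z" "ALL v:{32, 33, 34, 35}. g v = 0" and z: "z < 2 ^ s"
 shows "ex entry_cmd g (hm A) (basis {0}) g (hm (insert (code T (zset s z)) A)) (basis {0})"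
proof -
 let ?x = "zset s z" and ?G = "gates f series_cmd g (hm A)" and ?c = "code T (zset s z)"
 let ?g = "g(34 := ?c)"
 have b: "base g" "base ?g" using e by (simp_all add: env_def base_upd)
 have x: "?x <= Q" by (rule zset_Q[OF s_le_b0])
 have z0: "0 ~: ?x" by (auto simp: zset_def)
 have s1: "sym_diff {0} ?x = insert 0 ?x" "sym_diff (insert 0 ?x) ?x = {0}" using z0 by auto
 let ?B = "runs ?G (insert 0 ?x)"
 have 1: "ex bits_cmd g (hm A) (basis {0}) g (hm A) (basis (insert 0 ?x))"
  using ex_bits[OF b(1) g(1) _ z, of "{0}" A] g(2) unfolding s1 by simp
 have 2: "ex series_cmd g (hm A) (basis (insert 0 ?x)) g (hm A) (basis ?B)"
  unfolding act_basis[symmetric] by (rule ex_gates(1)[OF b(1) series_cmd_wf])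
 have 3: "ex read_cmd g (hm A) (basis ?B) ?g (hm A) (basis ?B)"
  using ex_read[OF b(1), of "hm A" ?B] g(2) unfolding series_run(2)[OF e x] by simp
 \<comment> \<open>Variable 34 has received the code in the meantime, but the circuit does not read
   it.\<close>
 have same: "gates f series_cmd ?g (hm A) = ?G" by (rule gates_unread) (simp add: test_cmd_unread)
 have "act (rev ?G) (basis ?B) = basis (insert 0 ?x)"
  unfolding gates_inverse[symmetric] act_basis unfolding gates_inverse runs_inverse ..
 hence 4: "ex (invc series_cmd) ?g (hm A) (basis ?B) ?g (hm A) (basis (insert 0 ?x))"
  using ex_gates(2)[OF b(2) series_cmd_wf, of "hm A" "basis ?B"] unfolding same by simp
 have 5: "ex bits_cmd ?g (hm A) (basis (insert 0 ?x)) ?g (hm A) (basis {0})"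
  using ex_bits[OF b(2) _ _ z, of "insert 0 ?x" A] g unfolding s1 by simp
 have cl: "?c < 2 ^ l" using e by (intro code_lt[of T TB]) (simp add: env_def)
 show ?thesis unfolding entry_cmd_def seqs.simps
  apply (rule ex_cong)
    apply (rule ex_Sq[OF 1 ex_Sq[OF 2 ex_Sq[OF 3 ex_Sq[OF 4 ex_Sq[OF 5]]]]])
    apply (rule ex_Sq)
    apply (rule ex_Sto[where k = "D + ?c" and m = 1])
  subgoal using b(1) by (simp add: base_def)
  apply simp
  subgoal using pow_lt_w[of 0] by simp
    apply (rule ex_Asg_Sq[where k = 0])
  apply simp
  apply simp
    apply (rule ex_Skip)
  using g hm_upd[OF cl] by (auto simp: fun_eq_iff)
qed

definition "codes = (%z. code TG (zset s z)) ` {..<2 ^ s}"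

text \<open>The \<open>2 ^ s\<close> iterations are not bounded by \<open>X\<close>, so their number
  stays visible in the cost.\<close>

lemma exact_collect:
 assumes e: "env TG 0 g" and g: "g 27 = 0" "ALL v:{32, 33, 34, 35}. g v = 0"
 shows "exact f w collect_cmd g hS (basis {0}) g (hm codes) (basis {0})
  (loop_cost w (V 15) (2 ^ s) (cost entry_cmd))"
proof -
 let ?H = "%t. hm ((%z. code TG (zset s z)) ` {..<t})"
 have "exact f w (For True 27 (V 15) entry_cmd) g (?H 0) (basis {0}) g (?H (2 ^ s)) (basis {0})
  (loop_cost w (V 15) (2 ^ s) (cost entry_cmd))"
 proof (rule exact_For[where G = "%_. g" and Hp = ?H and Qs = "%_. basis {0}"])
  show "(2::nat) ^ s < 2 ^ w" using s_le pb(7) by (intro power_strict_increasing) (auto simp: w_def)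
  fix t :: nat assume t: "t < 2 ^ s"
  have "env TG 0 (g(27 := t))" using e by (simp add: env_def base_upd)
  from ex_entry[OF this _ _ t, of "(%z. code TG (zset s z)) ` {..<t}"] g
  have "ex entry_cmd (g(27 := t)) (?H t) (basis {0}) (g(27 := t)) (?H (Suc t)) (basis {0})"
   by (simp add: lessThan_Suc)
  thus "EX x. exact f w entry_cmd (g(27 := t)) (?H t) (basis {0}) (g(27 := x)) (?H (Suc t)) (basis {0})
   (cost entry_cmd)" unfolding ex_def by blast
 qed (use e g in "auto simp: env_def base_def")
 thus ?thesis unfolding collect_cmd_def codes_def by (simp add: hm_empty)
qed

end

section \<open>Collision search\<close>

text \<open>Outcome 1 is certain to make \<open>d\<close> set register 0, so failure is at most as
  probable as outcome 0.\<close>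

lemma fails_Meas_Sq:
 assumes d: "triple f w (%g h q. EX g0 q0. P g0 h q0 & g = g0(v := 1) & q = collapse (ev e g0 h) True q0) d (%g h q. g 0 ~= 0) t"
  and p: "!!g h q. P g h q ==> outcome_prob (ev e g h) True q = \<pi>" "0 <= \<pi>" "\<pi> <= 1" and w: "1 <= w"
 shows "fails f w P (Sq (Meas v e) d) (1 - \<pi>)"
 unfolding fails_def
proof (intro allI impI)
 fix s :: config assume s: "P (reg s) (heap s) (qst s) & bdd w (reg s) (heap s)"
 define F where "F b = spend (ecs e s + 1 + fl (eva e s)) (set_reg v (of_bool b) (apply_gate (collapse (eva e s) b) s))" for b
 have pr: "outcome_prob (eva e s) True (qst s) = \<pi>" using p(1) s by (simp add: eva_def)
 have sem: "sem f (Sq (Meas v e) d) s = bind_pmf (bernoulli_pmf \<pi>) (%b. sem f d (F b))"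
  by (simp add: pr F_def bind_map_pmf)
 have FT: "reg (F True) = (reg s)(v := 1)" "heap (F True) = heap s" "qst (F True) = collapse (ev e (reg s) (heap s)) True (qst s)"
  by (simp_all add: F_def eva_def apply_gate_def set_reg_def)
 have "1 < (2::nat) ^ w" using w by (metis one_less_power one_less_numeral_iff semiring_norm(76) Suc_le_eq One_nat_def)
 hence bd: "bdd w (reg (F True)) (heap (F True))" using s unfolding FT by (auto intro: bdd_upd)
 have "EX g0 q0. P g0 (heap (F True)) q0 & reg (F True) = g0(v := 1) & qst (F True) = collapse (ev e g0 (heap (F True))) True q0"
  unfolding FT using s by (intro exI[of _ "reg s"] exI[of _ "qst s"]) simp
 with bd have "fail_prob (sem f d (F True)) = 0"
  using d[unfolded triple_def, rule_format, of "F True"] by (intro fail_prob_0) blast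
 hence "fail_prob (sem f (Sq (Meas v e) d) s) = fail_prob (sem f d (F False)) * (1 - \<pi>)"
  unfolding sem fail_prob_bind using p(2,3) by simp
 also have "... <= 1 * (1 - \<pi>)" using p(3) fail_prob_le_1 by (intro mult_right_mono) auto
 finally show "fail_prob (sem f (Sq (Meas v e) d) s) <= 1 - \<pi>" by simp
qed

lemma fails_Ite:
 assumes "fails f w (%g h q. P g h q & ev e g h ~= 0) c dl" "fails f w (%g h q. P g h q & ev e g h = 0) d dl"
 shows "fails f w P (Ite e c d) dl"
 unfolding fails_def
proof (intro allI impI)
 fix s :: config assume s: "P (reg s) (heap s) (qst s) & bdd w (reg s) (heap s)"
 let ?s = "spend (ecs e s + 1 + fl (eva e s)) s"
 have s': "P (reg ?s) (heap ?s) (qst ?s) & bdd w (reg ?s) (heap ?s)" "ev e (reg ?s) (heap ?s) = eva e s"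
  using s by (simp_all add: eva_def)
 show "fail_prob (sem f (Ite e c d) s) <= dl"
 proof (cases "eva e s = 0")
  case True
  thus ?thesis using assms(2)[unfolded fails_def, rule_format, of ?s] s' by simp
 next
  case False
  thus ?thesis using assms(1)[unfolded fails_def, rule_format, of ?s] s' by simp
 qed
qed

lemma fails_mono: "fails f w P c dl ==> (!!g h q. P' g h q ==> P g h q) ==> dl <= dl' ==> fails f w P' c dl'"
 unfolding fails_def by (meson order_trans)

lemma fails_1: "fails f w P c 1"
 by (simp add: fails_def fail_prob_le_1)

lemma fails_split:
 assumes "fails f w (%g h q. P g h q & g 0 = 0) c dl" "triple f w (%g h q. P g h q & g 0 ~= 0) c (%g h q. g 0 ~= 0) t" "0 <= dl"
 shows "fails f w P c dl"
 unfolding fails_def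
proof (intro allI impI)
 fix s :: config assume s: "P (reg s) (heap s) (qst s) & bdd w (reg s) (heap s)"
 show "fail_prob (sem f c s) <= dl"
 proof (cases "reg s 0 = 0")
  case True
  thus ?thesis using assms(1)[unfolded fails_def, rule_format, of s] s by simp
 next
  case False
  hence "fail_prob (sem f c s) = 0"
   using assms(2)[unfolded triple_def, rule_format, of s] s by (intro fail_prob_0) blast
  thus ?thesis using assms(3) by simp
 qed
qed

section \<open>Triples with one exponential factor\<close>

context machine
begin

text \<open>\<open>M\<close> accounts for loops with up to \<open>M\<close> iterations. Such a loop
  over a body of polynomial cost introduces the factor, by \<open>cost_For_big\<close>; sequences
  and loops with at most \<open>X\<close> iterations keep it, so it enters only once.\<close>

definition wm :: "nat => assertion => cmd => assertion => bool" where
 "wm M P c Q \<longleftrightarrow> triple f w P c Q (cost c * M)"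

lemma wm_conseq: "wm M P' c Q' ==> (!!g h q. P g h q ==> P' g h q) ==> (!!g h q. Q' g h q ==> Q g h q) ==> wm M P c Q"
 unfolding wm_def by (erule triple_conseq) auto

lemma wm_pre: "(!!g h q. P g h q ==> wm M (%g' h' q'. g' = g & h' = h & q' = q) c Q) ==> wm M P c Q"
 unfolding wm_def by (rule triple_pre)

lemma wm_triple: "triple f w P c Q t ==> t <= cost c * M ==> wm M P c Q"
 unfolding wm_def by (erule triple_conseq) auto

lemma wm_mono: "wm M P c Q ==> M <= M' ==> wm M' P c Q"
 unfolding wm_def by (erule triple_conseq) auto

lemma wm_ex: "ex c g h q g' h' q' ==> 1 <= M ==> wm M (%g1 h1 q1. g1 = g & h1 = h & q1 = q) c (%g1 h1 q1. g1 = g' & h1 = h' & q1 = q')"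
 unfolding ex_def exact_def by (erule wm_triple) simp

lemma wm_Skip: "wm M P Skip P"
 by (rule wm_triple[OF triple_Skip]) simp

lemma wm_Sq: "wm M P c Q ==> wm M Q d R ==> wm M P (Sq c d) R"
 unfolding wm_def by (erule (1) triple_conseq[OF triple_Sq]) (use mult_le_mono1[OF cost_Sq, of c d M] in "simp_all add: add_mult_distrib")

lemma wm_Asg: "(!!g h q. P g h q ==> ev e g h < 2 ^ w & Q (g(v := ev e g h)) h q) ==> 1 <= M ==> wm M P (Asg v e) Q"
 using cost_unit[of e] by (intro wm_triple[OF triple_Asg]) (auto intro: order_trans)

lemma wm_Ite:
 assumes "wm M (%g h q. P g h q & ev e g h ~= 0) c Q" "wm M (%g h q. P g h q & ev e g h = 0) d Q" "1 <= M"
 shows "wm M P (Ite e c d) Q"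
proof -
 let ?Y = "X ^ cdepth (Ite e c d)"
 have "cost c * M <= (csize c + csize d) * ?Y * M"
  "cost d * M <= (csize c + csize d) * ?Y * M"
  by (rule mult_le_mono1, rule mult_le_mono, simp, rule X_pow, simp)+
 hence t: "triple f w P (Ite e c d) Q (unit_cost w e + (csize c + csize d) * ?Y * M)"
  using assms unfolding wm_def by (intro triple_Ite) (auto elim: triple_conseq)
 have "unit_cost w e + (csize c + csize d) * ?Y * M <= (unit_cost w e + (csize c + csize d) * ?Y) * M"
  using assms(3) by (simp add: add_mult_distrib)
 also have "... <= csize (Ite e c d) * ?Y * M" by (rule mult_le_mono1, rule cost_Ite) simp
 finally show ?thesis by (rule wm_triple[OF t])
qed

lemma wm_For:
 assumes body: "!!t. t < k ==> wm M (%g h q. EX g'. I t g' h q & g = g'(v := t)) c (%g h q. I (Suc t) (g(v := 0)) h q)"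
  and pre: "!!g h q. P g h q ==> ev e g h = k & I 0 g h q & g v = 0"
  and post: "!!g h q. I k g h q ==> g v = 0 ==> Q g h q" and k: "k <= X" "k < 2 ^ w" "1 <= M"
 shows "wm M P (For True v e c) Q"
proof (rule wm_triple[OF triple_For[where I = I and k = k]])
 let ?t = "cost c"
 have "loop_cost w e k (?t * M) <= loop_cost w e k ?t * M"
  using k(3) by (simp add: loop_cost_def algebra_simps add_mono)
 also have "... <= cost (For True v e c) * M"
  by (rule mult_le_mono1, rule cost_For[OF k(1)])
 finally show "loop_cost w e k (?t * M) <= cost (For True v e c) * M" .
qed (use body[unfolded wm_def] pre post k in auto)

lemma cost_For_big: "k <= M ==> 1 <= M ==>
  loop_cost w e k (cost c) <= cost (For True v e c) * M"
proof -
 assume k: "k <= M" "1 <= M"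
 let ?t = "cost c"
 have "k * (?t + 6 * (w + 2)) <= M * (?t + 6 * (w + 2))" using k(1) by (rule mult_le_mono1)
 moreover have "(full_size e + 10) * (w + 2) <= M * ((full_size e + 10) * (w + 2))" using k(2) by simp
 ultimately have "loop_cost w e k ?t <= M * ((full_size e + 10) * (w + 2)) + M * (?t + 6 * (w + 2))"
  unfolding loop_cost_def by (intro add_mono)
 also have "... = loop_cost w e 1 ?t * M" by (simp add: loop_cost_def algebra_simps)
 also have "... <= cost (For True v e c) * M"
  by (rule mult_le_mono1, rule cost_For[OF X1])
 finally show ?thesis .
qed

end

definition z_sign :: "nat => qstate => qstate" where
 "z_sign t \<psi> = (%B. if t : B then - \<psi> B else \<psi> B)"

lemma t_gate_4: "t_gate t (t_gate t (t_gate t (t_gate t \<psi>))) = z_sign t \<psi>"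
proof -
 have "cis (pi / 4) * cis (pi / 4) * (cis (pi / 4) * cis (pi / 4)) = -1" by (simp add: cis_mult)
 hence "cis (pi / 4) * (cis (pi / 4) * (cis (pi / 4) * (cis (pi / 4) * a))) = - a" for a
  by (metis mult.assoc mult_minus1)
 thus ?thesis by (auto simp: t_gate_def z_sign_def fun_eq_iff)
qed

section \<open>Sign flip and measurement through a test circuit\<close>

context
 fixes Q :: "nat set" and f :: oracle_fun and c :: cmd and g h :: "nat => nat" and t :: nat and good :: "nat set => bool"
 assumes finQ: "finite Q" and Q0: "0 ~: Q"
  and run: "!!x. x <= Q ==> t : runs (gates f c g h) (insert 0 x) \<longleftrightarrow> good x"
begin

lemma run_embed: "0 : B ==> B - {0} <= Q ==> t : runs (gates f c g h) B \<longleftrightarrow> good (B - {0})"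
 using run[of "B - {0}"] by (simp add: insert_absorb)

text \<open>The circuit permutes basis states, so after the sign on the result qubit the inverse
  removes all garbage and each good index has changed its sign.\<close>

lemma phase_kick:
 "act (rev (gates f c g h)) (z_sign t (act (gates f c g h) (embed Q a))) = embed Q (flip_good good a)"
proof
 fix B
 show "act (rev (gates f c g h)) (z_sign t (act (gates f c g h) (embed Q a))) B = embed Q (flip_good good a) B"
 proof (cases "0 : B & B - {0} <= Q")
  case True
  hence "t : runs (gates f c g h) B \<longleftrightarrow> good (B - {0})" by (intro run_embed) auto
  thus ?thesis using True
   by (simp add: act_eq runs_inverse z_sign_def embed_def flip_good_def)
 next
  case False
  hence "embed Q b B = 0" for b by (auto simp: embed_def)
  thus ?thesis by (simp add: act_eq runs_inverse z_sign_def)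
 qed
qed

text \<open>Distinct indices go to distinct basis states, garbage included, so the outcomes have the
  total weights of the good and of the bad indices.\<close>

lemma outcome_embed:
 "outcome_prob t b (act (gates f c g h) (embed Q a)) = (\<Sum>x | x <= Q & good x = b. (cmod (a x))\<^sup>2)"
proof -
 let ?G = "gates f c g h"
 let ?\<psi> = "act ?G (embed Q a)" and ?F = "%x. runs ?G (insert 0 x)" and ?T = "{x. x <= Q & good x = b}"
 have inj: "inj_on ?F ?T"
 proof (rule inj_onI)
  fix x y assume xy: "x : ?T" "y : ?T" "?F x = ?F y"
  hence "insert 0 x = insert 0 y" using runs_inverse by metis
  moreover have "0 ~: x" "0 ~: y" using xy Q0 by auto
  ultimately show "x = y" by (metis insert_ident)
 qed
 have \<psi>F: "?\<psi> (?F x) = a x" if "x <= Q" for x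
 proof -
  have "0 ~: x" using that Q0 by auto
  thus ?thesis using that by (simp add: act_eq runs_inverse embed_def)
 qed
 have "outcome_prob t b ?\<psi> = (\<Sum>B\<in>?F ` ?T. (cmod (?\<psi> B))\<^sup>2)"
  unfolding outcome_prob_def
 proof (rule sum.mono_neutral_left)
  show "finite (?F ` ?T)" using finQ by simp
  show "{B. ?\<psi> B ~= 0 & (t : B) = b} \<subseteq> ?F ` ?T"
  proof
   fix B assume B: "B : {B. ?\<psi> B ~= 0 & (t : B) = b}"
   let ?C = "runs (rev ?G) B"
   have C: "0 : ?C" "?C - {0} <= Q" using B by (auto simp: act_eq embed_def split: if_splits)
   have BC: "runs ?G ?C = B" by (rule runs_inverse')
   hence "good (?C - {0}) = b" using run_embed[OF C] B by simp
   moreover have "B = ?F (?C - {0})" using C BC by (simp add: insert_absorb)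
   ultimately show "B : ?F ` ?T" using C by blast
  qed
  show "ALL B:?F ` ?T - {B. ?\<psi> B ~= 0 & (t : B) = b}. (cmod (?\<psi> B))\<^sup>2 = 0" using run by auto
 qed
 also have "... = (\<Sum>x\<in>?T. (cmod (?\<psi> (?F x)))\<^sup>2)" using inj by (simp add: sum.reindex)
 also have "... = (\<Sum>x\<in>?T. (cmod (a x))\<^sup>2)" using \<psi>F by (intro sum.cong) auto
 finally show ?thesis .
qed

lemma collapse_embed:
 "act (rev (gates f c g h)) (collapse t b (act (gates f c g h) (embed Q a)))
  = embed Q (%x. if good x = b then a x / complex_of_real (sqrt (\<Sum>x | x <= Q & good x = b. (cmod (a x))\<^sup>2)) else 0)"
proof
 fix B
 let ?G = "gates f c g h"
 have "act (rev ?G) (collapse t b (act ?G (embed Q a))) B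
  = (if (t : runs ?G B) = b then embed Q a B
    / complex_of_real (sqrt (outcome_prob t b (act ?G (embed Q a)))) else 0)"
  by (simp add: act_eq[of "rev ?G"] collapse_def) (simp add: act_eq runs_inverse)
 thus "act (rev ?G) (collapse t b (act ?G (embed Q a))) B
  = embed Q (%x. if good x = b then a x / complex_of_real (sqrt (\<Sum>x | x <= Q & good x = b. (cmod (a x))\<^sup>2)) else 0) B"
  unfolding outcome_embed by (simp add: embed_def run_embed)
qed

end

lemma fold_hadamard_embed: "set qs <= Q ==> 0 ~: Q ==> fold hadamard qs (embed Q a) = embed Q (fold hadamard qs a)"
 by (induction qs arbitrary: a) (simp_all add: hadamard_embed)

context instance_data
begin

definition "hC = hm codes"
definition "good x \<longleftrightarrow> 4 + n * n : x & code TH x : codes"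
text \<open>The cutoff for the number of iterations; \<open>doubling_index\<close> shows that a
  suitable power of two does not exceed it.\<close>

definition "M = 2 ^ s * n"
abbreviation "envH g \<equiv> env TH (n * n) g"
abbreviation "gc \<equiv> card {x. x <= Q & good x}"
abbreviation "th \<equiv> grover_angle Q good"
abbreviation "ang \<equiv> angle_state Q good th"
abbreviation "qs \<equiv> map ((+) 4) posl"

lemma Q0: "0 ~: Q" using Q_props(1) by auto

lemma envH_base: "envH g ==> base g" by (simp add: env_def)

lemma selH: "sel TH (n * n)" by (simp add: sel_def)

lemma test_run:
 assumes g: "envH g" and x: "x <= Q"
 shows "1 : runs (gates f test_cmd g hC) (insert 0 x) \<longleftrightarrow> good x"
proof -
 let ?B = "runs (gates f series_cmd g hC) (insert 0 x)"
 note B = series_run[OF g x, of codes, folded hC_def]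
 have DD: "D <= D * D" "4 + n * n < D" using n2 by (auto simp: D_def)
 have small: "k : ?B \<longleftrightarrow> k : insert 0 x" if "k < D" for k
 proof -
  have "k < D * D" using that DD by linarith
  thus ?thesis using B(1) by blast
 qed
 have x4: "k ~: x" if "k < 4" for k using x Q_props(1) that by fastforce
 have b: "1 ~: ?B" "2 ~: ?B" "4 + n * n : ?B \<longleftrightarrow> 4 + n * n : x" using small DD x4 by auto
 have "code TH x < 2 ^ l" by (rule code_lt[OF selH])
 hence "hC (D + code TH x) ~= 0 \<longleftrightarrow> code TH x : codes"
  unfolding hC_def by (subst hm_high) auto
 hence h: "hC (D + address (2 * (D * D)) l ?B) ~= 0 \<longleftrightarrow> code TH x : codes" unfolding B(2) .
 have g': "g 4 = l" "g 8 = D" "g 17 = n * n" using envH_base[OF g] by (auto simp: base_def)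
 have "2 < 2 * (D * D)" using DD by linarith
 thus ?thesis using b h unfolding good_def
  by (auto simp: test_cmd_def g' y_base_def x_base_def read_map_def tof_map_def)
qed

lemma zero_run:
 assumes g: "base g" and x: "x <= Q"
 shows "3 : runs (gates f zero_test_cmd g hC) (insert 0 x) \<longleftrightarrow> x = {}"
proof -
 have x4: "x <= {4..4 + n * n}" using x Q_props(1) by blast
 have g': "g 7 = zc" "g 42 = n * n + 1" using g by (auto simp: base_def)
 have "address 4 (n * n + 1) (insert 0 x) = 0 \<longleftrightarrow> x = {}"
 proof -
  have "{i. i < n * n + 1 & 4 + i : insert 0 x} = {} \<longleftrightarrow> x = {}"
  proof (safe, goal_cases)
   case (1 y)
   hence "y : {4..4 + n * n}" using x4 by blast
   hence "y = 4 + (y - 4)" "y - 4 < n * n + 1" by auto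
   thus ?case using 1 by (metis (mono_tags, lifting) CollectI empty_iff insertCI)
  qed auto
  thus ?thesis unfolding address_def by (auto simp: sum_eq_0_iff)
 qed
 moreover have "hC (zc + a) ~= 0 \<longleftrightarrow> a = 0" for a unfolding hC_def using D_gt by (subst hm_high) auto
 moreover have "3 ~: insert 0 x" using x4 by auto
 ultimately show ?thesis by (auto simp: zero_test_cmd_def g' read_map_def)
qed

text \<open>Good indices contain the additional bit \<open>4 + n * n\<close>, which only half of all
  indices do.\<close>

lemma half_good: "2 * gc <= 2 ^ card Q"
proof -
 have e: "4 + n * n : Q" by (simp add: Q_def)
 have "{x. x <= Q & good x} \<subseteq> insert (4 + n * n) ` Pow (Q - {4 + n * n})"
  by (auto simp: good_def intro!: image_eqI[of _ _ "_ - {4 + n * n}"])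
 hence "gc <= card (insert (4 + n * n) ` Pow (Q - {4 + n * n}))" using Q_props(2) by (intro card_mono) auto
 also have "... <= card (Pow (Q - {4 + n * n}))" using Q_props(2) by (intro card_image_le) auto
 also have "... = 2 ^ (card Q - 1)" using Q_props(2) e by (simp add: card_Pow card_Diff_singleton)
 finally show ?thesis using Q_props(3) by simp
qed

sublocale gr: grover Q good
 by unfold_locales (use Q_props(2) half_good in auto)

lemma M1: "1 <= M" "M < 2 ^ w" "2 * M < 2 ^ w" "2 ^ s <= M"
proof -
 show "1 <= M" "2 ^ s <= M" using n2 by (simp_all add: M_def)
 have "2 * (2 ^ s * n) < 2 * (2 ^ s * 2 ^ n)" by simp
 also have "... = 2 ^ (Suc s + n)" by (simp add: power_add)
 finally have *: "2 * M < 2 ^ (Suc s + n)" unfolding M_def .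
 show "2 * M < 2 ^ w" by (rule small_pow[OF *]) (use s_le pb(10) n2 in linarith)
 thus "M < 2 ^ w" by simp
qed

lemma ex_had_list:
 assumes g: "base g" and len: "length ys = b0 + 1"
  and e: "!!t. t <= b0 ==> ev e (g(20 := t)) h = ys ! t"
 shows "ex (For True 20 (V 36) (HadC e)) g h q g h (fold hadamard ys q)"
proof (rule ex_For[where k = "b0 + 1" and G = "%_. g" and Hp = "%_. h" and Qs = "%t. fold hadamard (take t ys) q"])
 have "b0 + 1 <= 20 * n ^ 3" using b0_le pb(7) by linarith
 thus "b0 + 1 <= X" "b0 + 1 < 2 ^ w" using small_X small_lt by auto
 fix t assume t: "t < b0 + 1"
 hence "take (Suc t) ys = take t ys @ [ys ! t]" using len by (intro take_Suc_conv_app_nth) simp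
 hence "ex (HadC e) (g(20 := t)) h (fold hadamard (take t ys) q) (g(20 := t)) h (fold hadamard (take (Suc t) ys) q)"
  using ex_HadC[OF e[of t], of "fold hadamard (take t ys) q"] t by simp
 thus "EX x. ex (HadC e) (g(20 := t)) h (fold hadamard (take t ys) q) (g(20 := x)) h (fold hadamard (take (Suc t) ys) q)" by blast
qed (use g len in "auto simp: base_def")

lemma ex_had: "base g ==> ex had_cmd g hC q g hC (fold hadamard qs q)"
 and ex_had_rev: "base g ==> ex had_rev_cmd g hC q g hC (fold hadamard (rev qs) q)"
proof -
 assume g: "base g"
 have pe: "ev (pos_exp e) (g(20 := t)) hC = qs ! u" if "u <= b0" "ev e (g(20 := t)) hC = u" for e t u
 proof -
  have "qs ! u = 4 + posl ! u" by (rule nth_map) (use that(1) len_posl in simp)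
  thus ?thesis using hm_pos[OF that(1), of codes] g that(2) by (simp add: pos_exp_def pos_base_def base_def hC_def)
 qed
 show "ex had_cmd g hC q g hC (fold hadamard qs q)"
  unfolding had_cmd_def by (rule ex_had_list[OF g]) (use pe len_posl in auto)
 show "ex had_rev_cmd g hC q g hC (fold hadamard (rev qs) q)"
  unfolding had_rev_cmd_def
 proof (rule ex_had_list[OF g])
  fix t assume t: "t <= b0"
  have "rev qs ! t = qs ! (b0 - t)" using t len_posl by (subst rev_nth) auto
  moreover have "ev (Op Minus (V 3) (V 20)) (g(20 := t)) hC = b0 - t" using g by (simp add: base_def)
  ultimately show "ev (pos_exp (Op Minus (V 3) (V 20))) (g(20 := t)) hC = rev qs ! t" using pe[of "b0 - t"] by simp
 qed (use len_posl in simp)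
qed

lemma qs_props: "distinct qs" "set qs = Q"
 using distinct_posl by (auto simp: distinct_map Q_def)

lemma ex_z: "ev e g h = t ==> ex (z_gate_cmd e) g h q g h (z_sign t q)"
proof -
 assume "ev e g h = t"
 hence 1: "ex (TC e) g h q g h (t_gate t q)" for q by (rule ex_TC)
 show ?thesis unfolding z_gate_cmd_def seqs.simps t_gate_4[symmetric]
  by (rule ex_Sq[OF 1 ex_Sq[OF 1 ex_Sq[OF 1 ex_Sq[OF 1 ex_Skip]]]])
qed

lemma zero_test_wf: "reversible zero_test_cmd" "wf_cmd zero_test_cmd" "loop_vars zero_test_cmd = {}" "bound_exps zero_test_cmd = {V 42}"
 by (simp_all add: zero_test_cmd_def)

lemma ex_grover:
 assumes g: "envH g"
 shows "ex grover_cmd g hC (embed Q (ang c al)) g hC (embed Q (ang (- c) (al + 2 * th)))"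
proof -
 have b: "base g" by (rule envH_base[OF g])
 let ?a = "flip_good good (ang c al)"
 have pk: "act (rev (gates f test_cmd g hC)) (z_sign 1 (act (gates f test_cmd g hC) (embed Q (ang c al)))) = embed Q ?a"
  by (rule phase_kick[OF Q_props(2) Q0 test_run[OF g]])
 have 1: "ex test_cmd g hC (embed Q (ang c al)) g hC (act (gates f test_cmd g hC) (embed Q (ang c al)))"
  by (rule ex_gates(1)[OF b test_cmd_wf])
 note 2 = ex_z[OF ev.simps(2)[of 1]]
 have 3: "ex (invc test_cmd) g hC (z_sign 1 (act (gates f test_cmd g hC) (embed Q (ang c al)))) g hC (embed Q ?a)"
  by (rule ex_cong[OF ex_gates(2)[OF b test_cmd_wf] refl refl pk])
 have fe: "fold hadamard qs (embed Q a) = embed Q (fold hadamard qs a)" "fold hadamard (rev qs) (embed Q a) = embed Q (fold hadamard (rev qs) a)" for a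
  by (rule fold_hadamard_embed[OF _ Q0], simp only: set_rev qs_props(2) order_refl)+
 have 4: "ex had_cmd g hC (embed Q ?a) g hC (embed Q (fold hadamard qs ?a))"
  unfolding fe(1)[symmetric] by (rule ex_had[OF b])
 let ?q = "embed Q (fold hadamard qs ?a)"
 have bo: "bounds_ok L zero_test_cmd g" using b pb(7) by (auto simp: bounds_ok_def zero_test_wf base_def L_def)
 have 5: "ex zero_test_cmd g hC q g hC (act (gates f zero_test_cmd g hC) q)" for q
  by (rule ex_circuit) (use zero_test_wf bo in auto)
 note 6 = ex_z[OF ev.simps(2)[of 3]]
 have "rev (gates f zero_test_cmd g hC) = gates f zero_test_cmd g hC" by (simp add: zero_test_cmd_def)
 hence fz: "act (gates f zero_test_cmd g hC) (z_sign 3 (act (gates f zero_test_cmd g hC) ?q))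
   = embed Q (flip_zero (fold hadamard qs ?a))"
  using phase_kick[OF Q_props(2) Q0 zero_run[OF b], of "fold hadamard qs ?a"]
  by (simp add: flip_good_def flip_zero_def)
 have 7: "ex zero_test_cmd g hC (z_sign 3 (act (gates f zero_test_cmd g hC) ?q)) g hC (embed Q (flip_zero (fold hadamard qs ?a)))"
  unfolding fz[symmetric] by (rule 5)
 have 8: "ex had_rev_cmd g hC (embed Q (flip_zero (fold hadamard qs ?a))) g hC (embed Q (ang (- c) (al + 2 * th)))"
  unfolding gr.grover_step[OF qs_props, symmetric] fe(2)[symmetric] by (rule ex_had_rev[OF b])
 show ?thesis unfolding grover_cmd_def seqs.simps
  by (rule ex_Sq[OF 1 ex_Sq[OF 2 ex_Sq[OF 3 ex_Sq[OF 4 ex_Sq[OF 5 ex_Sq[OF 6 ex_Sq[OF 7 ex_Sq[OF 8 ex_Skip]]]]]]]])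
qed

end

section \<open>Rounds, passes and repetitions of the search\<close>

context instance_data
begin

definition "st c al = embed Q (ang c al)"

definition "hit al = (if gc = 0 then 0 else (sin al)\<^sup>2)"

text \<open>Normalisation cancels \<open>cos al\<close> up to its sign, which moves into the global
  factor.\<close>

lemma collapse_miss:
 assumes c: "cmod c = 1" and al: "cos al ~= 0"
 shows "EX c'. cmod c' = 1 & embed Q (%x. if good x = False then ang c al x / complex_of_real (sqrt (\<Sum>x | x <= Q & good x = False. (cmod (ang c al x))\<^sup>2)) else 0) = st c' 0"
proof -
 have s: "(\<Sum>x | x <= Q & good x = False. (cmod (ang c al x))\<^sup>2) = (cos al)\<^sup>2"
  using gr.good_probability(2)[OF c, of al] by simp
 let ?c = "c * complex_of_real (cos al / \<bar>cos al\<bar>)"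
 have "cmod ?c = 1" using c al by (simp add: norm_mult norm_divide)
 moreover have "(%x. if good x = False then ang c al x / complex_of_real (sqrt ((cos al)\<^sup>2)) else 0) = ang ?c 0"
  by (auto simp: angle_state_def fun_eq_iff)
 ultimately show ?thesis unfolding s st_def by metis
qed

lemma measure_pre:
 assumes g: "envH g" and c: "cmod c = 1"
 shows "outcome_prob 1 True (act (gates f test_cmd g hC) (st c al)) = hit al"
proof -
 have "outcome_prob 1 True (act (gates f test_cmd g hC) (embed Q (ang c al))) = (\<Sum>x | x <= Q & good x = True. (cmod (ang c al x))\<^sup>2)"
  by (rule outcome_embed[OF Q_props(2) Q0 test_run[OF g]])
 also have "... = hit al" using gr.good_probability(1)[OF c, of al] by (simp add: hit_def)
 finally show ?thesis unfolding st_def .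
qed

lemma env_38: "envH g ==> envH (g(38 := k))" "envH g ==> envH (g(0 := k))" "envH g ==> envH (g(41 := k))"
 "envH g ==> envH (g(28 := k))" "envH g ==> envH (g(29 := k))" "envH g ==> envH (g(40 := k))"
 by (simp_all add: env_def base_upd)

lemma ex_after:
 assumes g: "envH g" and q: "act (rev (gates f test_cmd g hC)) q = q'"
 shows "ex (Sq (invc test_cmd) (Sq (Ite (V 38) (Asg 0 (N 1)) Skip) Skip)) (g(38 := of_bool b)) hC q
  (if b then g(38 := 1, 0 := 1) else g(38 := 0)) hC q'"
proof -
 have same: "gates f test_cmd (g(38 := k)) hC = gates f test_cmd g hC" for k by (rule gates_unread) (simp add: test_cmd_unread)
 have 1: "ex (invc test_cmd) (g(38 := of_bool b)) hC q (g(38 := of_bool b)) hC q'"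
  using ex_gates(2)[OF envH_base[OF env_38(1)[OF g]] test_cmd_wf, of "of_bool b" hC q] unfolding same q .
 have "ex (Ite (V 38) (Asg 0 (N 1)) Skip) (g(38 := of_bool b)) hC q' (if b then g(38 := 1, 0 := 1) else g(38 := 0)) hC q'"
 proof (rule ex_Ite)
  assume "ev (V 38) (g(38 := of_bool b)) hC ~= 0"
  hence b by simp
  thus "ex (Asg 0 (N 1)) (g(38 := of_bool b)) hC q' (if b then g(38 := 1, 0 := 1) else g(38 := 0)) hC q'"
   using pow_lt_w[of 0] by (intro ex_cong[OF ex_Asg[where k = 1]]) auto
 next
  assume "ev (V 38) (g(38 := of_bool b)) hC = 0"
  hence "\<not> b" by simp
  thus "ex Skip (g(38 := of_bool b)) hC q' (if b then g(38 := 1, 0 := 1) else g(38 := 0)) hC q'"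
   using ex_Skip by simp
 qed
 thus ?thesis by (intro ex_Sq[OF 1 ex_Sq[OF _ ex_Skip]])
qed

text \<open>Until a collision is found the state is at angle 0; afterwards nothing is claimed about
  it. With the flag \<open>b\<close> the invariant shows that a positive answer persists; its last
  conjunct excludes false positives.\<close>

definition ginv :: "bool => assertion" where
 "ginv b g h q \<longleftrightarrow> envH g & h = hC & g 40 = 0 & (b --> g 0 ~= 0) & (g 0 = 0 --> (EX c. cmod c = 1 & q = st c 0)) & (gc = 0 --> g 0 = 0)"

text \<open>Only outcomes of positive probability have to be considered: a positive one requires
  good indices, and a negative one requires \<open>cos al\<close> nonzero, so that the collapsed
  state is normalisable. Without good indices the angle is 0.\<close>

lemma bernoulli_hit: "b : set_pmf (bernoulli_pmf (hit al)) ==> (gc = 0 --> al = 0) ==> (b --> gc ~= 0) & (\<not> b --> cos al ~= 0)"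
proof -
 assume b: "b : set_pmf (bernoulli_pmf (hit al))" and z: "gc = 0 --> al = 0"
 have h01: "0 <= hit al" "hit al <= 1" by (simp_all add: hit_def abs_square_le_1)
 show ?thesis
 proof (cases b)
  case True
  hence "hit al ~= 0" using b h01 by (auto simp: set_pmf_iff)
  thus ?thesis using True by (auto simp: hit_def split: if_splits)
 next
  case False
  hence "hit al ~= 1" using b h01 by (auto simp: set_pmf_iff)
  hence "cos al ~= 0" using z by (auto simp: hit_def sin_squared_eq split: if_splits)
  thus ?thesis using False by simp
 qed
qed

lemma triple_measure:
 assumes g: "envH g" "g 40 = 0" "g 0 = 0" and c: "cmod c = 1" and al: "gc = 0 --> al = 0"
 shows "wm 1 (%g1 h1 q1. g1 = g & h1 = hC & q1 = st c al) meas_cmd (%g1 h1 q1. ginv False g1 h1 q1 & g1 28 = g 28 & g1 29 = g 29 & g1 41 = g 41)"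
  (is "wm 1 _ _ ?R")
 unfolding meas_cmd_def seqs.simps
proof (rule wm_Sq[OF wm_ex[OF ex_gates(1)[OF envH_base[OF g(1)] test_cmd_wf]]])
 let ?q = "act (gates f test_cmd g hC) (st c al)"
 let ?N = "%g1 h1 q1. EX b. (b --> gc ~= 0) & (\<not> b --> cos al ~= 0) & g1 = g(38 := of_bool b) & h1 = hC & q1 = collapse 1 b ?q"
 show "wm 1 (%g1 h1 q1. g1 = g & h1 = hC & q1 = ?q) (Sq (Meas 38 (N 1)) (Sq (invc test_cmd) (Sq (Ite (V 38) (Asg 0 (N 1)) Skip) Skip))) ?R"
 proof (rule wm_Sq[where Q = ?N])
  show "wm 1 (%g1 h1 q1. g1 = g & h1 = hC & q1 = ?q) (Meas 38 (N 1)) ?N"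
  proof (rule wm_triple[OF triple_Meas])
   fix g1 h1 q1 b assume a: "g1 = g & h1 = hC & q1 = ?q" "b : set_pmf (bernoulli_pmf (outcome_prob (ev (N 1) g1 h1) True q1))"
   hence "b : set_pmf (bernoulli_pmf (hit al))" using measure_pre[OF g(1) c, of al] by simp
   from bernoulli_hit[OF this al] show "?N (g1(38 := of_bool b)) h1 (collapse (ev (N 1) g1 h1) b q1)"
    using a(1) by (intro exI[of _ b]) (simp del: fun_upd_apply)
  next
   show "1 <= w" by (rule w1)
   show "unit_cost w (N 1) <= cost (Meas 38 (N 1)) * 1" using cost_unit[of "N 1"] by simp
  qed
  show "wm 1 ?N (Sq (invc test_cmd) (Sq (Ite (V 38) (Asg 0 (N 1)) Skip) Skip)) ?R"
  proof (rule wm_pre, elim exE conjE)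
   fix g1 h1 q1 b assume b: "b --> gc ~= 0" "\<not> b --> cos al ~= 0" "g1 = g(38 := of_bool b)" "h1 = hC" "q1 = collapse 1 b ?q"
   let ?q' = "act (rev (gates f test_cmd g hC)) (collapse 1 b ?q)"
   have m: "\<not> b ==> EX c'. cmod c' = 1 & ?q' = st c' 0"
    using collapse_miss[OF c, of al] b(2) collapse_embed[OF Q_props(2) Q0 test_run[OF g(1)], of False "ang c al"] by (simp add: st_def)
   show "wm 1 (%g' h' q'. g' = g1 & h' = h1 & q' = q1) (Sq (invc test_cmd) (Sq (Ite (V 38) (Asg 0 (N 1)) Skip) Skip)) ?R"
    unfolding b(3-5)
   proof (rule wm_conseq[OF wm_ex[OF ex_after[OF g(1) refl]]])
    fix g2 h2 q2 assume "g2 = (if b then g(38 := 1, 0 := 1) else g(38 := 0)) & h2 = hC & q2 = ?q'"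
    moreover have "envH (if b then g(38 := 1, 0 := 1) else g(38 := 0))" using g(1) by (simp add: env_38 del: fun_upd_apply)
    ultimately show "?R g2 h2 q2" using m b(1) g(2,3) by (auto simp: ginv_def)
   qed auto
  qed
 qed
qed simp

lemma fails_measure:
 assumes g: "envH g" and c: "cmod c = 1" and gc: "gc > 0"
 shows "fails f w (%g1 h1 q1. g1 = g & h1 = hC & q1 = st c al) meas_cmd ((cos al)\<^sup>2)"
 unfolding meas_cmd_def seqs.simps
proof (rule fails_exact_first[OF wm_ex[OF ex_gates(1)[OF envH_base[OF g] test_cmd_wf], unfolded wm_def, of 1]])
 let ?q = "act (gates f test_cmd g hC) (st c al)"
 have "fails f w (%g1 h1 q1. g1 = g & h1 = hC & q1 = ?q) (Sq (Meas 38 (N 1)) (Sq (invc test_cmd) (Sq (Ite (V 38) (Asg 0 (N 1)) Skip) Skip))) (1 - hit al)"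
 proof (rule fails_Meas_Sq)
  let ?d = "Sq (invc test_cmd) (Sq (Ite (V 38) (Asg 0 (N 1)) Skip) Skip)"
  have "wm 1 (%g1 h1 q1. g1 = g(38 := of_bool True) & h1 = hC & q1 = collapse 1 True ?q) ?d (%g1 h1 q1. g1 0 ~= 0)"
   by (rule wm_conseq[OF wm_ex[OF ex_after[OF g refl]]]) auto
  thus "triple f w (%g1 h1 q1. EX g0 q0. (g0 = g & h1 = hC & q0 = ?q) & g1 = g0(38 := 1) & q1 = collapse (ev (N 1) g0 h1) True q0)
   ?d (%g1 h1 q1. g1 0 ~= 0) (csize ?d * X ^ cdepth ?d * 1)"
   unfolding wm_def by (rule triple_conseq) (auto simp del: fun_upd_apply)
  show "hit al <= 1" "0 <= hit al" by (simp_all add: hit_def abs_square_le_1)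
 qed (use measure_pre[OF g c] w1 in auto)
 thus "fails f w (%g1 h1 q1. g1 = g & h1 = hC & q1 = ?q) (Sq (Meas 38 (N 1)) (Sq (invc test_cmd) (Sq (Ite (V 38) (Asg 0 (N 1)) Skip) Skip))) ((cos al)\<^sup>2)"
  using gc by (simp add: hit_def cos_squared_eq)
qed simp

lemma gc0_th: "gc = 0 ==> th = 0"
 using gr.sin_theta by (simp add: grover_angle_def)

lemma wm_loop:
 assumes g: "envH g" "g 40 = 0" "g 41 = J" and J: "J <= M"
 shows "wm M (%g1 h1 q1. g1 = g & h1 = hC & q1 = st c 0) (For True 40 (V 41) grover_cmd)
  (%g1 h1 q1. g1 = g & h1 = hC & q1 = st (c * (- 1) ^ J) (2 * real J * th))"
proof -
 have "exact f w (For True 40 (V 41) grover_cmd) g hC (st (c * (- 1) ^ 0) (2 * real 0 * th)) g hC (st (c * (- 1) ^ J) (2 * real J * th))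
  (loop_cost w (V 41) J (cost grover_cmd))"
 proof (rule exact_For[where G = "%_. g" and Hp = "%_. hC" and Qs = "%t. st (c * (- 1) ^ t) (2 * real t * th)"])
  fix t assume "t < J"
  have "ex grover_cmd (g(40 := t)) hC (st (c * (- 1) ^ t) (2 * real t * th)) (g(40 := t)) hC (st (c * (- 1) ^ Suc t) (2 * real (Suc t) * th))"
   using ex_grover[OF env_38(6)[OF g(1)], of t "c * (- 1) ^ t" "2 * real t * th"] by (simp add: st_def algebra_simps)
  thus "EX x. exact f w grover_cmd (g(40 := t)) hC (st (c * (- 1) ^ t) (2 * real t * th)) (g(40 := x)) hC (st (c * (- 1) ^ Suc t) (2 * real (Suc t) * th))
   (cost grover_cmd)" unfolding ex_def by blast
 qed (use g J M1 in auto)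
 thus ?thesis unfolding exact_def by (intro wm_triple[OF _ cost_For_big[OF J M1(1)]]) simp
qed

lemma round_rules:
 assumes g: "envH g" "g 40 = 0" "g 41 = J" "g 0 = 0" and J: "J <= M" and c: "cmod c = 1"
 shows "wm M (%g1 h1 q1. g1 = g & h1 = hC & q1 = st c 0) round_cmd (%g1 h1 q1. ginv False g1 h1 q1 & g1 28 = g 28 & g1 29 = g 29 & g1 41 = g 41)"
  and "gc > 0 ==> fails f w (%g1 h1 q1. g1 = g & h1 = hC & q1 = st c 0) round_cmd ((cos (2 * real J * th))\<^sup>2)"
proof -
 have c': "cmod (c * (- 1) ^ J) = 1" using c by (simp add: norm_mult norm_power)
 have z: "gc = 0 --> 2 * real J * th = 0" using gc0_th by simp
 show "wm M (%g1 h1 q1. g1 = g & h1 = hC & q1 = st c 0) round_cmd (%g1 h1 q1. ginv False g1 h1 q1 & g1 28 = g 28 & g1 29 = g 29 & g1 41 = g 41)"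
  unfolding round_cmd_def
  by (rule wm_Sq[OF wm_loop[OF g(1-3) J] wm_mono[OF triple_measure[OF g(1,2,4) c' z] M1(1)]])
 show "gc > 0 ==> fails f w (%g1 h1 q1. g1 = g & h1 = hC & q1 = st c 0) round_cmd ((cos (2 * real J * th))\<^sup>2)"
  unfolding round_cmd_def
  by (rule fails_exact_first[OF wm_loop[OF g(1-3) J, unfolded wm_def] fails_measure[OF g(1) c']])
qed

text \<open>The content of variable 41 in round \<open>t\<close>; it stays put once it exceeds
  \<open>M\<close>.\<close>

fun jump :: "nat => nat" where
 "jump 0 = 1"
| "jump (Suc t) = (if M < jump t then jump t else 2 * jump t)"

lemma jump_pow: "2 ^ i <= M ==> jump i = 2 ^ i"
proof (induction i)
 case (Suc i)
 hence "2 ^ i <= M" by simp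
 thus ?case using Suc.IH by simp
qed simp

abbreviation "pass_body \<equiv> Ite (less_exp (V 37) (V 41)) Skip (Sq (Ite (V 0) Skip round_cmd) (Asg 41 (Op Times (N 2) (V 41))))"

definition pinv :: "bool => nat => nat => nat => assertion" where
 "pinv b u t v g h q \<longleftrightarrow> ginv b g h q & g 28 = u & g 41 = jump t & g 29 = v"

lemma g37: "envH g ==> g 37 = M" by (simp add: env_def base_def M_def)

lemma pass_step: "wm M (pinv b u t v) pass_body (pinv b u (Suc t) v)"
proof (rule wm_Ite)
 show "1 <= M" by (rule M1)
 show "wm M (%g h q. pinv b u t v g h q & ev (less_exp (V 37) (V 41)) g h ~= 0) Skip (pinv b u (Suc t) v)"
  by (rule wm_conseq[OF wm_Skip[of M "pinv b u (Suc t) v"]]) (auto simp: pinv_def ginv_def g37)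
 let ?P = "%g h q. pinv b u t v g h q & jump t <= M"
 have 1: "wm M ?P (Ite (V 0) Skip round_cmd) ?P"
 proof (rule wm_Ite)
  show "1 <= M" by (rule M1)
  show "wm M (%g h q. ?P g h q & ev (V 0) g h ~= 0) Skip ?P" by (rule wm_conseq[OF wm_Skip[of M ?P]]) auto
  show "wm M (%g h q. ?P g h q & ev (V 0) g h = 0) round_cmd ?P"
  proof (rule wm_pre)
   fix g h q assume a: "?P g h q & ev (V 0) g h = 0"
   then obtain c where c: "cmod c = 1" "q = st c 0" by (auto simp: pinv_def ginv_def)
   have g: "envH g" "g 40 = 0" "g 41 = jump t" "g 0 = 0" "jump t <= M" "h = hC" "\<not> b" "g 28 = u" "g 29 = v"
    using a by (auto simp: pinv_def ginv_def)
   show "wm M (%g' h' q'. g' = g & h' = h & q' = q) round_cmd ?P"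
    unfolding c(2) g(6) by (rule wm_conseq[OF round_rules(1)[OF g(1-5) c(1)]]) (use g in "auto simp: pinv_def")
  qed
 qed
 have 2: "wm M ?P (Asg 41 (Op Times (N 2) (V 41))) (pinv b u (Suc t) v)"
 proof (rule wm_Asg)
  fix g h q assume a: "?P g h q"
  hence "2 * jump t < 2 ^ w" using M1(3) by linarith
  thus "ev (Op Times (N 2) (V 41)) g h < 2 ^ w & pinv b u (Suc t) v (g(41 := ev (Op Times (N 2) (V 41)) g h)) h q"
   using a by (auto simp: pinv_def ginv_def env_38(3))
 qed (rule M1)
 show "wm M (%g h q. pinv b u t v g h q & ev (less_exp (V 37) (V 41)) g h = 0) (Sq (Ite (V 0) Skip round_cmd) (Asg 41 (Op Times (N 2) (V 41)))) (pinv b u (Suc t) v)"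
  by (rule wm_conseq[OF wm_Sq[OF 1 2]]) (auto simp: pinv_def ginv_def g37)
qed

lemma fails_step:
 assumes t: "jump t <= M" and gc: "gc > 0"
 shows "fails f w (%g h q. pinv False u t v g h q & g 0 = 0) pass_body ((cos (2 * real (jump t) * th))\<^sup>2)"
  (is "fails f w ?P _ ?dl")
proof (rule fails_Ite)
 have no: "\<not> (?P g h q & ev (less_exp (V 37) (V 41)) g h ~= 0)" for g h q
  using t g37[of g] by (auto simp: pinv_def ginv_def)
 thus "fails f w (%g h q. ?P g h q & ev (less_exp (V 37) (V 41)) g h ~= 0) Skip ?dl"
  unfolding fails_def by blast
 have r: "fails f w ?P round_cmd ?dl"
  unfolding fails_def
 proof (intro allI impI)
  fix s :: config assume a: "?P (reg s) (heap s) (qst s) & bdd w (reg s) (heap s)"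
  then obtain c where c: "cmod c = 1" "qst s = st c 0" by (auto simp: pinv_def ginv_def)
  have g: "envH (reg s)" "reg s 40 = 0" "reg s 41 = jump t" "reg s 0 = 0" "heap s = hC"
   using a by (auto simp: pinv_def ginv_def)
  show "fail_prob (sem f round_cmd s) <= ?dl"
   using round_rules(2)[OF g(1-4) t c(1) gc, unfolded fails_def, rule_format, of s] c(2) g(5) a by simp
 qed
 have i: "fails f w ?P (Ite (V 0) Skip round_cmd) ?dl"
 proof (rule fails_Ite)
  have "\<not> (?P g h q & ev (V 0) g h ~= 0)" for g h q by auto
  thus "fails f w (%g h q. ?P g h q & ev (V 0) g h ~= 0) Skip ?dl" unfolding fails_def by blast
  show "fails f w (%g h q. ?P g h q & ev (V 0) g h = 0) round_cmd ?dl" by (rule fails_mono[OF r]) auto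
 qed
 have 1: "triple f w ?P (Ite (V 0) Skip round_cmd) (%g h q. g 41 <= M) (unit_cost w (V 0) + cost round_cmd * M)"
 proof (rule triple_Ite)
  show "triple f w (%g h q. ?P g h q & ev (V 0) g h ~= 0) Skip (%g h q. g 41 <= M) (cost round_cmd * M)"
   unfolding triple_def by auto
  show "triple f w (%g h q. ?P g h q & ev (V 0) g h = 0) round_cmd (%g h q. g 41 <= M) (cost round_cmd * M)"
  proof (rule triple_pre)
   fix g h q assume a: "?P g h q & ev (V 0) g h = 0"
   then obtain c where c: "cmod c = 1" "q = st c 0" by (auto simp: pinv_def ginv_def)
   have g: "envH g" "g 40 = 0" "g 41 = jump t" "g 0 = 0" "h = hC" using a by (auto simp: pinv_def ginv_def)
   show "triple f w (%g' h' q'. g' = g & h' = h & q' = q) round_cmd (%g h q. g 41 <= M) (cost round_cmd * M)"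
    unfolding c(2) g(5) by (rule triple_conseq[OF round_rules(1)[OF g(1-4) t c(1), unfolded wm_def]]) (use t g in auto)
  qed
 qed
 have F: "fails f w ?P (Sq (Ite (V 0) Skip round_cmd) (Asg 41 (Op Times (N 2) (V 41)))) (?dl * 1)"
 proof (rule fails_Sq[OF i 1 fails_1])
  show "triple f w (%g h q. g 41 <= M & g 0 ~= 0) (Asg 41 (Op Times (N 2) (V 41))) (%g h q. g 0 ~= 0) (unit_cost w (Op Times (N 2) (V 41)))"
   by (rule triple_Asg) (use M1(3) in auto)
 qed simp
 show "fails f w (%g h q. ?P g h q & ev (less_exp (V 37) (V 41)) g h = 0) (Sq (Ite (V 0) Skip round_cmd) (Asg 41 (Op Times (N 2) (V 41)))) ?dl"
  by (rule fails_mono[OF F]) simp_all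
qed

definition sinv :: "bool => nat => assertion" where
 "sinv b u g h q \<longleftrightarrow> ginv b g h q & g 28 = u & g 29 = 0"

lemma upd29: "pinv b u t v g h q ==> pinv b u t v' (g(29 := v')) h q"
 using env_38(5)[of g v'] by (auto simp: pinv_def ginv_def)

lemma upd28: "sinv b u g h q ==> sinv b u' (g(28 := u')) h q"
 using env_38(4)[of g u'] by (auto simp: sinv_def ginv_def)

lemma pass_body_loop: "wm M (%g h q. EX g'. pinv b u t 0 g' h q & g = g'(29 := t)) pass_body (%g h q. pinv b u (Suc t) 0 (g(29 := 0)) h q)"
 by (rule wm_conseq[OF pass_step[of b u t t]]) (auto dest: upd29 simp del: fun_upd_apply)

lemma l_le: "l <= X" "l < 2 ^ w"
 using small_X[of l] small_lt[of l] pb(3) by (auto simp: l_eq)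

lemma g4: "pinv b u t v g h q ==> g 4 = l" by (simp add: pinv_def ginv_def env_def base_def)

lemma pass_first: "wm M (sinv b u) (Asg 41 (N 1)) (pinv b u 0 0)"
 by (rule wm_Asg) (use pow_lt_w[of 0] M1 in "auto simp: sinv_def pinv_def ginv_def env_38(3)")

lemma wm_pass: "wm M (sinv b u) pass_cmd (sinv b u)"
 unfolding pass_cmd_def
proof (rule wm_Sq[OF pass_first])
 show "wm M (pinv b u 0 0) (For True 29 (V 4) pass_body) (sinv b u)"
 proof (rule wm_For[where I = "%t. pinv b u t 0", OF pass_body_loop _ _ l_le M1(1)])
  show "ev (V 4) g h = l & pinv b u 0 0 g h q & g 29 = 0" if "pinv b u 0 0 g h q" for g h q
   using that g4[OF that] by (simp add: pinv_def)
 qed (auto simp: pinv_def sinv_def)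
qed

text \<open>Round \<open>i\<close> performs \<open>2 ^ i\<close> iterations and fails with
  probability at most one half; the other rounds are bounded trivially by 1.\<close>

lemma fails_pass:
 assumes i: "2 ^ i <= M" "i < l" "(cos (2 * 2 ^ i * th))\<^sup>2 <= 1 / 2" and gc: "gc > 0"
 shows "fails f w (%g h q. sinv False u g h q & g 0 = 0) pass_cmd (1 / 2)"
 unfolding pass_cmd_def
proof (rule fails_exact_first)
 show "triple f w (%g h q. sinv False u g h q & g 0 = 0) (Asg 41 (N 1)) (%g h q. pinv False u 0 0 g h q & g 0 = 0) (unit_cost w (N 1))"
  by (rule triple_Asg) (use pow_lt_w[of 0] in "auto simp: sinv_def pinv_def ginv_def env_38(3)")
 let ?d = "%t. if t = i then 1 / 2 else (1::real)"
 have "fails f w (%g h q. pinv False u 0 0 g h q & g 0 = 0) (For True 29 (V 4) pass_body) (\<Prod>t<l. ?d t)"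
 proof (rule fails_For[where I = "%t. pinv False u t 0"])
  fix t
  show "triple f w (%g h q. EX g'. pinv False u t 0 g' h q & g = g'(29 := t)) pass_body (%g h q. pinv False u (Suc t) 0 (g(29 := 0)) h q)
   (cost pass_body * M)" using pass_body_loop unfolding wm_def .
  show "triple f w (%g h q. EX g'. pinv False u t 0 g' h q & g = g'(29 := t) & g 0 ~= 0) pass_body (%g h q. g 0 ~= 0)
   (cost pass_body * M)"
   by (rule triple_conseq[OF pass_body_loop[of True u t, unfolded wm_def]]) (auto simp: pinv_def ginv_def)
  show "fails f w (%g h q. EX g'. pinv False u t 0 g' h q & g = g'(29 := t) & g 0 = 0) pass_body (?d t)"
  proof (cases "t = i")
   case True
   have j: "jump t = 2 ^ i" using jump_pow i True by simp
   have "fails f w (%g h q. pinv False u t t g h q & g 0 = 0) pass_body ((cos (2 * real (jump t) * th))\<^sup>2)"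
    by (rule fails_step) (use j i gc in auto)
   thus ?thesis
   proof (rule fails_mono)
    show "pinv False u t t g h q & g 0 = 0" if "EX g'. pinv False u t 0 g' h q & g = g'(29 := t) & g 0 = 0" for g h q
     using that by (auto dest: upd29 simp del: fun_upd_apply)
    show "(cos (2 * real (jump t) * th))\<^sup>2 <= ?d t" using i(3) True j by simp
   qed
  qed (simp add: fails_1)
 next
  show "ev (V 4) g h = l & l < 2 ^ w & pinv False u 0 0 g h q & g 29 = 0" if "pinv False u 0 0 g h q" for g h q
   using that g4[OF that] l_le by (simp add: pinv_def)
 qed auto
 moreover have "(\<Prod>t<l. ?d t) = 1 / 2" using i(2) by (subst prod.delta) auto
 ultimately show "fails f w (%g h q. pinv False u 0 0 g h q & g 0 = 0) (For True 29 (V 4) pass_body) (1 / 2)" by simp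
qed

lemma search_body: "wm M (%g h q. EX g'. sinv b 0 g' h q & g = g'(28 := t)) pass_cmd (%g h q. sinv b 0 (g(28 := 0)) h q)"
 by (rule wm_conseq[OF wm_pass[of b t]]) (auto dest: upd28 simp del: fun_upd_apply)

lemma g39: "sinv b u g h q ==> g 39 = R" by (simp add: sinv_def ginv_def env_def base_def)

lemma wm_search: "wm M (sinv b 0) search_cmd (sinv b 0)"
 unfolding search_cmd_def
proof (rule wm_For[where I = "%t. sinv b 0", OF search_body _ _ R_lt(2,1) M1(1)])
 show "ev (V 39) g h = R & sinv b 0 g h q & g 28 = 0" if "sinv b 0 g h q" for g h q
  using that g39[OF that] by (simp add: sinv_def)
qed

lemma fails_search:
 assumes i: "2 ^ i <= M" "i < l" "(cos (2 * 2 ^ i * th))\<^sup>2 <= 1 / 2" and gc: "gc > 0"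
 shows "fails f w (sinv False 0) search_cmd ((1 / 2) ^ R)"
proof (rule fails_split)
 have keep: "triple f w (%g h q. EX g'. sinv False 0 g' h q & g = g'(28 := t) & g 0 ~= 0) pass_cmd (%g h q. g 0 ~= 0)
   (cost pass_cmd * M)" for t
  by (rule triple_conseq[OF search_body[of True t, unfolded wm_def]]) (auto simp: sinv_def ginv_def)
 have "fails f w (%g h q. sinv False 0 g h q & g 0 = 0) (For True 28 (V 39) pass_cmd) (\<Prod>t<R. (1 / 2))"
 proof (rule fails_For[where I = "%t. sinv False 0", OF search_body[unfolded wm_def] _ keep])
  fix t
  show "fails f w (%g h q. EX g'. sinv False 0 g' h q & g = g'(28 := t) & g 0 = 0) pass_cmd (1 / 2)"
   by (rule fails_mono[OF fails_pass[OF i gc]]) (auto dest: upd28 simp del: fun_upd_apply)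
 next
  show "ev (V 39) g h = R & R < 2 ^ w & sinv False 0 g h q & g 28 = 0" if "sinv False 0 g h q" for g h q
   using that g39[OF that] R_lt by (simp add: sinv_def)
 qed auto
 thus "fails f w (%g h q. sinv False 0 g h q & g 0 = 0) search_cmd ((1 / 2) ^ R)" by (simp add: search_cmd_def)
 show "triple f w (%g h q. sinv False 0 g h q & g 0 ~= 0) search_cmd (%g h q. g 0 ~= 0) (cost search_cmd * M)"
  by (rule triple_conseq[OF wm_search[of True, unfolded wm_def]]) (auto simp: sinv_def ginv_def)
qed simp

abbreviation "start \<equiv> (%g h q. g = g_in & h = h_in & q = basis {})"

text \<open>The first part gives the running time and the absence of false positives, the second the
  probability of overlooking a collision, halved by each of the \<open>R\<close> passes.\<close>

lemma iso_rules:
 shows "wm M start (iso_cmd R) (%g h q. gc = 0 --> g 0 = 0)"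
  and "2 ^ i <= M ==> i < l ==> (cos (2 * 2 ^ i * th))\<^sup>2 <= 1 / 2 ==> gc > 0 ==>
   fails f w start (iso_cmd R) ((1 / 2) ^ R)"
proof -
 let ?is = "%g h q (g1 :: nat => nat) (h1 :: nat => nat) (q1 :: qstate). g1 = g & h1 = h & q1 = q"
 obtain g where g: "ex (setup_cmd R) g_in h_in (basis {}) g hS (basis {0})" "base g" "g 0 = 0"
  "ALL v:{10, 11, 27, 28, 29, 32, 33, 34, 35, 38, 40, 41}. g v = 0" using ex_setup by blast
 have selG: "sel TG 0" by (simp add: sel_def)
 have g10: "g(10 := 0) = g" using g(4) by auto
 let ?g2 = "g(11 := \<one>\<^bsub>table_group TG\<^esub>)"
 let ?g3 = "?g2(10 := n * n)"
 let ?g4 = "?g3(11 := \<one>\<^bsub>table_group TH\<^esub>)"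
 have b2: "base ?g2" "base ?g3" "base ?g4" using g(2) by (simp_all only: base_upd insert_iff simp_thms)
 have e2: "env TG 0 ?g2" using b2(1) selG g(4) by (simp add: env_def)
 have e4: "envH ?g4" using b2(3) selH by (simp add: env_def)
 have "ex (Asg 10 (N 0)) g hS (basis {0}) (g(10 := 0)) hS (basis {0})" by (rule ex_Asg) auto
 hence 2: "ex (Asg 10 (N 0)) g hS (basis {0}) g hS (basis {0})" unfolding g10 .
 have 3: "ex ident_cmd g hS (basis {0}) ?g2 hS (basis {0})"
  unfolding hm_empty by (rule ex_ident[OF selG g(2) _ refl]) (use g(4) in simp)
 have "exact f w collect_cmd ?g2 hS (basis {0}) ?g2 (hm codes) (basis {0})
  (loop_cost w (V 15) (2 ^ s) (cost entry_cmd))"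
  by (rule exact_collect[OF e2]) (use g(4) in auto)
 hence 4: "wm M (?is ?g2 hS (basis {0})) collect_cmd (?is ?g2 hC (basis {0}))"
  unfolding exact_def hC_def collect_cmd_def by (rule wm_triple[OF _ cost_For_big[OF M1(4,1)]])
 have 5: "ex (Asg 10 (V 17)) ?g2 hC (basis {0}) ?g3 hC (basis {0})"
  by (rule ex_Asg) (use g(2) small_lt[OF pb(2)] in "auto simp: base_def")
 have 6: "ex ident_cmd ?g3 hC (basis {0}) ?g4 hC (basis {0})"
  unfolding hC_def by (rule ex_ident[OF selH b2(2) _ refl]) simp
 have emb: "basis {0} = embed Q zero_state"
  by (auto simp: basis_def embed_def zero_state_def fun_eq_iff)
 have "fold hadamard qs (basis {0}) = st 1 th"
  unfolding emb st_def gr.uniform_state[OF qs_props, symmetric]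
  by (rule fold_hadamard_embed[OF _ Q0], simp only: qs_props(2) order_refl)
 hence 7: "ex had_cmd ?g4 hC (basis {0}) ?g4 hC (st 1 th)" using ex_had[OF b2(3), of "basis {0}"] by simp
 have 8: "wm M (?is ?g4 hC (st 1 th)) meas_cmd (sinv False 0)"
  by (rule wm_conseq[OF wm_mono[OF triple_measure[OF e4, of 1 th] M1(1)]]) (use g(3,4) gc0_th in "auto simp: sinv_def")
 note W = wm_ex[OF _ M1(1)]
 show "wm M start (iso_cmd R) (%g h q. gc = 0 --> g 0 = 0)"
  unfolding iso_cmd_def seqs.simps
  by (rule wm_conseq[OF wm_Sq[OF W[OF g(1)] wm_Sq[OF W[OF 2] wm_Sq[OF W[OF 3] wm_Sq[OF 4 wm_Sq[OF W[OF 5]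
   wm_Sq[OF W[OF 6] wm_Sq[OF W[OF 7] wm_Sq[OF 8 wm_Sq[OF wm_search wm_Skip]]]]]]]]]])
   (auto simp: sinv_def ginv_def)
 assume i: "2 ^ i <= M" "i < l" "(cos (2 * 2 ^ i * th))\<^sup>2 <= 1 / 2" and gc: "gc > 0"
 have "fails f w (sinv False 0) (Sq search_cmd Skip) ((1 / 2) ^ R * 1)"
  by (rule fails_Sq[OF fails_search[OF i gc] wm_search[unfolded wm_def] fails_1])
   (rule triple_conseq[OF triple_Skip, where t = 0], auto)
 hence 9: "fails f w (sinv False 0) (Sq search_cmd Skip) ((1 / 2) ^ R)" by simp
 note F = fails_exact_first[OF W[unfolded wm_def]]
 show "fails f w start (iso_cmd R) ((1 / 2) ^ R)"
  unfolding iso_cmd_def seqs.simps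
  by (rule F[OF g(1) F[OF 2 F[OF 3 fails_exact_first[OF 4[unfolded wm_def] F[OF 5 F[OF 6 F[OF 7
   fails_exact_first[OF 8[unfolded wm_def] 9]]]]]]]])
qed

end

section \<open>Good indices and running time\<close>

lemma initial_segment:
 fixes K :: "nat set"
 assumes "finite K" "!!j k. k : K ==> j <= k ==> j : K"
 shows "K = {..<card K}"
proof (cases "K = {}")
 case False
 have "K = {..Max K}" using assms False by (auto intro: Max_in)
 moreover have "card {..Max K} = Suc (Max K)" by simp
 ultimately have "card K = Suc (Max K)" by metis
 thus ?thesis using \<open>K = {..Max K}\<close> by (simp add: lessThan_Suc_atMost)
qed simp

lemma set_decode_bound: "z < 2 ^ c ==> set_decode z <= {..<c}"
proof
 fix k assume z: "z < 2 ^ c" and k: "k : set_decode z"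
 show "k : {..<c}"
 proof (rule ccontr)
  assume "k ~: {..<c}"
  hence "(2::nat) ^ c <= 2 ^ k" by (intro power_increasing) auto
  with z have "z < 2 ^ k" by (rule less_le_trans)
  hence "z div 2 ^ k = 0" by simp
  thus False using k by (simp add: set_decode_def)
 qed
qed

context instance_data
begin

section \<open>Index bits and tuples of choices\<close>

definition "K i = {k. k < n & p ^ i * 2 ^ k <= n}"
definition "cc i = card (K i)"

lemma K_eq: "K i = {..<cc i}"
 unfolding cc_def
proof (rule initial_segment)
 fix j k assume k: "k : K i" "j <= k"
 hence "p ^ i * 2 ^ j <= p ^ i * 2 ^ k" by (intro mult_le_mono2 power_increasing) auto
 moreover have "p ^ i * 2 ^ k <= n" "k < n" using k by (auto simp: K_def)
 ultimately have "p ^ i * 2 ^ j <= n" "j < n" using k by linarith+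
 thus "j : K i" by (simp add: K_def)
qed (simp add: K_def)

text \<open>Bit number \<open>cc i\<close> is the first one left out. Hence \<open>2 ^ cc i\<close>
  exceeds \<open>n / p ^ i\<close> and thereby the number of choices, as
  \<open>matching_indices\<close> requires.\<close>

lemma cc_bound: "n < p ^ i * 2 ^ cc i"
proof (rule ccontr)
 assume "\<not> n < p ^ i * 2 ^ cc i"
 hence le: "p ^ i * 2 ^ cc i <= n" by simp
 have "2 ^ cc i <= n" by (rule order_trans[OF _ le]) (use p_props(3) in simp)
 hence "cc i < n" using less_le_trans[OF less_exp] by blast
 hence "cc i : K i" using le by (simp add: K_def)
 thus False unfolding K_eq by simp
qed

lemma length_irows: "length (irows i) = (\<Sum>a<i. cc a)"
proof (induction i)
 case (Suc i)
 have "length (ipart i n) = card {k. k < n & p ^ i * 2 ^ k <= n}"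
 proof -
  have "length (ipart i n) = length (filter (%k. p ^ i * 2 ^ k <= n) [0..<n])" by (simp add: ipart_def)
  also have "... = card (set (filter (%k. p ^ i * 2 ^ k <= n) [0..<n]))" by (subst distinct_card) auto
  also have "set (filter (%k. p ^ i * 2 ^ k <= n) [0..<n]) = {k. k < n & p ^ i * 2 ^ k <= n}" by auto
  finally show ?thesis .
 qed
 thus ?case using Suc by (simp add: rows_Suc cc_def K_def)
qed (simp add: irows_def)

abbreviation "Q0s \<equiv> (+) 4 ` set ps"

lemma Q0s_iff: "k < n ==> 4 + i * n + k : Q0s \<longleftrightarrow> i < n - 1 & k : K i"
proof -
 assume k: "k < n"
 have "4 + i * n + k : Q0s \<longleftrightarrow> i * n + k : set ps" by (auto simp: add.assoc)
 also have "... \<longleftrightarrow> i < n - 1 & k : K i"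
 proof
  assume "i * n + k : set ps"
  then obtain a b where ab: "i * n + k = a * n + b" "a < n - 1" "b < n" "p ^ a * 2 ^ b <= n"
   by (auto simp: ps_rows set_irows)
  hence "i = a" "k = b" using pair_index_inj[of i n k a b] k by auto
  thus "i < n - 1 & k : K i" using ab by (simp add: K_def)
 qed (auto simp: ps_rows set_irows K_def)
 finally show ?thesis .
qed

lemma Q0s_Q: "Q0s <= Q" by (auto simp: Q_def)

lemma idx_encode: "idx x i = set_encode {k. k < n & 4 + i * n + k : x}"
 by (simp add: idx_def address_def set_encode_def)

definition "W i = 2 ^ cc i"

lemma idx_lt:
 assumes "x <= Q0s"
 shows "idx x i < W i"
proof -
 have "{k. k < n & 4 + i * n + k : x} <= {..<cc i}" using Q0s_iff assms unfolding K_eq[symmetric] by blast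
 thus ?thesis unfolding idx_def address_def W_def by (rule sum_powers_lt)
qed

abbreviation "tr x \<equiv> restrict (idx x) {..<n - 1}"

lemma tr_space: "x <= Q0s ==> tr x : index_space W (n - 1)"
 using idx_lt by (auto simp: index_space_def)

lemma tr_inj:
 assumes x: "x <= Q0s" "y <= Q0s" and e: "tr x = tr y"
 shows "x = y"
proof -
 have sub: "x \<subseteq> y" if x: "x <= Q0s" and e: "tr x = tr y" for x y
 proof
  fix q assume q: "q : x"
  then obtain i k where ik: "q = 4 + (i * n + k)" "i < n - 1" "k < n"
   using x by (auto simp: ps_rows set_irows)
  have "idx x i = idx y i" using fun_cong[OF e, of i] ik by simp
  hence "{k. k < n & 4 + i * n + k : x} = {k. k < n & 4 + i * n + k : y}"
   unfolding idx_encode by (subst (asm) set_encode_eq) auto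
  thus "q : y" using q ik by (auto simp: add.assoc)
 qed
 show ?thesis using sub[OF x(1) e] sub[OF x(2) e[symmetric]] by blast
qed

text \<open>With \<open>tr_inj\<close> this identifies sets of index qubits with tuples of choice
  numbers, so that the counting of tuples applies to basis states.\<close>

lemma tr_surj:
 assumes r: "r : index_space W (n - 1)"
 shows "\<exists>x\<subseteq>Q0s. tr x = r"
proof -
 let ?x = "{4 + i * n + k | i k. i < n - 1 & k : set_decode (r i)}"
 have rW: "set_decode (r i) \<subseteq> K i" if "i < n - 1" for i
  using r that unfolding K_eq by (intro set_decode_bound) (auto simp: index_space_def W_def)
 have Kn: "k < n" if "k : K i" for i k using that by (simp add: K_def)
 have sub: "?x <= Q0s"
 proof
  fix q assume "q : ?x"
  then obtain i k where q: "q = 4 + i * n + k" "i < n - 1" "k : set_decode (r i)" by blast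
  hence "k : K i" "k < n" using rW Kn by blast+
  thus "q : Q0s" unfolding q(1) using Q0s_iff q(2) by simp
 qed
 have "idx ?x i = r i" if i: "i < n - 1" for i
 proof -
  have "4 + i * n + k : ?x \<longleftrightarrow> k : set_decode (r i)" if k: "k < n" for k
  proof
   assume "4 + i * n + k : ?x"
   then obtain a b where ab: "i * n + k = a * n + b" "a < n - 1" "b : set_decode (r a)" by auto
   hence "b < n" using rW Kn by blast
   hence "i = a" "k = b" using pair_index_inj[of i n k a b] k ab by auto
   thus "k : set_decode (r i)" using ab by simp
  qed (use i in blast)
  hence "{k. k < n & 4 + i * n + k : ?x} = set_decode (r i)" using rW[OF i] Kn by blast
  thus ?thesis unfolding idx_encode by simp
 qed
 hence "tr ?x = r" using r by (auto simp: index_space_def fun_eq_iff PiE_def extensional_def)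
 thus ?thesis using sub by blast
qed

lemma chain_series_cong:
 assumes "sel T TB" "!!i. i < n - 1 ==> r i = r' i"
 shows "chain_series (table_group T) r = chain_series (table_group T) r'"
proof -
 have "map (chain (table_group T) r) [0..<n] = map (chain (table_group T) r') [0..<n]"
  using assms(2) by (intro map_cong refl chain_cong) auto
 thus ?thesis unfolding chain_series_def sel_group(4)[OF assms(1)] by (simp only:)
qed

lemma zset_inj: "inj_on (zset s) {..<2 ^ s}"
proof (rule inj_onI)
 fix z z' assume z: "z : {..<2 ^ s}" "z' : {..<2 ^ s}" "zset s z = zset s z'"
 have "u : set_decode z \<longleftrightarrow> 4 + posl ! u : zset s z" if "u < s" for u z
  using that posl_nth_inj s_le_b0 by (auto simp: zset_def set_decode_def)
 hence "set_decode z = set_decode z'" using z set_decode_bound[of z s] set_decode_bound[of z' s] by blast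
 thus "z = z'" by (metis set_decode_inverse)
qed

text \<open>The stored indices are \<open>2 ^ s\<close> distinct tuples. By
  \<open>matching_indices\<close> at least \<open>2 ^ s / n\<close> tuples for \<open>H\<close> lead
  to the image of one of their series; each becomes a good index when the additional bit is
  set.\<close>

lemma good_count_bound:
 assumes iso: "ph : iso (table_group TG) (table_group TH)"
 shows "2 ^ s <= n * gc"
proof -
 have selG: "sel TG 0" by (simp add: sel_def)
 interpret nat_group_pair "table_group TG" "table_group TH" ph
  by (rule nat_group_pair.intro, rule group_pair.intro) (use sel_group[OF selG] sel_group[OF selH] iso in auto)
 let ?G = "table_group TG" and ?H = "table_group TH"
 let ?I = "(%z. tr (zset s z)) ` {..<2 ^ s}"
 let ?J = "{r : index_space W (n - 1). EX r0:?I. map (image ph) (chain_series ?G r0) = chain_series ?H r}"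
 have zs: "zset s z <= Q0s" for z by (rule zset_subset[OF s_le_b0])
 have "inj_on (%z. tr (zset s z)) {..<2 ^ s}"
  using tr_inj[OF zs zs] zset_inj by (auto simp: inj_on_def)
 hence cI: "card ?I = 2 ^ s" by (simp add: card_image)
 have ch: "card (choices ?G (chain ?G r i)) <= W i" for r i
 proof -
  have "card (choices ?G (chain ?G r i)) * p ^ i <= n"
   using card_choices_chain[OF sel_group(1)[OF selG] sel_group(3)[OF selG], of p r i] p_props(5) sel_group(4)[OF selG]
   by (simp add: prime_ge_2_nat)
  also have "n < p ^ i * 2 ^ cc i" by (rule cc_bound)
  finally have "p ^ i * card (choices ?G (chain ?G r i)) < p ^ i * 2 ^ cc i" by (simp add: mult.commute)
  thus ?thesis unfolding W_def by (simp add: less_imp_le)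
 qed
 have "card ?I <= card (carrier ?G) * card ?J"
  by (rule matching_indices[OF ch]) (use sel_group(4)[OF selG] n2 tr_space[OF zs] in auto)
 hence 1: "2 ^ s <= n * card ?J" using cI sel_group(4)[OF selG] by simp
 have "?J \<subseteq> (%x. tr (x - {4 + n * n})) ` {x. x <= Q & good x}"
 proof
  fix r assume "r : ?J"
  then obtain z where r: "r : index_space W (n - 1)" and z: "z < 2 ^ s" "map (image ph) (chain_series ?G (tr (zset s z))) = chain_series ?H r"
   by auto
  obtain x where x: "x <= Q0s" "tr x = r" using tr_surj[OF r] by blast
  let ?y = "insert (4 + n * n) x"
  have nx: "4 + n * n ~: x" using x(1) ps_lt by fastforce
  have same: "idx ?y i = idx x i" if "i < n - 1" for i
  proof -
   have "i * n + k ~= n * n" if "k < n" for k using pair_index_lt[of i n k n] \<open>i < n - 1\<close> that by linarith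
   thus ?thesis unfolding idx_def by (intro address_cong) (auto simp: add.assoc)
  qed
  have "chain_series ?G (tr (zset s z)) = chain_series ?G (idx (zset s z))" by (rule chain_series_cong[OF selG]) simp
  moreover have "chain_series ?H r = chain_series ?H (idx ?y)"
   unfolding x(2)[symmetric] by (rule chain_series_cong[OF selH]) (simp add: same)
  ultimately have "series_iso (ser TG (zset s z)) (ser TH ?y)"
   using z(2) iso by (auto simp: series_iso_def ser_def)
  hence "code TG (zset s z) = code TH ?y" using code_eq_iff[OF selG selH] by blast
  hence "good ?y" using z(1) unfolding good_def codes_def by (metis imageI insertI1 lessThan_iff)
  moreover have "?y <= Q" using x(1) Q0s_Q by (auto simp: Q_def)
  moreover have "r = tr (?y - {4 + n * n})" using x nx by (simp add: insert_Diff_if)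
  ultimately show "r : (%x. tr (x - {4 + n * n})) ` {x. x <= Q & good x}" by blast
 qed
 hence "card ?J <= gc" using Q_props(2) by (intro surj_card_le) auto
 thus ?thesis using 1 by (meson le_trans mult_le_mono2)
qed

lemma not_iso:
 assumes "\<not> table_group TG \<cong> table_group TH"
 shows "gc = 0"
proof -
 have selG: "sel TG 0" by (simp add: sel_def)
 have "\<not> good x" for x
 proof
  assume "good x"
  then obtain z where "code TH x = code TG (zset s z)" by (auto simp: good_def codes_def)
  hence "series_iso (ser TG (zset s z)) (ser TH x)" using code_eq_iff[OF selG selH] by metis
  thus False using assms by (auto simp: series_iso_def ser_def is_iso_def)
 qed
 thus ?thesis by simp
qed

text \<open>Squaring \<open>2 ^ i * sin th <= 1\<close> gives
  \<open>(2 ^ i)\<^sup>2 * gc <= 2 ^ (b0 + 1)\<close>. With \<open>2 ^ s <= n * gc\<close> and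
  \<open>b0 <= 3 * s\<close> it follows that \<open>(2 ^ i)\<^sup>2\<close> is at most
  \<open>2 * n * (2 ^ s)\<^sup>2\<close>, hence at most \<open>M\<^sup>2\<close>.\<close>

lemma doubling_index:
 assumes iso: "ph : iso (table_group TG) (table_group TH)"
 shows "EX i. 2 ^ i <= M & i < l & (cos (2 * 2 ^ i * th))\<^sup>2 <= 1 / 2" "gc > 0"
proof -
 have b: "2 ^ s <= n * gc" by (rule good_count_bound[OF iso])
 thus gc: "gc > 0" by (metis gr0I less_numeral_extra(3) mult_0_right not_le zero_less_power zero_less_numeral)
 obtain i where i: "(cos (2 * 2 ^ i * th))\<^sup>2 <= 1 / 2" "2 ^ i * sin th <= 1" by (rule gr.doubling_hits[OF gc])
 have "0 <= 2 ^ i * sin th" using gr.sin_theta by simp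
 hence "(2 ^ i * sin th)\<^sup>2 <= 1" using i(2) by (simp add: power_le_one)
 hence "(2 ^ i)\<^sup>2 * (real gc / 2 ^ card Q) <= 1" unfolding power_mult_distrib gr.sin_theta_sq .
 hence "(2 ^ i)\<^sup>2 * real gc <= 2 ^ (b0 + 1)" by (simp add: Q_props(3) field_simps)
 hence "real ((2 ^ i)\<^sup>2 * gc) <= real (2 ^ (b0 + 1))" by simp
 hence A: "(2 ^ i)\<^sup>2 * gc <= 2 ^ (b0 + 1)" by (simp only: of_nat_le_iff)
 have "b0 + 1 <= 3 * s + 1" by (simp add: s_def)
 hence B: "(2::nat) ^ (b0 + 1) <= 2 ^ (3 * s + 1)" by (intro power_increasing) auto
 have "(2 ^ i)\<^sup>2 * 2 ^ s <= (2 ^ i)\<^sup>2 * (n * gc)" using b by (rule mult_le_mono2)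
 also have "... = n * ((2 ^ i)\<^sup>2 * gc)" by simp
 also have "... <= n * 2 ^ (3 * s + 1)" using A B by (intro mult_le_mono2) linarith
 also have "... = (2 * n * (2 ^ s)\<^sup>2) * 2 ^ s" by (simp add: power_add power_mult[symmetric] power2_eq_square) (simp add: power_add[symmetric])
 also have "... <= M\<^sup>2 * 2 ^ s" using n2 by (simp add: M_def power_mult_distrib power2_eq_square[of n])
 finally have "(2 ^ i)\<^sup>2 <= M\<^sup>2" by simp
 hence iM: "2 ^ i <= M" by simp
 have "2 ^ i < 2 ^ s * (2::nat) ^ n" using iM less_le_trans[of "M" "2 ^ s * 2 ^ n" "2 ^ s * 2 ^ n"] unfolding M_def
  by (meson le_less_trans less_exp mult_less_mono2 zero_less_power zero_less_numeral)
 hence "2 ^ i < (2::nat) ^ (s + n)" by (simp add: power_add)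
 hence "i < s + n" by simp
 also have "... <= l" using s_le n2 unfolding l_eq by (intro order_trans[OF add_mono[of s "n * n" n "n * n * n"]]) auto
 finally show "EX i. 2 ^ i <= M & i < l & (cos (2 * 2 ^ i * th))\<^sup>2 <= 1 / 2" using iM i(1) by blast
qed

text \<open>Choice \<open>i\<close> takes about \<open>log 2 n - i * log 2 p\<close> bits, for
  \<open>i\<close> up to \<open>log p n\<close>. The sum is the area of a triangle, half of
  \<open>log 2 n * log p n\<close> up to lower order terms, and a third of it is \<open>s\<close>:
  this is the coefficient \<open>1 / 6\<close>.\<close>

lemma M_bound: "real M <= real n powr ((1 / 6) * log (real p) (real n) + 3)"
proof -
 define a where "a = log 2 (real n)"
 define P where "P = log 2 (real p)"
 define lam where "lam = log (real p) (real n)"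
 have a1: "1 <= a" unfolding a_def using n2 by simp
 have P1: "1 <= P" unfolding P_def using p_props(3) by simp
 have Pa: "P <= a" unfolding P_def a_def using p_props(3,4) by simp
 have la: "lam * P = a"
  unfolding lam_def P_def a_def log_def using p_props(3) by (simp add: field_simps)
 have l0: "0 <= lam" "lam <= a"
 proof -
  show "0 <= lam" using la P1 a1 by (metis less_le_not_le linorder_not_le mult_neg_pos order_less_le_trans zero_less_one order_trans)
  thus "lam <= a" using la P1 mult_left_mono[of 1 P lam] by simp
 qed
 \<comment> \<open>The choices that receive any bits; \<open>u\<close> will be the last of them,
   hence at most \<open>lam\<close>.\<close>
 let ?S = "{i. i < n - 1 & p ^ i <= n}"
 define t where "t = card ?S"
 have S: "?S = {..<t}" unfolding t_def
 proof (rule initial_segment)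
  fix j k assume k: "k : ?S" "j <= k"
  hence "p ^ j <= p ^ k" using p_props(3) by (intro power_increasing) auto
  thus "j : ?S" using k by auto
 qed simp
 have "0 : ?S" using n2 by simp
 then obtain u where u: "t = Suc u" unfolding S by (cases t) auto
 hence "u : ?S" unfolding S by simp
 hence "real (p ^ u) <= real n" by (simp only: of_nat_le_iff) simp
 hence "log 2 (real (p ^ u)) <= a" unfolding a_def using p_props(3) n2 by (intro log_le_cancel_iff[THEN iffD2]) auto
 hence uP: "real u * P <= a" using p_props(3) by (simp add: P_def log_nat_power)
 hence "real u * P <= lam * P" using la by simp
 hence ul: "real u <= lam" using P1 by simp
 have c: "real (cc i) <= 1 + a - real i * P" if "i : ?S" for i
 proof -
  have "0 : K i" using that n2 by (simp add: K_def)
  then obtain d where d: "cc i = Suc d" unfolding K_eq by (cases "cc i") auto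
  hence "d : K i" unfolding K_eq by simp
  hence "real (p ^ i * 2 ^ d) <= real n" by (simp only: of_nat_le_iff) (simp add: K_def)
  hence "log 2 (real (p ^ i * 2 ^ d)) <= a" unfolding a_def using p_props(3) n2 by (intro log_le_cancel_iff[THEN iffD2]) auto
  hence "real i * P + real d <= a" using p_props(3) by (simp add: P_def log_mult log_nat_power)
  thus ?thesis using d by simp
 qed
 have z: "cc i = 0" if "i < n - 1" "i ~: ?S" for i
 proof -
  have "\<not> p ^ i * 2 ^ k <= n" for k
  proof -
   have "p ^ i <= p ^ i * 2 ^ k" by simp
   moreover have "n < p ^ i" using that by auto
   ultimately show ?thesis by linarith
  qed
  hence "K i = {}" by (simp add: K_def)
  thus ?thesis by (simp add: cc_def)
 qed
 have "b0 = (\<Sum>i<n - 1. cc i)" by (simp add: b0_def ps_rows length_irows)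
 also have "... = (\<Sum>i\<in>?S. cc i)" using z by (intro sum.mono_neutral_right) auto
 finally have "real b0 = (\<Sum>i\<in>?S. real (cc i))" by simp
 also have "... <= (\<Sum>i\<in>?S. 1 + a - real i * P)" by (rule sum_mono) (rule c)
 also have "... = (\<Sum>i<Suc u. 1 + a - real i * P)" unfolding S u ..
 also have "... = (real u + 1) * (1 + a) - P * (real u * (real u + 1) / 2)"
  by (induction u) (simp_all add: field_simps)
 also have "... = (real u + 1) + P * ((real u + 1) * lam - real u * (real u + 1) / 2)"
  unfolding la[symmetric] by (simp add: algebra_simps)
 \<comment> \<open>As a function of \<open>u\<close> the parabola has its maximum at
   \<open>lam - 1 / 2\<close>; the difference to it is half a square.\<close>
 also have "... <= (real u + 1) + P * (lam\<^sup>2 / 2 + lam / 2 + 1 / 8)"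
 proof -
  have "0 <= (lam - real u - 1 / 2)\<^sup>2 / 2" by simp
  also have "... = (lam\<^sup>2 / 2 + lam / 2 + 1 / 8) - ((real u + 1) * lam - real u * (real u + 1) / 2)"
   by (simp add: power2_eq_square field_simps)
  finally show ?thesis using P1 by (intro add_left_mono mult_left_mono) auto
 qed
 also have "... = (real u + 1) + (a * lam / 2 + a / 2 + P / 8)"
  unfolding la[symmetric] by (simp add: power2_eq_square algebra_simps)
 also have "... <= a * lam / 2 + 3 * a" using ul l0 a1 Pa by linarith
 finally have b: "real b0 <= a * lam / 2 + 3 * a" .
 have "3 * s <= b0 + 2" by (simp add: s_def)
 hence "3 * real s <= real b0 + 2" by linarith
 hence s: "real s <= a * (lam / 6 + 2)" using b a1 by (simp add: algebra_simps)
 have n: "2 powr a = real n" unfolding a_def using n2 by simp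
 have "real M = 2 powr real s * real n" by (simp add: M_def powr_realpow)
 also have "... <= 2 powr (a * (lam / 6 + 2)) * real n" using s by (intro mult_right_mono powr_mono) auto
 also have "... = real n powr (lam / 6 + 2) * real n powr 1" using n n2 by (simp add: powr_powr[symmetric])
 also have "... = real n powr (lam / 6 + 3)" unfolding powr_add[symmetric] by (simp add: add.assoc)
 finally show ?thesis by (simp add: lam_def)
qed

section \<open>The time bound and the decision procedure\<close>

lemma X_bound: "X <= n ^ (45 + R)"
proof -
 have "(1::nat) <= n ^ 3" using n2 by simp
 hence "(R + 2) * 1 <= (R + 2) * n ^ 3" by (rule mult_le_mono2)
 hence "X <= (42 + R) * n ^ 3" unfolding X_def w_def L_def add_mult_distrib by linarith
 also have "42 + R <= n ^ (42 + R)" using less_exp[of "42 + R"] power_mono[of 2 n "42 + R"] n2 by linarith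
 finally have "X <= n ^ (42 + R) * n ^ 3" by simp
 also have "... = n ^ (45 + R)" unfolding power_add[symmetric] by (simp add: add.commute)
 finally show ?thesis .
qed

text \<open>Depends on \<open>R\<close> alone, hence on the error bound but not on the groups or
  their order.\<close>

definition "degree_bound = csize (iso_cmd R) + (45 + R) * cdepth (iso_cmd R)"

lemma time_bound: "real (cost (iso_cmd R) * M)
  <= real n powr ((1 / 6) * log (real p) (real n) + (real degree_bound + 3))"
proof -
 let ?S = "csize (iso_cmd R)" and ?d = "cdepth (iso_cmd R)"
 have "?S <= n ^ ?S" using less_exp[of ?S] power_mono[of 2 n ?S] n2 by linarith
 moreover have "X ^ ?d <= (n ^ (45 + R)) ^ ?d" using X_bound by (rule power_mono) simp
 ultimately have "?S * X ^ ?d <= n ^ ?S * (n ^ (45 + R)) ^ ?d" by (rule mult_le_mono)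
 also have "... = n ^ degree_bound" by (simp only: degree_bound_def power_add power_mult)
 finally have "real (?S * X ^ ?d) <= real (n ^ degree_bound)" by (simp only: of_nat_le_iff)
 also have "... = real n powr real degree_bound" using n2 by (simp add: powr_realpow)
 finally have "real (?S * X ^ ?d) * real M <= real n powr real degree_bound * real n powr ((1 / 6) * log (real p) (real n) + 3)"
  using M_bound by (intro mult_mono) auto
 thus ?thesis unfolding powr_add[symmetric] by (simp add: add_ac)
qed

lemma decides:
 assumes eps: "(1 / 2) ^ R <= \<epsilon>"
 shows "decides_within f (comp (iso_cmd R)) (group_pair_input n TG TH)
  (real n powr ((1 / 6) * log (real p) (real n) + (real degree_bound + 3))) \<epsilon> (table_group TG \<cong> table_group TH)"
proof -
 let ?s = "group_pair_input n TG TH"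
 obtain E where E: "simulates f (iso_cmd R) ?s E" using comp_correct[OF iso_cmd_wf] by blast
 then obtain k where k: "run f (comp (iso_cmd R)) k ?s = map_pmf (Pair Done) E"
  and abs: "map_pmf absc E = sem f (iso_cmd R) (absc ?s)" by (auto simp: simulates_def bstep_def)
 let ?a = "absc ?s"
 have a: "reg ?a = g_in" "heap ?a = h_in" "qst ?a = basis {}" "clock ?a = 0"
  by (auto simp: group_pair_input_def initial_config_def g_in_def h_in_def basis_def fun_eq_iff)
 have n_lt: "n < 2 ^ w" by (rule small_lt[OF pb(1)])
 have hb: "h_in i < 2 ^ w" for i
 proof -
  have "h_in i <= n"
  proof (cases "i < length (concat TG @ concat TH)")
   case True
   hence "h_in i : set (concat TG @ concat TH)" unfolding h_in_def by (simp only: if_True nth_mem)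
   then obtain r where r: "h_in i : set r" "r : set TG \<or> r : set TH" by auto
   then obtain T u where T: "group_table n T" "u < n" "r = T ! u" using TG TH
    by (metis group_table_def in_set_conv_nth)
   hence "length r = n" by (auto simp: group_table_def)
   then obtain v where v: "v < n" "h_in i = T ! u ! v" using r T by (metis in_set_conv_nth)
   interpret G: group "table_group T" using T by (simp add: group_table_def)
   have "T ! u ! v : carrier (table_group T)"
    using G.m_closed[of u v] T v by (simp add: table_group_def group_table_def)
   thus ?thesis using v T by (simp add: table_group_def group_table_def)
  qed (simp add: h_in_def)
  thus ?thesis using n_lt by simp
 qed
 have bd: "bdd w (reg ?a) (heap ?a)" unfolding a bdd_def using hb n_lt by (auto simp: g_in_def)
 have tr: "(gc = 0 --> reg s' 0 = 0) & clock s' <= cost (iso_cmd R) * M"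
  if "s' : set_pmf (sem f (iso_cmd R) ?a)" for s'
  using iso_rules(1)[unfolded wm_def triple_def, rule_format, of ?a s'] bd a that by simp
 have r0: "reg (absc s') 0 = reg s' 0" for s' :: config by simp
 have fp: "measure_pmf.prob E {s'. reg s' 0 = 0} = fail_prob (sem f (iso_cmd R) ?a)"
  unfolding abs[symmetric] fail_prob_def by (simp add: vimage_def)
 have time: "real (clock s') <= real n powr ((1 / 6) * log (real p) (real n) + (real degree_bound + 3))" if "s' : set_pmf E" for s'
 proof -
  have "absc s' : set_pmf (sem f (iso_cmd R) ?a)" unfolding abs[symmetric] using that by simp
  from tr[OF this] have "clock s' <= cost (iso_cmd R) * M" by simp
  hence "real (clock s') <= real (cost (iso_cmd R) * M)" by (simp only: of_nat_le_iff)
  thus ?thesis using time_bound by linarith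
 qed
 have prob: "measure_pmf.prob E {s'. (reg s' 0 ~= 0) = (table_group TG \<cong> table_group TH)} >= 1 - \<epsilon>"
 proof (cases "table_group TG \<cong> table_group TH")
  case False
  have "reg s' 0 = 0" if "s' : set_pmf E" for s'
  proof -
   have "absc s' : set_pmf (sem f (iso_cmd R) ?a)" unfolding abs[symmetric] using that by simp
   from tr[OF this] show ?thesis using not_iso[OF False] by simp
  qed
  hence "AE s' in measure_pmf E. s' : {s'. (reg s' 0 ~= 0) = (table_group TG \<cong> table_group TH)}"
   using False by (simp add: AE_measure_pmf_iff)
  hence "measure_pmf.prob E {s'. (reg s' 0 ~= 0) = (table_group TG \<cong> table_group TH)} = 1"
   by (subst measure_pmf.prob_eq_1) auto
  moreover have "0 <= \<epsilon>" by (rule order_trans[OF _ eps]) simp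
  ultimately show ?thesis by simp
 next
  case True
  then obtain ph where "ph : iso (table_group TG) (table_group TH)" by (auto simp: is_iso_def)
  note di = doubling_index[OF this]
  obtain i where i: "2 ^ i <= M" "i < l" "(cos (2 * 2 ^ i * th))\<^sup>2 <= 1 / 2" using di(1) by blast
  have "fail_prob (sem f (iso_cmd R) ?a) <= (1 / 2) ^ R"
   using iso_rules(2)[OF i di(2), unfolded fails_def, rule_format, of ?a] bd a by simp
  hence le: "measure_pmf.prob E {s'. reg s' 0 = 0} <= \<epsilon>" using eps fp by simp
  have eq: "{s'. (reg s' 0 ~= 0) = (table_group TG \<cong> table_group TH)} = UNIV - {s'. reg s' 0 = 0}" using True by auto
  have "measure_pmf.prob E (space (measure_pmf E) - {s'. reg s' 0 = 0}) = 1 - measure_pmf.prob E {s'. reg s' 0 = 0}"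
   by (rule measure_pmf.prob_compl) simp
  thus ?thesis unfolding eq using le by simp
 qed
 show ?thesis unfolding decides_within_def
 proof (intro exI[of _ k] conjI)
  show "ALL (P', s'):set_pmf (run f (comp (iso_cmd R)) k ?s). P' = Done &
   real (clock s') <= real n powr ((1 / 6) * log (real p) (real n) + (real degree_bound + 3))"
   unfolding k using time by auto
  show "1 - \<epsilon> <= measure_pmf.prob (run f (comp (iso_cmd R)) k ?s) {(P', s'). (reg s' 0 ~= 0) = (table_group TG \<cong> table_group TH)}"
   unfolding k using prob by (simp add: vimage_def)
 qed
qed

end

theorem theorem13:
  fixes \<epsilon> :: real
  assumes "\<epsilon> > 0"
  shows "\<exists>(P :: prog) (c :: real).
    \<forall>Can. canonization Can \<longrightarrow>
      (\<forall>n \<ge> 2. \<forall>G H. group_table n G \<longrightarrow> group_table n H \<longrightarrow>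
        decides_within (canonization_oracle Can) P (group_pair_input n G H)
          (real n powr ((1 / 6) * log (real (smallest_prime_divisor n)) (real n) + c))
          \<epsilon>
          (table_group G \<cong> table_group H))"
proof -
 \<comment> \<open>The number of passes of the search, each of which at least halves the failure
   probability.\<close>
 obtain R where R: "(1 / 2) ^ R < \<epsilon>" using real_arch_pow_inv[OF assms, of "1 / 2"] by auto
 let ?c = "real (csize (iso_cmd R) + (45 + R) * cdepth (iso_cmd R)) + 3"
 have "decides_within (canonization_oracle Can) (comp (iso_cmd R)) (group_pair_input n G H)
   (real n powr ((1 / 6) * log (real (smallest_prime_divisor n)) (real n) + ?c)) \<epsilon> (table_group G \<cong> table_group H)"
  if "canonization Can" "2 <= n" "group_table n G" "group_table n H" for Can n G H
 proof -
  interpret instance_data n R G H Can by (rule instance_data.intro) (use that in auto)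
  show ?thesis using decides[of \<epsilon>] R unfolding f_def p_def degree_bound_def by simp
 qed
 thus ?thesis by blast
qed

end
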